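(* Let $K$ be an algebraically closed field of arbitrary characteristic. Let $\widetilde{X} \subseteq \mathbb{P}^{r+1}_K$ be a rational normal scroll of codimension $\geq 2$ with vertex $\mathrm{Vert}(\widetilde{X})$, a cone over the smooth rational normal scroll $\widetilde{X}_0=S(a_1,\dots,a_n)$, and let $S(\underline{1})$ and $\bigtriangleup$ be the subvarieties of $\langle\widetilde{X}_0\rangle$ associated with $\widetilde{X}_0$ as described in the context. Let \begin{align*} V &:= \mathrm{Join}(\mathrm{Vert}(\widetilde{X}), \mathrm{Tan}(\widetilde{X}_0)),\\ W &:= \mathrm{Join}(\mathrm{Vert}(\widetilde{X}), \mathrm{Sec}(\widetilde{X}_0)),\\ A &:= \langle \mathrm{Vert}(\widetilde{X}), \langle S(\underline{1}) \rangle \rangle,\\ B &:= \mathrm{Join}(\mathrm{Vert}(\widetilde{X}), \mathrm{Join}(S(\underline{1}), \widetilde{X}_0)),\\ U &:= \mathrm{Join}(A, \bigtriangleup). \end{align*} Then $\widetilde{X} \subseteq B$, $A \subseteq B$, $B \cup U \subseteq V \subseteq W$ and (a) $SL^{\emptyset}(\widetilde{X}) = \mathbb{P}^{r+1}_K \setminus W$; (b) $SL^{q_1,q_2}(\widetilde{X}) = W \setminus V$; (c) $SL^{2q}(\widetilde{X}) = V \setminus (B \cup U)$; (d) $SL^{L_1\cup L_2}(\widetilde{X}) = B \setminus (A \cup \widetilde{X})$; (e) $SL^{C}(\widetilde{X}) = U \setminus B$; (f) $SL^{Q}(\widetilde{X}) = A \setminus \widetilde{X}$.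
   Context: Smooth rational normal scroll: given integers $1\le a_1\le\dots\le a_n$ ($n\ge1$), choose complementary linear subspaces $\Lambda_i\cong\mathbb{P}^{a_i}_K$ spanning $\mathbb{P}^{N}_K$, $N=a_1+\dots+a_n+n-1$, and embeddings $\phi_i:\mathbb{P}^1_K\to\Lambda_i$ as rational normal curves of degree $a_i$. Then $S(a_1,\dots,a_n)=\bigcup_{x\in\mathbb{P}^1_K}\langle\phi_1(x),\dots,\phi_n(x)\rangle$. Here $\langle\cdot\rangle$ denotes linear span. A rational normal scroll $\widetilde{X}\subseteq\mathbb{P}^{r+1}_K$ with vertex $\mathrm{Vert}(\widetilde{X})=\mathbb{P}^h_K$ ($h\ge-1$, with $\mathbb{P}^{-1}_K=\emptyset$) is the cone $\mathrm{Join}(\mathrm{Vert}(\widetilde{X}),\widetilde{X}_0)$ over a smooth rational normal scroll $\widetilde{X}_0$ in a linear subspace $\langle\widetilde{X}_0\rangle=\mathbb{P}^{r-h}_K$ complementary to $\mathrm{Vert}(\widetilde{X})$. For $\widetilde{X}_0=S(a_1,\dots,a_n)$ let $k$ be the number of indices $i$ with $a_i=1$ and $m$ the number of indices with $a_i\le2$. Let $S(\underline{1})=\bigcup_x\langle\phi_1(x),\dots,\phi_k(x)\rangle\subset\mathbb{P}^{2k-1}_K$ and $S(\underline{2})=\bigcup_x\langle\phi_{k+1}(x),\dots,\phi_m(x)\rangle\subset\mathbb{P}^{3(m-k)-1}_K$ (possibly empty) be the corresponding subscrolls of $\widetilde{X}_0$. One has $S(\underline{2})\cong C\times\mathbb{P}^{m-k-1}_K$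 for a smooth plane conic $C$; for $\beta\in\mathbb{P}^{m-k-1}_K$ let $C_\beta$ be the smooth plane conic $C\times\{\beta\}\subset S(\underline{2})$. Explicitly, choosing coordinates on each $\Lambda_j\cong\mathbb{P}^2_K$ ($k<j\le m$) in which $\phi_j(s:t)=(s^2:st:t^2)$, $C_\beta$ is the image of $(s:t)\mapsto(\beta_{j}\,(s^2,st,t^2))_{k<j\le m}$. Set $\bigtriangleup=\bigcup_{\beta}\langle C_\beta\rangle\cong\mathbb{P}^2_K\times\mathbb{P}^{m-k-1}_K\subset\mathbb{P}^{3(m-k)-1}_K$, a Segre variety (empty if $m=k$). $\mathrm{Join}(Y,Z)$ is the (reduced) embedded join, i.e. the closure of the union of the lines $\langle y,z\rangle$ with $y\in Y$, $z\in Z$, $y\ne z$; if one of $Y,Z$ is empty, the join is the other one. $\mathrm{Sec}(\widetilde{X}_0)$ is the closure of the union of chords joining pairs of distinct points of $\widetilde{X}_0$, and $\mathrm{Tan}(\widetilde{X}_0)$ is the closure of the union of the (embedded projective) tangent spaces of $\widetilde{X}_0$. For a hyperplane $E$ of a linear space $M$, $2E\subseteq M$ denotes the double hyperplane, the subscheme of $M$ defined by the square of a linear form defining $E$ (and $2\emptyset=\emptyset$). For a closed point $p\in\mathbb{P}^{r+1}_K\setminus\widetilde{X}$, the secant cone is $\mathrm{Sec}_p(\widetilde{X})=\bigcup_{q\in\widetilde{X},\ \mathrm{length}(\widetilde{X}\cap\langle p,q\rangle)\ge 2}\langle p,q\rangle$, with the convention $\mathrm{Sec}_p(\widetilde{X})=\{p\}$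 if there is no such $q$. The secant locus $\Sigma_p(\widetilde{X})$ is the scheme-theoretic intersection of $\widetilde{X}$ and $\mathrm{Sec}_p(\widetilde{X})$. The strata are the following sets of closed points $p\in\mathbb{P}^{r+1}_K\setminus\widetilde{X}$: $SL^{\emptyset}(\widetilde{X})$: $\Sigma_p(\widetilde{X})=2\,\mathrm{Vert}(\widetilde{X})\subseteq\langle\mathrm{Vert}(\widetilde{X}),p\rangle$; $SL^{q_1,q_2}(\widetilde{X})$: $\Sigma_p(\widetilde{X})=\mathrm{Join}(\mathrm{Vert}(\widetilde{X}),\{x,y\})$ where $x,y$ are two distinct points in some line $\mathbb{P}^1_K\subseteq\langle\widetilde{X}_0\rangle$; $SL^{2q}(\widetilde{X})$: $\Sigma_p(\widetilde{X})=2\,\mathrm{Join}(\mathrm{Vert}(\widetilde{X}),x)\subseteq\mathrm{Join}(\mathrm{Vert}(\widetilde{X}),L)$ where $L\subseteq\langle\widetilde{X}_0\rangle$ is a line and $x\in L$; $SL^{L_1\cup L_2}(\widetilde{X})$: $\Sigma_p(\widetilde{X})=\mathrm{Join}(\mathrm{Vert}(\widetilde{X}),L\cup L')$ where $L,L'\subseteq\langle\widetilde{X}_0\rangle$ are two distinct coplanar simple lines; $SL^{C}(\widetilde{X})$: $\Sigma_p(\widetilde{X})=\mathrm{Join}(\mathrm{Vert}(\widetilde{X}),D)$ where $D\subseteq\langle\widetilde{X}_0\rangle$ is a smooth plane conic; $SL^{Q}(\widetilde{X})$: $\Sigma_p(\widetilde{X})=\mathrm{Join}(\mathrm{Vert}(\widetilde{X}),F)$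 where $F\subseteq\langle\widetilde{X}_0\rangle$ is a smooth quadric surface in a $3$-space. *)

theory Defs
  imports
    "HOL-Analysis.Cartesian_Space"
    "HOL-Computational_Algebra.Polynomial"
    "HOL-Library.Poly_Mapping"
    "HOL-Library.Extended_Nat"
    "HOL-Library.Liminf_Limsup"
begin

section \<open>Projective space\<close>

text \<open>
  Closed points of the projective space of \<open>K\<^sup>d\<close> are the one-dimensional subspaces of \<open>'k ^ 'd\<close>,
  so the ambient space has dimension \<open>CARD('d) - 1\<close>. Linear subspaces are the sets
  \<open>proj_pts T\<close>; the empty set is the one of dimension \<open>-1\<close>.
\<close>

type_synonym ('k, 'd) point = "('k ^ 'd) set"

definition proj_pts :: "('k::field ^ 'd::finite) set \<Rightarrow> ('k, 'd) point set" where
  "proj_pts T = {vec.span {v} | v. v \<in> T \<and> v \<noteq> 0}"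

abbreviation proj_space :: "('k::field, 'd::finite) point set" where
  "proj_space \<equiv> proj_pts UNIV"

definition lin_span :: "('k::field, 'd::finite) point set \<Rightarrow> ('k, 'd) point set" where
  "lin_span Y = proj_pts (vec.span (\<Union>Y))"

definition linear_space :: "('k::field, 'd::finite) point set \<Rightarrow> bool" where
  "linear_space Y \<longleftrightarrow> (\<exists>T. vec.subspace T \<and> Y = proj_pts T)"

definition linear_space_dim :: "nat \<Rightarrow> ('k::field, 'd::finite) point set \<Rightarrow> bool" where
  "linear_space_dim e Y \<longleftrightarrow> (\<exists>T. vec.subspace T \<and> vec.dim T = e + 1 \<and> Y = proj_pts T)"

section \<open>The homogeneous coordinate ring\<close>

type_synonym ('k, 'd) mpoly = "('d \<Rightarrow>\<^sub>0 nat) \<Rightarrow>\<^sub>0 'k"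

definition mdeg :: "('d::finite \<Rightarrow>\<^sub>0 nat) \<Rightarrow> nat" where
  "mdeg m = (\<Sum>i\<in>UNIV. Poly_Mapping.lookup m i)"

text \<open>\<open>forms e\<close> is the graded piece of degree \<open>e\<close>, including \<open>0\<close>.\<close>

definition forms :: "nat \<Rightarrow> ('k::field, 'd::finite) mpoly set" where
  "forms e = {f. \<forall>m\<in>Poly_Mapping.keys f. mdeg m = e}"

definition mpeval :: "('k::field, 'd::finite) mpoly \<Rightarrow> 'k ^ 'd \<Rightarrow> 'k" where
  "mpeval f v =
     (\<Sum>m\<in>Poly_Mapping.keys f. Poly_Mapping.lookup f m * (\<Prod>i\<in>UNIV. (v $ i) ^ Poly_Mapping.lookup m i))"

definition mpderiv :: "'d \<Rightarrow> ('k::field, 'd::finite) mpoly \<Rightarrow> ('k, 'd) mpoly" where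
  "mpderiv i f =
     (\<Sum>m\<in>Poly_Mapping.keys f. Poly_Mapping.single (m - Poly_Mapping.single i 1)
                                    (of_nat (Poly_Mapping.lookup m i) * Poly_Mapping.lookup f m))"

definition dir_deriv :: "('k::field, 'd::finite) mpoly \<Rightarrow> 'k ^ 'd \<Rightarrow> 'k ^ 'd \<Rightarrow> 'k" where
  "dir_deriv f v w = (\<Sum>i\<in>UNIV. mpeval (mpderiv i f) v * w $ i)"

definition mpscale :: "'k::field \<Rightarrow> ('k, 'd::finite) mpoly \<Rightarrow> ('k, 'd) mpoly" where
  "mpscale c f = Poly_Mapping.single 0 c * f"

text \<open>
  \<open>mpv.dim\<close> is the dimension over the ground field; \<open>mpideal.span\<close> is the ideal generated by a
  set, namely the submodule spanned by it in the ring acting on itself.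
\<close>

global_interpretation mpv: vector_space "mpscale :: 'k::field \<Rightarrow> ('k, 'd::finite) mpoly \<Rightarrow> ('k, 'd) mpoly"
  by unfold_locales
    (simp_all add: mpscale_def distrib_left distrib_right single_add mult.assoc[symmetric] mult_single)

global_interpretation mpideal: module "(*) :: ('k::field, 'd::finite) mpoly \<Rightarrow> ('k, 'd) mpoly \<Rightarrow> ('k, 'd) mpoly"
  by unfold_locales (simp_all add: algebra_simps)

section \<open>Zariski topology\<close>

text \<open>
  For nonempty \<open>Y\<close> the vanishing ideal is homogeneous and saturated, since points contain all scalar
  multiples of their vectors and an algebraically closed field is infinite; the vanishing ideal of
  the empty set is the whole ring.
\<close>

definition vanishing_ideal :: "('k::field, 'd::finite) point set \<Rightarrow> ('k, 'd) mpoly set" where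
  "vanishing_ideal Y = {f. \<forall>p\<in>Y. \<forall>v\<in>p. mpeval f v = 0}"

definition zclosure :: "('k::field, 'd::finite) point set \<Rightarrow> ('k, 'd) point set" where
  "zclosure Y = {p \<in> proj_space. \<forall>f\<in>vanishing_ideal Y. \<forall>v\<in>p. mpeval f v = 0}"

definition zclosed :: "('k::field, 'd::finite) point set \<Rightarrow> bool" where
  "zclosed Y \<longleftrightarrow> Y \<subseteq> proj_space \<and> zclosure Y = Y"

definition zirreducible :: "('k::field, 'd::finite) point set \<Rightarrow> bool" where
  "zirreducible Y \<longleftrightarrow> Y \<noteq> {} \<and> zclosed Y \<and>
     (\<forall>Y1 Y2. zclosed Y1 \<and> zclosed Y2 \<and> Y = Y1 \<union> Y2 \<longrightarrow> Y = Y1 \<or> Y = Y2)"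

text \<open>Krull dimension: the supremum of the lengths of chains of irreducible closed subsets.\<close>

definition zdim :: "('k::field, 'd::finite) point set \<Rightarrow> enat" where
  "zdim Y = Sup {enat e | e. \<exists>Z :: nat \<Rightarrow> ('k, 'd) point set.
     (\<forall>i\<le>e. zirreducible (Z i) \<and> Z i \<subseteq> Y) \<and> (\<forall>i<e. Z i \<subset> Z (Suc i))}"

section \<open>Closed subschemes\<close>

text \<open>
  A closed subscheme of projective space is represented by its saturated homogeneous ideal, so that
  equality of subschemes is equality of ideals. A closed set with its reduced structure is
  represented by its vanishing ideal.
\<close>

definition saturate :: "('k::field, 'd::finite) mpoly set \<Rightarrow> ('k, 'd) mpoly set" where
  "saturate J = {f. \<exists>e. \<forall>g\<in>forms e. g * f \<in> J}"

definition scheme_inter ::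
  "('k::field, 'd::finite) mpoly set \<Rightarrow> ('k, 'd) mpoly set \<Rightarrow> ('k, 'd) mpoly set" where
  "scheme_inter J1 J2 = saturate (mpideal.span (J1 \<union> J2))"

definition hilbert_fun :: "('k::field, 'd::finite) mpoly set \<Rightarrow> nat \<Rightarrow> nat" where
  "hilbert_fun J e = mpv.dim (forms e :: ('k, 'd) mpoly set) - mpv.dim (J \<inter> forms e)"

text \<open>
  For a finite scheme the Hilbert function is eventually constant, with value the length; for a
  scheme of positive dimension the limit is infinite.
\<close>

definition scheme_length :: "('k::field, 'd::finite) mpoly set \<Rightarrow> enat" where
  "scheme_length J = liminf (\<lambda>e. enat (hilbert_fun J e))"

text \<open>
  \<open>is_double_hyperplane J E M\<close>: \<open>J\<close> is the ideal of \<open>2E \<subseteq> M\<close>. If \<open>M\<close> is a single point then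
  \<open>E = {}\<close> and \<open>J\<close> is the whole ring, in accordance with the convention that \<open>2E\<close> is then empty.
\<close>

definition is_double_hyperplane ::
  "('k::field, 'd::finite) mpoly set \<Rightarrow> ('k, 'd) point set \<Rightarrow> ('k, 'd) point set \<Rightarrow> bool" where
  "is_double_hyperplane J E M \<longleftrightarrow>
     (\<exists>l\<in>forms 1. E = {p \<in> M. \<forall>v\<in>p. mpeval l v = 0} \<and> E \<noteq> M \<and>
        J = saturate (mpideal.span (vanishing_ideal M \<union> {l ^ 2})))"

section \<open>Joins, secant and tangent varieties, smooth quadrics\<close>

definition join :: "('k::field, 'd::finite) point set \<Rightarrow> ('k, 'd) point set \<Rightarrow> ('k, 'd) point set" where
  "join Y Z =
     (if Y = {} then Z else if Z = {} then Y
      else zclosure (\<Union>{lin_span {y, z} | y z. y \<in> Y \<and> z \<in> Z \<and> y \<noteq> z}))"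

definition secant_variety :: "('k::field, 'd::finite) point set \<Rightarrow> ('k, 'd) point set" where
  "secant_variety Y = zclosure (\<Union>{lin_span {y, z} | y z. y \<in> Y \<and> z \<in> Y \<and> y \<noteq> z})"

definition tangent_space ::
  "('k::field, 'd::finite) point set \<Rightarrow> ('k, 'd) point \<Rightarrow> ('k, 'd) point set" where
  "tangent_space Y p = proj_pts {w. \<forall>f\<in>vanishing_ideal Y. \<forall>v\<in>p. dir_deriv f v w = 0}"

definition tangent_variety :: "('k::field, 'd::finite) point set \<Rightarrow> ('k, 'd) point set" where
  "tangent_variety Y = zclosure (\<Union>p\<in>Y. tangent_space Y p)"

text \<open>
  Smooth quadric of dimension \<open>e\<close> in a linear space of dimension \<open>e + 1\<close>, by the Jacobian criterion
  inside that space. Smoothness forces \<open>q\<close> not to vanish identically on \<open>T\<close>.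
\<close>

definition smooth_quadric :: "nat \<Rightarrow> ('k::field, 'd::finite) point set \<Rightarrow> bool" where
  "smooth_quadric e D \<longleftrightarrow>
     (\<exists>T. \<exists>q\<in>forms 2. vec.subspace T \<and> vec.dim T = e + 2 \<and>
        D = {p \<in> proj_pts T. \<forall>v\<in>p. mpeval q v = 0} \<and>
        (\<forall>v\<in>T. v \<noteq> 0 \<and> mpeval q v = 0 \<longrightarrow> (\<exists>w\<in>T. dir_deriv q v w \<noteq> 0)))"

section \<open>Rational normal scrolls\<close>

text \<open>
  An embedding of the projective line as a rational normal curve of degree \<open>a\<close> in
  \<open>proj_pts \<Lambda>\<close> is given in suitable coordinates by all monomials of degree \<open>a\<close>. Here \<open>\<phi>\<close> is
  a lift to vectors, unique up to a nonzero scalar; the basis \<open>b\<close> is the choice of coordinates.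
\<close>

definition rational_normal_embedding ::
  "nat \<Rightarrow> ('k::field ^ 'd::finite) set \<Rightarrow> ('k \<Rightarrow> 'k \<Rightarrow> 'k ^ 'd) \<Rightarrow> bool" where
  "rational_normal_embedding a \<Lambda> \<phi> \<longleftrightarrow>
     (\<exists>b :: nat \<Rightarrow> 'k ^ 'd.
        inj_on b {..a} \<and> vec.independent (b ` {..a}) \<and> vec.span (b ` {..a}) = \<Lambda> \<and>
        (\<forall>s t. \<phi> s t = (\<Sum>j\<le>a. (s ^ (a - j) * t ^ j) *s b j)))"

text \<open>
  Since \<open>\<Lambda> i\<close> has vector space dimension \<open>a i + 1\<close>, the last condition says that the \<open>\<Lambda> i\<close> are
  complementary, spanning a projective space of dimension \<open>a 1 + \<dots> + a n + n - 1\<close>.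
\<close>

definition smooth_scroll_data ::
  "nat \<Rightarrow> (nat \<Rightarrow> nat) \<Rightarrow> (nat \<Rightarrow> ('k::field ^ 'd::finite) set) \<Rightarrow>
     (nat \<Rightarrow> 'k \<Rightarrow> 'k \<Rightarrow> 'k ^ 'd) \<Rightarrow> bool" where
  "smooth_scroll_data n a \<Lambda> \<phi> \<longleftrightarrow>
     1 \<le> n \<and> (\<forall>i\<in>{1..n}. 1 \<le> a i) \<and> mono_on {1..n} a \<and>
     (\<forall>i\<in>{1..n}. rational_normal_embedding (a i) (\<Lambda> i) (\<phi> i)) \<and>
     vec.dim (vec.span (\<Union>i\<in>{1..n}. \<Lambda> i)) = (\<Sum>i=1..n. a i + 1)"

text \<open>\<open>subscroll \<phi> {1..n}\<close> is the smooth scroll; if \<open>I = {}\<close> the result is empty.\<close>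

definition subscroll ::
  "(nat \<Rightarrow> 'k::field \<Rightarrow> 'k \<Rightarrow> 'k ^ 'd::finite) \<Rightarrow> nat set \<Rightarrow> ('k, 'd) point set" where
  "subscroll \<phi> I = (\<Union>(s, t) \<in> UNIV - {(0, 0)}. proj_pts (vec.span {\<phi> i s t | i. i \<in> I}))"

text \<open>
  For indices \<open>j \<in> J\<close> with \<open>a j = 2\<close>, in the coordinates in which \<open>\<phi> j (s, t) = (s\<^sup>2, s t, t\<^sup>2)\<close>,
  the vector below is the point \<open>(s : t)\<close> of the conic \<open>C\<^sub>\<beta>\<close>.
\<close>

definition conic ::
  "(nat \<Rightarrow> 'k::field \<Rightarrow> 'k \<Rightarrow> 'k ^ 'd::finite) \<Rightarrow> nat set \<Rightarrow> (nat \<Rightarrow> 'k) \<Rightarrow> ('k, 'd) point set" where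
  "conic \<phi> J \<beta> = {vec.span {\<Sum>j\<in>J. \<beta> j *s \<phi> j s t} | s t. (s, t) \<noteq> (0, 0)}"

definition conic_planes ::
  "(nat \<Rightarrow> 'k::field \<Rightarrow> 'k \<Rightarrow> 'k ^ 'd::finite) \<Rightarrow> nat set \<Rightarrow> ('k, 'd) point set" where
  "conic_planes \<phi> J = (\<Union>\<beta> \<in> {\<beta>. \<exists>j\<in>J. \<beta> j \<noteq> 0}. lin_span (conic \<phi> J \<beta>))"

definition complementary_to_vertex ::
  "('k::field, 'd::finite) point set \<Rightarrow> ('k, 'd) point set \<Rightarrow> bool" where
  "complementary_to_vertex Vt X0 \<longleftrightarrow>
     linear_space Vt \<and> Vt \<inter> lin_span X0 = {} \<and> lin_span (Vt \<union> lin_span X0) = proj_space"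

section \<open>Secant loci and their strata\<close>

definition secant_cone ::
  "('k::field, 'd::finite) point set \<Rightarrow> ('k, 'd) point \<Rightarrow> ('k, 'd) point set" where
  "secant_cone X p =
     (let Q = {q \<in> X. 2 \<le> scheme_length
                (scheme_inter (vanishing_ideal X) (vanishing_ideal (lin_span {p, q})))}
      in if Q = {} then {p} else (\<Union>q\<in>Q. lin_span {p, q}))"

definition secant_locus ::
  "('k::field, 'd::finite) point set \<Rightarrow> ('k, 'd) point \<Rightarrow> ('k, 'd) mpoly set" where
  "secant_locus X p = scheme_inter (vanishing_ideal X) (vanishing_ideal (secant_cone X p))"

text \<open>
  In the strata, \<open>Vt\<close> is the vertex and \<open>X0\<close> the smooth scroll over which \<open>join Vt X0\<close> is the cone.
\<close>

definition SL_empty ::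
  "('k::field, 'd::finite) point set \<Rightarrow> ('k, 'd) point set \<Rightarrow> ('k, 'd) point set" where
  "SL_empty Vt X0 = {p \<in> proj_space - join Vt X0.
     is_double_hyperplane (secant_locus (join Vt X0) p) Vt (lin_span (Vt \<union> {p}))}"

definition SL_two_points ::
  "('k::field, 'd::finite) point set \<Rightarrow> ('k, 'd) point set \<Rightarrow> ('k, 'd) point set" where
  "SL_two_points Vt X0 = {p \<in> proj_space - join Vt X0.
     \<exists>L x y. linear_space_dim 1 L \<and> L \<subseteq> lin_span X0 \<and> x \<in> L \<and> y \<in> L \<and> x \<noteq> y \<and>
       secant_locus (join Vt X0) p = vanishing_ideal (join Vt {x, y})}"

definition SL_double_point ::
  "('k::field, 'd::finite) point set \<Rightarrow> ('k, 'd) point set \<Rightarrow> ('k, 'd) point set" where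
  "SL_double_point Vt X0 = {p \<in> proj_space - join Vt X0.
     \<exists>L x. linear_space_dim 1 L \<and> L \<subseteq> lin_span X0 \<and> x \<in> L \<and>
       is_double_hyperplane (secant_locus (join Vt X0) p) (join Vt {x}) (join Vt L)}"

definition SL_two_lines ::
  "('k::field, 'd::finite) point set \<Rightarrow> ('k, 'd) point set \<Rightarrow> ('k, 'd) point set" where
  "SL_two_lines Vt X0 = {p \<in> proj_space - join Vt X0.
     \<exists>L L'. linear_space_dim 1 L \<and> linear_space_dim 1 L' \<and>
       L \<subseteq> lin_span X0 \<and> L' \<subseteq> lin_span X0 \<and> L \<noteq> L' \<and>
       (\<exists>P. linear_space_dim 2 P \<and> L \<subseteq> P \<and> L' \<subseteq> P) \<and>
       secant_locus (join Vt X0) p = vanishing_ideal (join Vt (L \<union> L'))}"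

definition SL_conic ::
  "('k::field, 'd::finite) point set \<Rightarrow> ('k, 'd) point set \<Rightarrow> ('k, 'd) point set" where
  "SL_conic Vt X0 = {p \<in> proj_space - join Vt X0.
     \<exists>D. smooth_quadric 1 D \<and> D \<subseteq> lin_span X0 \<and>
       secant_locus (join Vt X0) p = vanishing_ideal (join Vt D)}"

definition SL_quadric ::
  "('k::field, 'd::finite) point set \<Rightarrow> ('k, 'd) point set \<Rightarrow> ('k, 'd) point set" where
  "SL_quadric Vt X0 = {p \<in> proj_space - join Vt X0.
     \<exists>F. smooth_quadric 2 F \<and> F \<subseteq> lin_span X0 \<and>
       secant_locus (join Vt X0) p = vanishing_ideal (join Vt F)}"

end

theory Submission
 imports Defs
begin

text \<open>
 \<^bold>\<open>Coordinates.\<close> Let \<open>\<xi> i j\<close> be the coordinates dual to the monomial bases of the spaces \<open>\<Lambda> i\<close>, vanishing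
 on the vertex. The cone over \<open>S(a\<^sub>1, \<dots>, a\<^sub>n)\<close> is the locus where the two-row matrix with columns
 \<open>(\<xi> i j, \<xi> i (j + 1))\<close> has rank at most one. A binary quadric \<open>h\<close> is apolar to a vector \<open>v\<close> if it kills all
 triples \<open>(\<xi> i j v, \<xi> i (j + 1) v, \<xi> i (j + 2) v)\<close>. If \<open>h\<close> is a product of two independent linear forms, this
 says that \<open>v\<close> is the sum of two vectors of the scroll over the zeros of \<open>h\<close>; if \<open>h\<close> is a square, that \<open>v\<close> is
 tangent to the scroll. So the varieties of the theorem have the following cones: \<open>W\<close> consists of the vectors
 apolar to some \<open>h \<noteq> 0\<close>, \<open>V\<close> of those apolar to a square, \<open>B\<close> of those for which the components with
 \<open>a i \<ge> 2\<close> form a vector of the scroll, \<open>A\<close> of those for which these components vanish, and \<open>U\<close> of those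
 for which the components with \<open>a i = 2\<close> are proportional and the ones with \<open>a i \<ge> 3\<close> vanish. All of these are
 given by polynomial equations, which makes the inclusions easy and identifies the Zariski closures
 in the definitions of joins, secant and tangent varieties.

 \<^bold>\<open>Secant loci.\<close> Let \<open>w\<close> be a vector outside the cone \<open>C\<close> over the scroll. Suppose that a linear subspace \<open>M\<close>
 contains \<open>w\<close>, that a quadric \<open>q\<close> from the ideal of \<open>C\<close> generates the restriction of this ideal to \<open>M\<close>, and that
 \<open>M\<close> contains the points of contact of all secants and tangents through \<open>w\<close>. Then the secant cone is \<open>M\<close>,
 and the secant locus is the subscheme \<open>q = 0\<close> of \<open>M\<close> (\<open>secant_locus_quadric\<close>): each line of \<open>M\<close> through
 \<open>w\<close> meets \<open>q = 0\<close> in a scheme of length two, whereas on a line through \<open>w\<close> and a point of \<open>C\<close> outside \<open>M\<close> the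
 quadrics of the ideal cut out a reduced point. In each of the six regions a suitable \<open>M\<close>, containing the
 vertex, is written down, with a minor of the matrix as \<open>q\<close>: the span of the vertex and \<open>w\<close> outside \<open>W\<close>, that of
 the vertex and a secant on \<open>W - V\<close>, of the vertex and a tangent on \<open>V - (B \<union> U)\<close>, and of the vertex
 and the plane of two lines, the plane of a conic or the space of a quadric surface on the remaining ones. Outside
 \<open>B \<union> U\<close> there is up to scalars at most one apolar quadric (\<open>apolar_unique\<close>), which controls the
 secants and tangents through \<open>w\<close>; on the other regions they are computed directly.

 \<^bold>\<open>Conclusion.\<close> Each region therefore lies in its stratum. The regions partition the complement of the scroll,
 so it remains to see that the strata are disjoint (\<open>strata\<close>). The support of the secant locus spans a space whose
 dimension exceeds that of the vertex by \<open>0\<close>, \<open>1\<close>, \<open>2\<close>, \<open>3\<close>, \<open>3\<close>, \<open>4\<close> for the empty set, a double point, two points,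
 two lines, a smooth conic and a smooth quadric surface, and a smooth conic contains no line.
\<close>

section \<open>Polynomial functions\<close>

lemma poly_mapping_sum_single: "(\<Sum>m\<in>Poly_Mapping.keys f. Poly_Mapping.single m (Poly_Mapping.lookup f m)) = f"
 by (rule poly_mapping_eqI)
  (auto simp: lookup_sum lookup_single when_def in_keys_iff sum.delta')

lemma mpeval_superset:
 assumes "finite S" "Poly_Mapping.keys f \<subseteq> S"
 shows "mpeval f v = (\<Sum>m\<in>S. Poly_Mapping.lookup f m * (\<Prod>i\<in>UNIV. (v $ i) ^ Poly_Mapping.lookup m i))"
 unfolding mpeval_def by (rule sum.mono_neutral_left) (use assms in \<open>auto simp: in_keys_iff\<close>)

lemma mpeval_add [simp]: "mpeval (f + g) v = mpeval f v + mpeval g v"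
proof -
 let ?S = "Poly_Mapping.keys f \<union> Poly_Mapping.keys g"
 have "Poly_Mapping.keys (f + g) \<subseteq> ?S" by (rule keys_add)
 then show ?thesis
  by (simp add: mpeval_superset[of ?S] lookup_add distrib_right sum.distrib)
qed

lemma mpeval_0 [simp]: "mpeval 0 v = 0"
 by (simp add: mpeval_def)

lemma mpeval_sum: "mpeval (\<Sum>x\<in>S. f x) v = (\<Sum>x\<in>S. mpeval (f x) v)"
 by (induction S rule: infinite_finite_induct) auto

lemma mpeval_single [simp]:
 "mpeval (Poly_Mapping.single m c) v = c * (\<Prod>i\<in>UNIV. (v $ i) ^ Poly_Mapping.lookup m i)"
 by (subst mpeval_superset[of "{m}"]) auto

lemma mpeval_mult [simp]: "mpeval (f * g) v = mpeval f v * mpeval g v"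
proof -
 have "f * g = (\<Sum>m\<in>Poly_Mapping.keys f. Poly_Mapping.single m (Poly_Mapping.lookup f m)) *
   (\<Sum>m\<in>Poly_Mapping.keys g. Poly_Mapping.single m (Poly_Mapping.lookup g m))"
  by (simp add: poly_mapping_sum_single)
 also have "\<dots> = (\<Sum>m\<in>Poly_Mapping.keys f. \<Sum>n\<in>Poly_Mapping.keys g.
   Poly_Mapping.single (m + n) (Poly_Mapping.lookup f m * Poly_Mapping.lookup g n))"
  by (simp add: sum_product mult_single)
 finally have "f * g = \<dots>" .
 then have "mpeval (f * g) v = (\<Sum>m\<in>Poly_Mapping.keys f. \<Sum>n\<in>Poly_Mapping.keys g.
   Poly_Mapping.lookup f m * Poly_Mapping.lookup g n * (\<Prod>i\<in>UNIV. (v $ i) ^ Poly_Mapping.lookup (m + n) i))"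
  by (simp add: mpeval_sum)
 also have "\<dots> = mpeval f v * mpeval g v"
  unfolding mpeval_def sum_product
  by (simp add: lookup_add power_add prod.distrib mult_ac)
 finally show ?thesis .
qed

lemma mpeval_1 [simp]: "mpeval 1 v = 1"
proof -
 have "mpeval (Poly_Mapping.single 0 1) v = 1" by (subst mpeval_single) simp
 then show ?thesis by (simp only: single_one)
qed

lemma mpeval_power [simp]: "mpeval (f ^ n) v = mpeval f v ^ n"
 by (induction n) auto

lemma mpeval_uminus [simp]: "mpeval (- f) v = - mpeval f v"
 using mpeval_add[of f "- f" v] by (simp add: eq_neg_iff_add_eq_0 add.commute)

lemma mpeval_minus [simp]: "mpeval (f - g) v = mpeval f v - mpeval g v"
 using mpeval_add[of f "- g" v] by simp

lemma mpeval_scale [simp]: "mpeval (mpscale c f) v = c * mpeval f v"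
 unfolding mpscale_def by simp

definition mpvar :: "'d \<Rightarrow> ('k::field, 'd::finite) mpoly" where
 "mpvar i = Poly_Mapping.single (Poly_Mapping.single i 1) 1"

lemma mpeval_var [simp]: "mpeval (mpvar i) v = v $ i"
proof -
 have "(\<Prod>j\<in>UNIV. (v $ j) ^ Poly_Mapping.lookup (Poly_Mapping.single i (1::nat)) j)
   = (\<Prod>j\<in>UNIV. if j = i then v $ j else 1)"
  by (rule prod.cong) (auto simp: lookup_single when_def)
 then show ?thesis by (simp add: mpvar_def)
qed

text \<open>The functions \<open>mpeval F\<close>, with an induction principle that spares the bookkeeping of
 monomials.\<close>

inductive polyfun :: "('k::field ^ 'd::finite \<Rightarrow> 'k) \<Rightarrow> bool" where
 polyfun_const: "polyfun (\<lambda>_. c)"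
| polyfun_coord: "polyfun (\<lambda>v. v $ i)"
| polyfun_add: "polyfun f \<Longrightarrow> polyfun g \<Longrightarrow> polyfun (\<lambda>v. f v + g v)"
| polyfun_mult: "polyfun f \<Longrightarrow> polyfun g \<Longrightarrow> polyfun (\<lambda>v. f v * g v)"

lemma polyfun_sum: "(\<And>x. x \<in> S \<Longrightarrow> polyfun (f x)) \<Longrightarrow> polyfun (\<lambda>v. \<Sum>x\<in>S. f x v)"
 by (induction S rule: infinite_finite_induct) (auto intro: polyfun.intros)

lemma polyfun_power: "polyfun f \<Longrightarrow> polyfun (\<lambda>v. f v ^ n)"
 by (induction n) (auto intro: polyfun.intros)

lemma polyfun_prod: "(\<And>x. x \<in> S \<Longrightarrow> polyfun (f x)) \<Longrightarrow> polyfun (\<lambda>v. \<Prod>x\<in>S. f x v)"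
 by (induction S rule: infinite_finite_induct) (auto intro: polyfun.intros)

lemma polyfun_uminus: "polyfun f \<Longrightarrow> polyfun (\<lambda>v. - f v)"
 using polyfun_mult[OF polyfun_const[of "-1"], of f] by simp

lemma polyfun_diff: "polyfun f \<Longrightarrow> polyfun g \<Longrightarrow> polyfun (\<lambda>v. f v - g v)"
 using polyfun_add[OF _ polyfun_uminus, of f g] by simp

lemmas polyfun_intros = polyfun.intros polyfun_sum polyfun_power polyfun_prod polyfun_uminus polyfun_diff

lemma polyfun_mpeval: "polyfun (mpeval f)"
 unfolding mpeval_def[abs_def] by (intro polyfun_intros)

lemma polyfun_obtain:
 assumes "polyfun f"
 obtains F where "f = mpeval F"
proof -
 have "\<exists>F. f = mpeval F" using assms
 proof induction
  case (polyfun_const c)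
  show ?case by (rule exI[of _ "mpscale c 1"]) (simp add: fun_eq_iff)
 next
  case (polyfun_coord i)
  show ?case by (rule exI[of _ "mpvar i"]) (simp add: fun_eq_iff)
 next
  case (polyfun_add f g)
  then obtain F G where "f = mpeval F" "g = mpeval G" by blast
  then show ?case by (intro exI[of _ "F + G"]) (simp add: fun_eq_iff)
 next
  case (polyfun_mult f g)
  then obtain F G where "f = mpeval F" "g = mpeval G" by blast
  then show ?case by (intro exI[of _ "F * G"]) (simp add: fun_eq_iff)
 qed
 then show ?thesis using that by blast
qed

subsection \<open>Linear functionals\<close>

definition functional :: "('k::field ^ 'd::finite \<Rightarrow> 'k) \<Rightarrow> bool" where
 "functional f \<longleftrightarrow> (\<forall>u v. f (u + v) = f u + f v) \<and> (\<forall>c v. f (c *s v) = c * f v)"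

lemma functionalD:
 assumes "functional f"
 shows "f (u + v) = f u + f v" "f (c *s v) = c * f v" "f 0 = 0" "f (- v) = - f v"
  "f (u - v) = f u - f v" "f (\<Sum>x\<in>S. g x) = (\<Sum>x\<in>S. f (g x))"
proof -
 show a: "f (u + v) = f u + f v" for u v using assms by (auto simp: functional_def)
 show s: "f (c *s v) = c * f v" for c v using assms by (auto simp: functional_def)
 show z: "f 0 = 0" using s[of 0 0] by simp
 show m: "f (- v) = - f v" for v using s[of "-1" v] by (simp add: vec.scale_minus_left)
 show "f (u - v) = f u - f v" using a[of u "- v"] m by simp
 show "f (\<Sum>x\<in>S. g x) = (\<Sum>x\<in>S. f (g x))"
  by (induction S rule: infinite_finite_induct) (auto simp: a z)
qed

lemma functionalI:
 "(\<And>u v. f (u + v) = f u + f v) \<Longrightarrow> (\<And>c v. f (c *s v) = c * f v) \<Longrightarrow> functional f"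
 by (simp add: functional_def)

lemma functional_expand:
 assumes "functional f" shows "f v = (\<Sum>i\<in>UNIV. v $ i * f (axis i 1))"
proof -
 have "v = (\<Sum>i\<in>UNIV. v $ i *s axis i 1)" by (simp add: basis_expansion)
 then have "f v = f (\<Sum>i\<in>UNIV. v $ i *s axis i 1)" by simp
 then show ?thesis by (simp add: functionalD[OF assms])
qed

lemma functional_scale: "functional f \<Longrightarrow> functional (\<lambda>v. c * f v)"
 unfolding functional_def by (simp add: algebra_simps)

lemma functional_diff: "functional f \<Longrightarrow> functional g \<Longrightarrow> functional (\<lambda>v. f v - g v)"
 unfolding functional_def by (simp add: algebra_simps)

lemma polyfun_functional: assumes "functional f" shows "polyfun f"
proof -
 have "f = (\<lambda>v. \<Sum>i\<in>UNIV. v $ i * f (axis i 1))" using functional_expand[OF assms] by blast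
 moreover have "polyfun (\<lambda>v. \<Sum>i\<in>UNIV. v $ i * f (axis i 1))" by (intro polyfun_intros)
 ultimately show ?thesis by metis
qed

lemma polyfun_compose:
 assumes "polyfun f" "\<And>i. polyfun (\<lambda>v. g v $ i)"
 shows "polyfun (\<lambda>v. f (g v))"
 using assms(1) by induction (auto intro: polyfun_intros assms(2))

text \<open>A vector outside a subspace can be completed to a basis that extends one of the subspace.\<close>

lemma functional_separates:
 assumes N: "vec.subspace N" and w: "w \<notin> N"
 obtains l where "functional l" "l w = 1" "\<And>v. v \<in> N \<Longrightarrow> l v = 0"
proof -
 obtain B where B: "B \<subseteq> N" "vec.independent B" "N \<subseteq> vec.span B"
  using vec.maximal_independent_subset[of N] by metis
 have sp: "vec.span B = N" using B N vec.span_minimal by blast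
 have ind: "vec.independent (insert w B)"
  using B w sp by (intro vec.independent_insertI) auto
 define C where "C = vec.extend_basis (insert w B)"
 have C: "vec.independent C" "vec.span C = UNIV" "insert w B \<subseteq> C"
  unfolding C_def using vec.independent_extend_basis[OF ind] vec.span_extend_basis[OF ind]
   vec.extend_basis_superset[OF ind] by auto
 define l where "l = (\<lambda>v. vec.representation C v w)"
 have "functional l" unfolding l_def
  by (rule functionalI) (simp_all add: vec.representation_add[OF C(1)] vec.representation_scale[OF C(1)] C(2))
 moreover have "l w = 1" unfolding l_def using vec.representation_basis[OF C(1), of w] C(3) by simp
 moreover have "l v = 0" if "v \<in> N" for v
 proof -
  have "v \<in> vec.span B" using that sp by simp
  then show ?thesis
  proof (induction rule: vec.span_induct_alt)
   case base show ?case by (simp add: functionalD[OF \<open>functional l\<close>])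
  next
   case (step c x y)
   have "x \<in> C" "x \<noteq> w" using step(1) C(3) B(1) w by auto
   then have "l x = 0" unfolding l_def using vec.representation_basis[OF C(1), of x] by simp
   then show ?case using step by (simp add: functionalD[OF \<open>functional l\<close>])
  qed
 qed
 ultimately show ?thesis using that by blast
qed

subsection \<open>Forms\<close>

lemma mdeg_add: "mdeg (m + n) = mdeg m + mdeg n"
 by (simp add: mdeg_def lookup_add sum.distrib)

lemma mdeg_0 [simp]: "mdeg 0 = 0"
 by (simp add: mdeg_def)

lemma mdeg_single: "mdeg (Poly_Mapping.single i n) = n"
proof -
 have "mdeg (Poly_Mapping.single i n) = (\<Sum>j\<in>UNIV. if j = i then n else 0)"
  unfolding mdeg_def by (rule sum.cong) (auto simp: lookup_single when_def)
 then show ?thesis by simp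
qed

lemma forms_0 [simp]: "0 \<in> forms e"
 by (simp add: forms_def)

lemma forms_add: "f \<in> forms e \<Longrightarrow> g \<in> forms e \<Longrightarrow> f + g \<in> forms e"
 unfolding forms_def using keys_add[of f g] by blast

lemma forms_uminus: "f \<in> forms e \<Longrightarrow> - f \<in> forms e"
 unfolding forms_def by (simp add: keys_def)

lemma forms_diff: "f \<in> forms e \<Longrightarrow> g \<in> forms e \<Longrightarrow> f - g \<in> forms e"
 using forms_add[of f e "- g"] forms_uminus[of g e] by simp

lemma forms_mult: "f \<in> forms e \<Longrightarrow> g \<in> forms e' \<Longrightarrow> f * g \<in> forms (e + e')"
 unfolding forms_def using keys_mult[of f g] by (auto simp: mdeg_add)

lemma forms_one: "1 \<in> forms 0"
 by (simp add: forms_def)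

lemma forms_power: "f \<in> forms e \<Longrightarrow> f ^ n \<in> forms (n * e)"
 by (induction n) (auto simp: forms_one intro: forms_mult)

lemma forms_scale: "f \<in> forms e \<Longrightarrow> mpscale c f \<in> forms e"
proof -
 assume "f \<in> forms e"
 moreover have "Poly_Mapping.single 0 c \<in> forms 0" by (simp add: forms_def)
 ultimately show ?thesis unfolding mpscale_def using forms_mult by fastforce
qed

lemma forms_sum: "(\<And>x. x \<in> S \<Longrightarrow> f x \<in> forms e) \<Longrightarrow> (\<Sum>x\<in>S. f x) \<in> forms e"
 by (induction S rule: infinite_finite_induct) (auto intro: forms_add)

lemma forms_var: "mpvar i \<in> forms 1"
 by (simp add: mpvar_def forms_def mdeg_single)

lemma functional_form:
 assumes "functional f" obtains l where "l \<in> forms 1" "mpeval l = f"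
proof
 let ?l = "\<Sum>i\<in>UNIV. mpscale (f (axis i 1)) (mpvar i)"
 show "?l \<in> forms 1" by (intro forms_sum forms_scale forms_var)
 show "mpeval ?l = f"
  by (rule ext, subst functional_expand[OF assms]) (simp add: mpeval_sum mult.commute)
qed

lemma mpeval_homogeneous: "f \<in> forms e \<Longrightarrow> mpeval f (c *s v) = c ^ e * mpeval f v"
 unfolding mpeval_def sum_distrib_left
proof (rule sum.cong)
 fix m assume "f \<in> forms e" "m \<in> Poly_Mapping.keys f"
 then have "mdeg m = e" by (simp add: forms_def)
 then have "(\<Prod>i\<in>UNIV. c ^ Poly_Mapping.lookup m i) = c ^ e"
  by (simp add: power_sum[symmetric] mdeg_def)
 then show "Poly_Mapping.lookup f m * (\<Prod>i\<in>UNIV. (c *s v) $ i ^ Poly_Mapping.lookup m i) =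
     c ^ e * (Poly_Mapping.lookup f m * (\<Prod>i\<in>UNIV. v $ i ^ Poly_Mapping.lookup m i))"
  by (simp add: power_mult_distrib prod.distrib)
qed simp

lemma finite_monomials: "finite {m :: 'd::finite \<Rightarrow>\<^sub>0 nat. mdeg m = e}"
proof (rule finite_imageD)
 have "Poly_Mapping.lookup m i \<le> e" if "mdeg m = e" for m :: "'d \<Rightarrow>\<^sub>0 nat" and i
  using that member_le_sum[of i UNIV "Poly_Mapping.lookup m"] by (simp add: mdeg_def)
 then have "Poly_Mapping.lookup ` {m :: 'd \<Rightarrow>\<^sub>0 nat. mdeg m = e} \<subseteq> (UNIV \<rightarrow>\<^sub>E {..e})"
  by auto
 then show "finite (Poly_Mapping.lookup ` {m :: 'd \<Rightarrow>\<^sub>0 nat. mdeg m = e})"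
  by (rule finite_subset) (intro finite_PiE, auto)
 show "inj_on Poly_Mapping.lookup {m :: 'd \<Rightarrow>\<^sub>0 nat. mdeg m = e}"
  by (simp add: inj_on_def)
qed

lemma forms_span:
 "forms e \<subseteq> mpv.span ((\<lambda>m. Poly_Mapping.single m 1) ` {m :: 'd::finite \<Rightarrow>\<^sub>0 nat. mdeg m = e})"
proof
 fix f :: "('k::field, 'd) mpoly" assume f: "f \<in> forms e"
 have "f = (\<Sum>m\<in>Poly_Mapping.keys f. mpscale (Poly_Mapping.lookup f m) (Poly_Mapping.single m 1))"
  by (simp add: mpscale_def mult_single poly_mapping_sum_single)
 also have "\<dots> \<in> mpv.span ((\<lambda>m. Poly_Mapping.single m 1) ` {m. mdeg m = e})"
  using f by (intro mpv.span_sum mpv.span_scale mpv.span_base) (auto simp: forms_def)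
 finally show "f \<in> mpv.span ((\<lambda>m. Poly_Mapping.single m 1) ` {m. mdeg m = e})" .
qed

lemma forms_subspace: "mpv.subspace (forms e)"
 unfolding mpv.subspace_def by (auto intro: forms_add forms_scale)

subsection \<open>Restriction to curves and directional derivatives\<close>

lemma mpeval_mpderiv:
 "mpeval (mpderiv i f) v = (\<Sum>m\<in>Poly_Mapping.keys f. of_nat (Poly_Mapping.lookup m i) * Poly_Mapping.lookup f m *
   (v $ i ^ (Poly_Mapping.lookup m i - 1) * (\<Prod>j\<in>UNIV - {i}. v $ j ^ Poly_Mapping.lookup m j)))"
proof -
 have "(\<Prod>j\<in>UNIV. v $ j ^ Poly_Mapping.lookup (m - Poly_Mapping.single i 1) j) =
   v $ i ^ (Poly_Mapping.lookup m i - 1) * (\<Prod>j\<in>UNIV - {i}. v $ j ^ Poly_Mapping.lookup m j)" for m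
  by (subst prod.remove[of UNIV i]) (auto simp: lookup_minus lookup_single when_def intro!: prod.cong)
 then show ?thesis unfolding mpderiv_def mpeval_sum mpeval_single by simp
qed

text \<open>The chain rule, as an identity of polynomials: it holds in every characteristic.\<close>

lemma mpeval_along_curve:
 fixes P :: "'d::finite \<Rightarrow> 'k::field poly"
 obtains R where "\<And>\<tau>. poly R \<tau> = mpeval f (\<chi> i. poly (P i) \<tau>)"
  "poly (pderiv R) 0 = dir_deriv f (\<chi> i. poly (P i) 0) (\<chi> i. poly (pderiv (P i)) 0)"
proof
 define R where "R = (\<Sum>m\<in>Poly_Mapping.keys f. smult (Poly_Mapping.lookup f m) (\<Prod>i\<in>UNIV. P i ^ Poly_Mapping.lookup m i))"
 show "poly R \<tau> = mpeval f (\<chi> i. poly (P i) \<tau>)" for \<tau>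
  unfolding R_def mpeval_def by (simp add: poly_sum poly_prod poly_power)
 have pp: "pderiv (p ^ n) = smult (of_nat n) (p ^ (n - 1)) * pderiv p" for p :: "'k poly" and n
  by (cases n) (simp_all add: pderiv_power_Suc del: of_nat_Suc power_Suc)
 have "poly (pderiv R) 0 = (\<Sum>m\<in>Poly_Mapping.keys f. Poly_Mapping.lookup f m *
   (\<Sum>i\<in>UNIV. (\<Prod>j\<in>UNIV-{i}. poly (P j) 0 ^ Poly_Mapping.lookup m j) *
    (of_nat (Poly_Mapping.lookup m i) * (poly (P i) 0 ^ (Poly_Mapping.lookup m i - 1)) * poly (pderiv (P i)) 0)))"
  unfolding R_def
  by (simp add: higher_pderiv_sum[of 1, simplified] pderiv_smult pderiv_prod pp poly_sum poly_prod poly_power mult_ac)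
 also have "\<dots> = dir_deriv f (\<chi> i. poly (P i) 0) (\<chi> i. poly (pderiv (P i)) 0)"
  unfolding dir_deriv_def mpeval_mpderiv sum_distrib_left sum_distrib_right
  by (subst sum.swap, rule sum.cong[OF refl], rule sum.cong[OF refl]) (simp add: mult_ac)
 finally show "poly (pderiv R) 0 = \<dots>" .
qed

lemma infinite_alg_closed: "infinite (UNIV :: 'k::alg_closed_field set)"
proof
 assume fin: "finite (UNIV :: 'k set)"
 define p :: "'k poly" where "p = (\<Prod>c\<in>UNIV. [:- c, 1:]) + 1"
 have deg: "degree (\<Prod>c\<in>UNIV. [:- c, 1:] :: 'k poly) = card (UNIV :: 'k set)"
  by (subst degree_prod_sum_eq) auto
 have "card (UNIV :: 'k set) > 0" using fin by (simp add: card_gt_0_iff)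
 then have "degree p > 0" unfolding p_def using deg by (subst degree_add_eq_left) auto
 then obtain x where "poly p x = 0" using alg_closed_imp_poly_has_root by blast
 moreover have "(\<Prod>c\<in>UNIV. poly [:- c, 1:] x) = 0"
  using fin by (intro prod_zero) (auto intro!: bexI[of _ x])
 then have "poly p x = 1" unfolding p_def by (simp add: poly_prod)
 ultimately show False by simp
qed

lemma poly_eq_if_cofinite:
 fixes p q :: "'k::alg_closed_field poly"
 assumes "finite S" "\<And>x. x \<notin> S \<Longrightarrow> poly p x = poly q x"
 shows "p = q"
proof (rule ccontr)
 assume "p \<noteq> q"
 then have "finite {x. poly (p - q) x = 0}" by (intro poly_roots_finite) simp
 moreover have "- S \<subseteq> {x. poly (p - q) x = 0}" using assms by auto
 ultimately have "finite (- S)" by (rule rev_finite_subset)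
 then have "finite (S \<union> - S)" using assms(1) by simp
 then have "finite (UNIV :: 'k set)" by (simp only: Compl_partition)
 then show False using infinite_alg_closed by blast
qed

section \<open>Algebraic cones and their projectivisations\<close>

definition cone :: "('k::field ^ 'd::finite) set \<Rightarrow> bool" where
 "cone S \<longleftrightarrow> 0 \<in> S \<and> (\<forall>c. \<forall>v\<in>S. c *s v \<in> S)"

definition alg_cone :: "('k::field ^ 'd::finite) set \<Rightarrow> bool" where
 "alg_cone S \<longleftrightarrow> cone S \<and> (\<exists>F. (\<forall>f\<in>F. polyfun f) \<and> S = {v. \<forall>f\<in>F. f v = 0})"

lemma alg_cone_imp_cone: "alg_cone S \<Longrightarrow> cone S"
 by (simp add: alg_cone_def)

lemma cone_scale: "cone S \<Longrightarrow> v \<in> S \<Longrightarrow> c *s v \<in> S"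
 by (simp add: cone_def)

lemma subspace_imp_cone: "vec.subspace S \<Longrightarrow> cone S"
 by (simp add: cone_def vec.subspace_0 vec.subspace_scale)

lemma subspace_imp_alg_cone:
 assumes "vec.subspace S" shows "alg_cone S"
 unfolding alg_cone_def
proof (intro conjI exI)
 show "cone S" using assms by (rule subspace_imp_cone)
 let ?F = "{l. functional l \<and> (\<forall>v\<in>S. l v = 0)}"
 show "\<forall>f\<in>?F. polyfun f" by (simp add: polyfun_functional)
 show "S = {v. \<forall>f\<in>?F. f v = 0}"
 proof (rule set_eqI, rule iffI)
  fix v assume v: "v \<in> {v. \<forall>f\<in>?F. f v = 0}"
  show "v \<in> S"
  proof (rule ccontr)
   assume "v \<notin> S"
   then obtain l where "functional l" "l v = 1" "\<And>u. u \<in> S \<Longrightarrow> l u = 0"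
    using functional_separates[OF assms] by metis
   then show False using v by force
  qed
 qed auto
qed

lemma alg_cone_Int:
 assumes "alg_cone S" "alg_cone T" shows "alg_cone (S \<inter> T)"
proof -
 obtain F G where "\<forall>f\<in>F. polyfun f" "S = {v. \<forall>f\<in>F. f v = 0}"
   "\<forall>f\<in>G. polyfun f" "T = {v. \<forall>f\<in>G. f v = 0}"
  using assms unfolding alg_cone_def by blast
 then show ?thesis using assms unfolding alg_cone_def cone_def
  by (intro conjI exI[of _ "F \<union> G"]) auto
qed

text \<open>The restriction to \<open>{v. \<forall>x\<in>A. f x v = 0}\<close> is the form in which determinantal
 conditions appear below.\<close>

lemma alg_coneI:
 assumes "cone S" "\<And>x. x \<in> A \<Longrightarrow> polyfun (f x)" "S = {v. \<forall>x\<in>A. f x v = 0}"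
 shows "alg_cone S"
 unfolding alg_cone_def using assms by (intro conjI exI[of _ "f ` A"]) auto

lemma alg_cone_quadric:
 assumes "vec.subspace M" "q \<in> forms 2"
 shows "alg_cone {v \<in> M. mpeval q v = 0}"
proof -
 have "alg_cone {v. mpeval q v = 0}"
  by (rule alg_coneI[where A = "{()}" and f = "\<lambda>_. mpeval q"])
   (use assms in \<open>auto simp: cone_def mpeval_homogeneous polyfun_mpeval mpeval_homogeneous[of q 2 0 0, simplified]\<close>)
 then have "alg_cone (M \<inter> {v. mpeval q v = 0})"
  by (rule alg_cone_Int[OF subspace_imp_alg_cone[OF assms(1)]])
 then show ?thesis by (simp add: Int_def)
qed

lemma span_singleton: "vec.span {v} = range (\<lambda>c. c *s v)"
 by (rule vec.span_singleton)

lemma mem_span_singleton: "u \<in> vec.span {v} \<longleftrightarrow> (\<exists>c. u = c *s v)"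
 by (auto simp: span_singleton)

lemma span_singleton_eq_iff:
 fixes u v :: "'k::field ^ 'd::finite"
 assumes "u \<noteq> 0" shows "vec.span {u} = vec.span {v} \<longleftrightarrow> (\<exists>c. c \<noteq> 0 \<and> u = c *s v)"
proof
 assume "vec.span {u} = vec.span {v}"
 then have "u \<in> vec.span {v}" using vec.span_base[of u "{u}"] by simp
 then obtain c where "u = c *s v" by (auto simp: mem_span_singleton)
 then show "\<exists>c. c \<noteq> 0 \<and> u = c *s v" using assms by (intro exI[of _ c]) auto
next
 assume "\<exists>c. c \<noteq> 0 \<and> u = c *s v"
 then obtain c where c: "c \<noteq> 0" "u = c *s v" by blast
 then have "v = inverse c *s u" by simp
 then have "v \<in> vec.span {u}" by (auto simp: mem_span_singleton)
 moreover have "u \<in> vec.span {v}" using c by (auto simp: mem_span_singleton)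
 ultimately show "vec.span {u} = vec.span {v}"
  by (simp add: vec.span_eq)
qed

lemma mem_proj_pts:
 assumes "cone S" "v \<noteq> 0"
 shows "vec.span {v} \<in> proj_pts S \<longleftrightarrow> v \<in> S"
proof
 assume "vec.span {v} \<in> proj_pts S"
 then obtain u where "u \<in> S" "u \<noteq> 0" "vec.span {v} = vec.span {u}" by (auto simp: proj_pts_def)
 then obtain c where "v = c *s u" using span_singleton_eq_iff[OF assms(2)] by blast
 then show "v \<in> S" using assms(1) \<open>u \<in> S\<close> by (simp add: cone_scale)
qed (use assms in \<open>auto simp: proj_pts_def\<close>)

lemma proj_ptsE:
 assumes "p \<in> proj_pts S" obtains v where "v \<in> S" "v \<noteq> 0" "p = vec.span {v}"
 using assms by (auto simp: proj_pts_def)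

lemma proj_pts_mono: "S \<subseteq> T \<Longrightarrow> proj_pts S \<subseteq> proj_pts T"
 by (auto simp: proj_pts_def)

lemma proj_pts_subset_iff:
 assumes "cone S" "cone T" shows "proj_pts S \<subseteq> proj_pts T \<longleftrightarrow> S \<subseteq> T"
proof
 assume a: "proj_pts S \<subseteq> proj_pts T"
 show "S \<subseteq> T"
 proof
  fix v assume v: "v \<in> S"
  show "v \<in> T"
  proof (cases "v = 0")
   case False
   then have "vec.span {v} \<in> proj_pts S" using v assms mem_proj_pts by blast
   then show ?thesis using a False assms mem_proj_pts by blast
  qed (use assms in \<open>simp add: cone_def\<close>)
 qed
qed (rule proj_pts_mono)

lemma proj_pts_eq_iff:
 assumes "cone S" "cone T" shows "proj_pts S = proj_pts T \<longleftrightarrow> S = T"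
 using proj_pts_subset_iff[OF assms] proj_pts_subset_iff[OF assms(2,1)] by blast

lemma proj_pts_empty_iff: "cone S \<Longrightarrow> proj_pts S = {} \<longleftrightarrow> S = {0}"
 by (auto simp: proj_pts_def cone_def)

lemma mem_point_of_cone:
 assumes "cone S" "p \<in> proj_pts S" "v \<in> p" shows "v \<in> S"
 using assms by (auto elim!: proj_ptsE simp: mem_span_singleton cone_scale)

lemma Union_proj_pts:
 assumes "cone S" "S \<noteq> {0}" shows "\<Union>(proj_pts S) = S"
proof
 show "\<Union>(proj_pts S) \<subseteq> S" using assms mem_point_of_cone by blast
 show "S \<subseteq> \<Union>(proj_pts S)"
 proof
  fix v assume v: "v \<in> S"
  obtain u where u: "u \<in> S" "u \<noteq> 0" using assms by (auto simp: cone_def)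
  show "v \<in> \<Union>(proj_pts S)"
  proof (cases "v = 0")
   case True
   then show ?thesis using u vec.span_zero by (auto simp: proj_pts_def)
  next
   case False
   then show ?thesis using v vec.span_base[of v "{v}"] by (auto simp: proj_pts_def)
  qed
 qed
qed

lemma span_Union_proj_pts:
 assumes "cone S" shows "vec.span (\<Union>(proj_pts S)) = vec.span S"
 using Union_proj_pts[OF assms] proj_pts_empty_iff[OF assms] by (cases "S = {0}") auto

lemma mem_vanishing_ideal:
 assumes "cone S" "S \<noteq> {0}"
 shows "f \<in> vanishing_ideal (proj_pts S) \<longleftrightarrow> (\<forall>v\<in>S. mpeval f v = 0)"
proof -
 have "f \<in> vanishing_ideal (proj_pts S) \<longleftrightarrow> (\<forall>v\<in>\<Union>(proj_pts S). mpeval f v = 0)"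
  by (auto simp: vanishing_ideal_def)
 then show ?thesis using Union_proj_pts[OF assms] by simp
qed

lemma zclosure_subset:
 assumes "alg_cone S" "Y \<subseteq> proj_pts S" shows "zclosure Y \<subseteq> proj_pts S"
proof
 fix p assume p: "p \<in> zclosure Y"
 obtain F where F: "\<forall>f\<in>F. polyfun f" "S = {v. \<forall>f\<in>F. f v = 0}" using assms unfolding alg_cone_def by blast
 obtain v where v: "v \<noteq> 0" "p = vec.span {v}"
  using p unfolding zclosure_def by (auto elim: proj_ptsE)
 have "f v = 0" if f: "f \<in> F" for f
 proof -
  obtain G where G: "f = mpeval G" using F f polyfun_obtain by metis
  have "G \<in> vanishing_ideal Y" unfolding vanishing_ideal_def
  proof (intro CollectI ballI)
   fix y u assume "y \<in> Y" "u \<in> y"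
   then have "u \<in> S" using assms mem_point_of_cone alg_cone_imp_cone by blast
   then show "mpeval G u = 0" using F f G by auto
  qed
  then show ?thesis using p v G vec.span_base[of v "{v}"] unfolding zclosure_def by auto
 qed
 then have "v \<in> S" using F by auto
 then show "p \<in> proj_pts S" using v by (auto simp: proj_pts_def)
qed

lemma subset_zclosure: "Y \<subseteq> proj_space \<Longrightarrow> Y \<subseteq> zclosure Y"
 by (auto simp: zclosure_def vanishing_ideal_def)

lemma zclosure_proj_pts: "alg_cone S \<Longrightarrow> zclosure (proj_pts S) = proj_pts S"
 by (intro equalityI zclosure_subset subset_zclosure proj_pts_mono) auto

text \<open>Every computation of a closure below has this form: \<open>S\<close> is closed, and a form vanishing on \<open>Y\<close>
 vanishes on \<open>S\<close>.\<close>

lemma zclosure_eqI: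
 assumes "alg_cone S" "Y \<subseteq> proj_pts S"
  "\<And>v f. v \<in> S \<Longrightarrow> v \<noteq> 0 \<Longrightarrow> f \<in> vanishing_ideal Y \<Longrightarrow> mpeval f v = 0"
 shows "zclosure Y = proj_pts S"
proof
 show "zclosure Y \<subseteq> proj_pts S" by (rule zclosure_subset) (use assms in auto)
 show "proj_pts S \<subseteq> zclosure Y"
 proof
  fix p assume "p \<in> proj_pts S"
  then obtain v where v: "v \<in> S" "v \<noteq> 0" "p = vec.span {v}" by (rule proj_ptsE)
  have Yne: "Y \<noteq> {}"
  proof
   assume "Y = {}"
   then have "1 \<in> vanishing_ideal Y" by (simp add: vanishing_ideal_def)
   then show False using assms(3)[OF v(1,2), of 1] by simp
  qed
  have z: "mpeval f 0 = 0" if "f \<in> vanishing_ideal Y" for f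
  proof -
   obtain y where "y \<in> Y" using Yne by blast
   moreover from this obtain u where "y = vec.span {u}" using assms(2) by (auto elim: proj_ptsE)
   ultimately show ?thesis using that vec.span_zero[of "{u}"] by (auto simp: vanishing_ideal_def)
  qed
  show "p \<in> zclosure Y" unfolding zclosure_def
  proof (intro CollectI conjI ballI)
   show "p \<in> proj_space" using v by (auto simp: proj_pts_def)
   fix f u assume f: "f \<in> vanishing_ideal Y" and "u \<in> p"
   then obtain c where u: "u = c *s v" using v by (auto simp: mem_span_singleton)
   have "cone S" using assms(1) by (rule alg_cone_imp_cone)
   then show "mpeval f u = 0"
    using assms(3)[of u f] z f u v cone_scale by (cases "u = 0") auto
  qed
 qed
qed

lemma span_Union_zclosure:
 assumes "Y \<subseteq> proj_space" shows "vec.span (\<Union>(zclosure Y)) = vec.span (\<Union>Y)"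
proof
 let ?N = "vec.span (\<Union>Y)"
 have "Y \<subseteq> proj_pts ?N"
 proof
  fix p assume p: "p \<in> Y"
  then obtain v where v: "v \<noteq> 0" "p = vec.span {v}" using assms by (auto elim: proj_ptsE)
  then have "v \<in> \<Union>Y" using p vec.span_base[of v "{v}"] by blast
  then have "v \<in> ?N" by (rule vec.span_base)
  then show "p \<in> proj_pts ?N" using v by (auto simp: proj_pts_def)
 qed
 then have "zclosure Y \<subseteq> proj_pts ?N"
  by (rule zclosure_subset[OF subspace_imp_alg_cone[OF vec.subspace_span]])
 then have "\<Union>(zclosure Y) \<subseteq> ?N"
  using mem_point_of_cone[OF subspace_imp_cone[OF vec.subspace_span]] by blast
 then show "vec.span (\<Union>(zclosure Y)) \<subseteq> ?N" by (rule vec.span_minimal) simp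
 show "?N \<subseteq> vec.span (\<Union>(zclosure Y))"
  using subset_zclosure[OF assms] by (intro vec.span_mono) blast
qed

lemma span_span_union: "vec.span (vec.span A \<union> vec.span B) = vec.span (A \<union> B)"
proof
 have "vec.span A \<subseteq> vec.span (A \<union> B)" "vec.span B \<subseteq> vec.span (A \<union> B)"
  by (auto intro: vec.span_mono[THEN subsetD])
 then show "vec.span (vec.span A \<union> vec.span B) \<subseteq> vec.span (A \<union> B)"
  by (intro vec.span_minimal) auto
 show "vec.span (A \<union> B) \<subseteq> vec.span (vec.span A \<union> vec.span B)"
  by (intro vec.span_mono Un_mono vec.span_superset)
qed

lemma lin_span_pair: "lin_span {vec.span {u}, vec.span {v}} = proj_pts (vec.span {u, v})"
 unfolding lin_span_def using span_span_union[of "{u}" "{v}"] by (simp add: insert_commute)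

lemma mem_span_pair: "x \<in> vec.span {u, v} \<longleftrightarrow> (\<exists>a b. x = a *s u + b *s v)"
proof
 assume "x \<in> vec.span {u, v}"
 then obtain k where "x - k *s u \<in> vec.span {v}" by (auto simp: vec.span_insert)
 then obtain b where "x - k *s u = b *s v" by (auto simp: mem_span_singleton)
 then have "x = k *s u + b *s v" by (simp add: algebra_simps)
 then show "\<exists>a b. x = a *s u + b *s v" by blast
next
 assume "\<exists>a b. x = a *s u + b *s v"
 then show "x \<in> vec.span {u, v}"
  using vec.span_base[of u "{u, v}"] vec.span_base[of v "{u, v}"] by (auto intro!: vec.span_add vec.span_scale)
qed

text \<open>The join is described on the level of cones; its lines have to join distinct points,
 whence the last two assumptions.\<close>

lemma join_cones:
 assumes P: "cone P" and Z: "cone Z" and C: "alg_cone C"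
  and C_eq: "C = {p + z | p z. p \<in> P \<and> z \<in> Z}"
  and hp: "\<And>z. z \<in> Z \<Longrightarrow> z \<noteq> 0 \<Longrightarrow> P \<noteq> {0} \<Longrightarrow> \<exists>p\<in>P. p \<noteq> 0 \<and> vec.span {p} \<noteq> vec.span {z}"
  and hz: "\<And>p. p \<in> P \<Longrightarrow> p \<noteq> 0 \<Longrightarrow> Z \<noteq> {0} \<Longrightarrow> \<exists>z\<in>Z. z \<noteq> 0 \<and> vec.span {p} \<noteq> vec.span {z}"
 shows "join (proj_pts P) (proj_pts Z) = proj_pts C"
proof (cases "P = {0} \<or> Z = {0}")
 case True
 then show ?thesis
 proof
  assume "P = {0}"
  then have "C = Z" using C_eq by auto
  moreover have "proj_pts P = {}" using \<open>P = {0}\<close> P by (simp add: proj_pts_empty_iff)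
  ultimately show ?thesis by (simp add: join_def)
 next
  assume "Z = {0}"
  then have "C = P" using C_eq by auto
  moreover have "proj_pts Z = {}" using \<open>Z = {0}\<close> Z by (simp add: proj_pts_empty_iff)
  ultimately show ?thesis by (simp add: join_def)
 qed
next
 case False
 let ?Y = "\<Union>{lin_span {y, z} | y z. y \<in> proj_pts P \<and> z \<in> proj_pts Z \<and> y \<noteq> z}"
 have line: "a *s p + b *s z \<in> C" if "p \<in> P" "z \<in> Z" for a b p z
  using cone_scale[OF P that(1), of a] cone_scale[OF Z that(2), of b] C_eq by blast
 have mem: "vec.span {x} \<in> ?Y" if "p \<in> P" "z \<in> Z" "p \<noteq> 0" "z \<noteq> 0" "vec.span {p} \<noteq> vec.span {z}"
   "x = a *s p + b *s z" "x \<noteq> 0" for p z x a b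
 proof -
  have "vec.span {x} \<in> lin_span {vec.span {p}, vec.span {z}}"
   unfolding lin_span_pair using that mem_span_pair[of x p z] by (auto simp: proj_pts_def)
  moreover have "vec.span {p} \<in> proj_pts P" "vec.span {z} \<in> proj_pts Z" using that by (auto simp: proj_pts_def)
  ultimately show ?thesis using that by blast
 qed
 have "?Y = proj_pts C"
 proof
  show "?Y \<subseteq> proj_pts C"
  proof
   fix x assume "x \<in> ?Y"
   then obtain y z where yz: "y \<in> proj_pts P" "z \<in> proj_pts Z" "x \<in> lin_span {y, z}" by blast
   from yz(1) obtain p where p: "p \<in> P" "y = vec.span {p}" by (rule proj_ptsE)
   from yz(2) obtain z' where z': "z' \<in> Z" "z = vec.span {z'}" by (rule proj_ptsE)
   have "x \<in> proj_pts (vec.span {p, z'})" using yz(3) p z' lin_span_pair by blast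
   then obtain u where u: "u \<in> vec.span {p, z'}" "u \<noteq> 0" "x = vec.span {u}" by (rule proj_ptsE)
   then show "x \<in> proj_pts C" using line p z' by (auto simp: mem_span_pair proj_pts_def)
  qed
  show "proj_pts C \<subseteq> ?Y"
  proof
   fix x assume "x \<in> proj_pts C"
   then obtain u where u: "u \<in> C" "u \<noteq> 0" "x = vec.span {u}" by (rule proj_ptsE)
   then obtain p z where pz: "p \<in> P" "z \<in> Z" "u = p + z" using C_eq by blast
   consider "p = 0" | "z = 0" | "p \<noteq> 0" "z \<noteq> 0" "vec.span {p} \<noteq> vec.span {z}"
    | "p \<noteq> 0" "z \<noteq> 0" "vec.span {p} = vec.span {z}" by blast
   then show "x \<in> ?Y"
   proof cases
    case 1
    then have z: "z \<noteq> 0" "u = z" using u pz by auto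
    then obtain p' where "p' \<in> P" "p' \<noteq> 0" "vec.span {p'} \<noteq> vec.span {z}" using hp pz False by blast
    then show ?thesis using mem[of p' z u 0 1] z u pz by simp
   next
    case 2
    then have z: "p \<noteq> 0" "u = p" using u pz by auto
    then obtain z' where "z' \<in> Z" "z' \<noteq> 0" "vec.span {p} \<noteq> vec.span {z'}" using hz pz False by blast
    then show ?thesis using mem[of p z' u 1 0] z u pz by simp
   next
    case 3
    then show ?thesis using mem[of p z u 1 1] u pz by simp
   next
    case 4
    then obtain c where c: "p = c *s z" using span_singleton_eq_iff by blast
    obtain p' where "p' \<in> P" "p' \<noteq> 0" "vec.span {p'} \<noteq> vec.span {z}" using hp pz 4 False by blast
    moreover have "u = (c + 1) *s z" using pz c by (simp add: vec.scale_left_distrib)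
    ultimately show ?thesis using mem[of p' z u 0 "c + 1"] 4 u pz by simp
   qed
  qed
 qed
 then have "join (proj_pts P) (proj_pts Z) = zclosure (proj_pts C)"
  using False P Z by (simp add: join_def proj_pts_empty_iff)
 then show ?thesis using C by (simp add: zclosure_proj_pts)
qed

section \<open>Division of polynomial functions on a linear subspace\<close>

lemma polyfun_on_line:
 assumes "polyfun f" obtains R where "\<And>\<tau>. poly R \<tau> = f (u + \<tau> *s v)"
proof -
 have "\<exists>R. \<forall>\<tau>. poly R \<tau> = f (u + \<tau> *s v)" using assms
 proof induction
  case (polyfun_const c) show ?case by (rule exI[of _ "[:c:]"]) simp
 next
  case (polyfun_coord i) show ?case by (rule exI[of _ "[:u $ i, v $ i:]"]) simp
 next
  case (polyfun_add f g)
  then obtain R S where "\<forall>\<tau>. poly R \<tau> = f (u + \<tau> *s v)" "\<forall>\<tau>. poly S \<tau> = g (u + \<tau> *s v)" by blast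
  then show ?case by (intro exI[of _ "R + S"]) simp
 next
  case (polyfun_mult f g)
  then obtain R S where "\<forall>\<tau>. poly R \<tau> = f (u + \<tau> *s v)" "\<forall>\<tau>. poly S \<tau> = g (u + \<tau> *s v)" by blast
  then show ?case by (intro exI[of _ "R * S"]) simp
 qed
 then show ?thesis using that by blast
qed

text \<open>On the line joining \<open>v0\<close> and \<open>v\<close> the product of two polynomials in one variable vanishes, and the
 first is not zero.\<close>

lemma polyfun_no_zero_divisors:
 fixes f g :: "'k::alg_closed_field ^ 'd::finite \<Rightarrow> 'k"
 assumes f: "polyfun f" and g: "polyfun g" and M: "vec.subspace M"
  and fg: "\<And>v. v \<in> M \<Longrightarrow> f v * g v = 0" and nz: "v0 \<in> M" "f v0 \<noteq> 0" and v: "v \<in> M"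
 shows "g v = 0"
proof -
 obtain R where R: "\<And>\<tau>. poly R \<tau> = f (v + \<tau> *s (v0 - v))" using polyfun_on_line[OF f] by blast
 obtain S where S: "\<And>\<tau>. poly S \<tau> = g (v + \<tau> *s (v0 - v))" using polyfun_on_line[OF g] by blast
 have "v + \<tau> *s (v0 - v) \<in> M" for \<tau>
  using M v nz by (intro vec.subspace_add vec.subspace_scale vec.subspace_diff)
 then have "R * S = 0" using fg R S by (intro poly_eq_if_cofinite[of "{}"]) auto
 moreover have "R \<noteq> 0" using R[of 1] nz by auto
 ultimately have "S = 0" by simp
 then show "g v = 0" using S[of 0] by simp
qed

text \<open>The difference \<open>v - (v - l v *s e)\<close> is a multiple of \<open>e\<close> by \<open>l v\<close>.\<close>

lemma polyfun_factor:
 assumes "polyfun f" and l: "functional l"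
 obtains h where "polyfun h" "\<And>v. f v = f (v - l v *s e) + l v * h v"
proof -
 have p: "polyfun (\<lambda>v. (v - l v *s e) $ i)" for i
  using polyfun_functional[OF l] by (auto intro!: polyfun_intros)
 have "\<exists>h. polyfun h \<and> (\<forall>v. f v = f (v - l v *s e) + l v * h v)" using assms(1)
 proof induction
  case (polyfun_const c) show ?case by (intro exI[of _ "\<lambda>_. 0"]) (simp add: polyfun.polyfun_const)
 next
  case (polyfun_coord i) show ?case by (intro exI[of _ "\<lambda>_. e $ i"]) (simp add: polyfun.polyfun_const)
 next
  case (polyfun_add f g)
  then obtain h k where hk: "polyfun h" "\<And>v. f v = f (v - l v *s e) + l v * h v"
   "polyfun k" "\<And>v. g v = g (v - l v *s e) + l v * k v" by blast
  have "f v + g v = f (v - l v *s e) + g (v - l v *s e) + l v * (h v + k v)" for v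
  proof -
   have "f v + g v = (f (v - l v *s e) + l v * h v) + (g (v - l v *s e) + l v * k v)"
    by (rule arg_cong2[where f = "(+)"]) (rule hk)+
   also have "\<dots> = f (v - l v *s e) + g (v - l v *s e) + l v * (h v + k v)"
    by (simp add: distrib_left add_ac)
   finally show ?thesis .
  qed
  then show ?case using polyfun.polyfun_add[OF hk(1,3)] by (intro exI conjI allI)
 next
  case (polyfun_mult f g)
  then obtain h k where hk: "polyfun h" "\<And>v. f v = f (v - l v *s e) + l v * h v"
   "polyfun k" "\<And>v. g v = g (v - l v *s e) + l v * k v" by blast
  have "polyfun (\<lambda>v. h v * g v + f (v - l v *s e) * k v)"
   by (intro polyfun_intros hk polyfun_mult polyfun_compose[of f] p)
  moreover have "f v * g v = f (v - l v *s e) * g (v - l v *s e) + l v * (h v * g v + f (v - l v *s e) * k v)" for v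
  proof -
   have "f v * g v = f (v - l v *s e) * g v + l v * (h v * g v)"
    by (subst hk(2)) (simp add: algebra_simps)
   also have "f (v - l v *s e) * g v = f (v - l v *s e) * g (v - l v *s e) + l v * (f (v - l v *s e) * k v)"
    by (subst hk(4)) (simp add: algebra_simps)
   finally show ?thesis by (simp add: algebra_simps)
  qed
  ultimately show ?case by (intro exI conjI allI)
 qed
 then show ?thesis using that by blast
qed

lemma divides_by_functional:
 assumes f: "polyfun f" and l: "functional l" "l e = 1" and M: "vec.subspace M" "e \<in> M"
  and vanish: "\<And>v. v \<in> M \<Longrightarrow> l v = 0 \<Longrightarrow> f v = 0"
 obtains h where "polyfun h" "\<And>v. v \<in> M \<Longrightarrow> f v = l v * h v"
proof -
 obtain h where h: "polyfun h" "\<And>v. f v = f (v - l v *s e) + l v * h v"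
  using polyfun_factor[OF f l(1)] by blast
 have "f v = l v * h v" if "v \<in> M" for v
 proof -
  have "f (v - l v *s e) = 0"
   using that M l by (intro vanish vec.subspace_diff vec.subspace_scale) (auto simp: functionalD[OF l(1)])
  then show ?thesis using h(2)[of v] by simp
 qed
 then show ?thesis using h that by blast
qed

lemma dir_deriv_eq_coeff:
 fixes f :: "('k::alg_closed_field, 'd::finite) mpoly"
 assumes "\<And>\<tau>. mpeval f (v + \<tau> *s w) = poly R \<tau>"
 shows "dir_deriv f v w = coeff R 1"
proof -
 obtain S where S: "\<And>\<tau>. poly S \<tau> = mpeval f (\<chi> i. poly [:v $ i, w $ i:] \<tau>)"
  "poly (pderiv S) 0 = dir_deriv f (\<chi> i. poly [:v $ i, w $ i:] 0) (\<chi> i. poly (pderiv [:v $ i, w $ i:]) 0)"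
  by (rule mpeval_along_curve[of f "\<lambda>i. [:v $ i, w $ i:]"]) (rule that)
 have "(\<chi> i. poly [:v $ i, w $ i:] \<tau>) = v + \<tau> *s w" for \<tau> by (simp add: vec_eq_iff)
 then have "S = R" using S(1) assms by (intro poly_eq_if_cofinite[of "{}"]) auto
 moreover have "(\<chi> i. poly [:v $ i, w $ i:] 0) = v" "(\<chi> i. poly (pderiv [:v $ i, w $ i:]) 0) = w"
  by (simp_all add: vec_eq_iff pderiv_pCons)
 ultimately show ?thesis using S(2) by (simp add: poly_0_coeff_0 coeff_pderiv)
qed

lemma dir_deriv_along_curve:
 fixes f :: "('k::alg_closed_field, 'd::finite) mpoly"
 assumes curve: "\<And>i \<tau>. \<gamma> \<tau> $ i = poly (P i) \<tau>" and zero: "\<And>\<tau>. mpeval f (\<gamma> \<tau>) = 0"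
  and "\<And>i. v $ i = coeff (P i) 0" "\<And>i. w $ i = coeff (P i) 1"
 shows "dir_deriv f v w = 0"
proof -
 obtain R where R: "\<And>\<tau>. poly R \<tau> = mpeval f (\<chi> i. poly (P i) \<tau>)"
  "poly (pderiv R) 0 = dir_deriv f (\<chi> i. poly (P i) 0) (\<chi> i. poly (pderiv (P i)) 0)"
  by (rule mpeval_along_curve[of f P]) (rule that)
 have "(\<chi> i. poly (P i) \<tau>) = \<gamma> \<tau>" for \<tau> by (simp add: vec_eq_iff curve)
 then have "R = 0" using R(1) zero by (intro poly_eq_if_cofinite[of "{}"]) auto
 moreover have "(\<chi> i. poly (P i) 0) = v" "(\<chi> i. poly (pderiv (P i)) 0) = w"
  using assms(3,4) by (simp_all add: vec_eq_iff poly_0_coeff_0 coeff_pderiv)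
 ultimately show ?thesis using R(2) by simp
qed

text \<open>The quotient by \<open>l\<close> vanishes again on the hyperplane \<open>l = 0\<close>, since its value there is the derivative
 of \<open>f\<close> in the direction \<open>e\<close>.\<close>

lemma divides_by_square:
 fixes f :: "('k::alg_closed_field, 'd::finite) mpoly"
 assumes l: "functional l" "l e = 1" and M: "vec.subspace M" "e \<in> M"
  and vanish: "\<And>v. v \<in> M \<Longrightarrow> l v = 0 \<Longrightarrow> mpeval f v = 0"
  and deriv: "\<And>v. v \<in> M \<Longrightarrow> l v = 0 \<Longrightarrow> dir_deriv f v e = 0"
 obtains h where "polyfun h" "\<And>v. v \<in> M \<Longrightarrow> mpeval f v = l v ^ 2 * h v"
proof -
 obtain h where h: "polyfun h" "\<And>v. v \<in> M \<Longrightarrow> mpeval f v = l v * h v"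
  using divides_by_functional[OF polyfun_mpeval l M vanish] by blast
 have "h v = 0" if v: "v \<in> M" "l v = 0" for v
 proof -
  obtain S where S: "\<And>\<tau>. poly S \<tau> = h (v + \<tau> *s e)" using polyfun_on_line[OF h(1)] by blast
  have "mpeval f (v + \<tau> *s e) = poly ([:0, 1:] * S) \<tau>" for \<tau>
   using v M l S h(2)[of "v + \<tau> *s e"]
   by (simp add: vec.subspace_add vec.subspace_scale functionalD[OF l(1)])
  then have "dir_deriv f v e = coeff ([:0, 1:] * S) 1" by (rule dir_deriv_eq_coeff)
  then have "coeff S 0 = 0" using deriv[OF v] by simp
  then show ?thesis using S[of 0] by (simp add: poly_0_coeff_0)
 qed
 then obtain k where k: "polyfun k" "\<And>v. v \<in> M \<Longrightarrow> h v = l v * k v"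
  using divides_by_functional[OF h(1) l M] by blast
 then show ?thesis using h that[of k] by (simp add: power2_eq_square mult.assoc)
qed

lemma divides_by_functional_pair:
 fixes f :: "'k::alg_closed_field ^ 'd::finite \<Rightarrow> 'k"
 assumes f: "polyfun f" and M: "vec.subspace M"
  and y: "functional y" "y a = 1" "a \<in> M" and z: "functional z" "z b = 1" "b \<in> M" and za: "z a = 0"
  and vanish: "\<And>v. v \<in> M \<Longrightarrow> y v * z v = 0 \<Longrightarrow> f v = 0"
 obtains h where "polyfun h" "\<And>v. v \<in> M \<Longrightarrow> f v = y v * z v * h v"
proof -
 obtain h where h: "polyfun h" "\<And>v. v \<in> M \<Longrightarrow> f v = y v * h v"
  using divides_by_functional[OF f y(1,2) M y(3)] vanish by (metis mult_zero_left)
 let ?N = "{v \<in> M. z v = 0}"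
 have N: "vec.subspace ?N"
  using M by (auto simp: vec.subspace_def functionalD[OF z(1)])
 have "h v = 0" if "v \<in> ?N" for v
  using polyfun_no_zero_divisors[OF polyfun_functional[OF y(1)] h(1) N, of a v] h(2) vanish y za that by auto
 then obtain k where "polyfun k" "\<And>v. v \<in> M \<Longrightarrow> h v = z v * k v"
  using divides_by_functional[OF h(1) z(1,2) M z(3)] by blast
 then show ?thesis using h that[of k] by (simp add: mult.assoc)
qed

text \<open>Elimination of the coordinate \<open>z\<close>, along the direction \<open>b\<close>, by means of \<open>y z = g\<close> after
 multiplication by a power of \<open>y\<close>.\<close>

lemma reduce_mod_quadric:
 assumes f: "polyfun f" and y: "functional y" and z: "functional z" "z b = 1" and yb: "y b = 0"
  and g: "polyfun g" "\<And>v c. g (v + c *s b) = g v"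
 obtains N A H where "polyfun A" "polyfun H" "\<And>v c. A (v + c *s b) = A v"
  "\<And>v. y v ^ N * f v = A v + (y v * z v - g v) * H v"
proof -
 note yp = polyfun_functional[OF y] and zp = polyfun_functional[OF z(1)]
 let ?P = "\<lambda>f N A H. polyfun A \<and> polyfun H \<and> (\<forall>v c. A (v + c *s b) = A v) \<and>
  (\<forall>v. y v ^ N * f v = A v + (y v * z v - g v) * H v)"
 have yv: "y (v + c *s b) = y v" for v c by (simp add: functionalD[OF y] yb)
 have "\<exists>N A H. ?P f N A H" using f
 proof induction
  case (polyfun_const c)
  show ?case by (rule exI[of _ 0], rule exI[of _ "\<lambda>_. c"], rule exI[of _ "\<lambda>_. 0"])
    (simp add: polyfun.polyfun_const)
 next
  case (polyfun_coord i)
  let ?A = "\<lambda>v. y v * (v $ i - z v * b $ i) + g v * b $ i" and ?H = "\<lambda>_ :: ('a, 'b) vec. b $ i"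
  have "?P (\<lambda>v. v $ i) 1 ?A ?H"
   by (auto intro!: polyfun_intros yp zp g(1) simp: yv g(2) functionalD[OF z(1)] z(2) algebra_simps)
  then show ?case by blast
 next
  case (polyfun_add f1 f2)
  then obtain N1 A1 H1 N2 A2 H2 where 1: "?P f1 N1 A1 H1" and 2: "?P f2 N2 A2 H2" by blast
  let ?A = "\<lambda>v. y v ^ N2 * A1 v + y v ^ N1 * A2 v" and ?H = "\<lambda>v. y v ^ N2 * H1 v + y v ^ N1 * H2 v"
  have "y v ^ (N1 + N2) * (f1 v + f2 v) = ?A v + (y v * z v - g v) * ?H v" for v
  proof -
   have "y v ^ (N1 + N2) * (f1 v + f2 v) = y v ^ N2 * (y v ^ N1 * f1 v) + y v ^ N1 * (y v ^ N2 * f2 v)"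
    by (simp add: algebra_simps power_add)
   also have "y v ^ N1 * f1 v = A1 v + (y v * z v - g v) * H1 v" using 1 by blast
   also have "y v ^ N2 * f2 v = A2 v + (y v * z v - g v) * H2 v" using 2 by blast
   finally show ?thesis by (simp add: algebra_simps)
  qed
  moreover have "polyfun ?A" "polyfun ?H" using 1 2 by (auto intro!: polyfun_intros yp)
  ultimately have "?P (\<lambda>v. f1 v + f2 v) (N1 + N2) ?A ?H" using 1 2 by (simp add: yv)
  then show ?case by blast
 next
  case (polyfun_mult f1 f2)
  then obtain N1 A1 H1 N2 A2 H2 where 1: "?P f1 N1 A1 H1" and 2: "?P f2 N2 A2 H2" by blast
  let ?A = "\<lambda>v. A1 v * A2 v" and ?H = "\<lambda>v. A1 v * H2 v + H1 v * A2 v + (y v * z v - g v) * H1 v * H2 v"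
  have "y v ^ (N1 + N2) * (f1 v * f2 v) = ?A v + (y v * z v - g v) * ?H v" for v
  proof -
   have "y v ^ (N1 + N2) * (f1 v * f2 v) = (y v ^ N1 * f1 v) * (y v ^ N2 * f2 v)"
    by (simp add: algebra_simps power_add)
   also have "y v ^ N1 * f1 v = A1 v + (y v * z v - g v) * H1 v" using 1 by blast
   also have "y v ^ N2 * f2 v = A2 v + (y v * z v - g v) * H2 v" using 2 by blast
   finally show ?thesis by (simp add: algebra_simps)
  qed
  moreover have "polyfun ?A" "polyfun ?H" using 1 2 by (auto intro!: polyfun_intros yp zp g(1))
  ultimately have "?P (\<lambda>v. f1 v * f2 v) (N1 + N2) ?A ?H" using 1 2 by simp
  then show ?case by blast
 qed
 then show ?thesis using that by metis
qed

text \<open>The quadric \<open>y z - g\<close> with \<open>g \<noteq> 0\<close> free of \<open>y\<close> and \<open>z\<close> generates the ideal of its zero set on \<open>M\<close>. If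
 \<open>y \<noteq> 0\<close>, then \<open>z = g / y\<close> gives a zero, so that the remainder \<open>A\<close> of the elimination vanishes; the power of \<open>y\<close> is then
 cancelled, as \<open>g\<close> does not vanish identically on the hyperplane \<open>y = 0\<close>.\<close>

lemma divides_by_quadric:
 fixes f :: "'k::alg_closed_field ^ 'd::finite \<Rightarrow> 'k"
 assumes f: "polyfun f" and M: "vec.subspace M"
  and y: "functional y" "y a = 1" "a \<in> M" "y b = 0" and z: "functional z" "z b = 1" "b \<in> M" "z a = 0"
  and g: "polyfun g" "\<And>v c. g (v + c *s a) = g v" "\<And>v c. g (v + c *s b) = g v" and gnz: "u \<in> M" "g u \<noteq> 0"
  and vanish: "\<And>v. v \<in> M \<Longrightarrow> y v * z v = g v \<Longrightarrow> f v = 0"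
 obtains h where "polyfun h" "\<And>v. v \<in> M \<Longrightarrow> f v = (y v * z v - g v) * h v"
proof -
 note yp = polyfun_functional[OF y(1)]
 obtain N A H where A: "polyfun A" "polyfun H" "\<And>v c. A (v + c *s b) = A v"
  and eq: "\<And>v. y v ^ N * f v = A v + (y v * z v - g v) * H v"
  using reduce_mod_quadric[OF f y(1) z(1,2) y(4) g(1,3)] by metis
 have yA: "y v * A v = 0" if v: "v \<in> M" for v
 proof (cases "y v = 0")
  case False
  define x where "x = v + (g v / y v - z v) *s b"
  have x: "x \<in> M" unfolding x_def using v z M by (intro vec.subspace_add vec.subspace_scale)
  have xs: "y x = y v" "z x = g v / y v" "g x = g v" "A x = A v"
   unfolding x_def by (simp_all add: functionalD[OF y(1)] functionalD[OF z(1)] y z g A)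
  have "f x = 0" using vanish[OF x] xs False by simp
  then have "A x = 0" using eq[of x] xs False by simp
  then show ?thesis using xs by simp
 qed simp
 have A0: "A v = 0" if "v \<in> M" for v
  by (rule polyfun_no_zero_divisors[OF yp A(1) M yA y(3)]) (use y(2) that in auto)
 define N' where "N' = {v \<in> M. y v = 0}"
 have sN: "vec.subspace N'" unfolding N'_def
  using M by (auto simp: vec.subspace_def functionalD[OF y(1)])
 have gN: "u - y u *s a \<in> N'" "g (u - y u *s a) \<noteq> 0"
 proof -
  show "u - y u *s a \<in> N'" unfolding N'_def using gnz M y
   by (auto simp: functionalD[OF y(1)] intro!: vec.subspace_diff vec.subspace_scale)
  have "u - y u *s a = u + (- y u) *s a" by (simp add: vec.scale_minus_left)
  then show "g (u - y u *s a) \<noteq> 0" using g(2)[of u "- y u"] gnz by simp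
 qed
 have "\<exists>h. polyfun h \<and> (\<forall>v\<in>M. f v = (y v * z v - g v) * h v)"
  if "polyfun H" "\<forall>v\<in>M. y v ^ N * f v = (y v * z v - g v) * H v" for H N
  using that
 proof (induction N arbitrary: H)
  case (Suc N)
  have "H v = 0" if v: "v \<in> N'" for v
  proof (rule polyfun_no_zero_divisors[OF g(1) Suc.prems(1) sN _ gN v])
   fix x assume "x \<in> N'"
   then show "g x * H x = 0" using Suc.prems(2) by (auto simp: N'_def)
  qed
  then obtain K where K: "polyfun K" "\<And>v. v \<in> M \<Longrightarrow> H v = y v * K v"
   using divides_by_functional[OF Suc.prems(1) y(1,2) M y(3)] by (auto simp: N'_def)
  let ?D = "\<lambda>v. y v ^ N * f v - (y v * z v - g v) * K v"
  have pD: "polyfun ?D" by (intro polyfun_intros f yp K g polyfun_functional[OF z(1)])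
  have yD: "y v * ?D v = 0" if "v \<in> M" for v
  proof -
   have "y v * ?D v = y v ^ Suc N * f v - (y v * z v - g v) * (y v * K v)"
    by (simp add: algebra_simps)
   then show ?thesis using Suc.prems(2) K(2) that by simp
  qed
  have "?D v = 0" if "v \<in> M" for v
   by (rule polyfun_no_zero_divisors[OF yp pD M yD y(3)]) (use y(2) that in auto)
  then show ?case using Suc.IH[OF K(1)] by simp
 qed auto
 then show ?thesis using that A(2) eq A0 by (metis add_0)
qed

section \<open>Ideals of quadrics in linear subspaces\<close>

lemma vanishing_ideal_subspace: "mpideal.subspace (vanishing_ideal Y)"
 by (auto simp: mpideal.subspace_def vanishing_ideal_def)

lemma mem_ideal_sum:
 assumes M: "cone M" "M \<noteq> {0}" and I: "mpideal.subspace I"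
 shows "f \<in> mpideal.span (vanishing_ideal (proj_pts M) \<union> I) \<longleftrightarrow> (\<exists>g\<in>I. \<forall>v\<in>M. mpeval f v = mpeval g v)"
proof -
 have "f \<in> mpideal.span (vanishing_ideal (proj_pts M) \<union> I) \<longleftrightarrow>
   (\<exists>a\<in>vanishing_ideal (proj_pts M). \<exists>g\<in>I. f = a + g)"
  unfolding mpideal.span_Un using I vanishing_ideal_subspace[of "proj_pts M"]
  by (auto simp: mpideal.span_eq_iff[THEN iffD2])
 also have "\<dots> \<longleftrightarrow> (\<exists>g\<in>I. f - g \<in> vanishing_ideal (proj_pts M))"
  by (metis add_diff_cancel_right' diff_add_cancel)
 finally show ?thesis using M by (simp add: mem_vanishing_ideal)
qed

lemma mem_scheme_inter:
 assumes M: "cone M" "M \<noteq> {0}" and I: "mpideal.subspace I"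
 shows "f \<in> scheme_inter I (vanishing_ideal (proj_pts M)) \<longleftrightarrow>
  (\<exists>e. \<forall>g\<in>forms e. \<exists>h\<in>I. \<forall>v\<in>M. mpeval g v * mpeval f v = mpeval h v)"
 unfolding scheme_inter_def saturate_def Un_commute[of I] by (simp add: mem_ideal_sum[OF assms])

text \<open>The saturated ideal of the subscheme \<open>q = 0\<close> of \<open>M\<close>.\<close>

definition quadric_ideal ::
 "('k::field ^ 'd::finite) set \<Rightarrow> ('k, 'd) mpoly \<Rightarrow> ('k, 'd) mpoly set" where
 "quadric_ideal M q = {f. \<exists>e. \<forall>g\<in>forms e. \<exists>h. \<forall>v\<in>M. mpeval g v * mpeval f v = mpeval q v * mpeval h v}"

lemma obtain_nonvanishing_form:
 fixes v :: "'k::field ^ 'd::finite"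
 assumes "v \<noteq> 0" obtains g :: "('k, 'd) mpoly" where "g \<in> forms e" "mpeval g v \<noteq> 0"
proof -
 obtain i where "v $ i \<noteq> 0" using assms by (auto simp: vec_eq_iff)
 moreover have "mpvar i ^ e \<in> forms e" using forms_power[OF forms_var[of i], of e] by simp
 ultimately show ?thesis using that[of "mpvar i ^ e"] by simp
qed

lemma quadric_ideal_double_hyperplane:
 assumes M: "vec.subspace M" and l: "functional l" "e \<in> M" "l e = 1" and c: "c \<noteq> 0"
  and q: "\<And>v. v \<in> M \<Longrightarrow> mpeval q v = c * l v ^ 2"
 shows "is_double_hyperplane (quadric_ideal M q) (proj_pts {v \<in> M. l v = 0}) (proj_pts M)"
proof -
 obtain L where L: "L \<in> forms 1" "mpeval L = l" using functional_form[OF l(1)] by blast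
 have e0: "e \<noteq> 0" using l by (auto simp: functionalD[OF l(1)])
 note cM = subspace_imp_cone[OF M]
 have nz: "M \<noteq> {0}" using l(2) e0 by auto
 have E: "proj_pts {v \<in> M. l v = 0} = {p \<in> proj_pts M. \<forall>v\<in>p. mpeval L v = 0}"
 proof (intro equalityI subsetI)
  fix p assume "p \<in> proj_pts {v \<in> M. l v = 0}"
  then obtain v where "v \<in> M" "l v = 0" "v \<noteq> 0" "p = vec.span {v}" by (auto elim: proj_ptsE)
  then show "p \<in> {p \<in> proj_pts M. \<forall>v\<in>p. mpeval L v = 0}"
   by (auto simp: proj_pts_def mem_span_singleton L functionalD[OF l(1)])
 next
  fix p assume p: "p \<in> {p \<in> proj_pts M. \<forall>v\<in>p. mpeval L v = 0}"
  then obtain v where "v \<in> M" "v \<noteq> 0" "p = vec.span {v}" by (auto elim: proj_ptsE)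
  moreover from this have "l v = 0" using p vec.span_base[of v "{v}"] L by auto
  ultimately show "p \<in> proj_pts {v \<in> M. l v = 0}" by (auto simp: proj_pts_def)
 qed
 have ne: "proj_pts {v \<in> M. l v = 0} \<noteq> proj_pts M"
 proof
  assume "proj_pts {v \<in> M. l v = 0} = proj_pts M"
  moreover have "cone {v \<in> M. l v = 0}" using cM by (auto simp: cone_def functionalD[OF l(1)])
  ultimately have "{v \<in> M. l v = 0} = M" using proj_pts_eq_iff cM by blast
  then have "l e = 0" using l(2) by blast
  then show False using l(3) by simp
 qed
 have "f \<in> quadric_ideal M q \<longleftrightarrow> f \<in> saturate (mpideal.span (vanishing_ideal (proj_pts M) \<union> {L ^ 2}))" for f
 proof -
  have "mpideal.span (vanishing_ideal (proj_pts M) \<union> {L ^ 2}) =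
    mpideal.span (vanishing_ideal (proj_pts M) \<union> mpideal.span {L ^ 2})"
   unfolding mpideal.span_Un mpideal.span_span ..
  also have "\<dots> = {f. \<exists>h. \<forall>v\<in>M. mpeval f v = l v ^ 2 * mpeval h v}"
   unfolding set_eq_iff mem_ideal_sum[OF cM nz mpideal.subspace_span]
   by (auto simp: mpideal.span_singleton L mult.commute)
  also have "\<dots> = {f. \<exists>h. \<forall>v\<in>M. mpeval f v = mpeval q v * mpeval h v}"
  proof (intro Collect_cong iffI)
   fix f assume "\<exists>h. \<forall>v\<in>M. mpeval f v = l v ^ 2 * mpeval h v"
   then obtain h where "\<forall>v\<in>M. mpeval f v = l v ^ 2 * mpeval h v" by blast
   then show "\<exists>h. \<forall>v\<in>M. mpeval f v = mpeval q v * mpeval h v"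
    by (intro exI[of _ "mpscale (inverse c) h"]) (auto simp: q c field_simps)
  next
   fix f assume "\<exists>h. \<forall>v\<in>M. mpeval f v = mpeval q v * mpeval h v"
   then obtain h where "\<forall>v\<in>M. mpeval f v = mpeval q v * mpeval h v" by blast
   then show "\<exists>h. \<forall>v\<in>M. mpeval f v = l v ^ 2 * mpeval h v"
    by (intro exI[of _ "mpscale c h"]) (auto simp: q)
  qed
  finally show ?thesis unfolding saturate_def quadric_ideal_def by simp
 qed
 then have "quadric_ideal M q = saturate (mpideal.span (vanishing_ideal (proj_pts M) \<union> {L ^ 2}))" by blast
 then show ?thesis
  unfolding is_double_hyperplane_def using L(1) E ne by blast
qed

lemma quadric_ideal_reduced:
 fixes q :: "('k::alg_closed_field, 'd::finite) mpoly"
 assumes M: "vec.subspace M" and q: "q \<in> forms 2" and u: "u \<in> M" "u \<noteq> 0" "mpeval q u = 0"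
  and div: "\<And>f. polyfun f \<Longrightarrow> (\<And>v. v \<in> M \<Longrightarrow> mpeval q v = 0 \<Longrightarrow> f v = 0) \<Longrightarrow>
    \<exists>h. polyfun h \<and> (\<forall>v\<in>M. f v = mpeval q v * h v)"
 shows "quadric_ideal M q = vanishing_ideal (proj_pts {v \<in> M. mpeval q v = 0})"
proof (intro set_eqI)
 fix f
 let ?S = "{v \<in> M. mpeval q v = 0}"
 have S: "cone ?S" "?S \<noteq> {0}"
  using alg_cone_imp_cone[OF alg_cone_quadric[OF M q]] u by auto
 have "f \<in> quadric_ideal M q \<longleftrightarrow> (\<forall>v\<in>?S. mpeval f v = 0)"
 proof
  assume "f \<in> quadric_ideal M q"
  then obtain e where e: "\<forall>g\<in>forms e. \<exists>h. \<forall>v\<in>M. mpeval g v * mpeval f v = mpeval q v * mpeval h v"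
   by (auto simp: quadric_ideal_def)
  have nz: "mpeval f v = 0" if v: "v \<in> ?S" "v \<noteq> 0" for v
  proof -
   obtain g :: "('k, 'd) mpoly" where g: "g \<in> forms e" "mpeval g v \<noteq> 0"
    using obtain_nonvanishing_form[OF v(2)] by blast
   then show ?thesis using e v by fastforce
  qed
  obtain R where R: "\<And>\<tau>. poly R \<tau> = mpeval f (0 + \<tau> *s u)" using polyfun_on_line[OF polyfun_mpeval] by blast
  have "poly R \<tau> = poly 0 \<tau>" if "\<tau> \<notin> {0}" for \<tau>
   using R nz[of "\<tau> *s u"] cone_scale[OF S(1), of u \<tau>] u that by simp
  then have "R = 0" by (intro poly_eq_if_cofinite[of "{0}"]) auto
  then have "mpeval f 0 = 0" using R[of 0] by simp
  then show "\<forall>v\<in>?S. mpeval f v = 0" using nz by auto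
 next
  assume a: "\<forall>v\<in>?S. mpeval f v = 0"
  then obtain h where h: "polyfun h" "\<forall>v\<in>M. mpeval f v = mpeval q v * h v" using div[OF polyfun_mpeval, of f] by auto
  obtain H where H: "h = mpeval H" using polyfun_obtain[OF h(1)] by blast
  show "f \<in> quadric_ideal M q" unfolding quadric_ideal_def
  proof (rule CollectI, rule exI[of _ 0], rule ballI)
   fix g :: "('k, 'd) mpoly"
   show "\<exists>h. \<forall>v\<in>M. mpeval g v * mpeval f v = mpeval q v * mpeval h v"
    using h(2) by (intro exI[of _ "g * H"]) (simp add: H algebra_simps)
  qed
 qed
 then show "f \<in> quadric_ideal M q \<longleftrightarrow> f \<in> vanishing_ideal (proj_pts ?S)"
  by (simp add: mem_vanishing_ideal[OF S])
qed

section \<open>Lengths of finite subschemes of a line\<close>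

lemma mpv_dim_add_2_le:
 fixes F S :: "('k::field, 'd::finite) mpoly set"
 assumes F: "mpv.subspace F" "F \<subseteq> mpv.span T" "finite T" and S: "S \<subseteq> F"
  and lin: "\<And>f g. \<phi> (f + g) = \<phi> f + \<phi> g" "\<And>c f. \<phi> (mpscale c f) = c * \<phi> f"
    "\<And>f g. \<psi> (f + g) = \<psi> f + \<psi> g" "\<And>c f. \<psi> (mpscale c f) = c * \<psi> f"
  and zero: "\<And>f. f \<in> S \<Longrightarrow> \<phi> f = (0::'k) \<and> \<psi> f = (0::'k)"
  and f: "f \<in> F" "\<phi> f = 1" "\<psi> f = 0" and g: "g \<in> F" "\<phi> g = 0" "\<psi> g = 1"
 shows "mpv.dim S + 2 \<le> mpv.dim F"
proof -
 let ?S = "{x \<in> F. \<phi> x = 0 \<and> \<psi> x = 0}"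
 have z: "\<phi> 0 = 0" "\<psi> 0 = 0" using lin(2)[of 0 0] lin(4)[of 0 0] by auto
 have sub: "mpv.subspace ?S"
  using F(1) by (auto simp: mpv.subspace_def lin z)
 obtain B where B: "B \<subseteq> ?S" "mpv.independent B" "?S \<subseteq> mpv.span B" "card B = mpv.dim ?S"
  by (rule mpv.basis_exists[of ?S])
 have spB: "mpv.span B = ?S" using B sub mpv.span_minimal by blast
 have finB: "finite B" using mpv.independent_span_bound[OF F(3) B(2)] B(1) F(2) by blast
 have "mpv.dim S \<le> card B"
  using mpv.dim_le_card[of S B] finB spB zero S by auto
 have "f \<notin> mpv.span B" using spB f by simp
 then have i1: "mpv.independent (insert f B)" "f \<notin> B"
  using B(2) mpv.independent_insertI mpv.span_base by blast+
 have g': "g \<notin> mpv.span (insert f B)"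
 proof
  assume "g \<in> mpv.span (insert f B)"
  then obtain k where "g - mpscale k f \<in> ?S" using spB by (auto simp: mpv.span_insert)
  then have "\<phi> (g - mpscale k f) = 0" "\<psi> (g - mpscale k f) = 0" by auto
  moreover have "g = (g - mpscale k f) + mpscale k f" by simp
  ultimately have "\<psi> g = k * \<psi> f" using lin(3)[of "g - mpscale k f" "mpscale k f"] lin(4) by simp
  then show False using f g by simp
 qed
 then have i2: "mpv.independent (insert g (insert f B))" "g \<notin> insert f B"
  using i1(1) mpv.independent_insertI mpv.span_base by blast+
 obtain C where C: "insert g (insert f B) \<subseteq> C" "C \<subseteq> F" "mpv.independent C" "F \<subseteq> mpv.span C"
  using mpv.maximal_independent_subset_extend[of "insert g (insert f B)" F] i2 f g B by blast
 have finC: "finite C" using mpv.independent_span_bound[OF F(3) C(3)] C(2) F(2) by blast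
 have "card C = mpv.dim F" using mpv.basis_card_eq_dim[OF C(2,4,3)] by simp
 moreover have "card (insert g (insert f B)) \<le> card C" using C finC by (intro card_mono)
 moreover have "card (insert g (insert f B)) = card B + 2" using i1 i2 finB by simp
 ultimately show ?thesis using \<open>mpv.dim S \<le> card B\<close> by simp
qed

lemma mpv_dim_le_Suc:
 fixes F S :: "('k::field, 'd::finite) mpoly set"
 assumes T: "S \<subseteq> mpv.span T" "finite T" and F: "F \<subseteq> mpv.span (insert f S)"
 shows "mpv.dim F \<le> mpv.dim S + 1"
proof -
 obtain B where B: "B \<subseteq> S" "mpv.independent B" "S \<subseteq> mpv.span B" "card B = mpv.dim S"
  by (rule mpv.basis_exists[of S])
 have finB: "finite B" using mpv.independent_span_bound[OF T(2) B(2)] B(1) T(1) by blast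
 have "insert f S \<subseteq> mpv.span (insert f B)"
  using B(3) mpv.span_mono[of B "insert f B"] mpv.span_base[of f "insert f B"] by blast
 then have "mpv.span (insert f S) \<subseteq> mpv.span (insert f B)"
  by (rule mpv.span_minimal) (rule mpv.subspace_span)
 then have "mpv.dim F \<le> card (insert f B)" using F finB by (intro mpv.dim_le_card) auto
 then show ?thesis using B(4) finB card_insert_le_m1[of "Suc (card B)" B f] by (simp add: card_insert_if split: if_splits)
qed

text \<open>The functionals \<open>\<phi>\<close> and \<open>\<psi>\<close> vanish on the ideal and are independent in each degree: evaluation
 at two points, or evaluation and derivative at one point.\<close>

lemma two_le_scheme_length:
 fixes J :: "('k::field, 'd::finite) mpoly set"
 assumes lin: "\<And>f g. \<phi> (f + g) = \<phi> f + \<phi> g" "\<And>c f. \<phi> (mpscale c f) = c * \<phi> f"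
    "\<And>f g. \<psi> (f + g) = \<psi> f + \<psi> g" "\<And>c f. \<psi> (mpscale c f) = c * \<psi> f"
  and zero: "\<And>f. f \<in> J \<Longrightarrow> \<phi> f = (0::'k) \<and> \<psi> f = (0::'k)"
  and f: "\<And>e. e \<ge> 1 \<Longrightarrow> f e \<in> forms e \<and> \<phi> (f e) = 1 \<and> \<psi> (f e) = 0"
  and g: "\<And>e. e \<ge> 1 \<Longrightarrow> g e \<in> forms e \<and> \<phi> (g e) = 0 \<and> \<psi> (g e) = 1"
 shows "2 \<le> scheme_length J"
proof -
 have "2 \<le> hilbert_fun J e" if "e \<ge> 1" for e
 proof -
  have "mpv.dim (J \<inter> forms e) + 2 \<le> mpv.dim (forms e :: ('k, 'd) mpoly set)"
   by (rule mpv_dim_add_2_le[OF forms_subspace forms_span _ _ lin, of e _ "f e" "g e"])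
    (use f[OF that] g[OF that] zero finite_monomials in auto)
  then show ?thesis unfolding hilbert_fun_def by simp
 qed
 then have "eventually (\<lambda>e. 2 \<le> enat (hilbert_fun J e)) sequentially"
  by (auto simp: eventually_sequentially numeral_eq_enat intro!: exI[of _ 1])
 then show ?thesis unfolding scheme_length_def by (rule Liminf_bounded)
qed

text \<open>From degree two on, the ideal contains all forms vanishing at \<open>v\<close>, so that its Hilbert function is at
 most one.\<close>

lemma scheme_length_less_2:
 fixes J :: "('k::field, 'd::finite) mpoly set"
 assumes v: "v \<noteq> 0" and J: "\<And>e u. e \<ge> 2 \<Longrightarrow> u \<in> forms e \<Longrightarrow> mpeval u v = 0 \<Longrightarrow> u \<in> J"
 shows "\<not> 2 \<le> scheme_length J"
proof -
 have "hilbert_fun J e \<le> 1" if e: "e \<ge> 2" for e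
 proof -
  obtain f :: "('k, 'd) mpoly" where f: "f \<in> forms e" "mpeval f v \<noteq> 0"
   using obtain_nonvanishing_form[OF v] by blast
  have "forms e \<subseteq> mpv.span (insert f (J \<inter> forms e))"
  proof
   fix u :: "('k, 'd) mpoly" assume u: "u \<in> forms e"
   let ?c = "mpeval u v / mpeval f v"
   have "u - mpscale ?c f \<in> forms e" by (intro forms_diff forms_scale u f)
   moreover have "mpeval (u - mpscale ?c f) v = 0" using f by simp
   ultimately have "u - mpscale ?c f \<in> mpv.span (insert f (J \<inter> forms e))"
    using J[OF e] by (intro mpv.span_base) auto
   moreover have "mpscale ?c f \<in> mpv.span (insert f (J \<inter> forms e))"
    by (intro mpv.span_scale mpv.span_base) auto
   ultimately have "(u - mpscale ?c f) + mpscale ?c f \<in> mpv.span (insert f (J \<inter> forms e))"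
    by (rule mpv.span_add)
   then show "u \<in> mpv.span (insert f (J \<inter> forms e))" by simp
  qed
  moreover have "J \<inter> forms e \<subseteq> mpv.span ((\<lambda>m. Poly_Mapping.single m 1) ` {m. mdeg m = e})"
   using forms_span by blast
  ultimately have "mpv.dim (forms e :: ('k, 'd) mpoly set) \<le> mpv.dim (J \<inter> forms e) + 1"
   by (intro mpv_dim_le_Suc) (auto intro: finite_monomials)
  then show ?thesis unfolding hilbert_fun_def by simp
 qed
 then have "eventually (\<lambda>e. enat (hilbert_fun J e) \<le> enat 1) sequentially"
  by (auto simp: eventually_sequentially intro!: exI[of _ 2])
 then have "scheme_length J \<le> liminf (\<lambda>e. enat 1)"
  unfolding scheme_length_def by (rule Liminf_mono)
 also have "\<dots> = enat 1" by (rule Liminf_const) simp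
 finally have "scheme_length J \<le> enat 1" .
 then show ?thesis by (auto simp: numeral_eq_enat dest: order_trans)
qed

lemma dir_deriv_add:
 fixes f :: "('k::alg_closed_field, 'd::finite) mpoly"
 shows "dir_deriv (f + g) v w = dir_deriv f v w + dir_deriv g v w"
  and "dir_deriv (mpscale c f) v w = c * dir_deriv f v w"
proof -
 obtain R S where R: "\<And>\<tau>. poly R \<tau> = mpeval f (v + \<tau> *s w)" and S: "\<And>\<tau>. poly S \<tau> = mpeval g (v + \<tau> *s w)"
  using polyfun_on_line[OF polyfun_mpeval] by metis
 have "dir_deriv (f + g) v w = coeff (R + S) 1" "dir_deriv (mpscale c f) v w = coeff (smult c R) 1"
  "dir_deriv f v w = coeff R 1" "dir_deriv g v w = coeff S 1"
  by (rule dir_deriv_eq_coeff; simp add: R S)+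
 then show "dir_deriv (f + g) v w = dir_deriv f v w + dir_deriv g v w"
  "dir_deriv (mpscale c f) v w = c * dir_deriv f v w" by simp_all
qed

lemma quadratic_form_expand:
 fixes f :: "('k::alg_closed_field, 'd::finite) mpoly"
 assumes "f \<in> forms 2"
 shows "mpeval f (a *s w + b *s v) = a^2 * mpeval f w + a * b * dir_deriv f v w + b^2 * mpeval f v"
proof -
 obtain R where R: "\<And>\<tau>. poly R \<tau> = mpeval f (v + \<tau> *s w)" using polyfun_on_line[OF polyfun_mpeval] by blast
 obtain S where S: "\<And>\<tau>. poly S \<tau> = mpeval f (w + \<tau> *s v)" using polyfun_on_line[OF polyfun_mpeval] by blast
 have "poly (monom 1 (degree R) * S) \<tau> = poly (monom 1 2 * reflect_poly R) \<tau>" if "\<tau> \<notin> {0}" for \<tau>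
 proof -
  have "w + \<tau> *s v = \<tau> *s (v + inverse \<tau> *s w)"
   using that by (simp add: vec.scale_right_distrib add.commute)
  then have "poly S \<tau> = \<tau>^2 * poly R (inverse \<tau>)" by (simp add: R S mpeval_homogeneous[OF assms])
  then show ?thesis using that by (simp add: poly_reflect_poly_nz poly_monom)
 qed
 then have eq: "monom 1 (degree R) * S = monom 1 2 * reflect_poly R"
  by (intro poly_eq_if_cofinite[of "{0}"]) auto
 have deg: "degree R \<le> 2"
 proof (rule ccontr)
  assume "\<not> degree R \<le> 2"
  then have "coeff (monom 1 (degree R) * S) 2 = 0" by (simp add: coeff_monom_mult)
  then have "lead_coeff R = 0" unfolding eq by (simp add: coeff_monom_mult)
  then have "R = 0" by simp
  then show False using \<open>\<not> degree R \<le> 2\<close> by simp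
 qed
 have R2: "R = [:coeff R 0, coeff R 1, coeff R 2:]"
  by (rule poly_eqI) (use deg in \<open>auto simp: coeff_pCons coeff_eq_0 numeral_2_eq_2 split: nat.splits\<close>)
 have c0: "coeff R 0 = mpeval f v" using R[of 0] by (simp add: poly_0_coeff_0)
 have c1: "coeff R 1 = dir_deriv f v w" by (rule dir_deriv_eq_coeff[symmetric]) (simp add: R)
 have c2: "coeff R 2 = mpeval f w"
 proof -
  have "coeff (monom 1 (degree R) * S) (degree R) = coeff (monom 1 2 * reflect_poly R) (degree R)"
   using eq by simp
  then have "coeff S 0 = (if 2 \<le> degree R then coeff (reflect_poly R) (degree R - 2) else 0)"
   by (simp add: coeff_monom_mult)
  moreover have "coeff S 0 = mpeval f w" using S[of 0] by (simp add: poly_0_coeff_0)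
  ultimately show ?thesis using deg by (auto simp: coeff_reflect_poly coeff_eq_0)
 qed
 have Rp: "mpeval f (v + \<tau> *s w) = mpeval f v + \<tau> * dir_deriv f v w + \<tau>^2 * mpeval f w" for \<tau>
  unfolding R[symmetric] by (subst R2) (simp add: c0 c1[unfolded One_nat_def] c2 algebra_simps power2_eq_square)
 show ?thesis
 proof (cases "b = 0")
  case True
  then show ?thesis by (simp add: mpeval_homogeneous[OF assms])
 next
  case False
  then have "a *s w + b *s v = b *s (v + (a / b) *s w)" by (simp add: vec.scale_right_distrib add.commute)
  then have "mpeval f (a *s w + b *s v) = b^2 * (mpeval f v + (a/b) * dir_deriv f v w + (a/b)^2 * mpeval f w)"
   by (simp only: mpeval_homogeneous[OF assms] Rp)
  also have "\<dots> = a^2 * mpeval f w + a * b * dir_deriv f v w + b^2 * mpeval f v"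
   using False by (simp add: field_simps power2_eq_square)
  finally show ?thesis .
 qed
qed

section \<open>The secant locus as a quadric\<close>

text \<open>The hypotheses of \<open>secant_locus_quadric\<close>: the cone \<open>C\<close> is cut out by the quadrics \<open>G\<close>,
 the quadric \<open>q\<close> generates the restriction to \<open>M\<close> of the ideal of \<open>C\<close>, and \<open>M\<close> contains
 the points of contact of all secants and tangents of \<open>C\<close> passing through \<open>w\<close>.\<close>

locale secant_quadric =
 fixes G :: "('k::alg_closed_field, 'd::finite) mpoly set" and C M w q
 assumes C_eq: "C = {v. \<forall>g\<in>G. mpeval g v = 0}" and G: "G \<subseteq> forms 2" and C_nontrivial: "C \<noteq> {0}"
  and M: "vec.subspace M" "w \<in> M" and wC: "w \<notin> C"
  and q: "q \<in> forms 2" "mpeval q w \<noteq> 0" and qC: "\<And>v. v \<in> C \<Longrightarrow> mpeval q v = 0"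
  and divides: "\<And>f. (\<And>v. v \<in> C \<Longrightarrow> mpeval f v = 0) \<Longrightarrow> \<exists>h. \<forall>v\<in>M. mpeval f v = mpeval q v * mpeval h v"
  and chord: "\<And>v v'. v \<in> C \<Longrightarrow> v' \<in> C \<Longrightarrow> w = v + v' \<Longrightarrow> v \<in> M"
  and tangent: "\<And>v. v \<in> C \<Longrightarrow> (\<And>g. g \<in> G \<Longrightarrow> dir_deriv g v w = 0) \<Longrightarrow> v \<in> M"
begin

lemma C_cone: "cone C"
 unfolding cone_def
proof (intro conjI allI ballI)
 show "0 \<in> C" using G mpeval_homogeneous[of _ 2 0 0] by (auto simp: C_eq)
 fix c v assume "v \<in> C"
 then show "c *s v \<in> C" using G by (auto simp: C_eq mpeval_homogeneous)
qed

lemma w_nz: "w \<noteq> 0" using wC C_cone by (auto simp: cone_def)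

lemma M_cap_C: "v \<in> M \<Longrightarrow> mpeval q v = 0 \<Longrightarrow> v \<in> C"
proof -
 assume v: "v \<in> M" "mpeval q v = 0"
 have "mpeval g v = 0" if "g \<in> G" for g
 proof -
  have "mpeval g v = 0" if "v \<in> C" for v using that \<open>g \<in> G\<close> by (simp add: C_eq)
  then obtain h where "\<forall>v\<in>M. mpeval g v = mpeval q v * mpeval h v" using divides by blast
  then show ?thesis using v by simp
 qed
 then show "v \<in> C" by (simp add: C_eq)
qed

abbreviation line_ideal :: "'k ^ 'd \<Rightarrow> ('k, 'd) mpoly set" where
 "line_ideal v \<equiv> scheme_inter (vanishing_ideal (proj_pts C)) (vanishing_ideal (lin_span {vec.span {w}, vec.span {v}}))"

lemma mem_line_ideal:
 "f \<in> line_ideal v \<longleftrightarrow> (\<exists>e. \<forall>g\<in>forms e. \<exists>h. (\<forall>v\<in>C. mpeval h v = 0) \<and>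
   (\<forall>a b. mpeval g (a *s w + b *s v) * mpeval f (a *s w + b *s v) = mpeval h (a *s w + b *s v)))"
proof -
 have "cone (vec.span {w, v})" "vec.span {w, v} \<noteq> {0}"
  using w_nz vec.span_base[of w "{w, v}"] by (auto intro: subspace_imp_cone)
 then have "f \<in> line_ideal v \<longleftrightarrow> (\<exists>e. \<forall>g\<in>forms e. \<exists>h\<in>vanishing_ideal (proj_pts C).
   \<forall>x\<in>vec.span {w, v}. mpeval g x * mpeval f x = mpeval h x)"
  unfolding lin_span_pair by (intro mem_scheme_inter vanishing_ideal_subspace)
 also have "\<dots> \<longleftrightarrow> (\<exists>e. \<forall>g\<in>forms e. \<exists>h. (\<forall>v\<in>C. mpeval h v = 0) \<and>
   (\<forall>a b. mpeval g (a *s w + b *s v) * mpeval f (a *s w + b *s v) = mpeval h (a *s w + b *s v)))"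
 proof (intro ex_cong1 ball_cong refl)
  fix e g
  show "(\<exists>h\<in>vanishing_ideal (proj_pts C). \<forall>x\<in>vec.span {w, v}. mpeval g x * mpeval f x = mpeval h x) \<longleftrightarrow>
   (\<exists>h. (\<forall>v\<in>C. mpeval h v = 0) \<and> (\<forall>a b. mpeval g (a *s w + b *s v) * mpeval f (a *s w + b *s v) = mpeval h (a *s w + b *s v)))"
   unfolding Bex_def mem_vanishing_ideal[OF C_cone C_nontrivial] Ball_def[of "vec.span {w, v}"] mem_span_pair
   by (intro ex_cong1) blast
 qed
 finally show ?thesis .
qed

lemma line_ideal_vanishes:
 assumes "f \<in> line_ideal v" "x \<in> C" "x \<noteq> 0" "x = a *s w + b *s v" shows "mpeval f x = 0"
proof -
 obtain e where e: "\<forall>g\<in>forms e. \<exists>h. (\<forall>v\<in>C. mpeval h v = 0) \<and>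
   (\<forall>a b. mpeval g (a *s w + b *s v) * mpeval f (a *s w + b *s v) = mpeval h (a *s w + b *s v))"
  using assms(1) mem_line_ideal by blast
 obtain g :: "('k, 'd) mpoly" where g: "g \<in> forms e" "mpeval g x \<noteq> 0" using obtain_nonvanishing_form[OF assms(3)] by blast
 then obtain h where "\<forall>v\<in>C. mpeval h v = 0" "mpeval g x * mpeval f x = mpeval h x"
  using e assms(4) by metis
 then show ?thesis using assms(2) g(2) by simp
qed

lemma dual_pair:
 fixes x y :: "'k ^ 'd"
 assumes "x \<notin> vec.span {y}"
 obtains l where "l \<in> forms 1" "functional (mpeval l)" "mpeval l x = 1" "mpeval l y = 0"
proof -
 obtain k where k: "functional k" "k x = 1" "\<And>v. v \<in> vec.span {y} \<Longrightarrow> k v = 0"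
  using functional_separates[OF vec.subspace_span assms] by blast
 obtain l where "l \<in> forms 1" "mpeval l = k" using functional_form[OF k(1)] by blast
 then show ?thesis using that k vec.span_base[of y "{y}"] by auto
qed

lemma w_not_in_span: "v \<in> C \<Longrightarrow> w \<notin> vec.span {v}"
 using wC C_cone by (auto simp: mem_span_singleton cone_scale)

lemma v_not_in_span: "v \<in> C \<Longrightarrow> v \<noteq> 0 \<Longrightarrow> v \<notin> vec.span {w}"
proof
 assume v: "v \<in> C" "v \<noteq> 0" "v \<in> vec.span {w}"
 then obtain c where "v = c *s w" by (auto simp: mem_span_singleton)
 then have "w = inverse c *s v" using v by auto
 then show False using wC v C_cone cone_scale by metis
qed

text \<open>The quadric \<open>q\<close> restricts to the line through \<open>w\<close> and \<open>v\<close> as a product of the form vanishing at \<open>v\<close> and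
 another form, whose zero is either a second point of \<open>C\<close> or \<open>v\<close> again.\<close>

lemma length_in_M:
 assumes v: "v \<in> M" "v \<in> C" "v \<noteq> 0" shows "2 \<le> scheme_length (line_ideal v)"
proof -
 define c d where "c = mpeval q w" and "d = dir_deriv q v w"
 have qe: "mpeval q (a *s w + b *s v) = a^2 * c + a * b * d" for a b
  using quadratic_form_expand[OF q(1), of a w b v] qC[OF v(2)] by (simp add: c_def d_def)
 have c0: "c \<noteq> 0" using q by (simp add: c_def)
 obtain lv where lv: "lv \<in> forms 1" "functional (mpeval lv)" "mpeval lv v = 1" "mpeval lv w = 0"
  using dual_pair[OF v_not_in_span] v by blast
 obtain lw where lw: "lw \<in> forms 1" "functional (mpeval lw)" "mpeval lw w = 1" "mpeval lw v = 0"
  using dual_pair[OF w_not_in_span] v by blast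
 have pow: "l ^ e \<in> forms e" if "l \<in> forms 1" for l :: "('k, 'd) mpoly" and e
  using forms_power[OF that, of e] by simp
 show ?thesis
 proof (cases "d = 0")
  case False
  \<comment> \<open>The line meets \<open>C\<close> in a second point, and both evaluations annihilate the ideal.\<close>
  define x where "x = d *s w + (- c) *s v"
  have x: "x \<in> C"
  proof (rule M_cap_C)
   show "x \<in> M" unfolding x_def using v M by (intro vec.subspace_add vec.subspace_scale)
   show "mpeval q x = 0" unfolding x_def qe by (simp add: power2_eq_square)
  qed
  define kx where "kx = mpscale (inverse d) lw"
  define kv where "kv = lv + mpscale (c / d) lw"
  have kx: "kx \<in> forms 1" "mpeval kx x = 1" "mpeval kx v = 0"
   using False forms_scale[OF lw(1)] by (auto simp: kx_def x_def lw functionalD[OF lw(2)])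
  have kv: "kv \<in> forms 1" "mpeval kv x = 0" "mpeval kv v = 1"
   using False forms_add[OF lv(1) forms_scale[OF lw(1)]]
   by (auto simp: kv_def x_def lw lv functionalD[OF lw(2)] functionalD[OF lv(2)])
  have x0: "x \<noteq> 0" using kx by (auto simp: kx_def functionalD[OF lw(2)])
  show ?thesis
  proof (rule two_le_scheme_length[where \<phi> = "\<lambda>f. mpeval f v" and \<psi> = "\<lambda>f. mpeval f x"
    and f = "\<lambda>e. kv ^ e" and g = "\<lambda>e. kx ^ e"])
   fix f assume f: "f \<in> line_ideal v"
   show "mpeval f v = 0 \<and> mpeval f x = 0"
    using line_ideal_vanishes[OF f v(2,3), of 0 1] line_ideal_vanishes[OF f x x0, of d "- c"] by (simp add: x_def)
  qed (use pow kv kx in \<open>auto simp: power_0_left\<close>)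
 next
  case True
  \<comment> \<open>The line is tangent to \<open>C\<close>, and the derivative along the line annihilates the ideal.\<close>
  show ?thesis
  proof (rule two_le_scheme_length[where \<phi> = "\<lambda>f. mpeval f v" and \<psi> = "\<lambda>f. dir_deriv f v w"
    and f = "\<lambda>e. lv ^ e" and g = "\<lambda>e. lw * lv ^ (e - 1)"])
   fix f assume f: "f \<in> line_ideal v"
   have f0: "mpeval f v = 0" using line_ideal_vanishes[OF f v(2,3), of 0 1] by simp
   obtain e where e: "\<forall>g\<in>forms e. \<exists>h. (\<forall>v\<in>C. mpeval h v = 0) \<and>
     (\<forall>a b. mpeval g (a *s w + b *s v) * mpeval f (a *s w + b *s v) = mpeval h (a *s w + b *s v))"
    using f mem_line_ideal by blast
   obtain g :: "('k, 'd) mpoly" where g: "g \<in> forms e" "mpeval g v \<noteq> 0" using obtain_nonvanishing_form[OF v(3)] by blast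
   then obtain h where h: "\<forall>v\<in>C. mpeval h v = 0"
    "\<And>a b. mpeval g (a *s w + b *s v) * mpeval f (a *s w + b *s v) = mpeval h (a *s w + b *s v)"
    using e by blast
   obtain k where k: "\<And>x. x \<in> M \<Longrightarrow> mpeval h x = mpeval q x * mpeval k x" using divides[of h] h(1) by blast
   obtain R where R: "\<And>\<tau>. poly R \<tau> = mpeval f (v + \<tau> *s w)" using polyfun_on_line[OF polyfun_mpeval] by blast
   obtain S where S: "\<And>\<tau>. poly S \<tau> = mpeval g (v + \<tau> *s w)" using polyfun_on_line[OF polyfun_mpeval] by blast
   obtain T where T: "\<And>\<tau>. poly T \<tau> = mpeval k (v + \<tau> *s w)" using polyfun_on_line[OF polyfun_mpeval] by blast
   have "poly (S * R) \<tau> = poly ([:0, 0, c:] * T) \<tau>" for \<tau>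
    using h(2)[of \<tau> 1] k[of "v + \<tau> *s w"] qe[of \<tau> 1] M v True
    by (simp add: R S T add.commute vec.subspace_add vec.subspace_scale power2_eq_square algebra_simps)
   then have eq: "S * R = [:0, 0, c:] * T" by (intro poly_eq_if_cofinite[of "{}"]) auto
   have "coeff R 0 = 0" using R[of 0] f0 by (simp add: poly_0_coeff_0)
   moreover have "coeff S 0 \<noteq> 0" using S[of 0] g by (simp add: poly_0_coeff_0)
   moreover have "coeff (S * R) 1 = coeff S 0 * coeff R 1 + coeff S 1 * coeff R 0"
    by (simp add: coeff_mult)
   moreover have "coeff ([:0, 0, c:] * T) 1 = 0" by (simp add: coeff_pCons)
   ultimately have "coeff R 1 = 0" using eq by auto
   moreover have "dir_deriv f v w = coeff R 1" by (rule dir_deriv_eq_coeff) (simp add: R)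
   ultimately show "mpeval f v = 0 \<and> dir_deriv f v w = 0" using f0 by simp
  next
   fix e :: nat assume e: "1 \<le> e"
   have "dir_deriv (lv ^ e) v w = coeff [:1:] 1"
    by (rule dir_deriv_eq_coeff) (simp add: functionalD[OF lv(2)] lv)
   then show "lv ^ e \<in> forms e \<and> mpeval (lv ^ e) v = 1 \<and> dir_deriv (lv ^ e) v w = 0"
    using pow lv by simp
   have "dir_deriv (lw * lv ^ (e - 1)) v w = coeff [:0, 1:] 1"
    by (rule dir_deriv_eq_coeff) (simp add: functionalD[OF lv(2)] functionalD[OF lw(2)] lv lw)
   then show "lw * lv ^ (e - 1) \<in> forms e \<and> mpeval (lw * lv ^ (e - 1)) v = 0 \<and> dir_deriv (lw * lv ^ (e - 1)) v w = 1"
    using pow[OF lv(1), of "e - 1"] forms_mult[OF lw(1), of "lv ^ (e - 1)" "e - 1"] e lw by simp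
  qed (simp_all add: dir_deriv_add)
 qed
qed

text \<open>A line through \<open>w\<close> that is neither a secant nor a tangent at \<open>v\<close> carries two independent
 quadrics vanishing on \<open>C\<close>, so that \<open>v\<close> is a reduced isolated point of the intersection.\<close>

lemma length_not_in_M:
 assumes v: "v \<in> C" "v \<notin> M" shows "\<not> 2 \<le> scheme_length (line_ideal v)"
proof -
 have v0: "v \<noteq> 0" using v M vec.subspace_0 by blast
 have vG: "mpeval g v = 0" if "g \<in> G" for g using v that C_eq by auto
 define c d where "c = (\<lambda>g. mpeval g w)" and "d = (\<lambda>g. dir_deriv g v w)"
 have ex: "mpeval g (a *s w + b *s v) = a^2 * c g + a * b * d g" if "g \<in> G" for g a b
  using quadratic_form_expand[of g a w b v] G that vG by (auto simp: c_def d_def)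
 obtain f1 where f1: "f1 \<in> G" "d f1 \<noteq> 0" using tangent[OF v(1)] v(2) d_def by blast
 obtain f2 where f2: "f2 \<in> G" "c f2 \<noteq> 0" using wC C_eq c_def by auto
 have "\<exists>f\<in>G. \<exists>g\<in>G. c f * d g \<noteq> c g * d f"
 proof (rule ccontr)
  assume "\<not> ?thesis"
  then have pr: "c f * d g = c g * d f" if "f \<in> G" "g \<in> G" for f g using that by blast
  have c1: "c f1 \<noteq> 0" using pr[OF f1(1) f2(1)] f1 f2 by auto
  define x where "x = d f1 *s w + (- c f1) *s v"
  have "x \<in> C"
  proof -
   have "mpeval g x = 0" if "g \<in> G" for g
    unfolding x_def ex[OF that] using pr[OF f1(1) that] by (simp add: power2_eq_square algebra_simps)
   then show ?thesis by (simp add: C_eq)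
  qed
  then have "inverse (d f1) *s x \<in> C" "(c f1 / d f1) *s v \<in> C" using C_cone v cone_scale by auto
  moreover have "w = (c f1 / d f1) *s v + inverse (d f1) *s x"
   using f1 unfolding x_def by (simp add: vec.scale_right_distrib vec.scale_minus_left divide_inverse mult.commute vec.scale_right_diff_distrib)
  ultimately have "(c f1 / d f1) *s v \<in> M" using chord by blast
  then have "(d f1 / c f1) *s ((c f1 / d f1) *s v) \<in> M" using M vec.subspace_scale by blast
  then show False using v f1 c1 by simp
 qed
 then obtain f g where fg: "f \<in> G" "g \<in> G" "c f * d g - c g * d f \<noteq> 0" by auto
 define \<delta> where "\<delta> = c f * d g - c g * d f"
 have \<delta>: "\<delta> \<noteq> 0" using fg by (simp add: \<delta>_def)
 define F1 where "F1 = mpscale (inverse \<delta>) (mpscale (d g) f - mpscale (d f) g)"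
 define F2 where "F2 = mpscale (inverse \<delta>) (mpscale (c f) g - mpscale (c g) f)"
 have F1: "mpeval F1 (a *s w + b *s v) = a^2" for a b
 proof -
  have "mpeval F1 (a *s w + b *s v) = inverse \<delta> * (a^2 * \<delta>)"
   unfolding F1_def by (simp add: ex fg \<delta>_def algebra_simps)
  then show ?thesis using \<delta> by simp
 qed
 have F2: "mpeval F2 (a *s w + b *s v) = a * b" for a b
 proof -
  have "mpeval F2 (a *s w + b *s v) = inverse \<delta> * (a * b * \<delta>)"
   unfolding F2_def by (simp add: ex fg \<delta>_def algebra_simps)
  then show ?thesis using \<delta> by simp
 qed
 have FC: "mpeval F1 x = 0" "mpeval F2 x = 0" if "x \<in> C" for x
  using that fg by (auto simp: F1_def F2_def C_eq)
 obtain lv where lv: "functional (mpeval lv)" "mpeval lv v = 1" "mpeval lv w = 0"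
  using dual_pair[OF v_not_in_span[OF v(1) v0]] by blast
 obtain lw where lw: "functional (mpeval lw)" "mpeval lw w = 1" "mpeval lw v = 0"
  using dual_pair[OF w_not_in_span[OF v(1)]] by blast
 let ?l = "vec.span {w, v}"
 have wl: "w \<in> ?l" "v \<in> ?l" by (auto intro: vec.span_base)
 have lwv: "mpeval lw (a *s w + b *s v) = a" "mpeval lv (a *s w + b *s v) = b" for a b
  using lv lw by (simp_all add: functionalD[OF lv(1)] functionalD[OF lw(1)])
 show ?thesis
 proof (rule scheme_length_less_2[OF v0])
  fix e and u :: "('k, 'd) mpoly" assume e: "e \<ge> 2" and u: "u \<in> forms e" "mpeval u v = 0"
  have "mpeval u x = 0" if x: "x \<in> ?l" "mpeval lw x = 0" for x
  proof -
   obtain a b where ab: "x = a *s w + b *s v" using x mem_span_pair by blast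
   then have "x = b *s v" using x lwv[of a b] by simp
   then show ?thesis using mpeval_homogeneous[OF u(1), of b v] u(2) by simp
  qed
  then obtain h where h: "polyfun h" "\<And>x. x \<in> ?l \<Longrightarrow> mpeval u x = mpeval lw x * h x"
   using divides_by_functional[OF polyfun_mpeval lw(1,2) vec.subspace_span wl(1)] by blast
  obtain R where R: "\<And>\<tau>. poly R \<tau> = h (0 + \<tau> *s w)" using polyfun_on_line[OF h(1)] by blast
  have "poly (monom (mpeval u w) e) \<tau> = poly ([:0, 1:] * R) \<tau>" for \<tau>
   using h(2)[of "\<tau> *s w"] R[of \<tau>] wl(1)
   by (simp add: mpeval_homogeneous[OF u(1)] poly_monom functionalD[OF lw(1)] lw vec.span_scale mult.commute)
  then have "monom (mpeval u w) e = [:0, 1:] * R" by (intro poly_eq_if_cofinite[of "{}"]) auto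
  then have "coeff (monom (mpeval u w) e) 1 = coeff ([:0, 1:] * R) 1" by simp
  then have "coeff R 0 = 0" using e by simp
  then have h0: "h 0 = 0" using R[of 0] by (simp add: poly_0_coeff_0)
  obtain A where A: "polyfun A" "\<And>x. h x = h (x - mpeval lw x *s w) + mpeval lw x * A x"
   using polyfun_factor[OF h(1) lw(1)] by blast
  let ?h = "\<lambda>x. h (x - mpeval lw x *s w)"
  have "polyfun ?h"
   by (rule polyfun_compose[OF h(1)]) (auto intro!: polyfun_intros polyfun_mpeval)
  moreover have "?h x = 0" if x: "x \<in> ?l" "mpeval lv x = 0" for x
  proof -
   obtain a b where ab: "x = a *s w + b *s v" using x mem_span_pair by blast
   then have "x = a *s w" using x lwv[of a b] by simp
   then show ?thesis using lwv[of a 0] h0 by simp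
  qed
  ultimately obtain B where B: "polyfun B" "\<And>x. x \<in> ?l \<Longrightarrow> ?h x = mpeval lv x * B x"
   using divides_by_functional[OF _ lv(1,2) vec.subspace_span wl(2)] by blast
  obtain A' B' where AB: "A = mpeval A'" "B = mpeval B'" using polyfun_obtain A(1) B(1) by metis
  let ?k = "F2 * B' + F1 * A'"
  have "mpeval u (a *s w + b *s v) = mpeval ?k (a *s w + b *s v)" for a b
  proof -
   have x: "a *s w + b *s v \<in> ?l" by (auto simp: mem_span_pair)
   have "mpeval u (a *s w + b *s v) = a * h (a *s w + b *s v)" using h(2)[OF x] lwv by simp
   also have "h (a *s w + b *s v) = b * B (a *s w + b *s v) + a * A (a *s w + b *s v)"
    using A(2)[of "a *s w + b *s v"] B(2)[OF x] lwv by simp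
   finally show ?thesis by (simp add: AB F1 F2 algebra_simps power2_eq_square)
  qed
  then have "(\<forall>v\<in>C. mpeval (g * ?k) v = 0) \<and> (\<forall>a b. mpeval g (a *s w + b *s v) *
    mpeval u (a *s w + b *s v) = mpeval (g * ?k) (a *s w + b *s v))" for g
   by (simp add: FC)
  then show "u \<in> line_ideal v" unfolding mem_line_ideal by blast
 qed
qed

text \<open>The restriction of \<open>q\<close> to a line through \<open>w\<close> has a zero, the field being algebraically closed.\<close>

lemma second_intersection:
 assumes x: "x \<in> M" "x \<notin> vec.span {w}"
 obtains \<tau> where "x + \<tau> *s w \<in> C \<inter> M" "x + \<tau> *s w \<noteq> 0"
proof -
 let ?p = "[:mpeval q x, dir_deriv q x w, mpeval q w:]"
 have "degree ?p > 0" using q by simp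
 then obtain \<tau> where \<tau>: "poly ?p \<tau> = 0" using alg_closed_imp_poly_has_root by blast
 have "mpeval q (x + \<tau> *s w) = 0"
  using quadratic_form_expand[OF q(1), of \<tau> w 1 x] \<tau> by (simp add: algebra_simps power2_eq_square)
 moreover have xM: "x + \<tau> *s w \<in> M" using x M by (intro vec.subspace_add vec.subspace_scale)
 ultimately have "x + \<tau> *s w \<in> C \<inter> M" using M_cap_C by blast
 moreover have "x + \<tau> *s w \<noteq> 0"
 proof
  assume "x + \<tau> *s w = 0"
  then have "x = (- \<tau>) *s w" by (simp add: eq_neg_iff_add_eq_0 vec.scale_minus_left)
  then show False using x mem_span_singleton by blast
 qed
 ultimately show ?thesis using that by blast
qed

lemma secant_cone_eq: "secant_cone (proj_pts C) (vec.span {w}) = proj_pts M"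
proof -
 define Q where "Q = {p \<in> proj_pts C. 2 \<le> scheme_length
   (scheme_inter (vanishing_ideal (proj_pts C)) (vanishing_ideal (lin_span {vec.span {w}, p})))}"
 have Q: "Q = proj_pts (C \<inter> M)"
 proof (intro equalityI subsetI)
  fix p assume p: "p \<in> Q"
  then obtain v where v: "v \<in> C" "v \<noteq> 0" "p = vec.span {v}" unfolding Q_def by (auto elim: proj_ptsE)
  then have "v \<in> M" using p length_not_in_M[OF v(1)] unfolding Q_def by auto
  then show "p \<in> proj_pts (C \<inter> M)" using v by (auto simp: proj_pts_def)
 next
  fix p assume "p \<in> proj_pts (C \<inter> M)"
  then obtain v where v: "v \<in> C" "v \<in> M" "v \<noteq> 0" "p = vec.span {v}" by (auto elim: proj_ptsE)
  then show "p \<in> Q" unfolding Q_def using length_in_M[of v] by (auto simp: proj_pts_def)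
 qed
 have sc: "secant_cone (proj_pts C) (vec.span {w}) = (if Q = {} then {vec.span {w}} else \<Union>p\<in>Q. lin_span {vec.span {w}, p})"
  unfolding secant_cone_def Q_def Let_def ..
 have wM: "vec.span {w} \<subseteq> M" using M by (intro vec.span_minimal) auto
 show ?thesis
 proof (cases "Q = {}")
  case True
  have "M \<subseteq> vec.span {w}"
  proof
   fix x assume x: "x \<in> M"
   show "x \<in> vec.span {w}"
   proof (rule ccontr)
    assume "x \<notin> vec.span {w}"
    then obtain \<tau> where "x + \<tau> *s w \<in> C \<inter> M" "x + \<tau> *s w \<noteq> 0" using second_intersection x by blast
    then show False using True Q by (auto simp: proj_pts_def)
   qed
  qed
  then have "M = vec.span {w}" using wM by blast
  moreover have "proj_pts (vec.span {w}) = {vec.span {w}}"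
  proof (intro equalityI subsetI)
   fix p assume "p \<in> proj_pts (vec.span {w})"
   then obtain v where "v \<in> vec.span {w}" "v \<noteq> 0" "p = vec.span {v}" by (rule proj_ptsE)
   then show "p \<in> {vec.span {w}}" using span_singleton_eq_iff[of v w] by (auto simp: mem_span_singleton)
  qed (use w_nz vec.span_base[of w "{w}"] in \<open>auto simp: proj_pts_def\<close>)
  ultimately show ?thesis using sc True by simp
 next
  case False
  have "(\<Union>p\<in>Q. lin_span {vec.span {w}, p}) = proj_pts M"
  proof (intro equalityI subsetI)
   fix y assume "y \<in> (\<Union>p\<in>Q. lin_span {vec.span {w}, p})"
   then obtain p where p: "p \<in> Q" "y \<in> lin_span {vec.span {w}, p}" by blast
   then obtain v where v: "v \<in> M" "p = vec.span {v}" unfolding Q by (auto elim: proj_ptsE)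
   have "vec.span {w, v} \<subseteq> M" using v M by (intro vec.span_minimal) auto
   then show "y \<in> proj_pts M" using p(2) v proj_pts_mono lin_span_pair by blast
  next
   fix y assume "y \<in> proj_pts M"
   then obtain x where x: "x \<in> M" "x \<noteq> 0" "y = vec.span {x}" by (rule proj_ptsE)
   obtain v where v: "v \<in> C \<inter> M" "v \<noteq> 0" "x \<in> vec.span {w, v}"
   proof (cases "x \<in> vec.span {w}")
    case True
    obtain p where "p \<in> Q" using False by blast
    then obtain v where v: "v \<in> C \<inter> M" "v \<noteq> 0" unfolding Q by (auto elim: proj_ptsE)
    then show ?thesis using that[of v] True vec.span_mono[of "{w}" "{w, v}"] by blast
   next
    case False
    then obtain \<tau> where \<tau>: "x + \<tau> *s w \<in> C \<inter> M" "x + \<tau> *s w \<noteq> 0" using second_intersection x by blast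
    have "x = (- \<tau>) *s w + 1 *s (x + \<tau> *s w)" by (simp add: vec.scale_minus_left)
    then have "x \<in> vec.span {w, x + \<tau> *s w}" using mem_span_pair by blast
    then show ?thesis using that \<tau> by blast
   qed
   then have "vec.span {v} \<in> Q" "y \<in> lin_span {vec.span {w}, vec.span {v}}"
    using x unfolding Q lin_span_pair by (auto simp: proj_pts_def)
   then show "y \<in> (\<Union>p\<in>Q. lin_span {vec.span {w}, p})" by blast
  qed
  then show ?thesis using sc False by simp
 qed
qed

theorem secant_locus_quadric: "secant_locus (proj_pts C) (vec.span {w}) = quadric_ideal M q"
proof (intro set_eqI)
 fix f
 have M': "cone M" "M \<noteq> {0}" using M w_nz by (auto intro: subspace_imp_cone)
 have "f \<in> secant_locus (proj_pts C) (vec.span {w}) \<longleftrightarrow>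
  (\<exists>e. \<forall>g\<in>forms e. \<exists>h\<in>vanishing_ideal (proj_pts C). \<forall>v\<in>M. mpeval g v * mpeval f v = mpeval h v)"
  unfolding secant_locus_def secant_cone_eq by (rule mem_scheme_inter[OF M' vanishing_ideal_subspace])
 also have "\<dots> \<longleftrightarrow> f \<in> quadric_ideal M q"
  unfolding quadric_ideal_def mem_Collect_eq
 proof (intro ex_cong1 ball_cong refl)
  fix e g
  show "(\<exists>h\<in>vanishing_ideal (proj_pts C). \<forall>v\<in>M. mpeval g v * mpeval f v = mpeval h v) \<longleftrightarrow>
    (\<exists>h. \<forall>v\<in>M. mpeval g v * mpeval f v = mpeval q v * mpeval h v)"
  proof
   assume "\<exists>h\<in>vanishing_ideal (proj_pts C). \<forall>v\<in>M. mpeval g v * mpeval f v = mpeval h v"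
   then obtain h where h: "\<forall>v\<in>C. mpeval h v = 0" "\<forall>v\<in>M. mpeval g v * mpeval f v = mpeval h v"
    using mem_vanishing_ideal[OF C_cone C_nontrivial] by blast
   obtain k where "\<forall>v\<in>M. mpeval h v = mpeval q v * mpeval k v" using divides[of h] h(1) by blast
   then show "\<exists>h. \<forall>v\<in>M. mpeval g v * mpeval f v = mpeval q v * mpeval h v" using h(2) by auto
  next
   assume "\<exists>h. \<forall>v\<in>M. mpeval g v * mpeval f v = mpeval q v * mpeval h v"
   then obtain h where "\<forall>v\<in>M. mpeval g v * mpeval f v = mpeval (q * h) v" by auto
   moreover have "q * h \<in> vanishing_ideal (proj_pts C)"
    using qC by (simp add: mem_vanishing_ideal[OF C_cone C_nontrivial])
   ultimately show "\<exists>h\<in>vanishing_ideal (proj_pts C). \<forall>v\<in>M. mpeval g v * mpeval f v = mpeval h v" by blast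
  qed
 qed
 finally show "f \<in> secant_locus (proj_pts C) (vec.span {w}) \<longleftrightarrow> f \<in> quadric_ideal M q" .
qed

end

lemma quadric_points:
 fixes T :: "('k::alg_closed_field ^ 'd::finite) set"
 assumes "cone T" "q \<in> forms 2"
 shows "proj_pts {v \<in> T. mpeval q v = 0} = {p \<in> proj_pts T. \<forall>v\<in>p. mpeval q v = 0}"
proof (intro equalityI subsetI)
 fix p assume "p \<in> proj_pts {v \<in> T. mpeval q v = 0}"
 then obtain v where "v \<in> T" "mpeval q v = 0" "v \<noteq> 0" "p = vec.span {v}" by (auto elim: proj_ptsE)
 then show "p \<in> {p \<in> proj_pts T. \<forall>v\<in>p. mpeval q v = 0}"
  by (auto simp: proj_pts_def mem_span_singleton mpeval_homogeneous[OF assms(2)])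
next
 fix p assume p: "p \<in> {p \<in> proj_pts T. \<forall>v\<in>p. mpeval q v = 0}"
 then obtain v where "v \<in> T" "v \<noteq> 0" "p = vec.span {v}" by (auto elim: proj_ptsE)
 moreover from this have "mpeval q v = 0" using p vec.span_base[of v "{v}"] by auto
 ultimately show "p \<in> proj_pts {v \<in> T. mpeval q v = 0}" by (auto simp: proj_pts_def)
qed

section \<open>Apolarity of binary forms\<close>

definition psi :: "nat \<Rightarrow> 'k::field \<Rightarrow> 'k \<Rightarrow> nat \<Rightarrow> 'k" where
 "psi a s t j = s ^ (a - j) * t ^ j"

text \<open>The polynomial \<open>psi_poly a s t s' t' j\<close> in \<open>\<tau>\<close> is \<open>psi a (s + \<tau> s') (t + \<tau> t') j\<close>,
 and \<open>dpsi\<close> is its derivative at \<open>\<tau> = 0\<close>.\<close>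

definition psi_poly :: "nat \<Rightarrow> 'k::field \<Rightarrow> 'k \<Rightarrow> 'k \<Rightarrow> 'k \<Rightarrow> nat \<Rightarrow> 'k poly" where
 "psi_poly a s t s' t' j = [:s, s':] ^ (a - j) * [:t, t':] ^ j"

definition dpsi :: "nat \<Rightarrow> 'k::field \<Rightarrow> 'k \<Rightarrow> 'k \<Rightarrow> 'k \<Rightarrow> nat \<Rightarrow> 'k" where
 "dpsi a s t s' t' j = coeff (psi_poly a s t s' t' j) 1"

lemma poly_psi_poly: "poly (psi_poly a s t s' t' j) \<tau> = psi a (s + \<tau> * s') (t + \<tau> * t') j"
 by (simp add: psi_poly_def psi_def poly_power)

lemma coeff_psi_poly_0: "coeff (psi_poly a s t s' t' j) 0 = psi a s t j"
 using poly_psi_poly[of a s t s' t' j 0] by (simp add: poly_0_coeff_0)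

lemma psi_shift:
 assumes "j < a" shows "psi a s t j = s * psi (a - 1) s t j" "psi a s t (Suc j) = t * psi (a - 1) s t j"
proof -
 have "a - j = Suc (a - 1 - j)" using assms by simp
 then show "psi a s t j = s * psi (a - 1) s t j" by (simp add: psi_def)
 show "psi a s t (Suc j) = t * psi (a - 1) s t j" by (simp add: psi_def)
qed

lemma psi_linear: "j < a \<Longrightarrow> t * psi a s t j = s * psi a s t (Suc j)"
 by (simp add: psi_shift)

lemma psi_nonzero:
 assumes "(s, t) \<noteq> (0, 0)" obtains j where "j \<le> a" "psi a s t j \<noteq> 0"
 using that[of 0] that[of a] assms by (cases "s = 0") (auto simp: psi_def)

lemma psi_poly_quadric:
 assumes "j + 2 \<le> a"
 shows "[:h0:] * psi_poly a s t s' t' j + [:h1:] * psi_poly a s t s' t' (Suc j) + [:h2:] * psi_poly a s t s' t' (Suc (Suc j))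
  = ([:h0:] * [:s, s':]^2 + [:h1:] * ([:s, s':] * [:t, t':]) + [:h2:] * [:t, t':]^2) * psi_poly (a - 2) s t s' t' j"
proof -
 obtain c where "a = c + j + 2" using assms by (metis add.assoc add.commute le_Suc_ex)
 then have "a - j = Suc (Suc c)" "a - Suc j = Suc c" "a - Suc (Suc j) = c" "a - 2 - j = c" by auto
 then show ?thesis unfolding psi_poly_def by (simp only: power_Suc power2_eq_square) (simp only: algebra_simps)
qed

lemma apolar_psi:
 assumes "j + 2 \<le> a"
 shows "h0 * psi a s t j + h1 * psi a s t (Suc j) + h2 * psi a s t (Suc (Suc j))
  = (h0 * s^2 + h1 * (s * t) + h2 * t^2) * psi (a - 2) s t j"
 using arg_cong[OF psi_poly_quadric[OF assms, of h0 s t 0 0 h1 h2], of "\<lambda>p. poly p 0"]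
 by (simp add: poly_psi_poly)

lemma apolar_dpsi:
 assumes "j + 2 \<le> a"
 shows "h0 * dpsi a s t s' t' j + h1 * dpsi a s t s' t' (Suc j) + h2 * dpsi a s t s' t' (Suc (Suc j))
  = (h0 * s^2 + h1 * (s * t) + h2 * t^2) * dpsi (a - 2) s t s' t' j
   + (2 * h0 * s * s' + h1 * (s * t' + s' * t) + 2 * h2 * t * t') * psi (a - 2) s t j"
proof -
 let ?q = "[:h0:] * [:s, s':]^2 + [:h1:] * ([:s, s':] * [:t, t':]) + [:h2:] * [:t, t':]^2"
 have "h0 * dpsi a s t s' t' j + h1 * dpsi a s t s' t' (Suc j) + h2 * dpsi a s t s' t' (Suc (Suc j)) =
  coeff (?q * psi_poly (a - 2) s t s' t' j) 1"
  unfolding psi_poly_quadric[OF assms, symmetric] dpsi_def by simp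
 also have "\<dots> = coeff ?q 0 * dpsi (a - 2) s t s' t' j + coeff ?q 1 * psi (a - 2) s t j"
  by (simp add: coeff_mult coeff_psi_poly_0 dpsi_def)
 also have "coeff ?q 0 = h0 * s^2 + h1 * (s * t) + h2 * t^2"
  by (simp add: power2_eq_square)
 also have "coeff ?q 1 = 2 * h0 * s * s' + h1 * (s * t' + s' * t) + 2 * h2 * t * t'"
  by (simp add: power2_eq_square algebra_simps)
 finally show ?thesis .
qed

lemma dpsi_linear:
 assumes "j < a"
 shows "t * dpsi a s t s' t' j - s * dpsi a s t s' t' (Suc j) = (t * s' - s * t') * psi (a - 1) s t j"
proof -
 have "a - j = Suc (a - Suc j)" using assms by simp
 then have "[:t, t':] * psi_poly a s t s' t' j = [:s, s':] * psi_poly a s t s' t' (Suc j)"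
  by (simp only: psi_poly_def power_Suc mult_ac)
 then have "coeff ([:t, t':] * psi_poly a s t s' t' j) 1 = coeff ([:s, s':] * psi_poly a s t s' t' (Suc j)) 1"
  by simp
 then have "t * dpsi a s t s' t' j + t' * psi a s t j = s * dpsi a s t s' t' (Suc j) + s' * psi a s t (Suc j)"
  by (simp add: dpsi_def coeff_psi_poly_0 coeff_pCons)
 then show ?thesis using psi_shift[OF assms, of s t] by (simp add: algebra_simps)
qed

lemma killed_by_linear_form:
 assumes st: "(s, t) \<noteq> (0, 0)" and x: "\<And>j. j < a \<Longrightarrow> t * x j = s * x (Suc j)"
 obtains c where "\<And>j. j \<le> a \<Longrightarrow> x j = c * psi a s t j"
proof (cases "s = 0")
 case True
 then have "x j = (x a / t ^ a) * psi a s t j" if "j \<le> a" for j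
  using st x[of j] that by (cases "j = a") (auto simp: psi_def)
 then show ?thesis using that by blast
next
 case False
 have "x j = (x 0 / s ^ a) * psi a s t j" if "j \<le> a" for j using that
 proof (induction j)
  case 0 then show ?case using False by (simp add: psi_def)
 next
  case (Suc j)
  have "s * x (Suc j) = t * x j" using x[of j] Suc.prems by simp
  also have "x j = (x 0 / s ^ a) * psi a s t j" using Suc by simp
  also have "t * \<dots> = s * ((x 0 / s ^ a) * psi a s t (Suc j))"
   using psi_linear[of j a t s] Suc.prems by simp
  finally show ?case using False mult_left_cancel by blast
 qed
 then show ?thesis using that by blast
qed

text \<open>The solutions of the recursion with characteristic polynomial the product of the two linear forms:
 applying one form leaves a sequence killed by the other.\<close>

lemma killed_by_two_linear_forms:
 assumes D: "t * s' - s * t' \<noteq> 0" and a: "1 \<le> a"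
  and x: "\<And>j. j + 2 \<le> a \<Longrightarrow> (t * t') * x j + (- (t * s' + s * t')) * x (Suc j) + (s * s') * x (Suc (Suc j)) = 0"
 obtains c d where "\<And>j. j \<le> a \<Longrightarrow> x j = c * psi a s t j + d * psi a s' t' j"
proof -
 have st: "(s, t) \<noteq> (0, 0)" "(s', t') \<noteq> (0, 0)" using D by auto
 obtain c where c: "\<And>j. j \<le> a - 1 \<Longrightarrow> t' * x j - s' * x (Suc j) = c * psi (a - 1) s t j"
 proof (rule killed_by_linear_form[OF st(1), of "a - 1" "\<lambda>j. t' * x j - s' * x (Suc j)"])
  fix j assume "j < a - 1"
  then show "t * (t' * x j - s' * x (Suc j)) = s * (t' * x (Suc j) - s' * x (Suc (Suc j)))"
   using x[of j] by (simp add: algebra_simps)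
 qed blast
 obtain d where d: "\<And>j. j \<le> a - 1 \<Longrightarrow> t * x j - s * x (Suc j) = d * psi (a - 1) s' t' j"
 proof (rule killed_by_linear_form[OF st(2), of "a - 1" "\<lambda>j. t * x j - s * x (Suc j)"])
  fix j assume "j < a - 1"
  then show "t' * (t * x j - s * x (Suc j)) = s' * (t * x (Suc j) - s * x (Suc (Suc j)))"
   using x[of j] by (simp add: algebra_simps)
 qed blast
 let ?D = "t * s' - s * t'"
 have solve: "y = (- c / D) * Q + (d / D) * P" if "D \<noteq> 0" "D * y = d * P - c * Q" for D y d P c Q :: 'a
  using that by (simp add: field_simps)
 have lo: "x j = (- c / ?D) * psi a s t j + (d / ?D) * psi a s' t' j"
  and hi: "x (Suc j) = (- c / ?D) * psi a s t (Suc j) + (d / ?D) * psi a s' t' (Suc j)" if "j < a" for j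
 proof -
  have j: "j \<le> a - 1" using that by simp
  have "?D * x j = s' * (t * x j - s * x (Suc j)) - s * (t' * x j - s' * x (Suc j))"
   by (simp add: algebra_simps)
  also have "\<dots> = d * psi a s' t' j - c * psi a s t j"
   unfolding c[OF j] d[OF j] using psi_shift(1)[OF that, of s t] psi_shift(1)[OF that, of s' t'] by (simp add: algebra_simps)
  finally show "x j = (- c / ?D) * psi a s t j + (d / ?D) * psi a s' t' j"
   by (rule solve[OF D])
  have "?D * x (Suc j) = t' * (t * x j - s * x (Suc j)) - t * (t' * x j - s' * x (Suc j))"
   by (simp add: algebra_simps)
  also have "\<dots> = d * psi a s' t' (Suc j) - c * psi a s t (Suc j)"
   unfolding c[OF j] d[OF j] using psi_shift(2)[OF that, of s t] psi_shift(2)[OF that, of s' t'] by (simp add: algebra_simps)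
  finally show "x (Suc j) = (- c / ?D) * psi a s t (Suc j) + (d / ?D) * psi a s' t' (Suc j)"
   by (rule solve[OF D])
 qed
 have "x j = (- c / ?D) * psi a s t j + (d / ?D) * psi a s' t' j" if "j \<le> a" for j
  using lo[of j] hi[of "j - 1"] that a by (cases "j < a") auto
 then show ?thesis using that by blast
qed

lemma killed_by_square:
 assumes D: "t * s' - s * t' \<noteq> 0" and a: "1 \<le> a"
  and x: "\<And>j. j + 2 \<le> a \<Longrightarrow> (t * t) * x j + (- (t * s + s * t)) * x (Suc j) + (s * s) * x (Suc (Suc j)) = 0"
 obtains c d where "\<And>j. j \<le> a \<Longrightarrow> x j = c * psi a s t j + d * dpsi a s t s' t' j"
proof -
 have st: "(s, t) \<noteq> (0, 0)" using D by auto
 obtain d where d: "\<And>j. j \<le> a - 1 \<Longrightarrow> t * x j - s * x (Suc j) = d * psi (a - 1) s t j"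
 proof (rule killed_by_linear_form[OF st, of "a - 1" "\<lambda>j. t * x j - s * x (Suc j)"])
  fix j assume "j < a - 1"
  then show "t * (t * x j - s * x (Suc j)) = s * (t * x (Suc j) - s * x (Suc (Suc j)))"
   using x[of j] by (simp add: algebra_simps)
 qed blast
 let ?D = "t * s' - s * t'"
 obtain c where c: "\<And>j. j \<le> a \<Longrightarrow> x j - (d / ?D) * dpsi a s t s' t' j = c * psi a s t j"
 proof (rule killed_by_linear_form[OF st, of a "\<lambda>j. x j - (d / ?D) * dpsi a s t s' t' j"])
  fix j assume j: "j < a"
  have "(d / ?D) * (t * dpsi a s t s' t' j - s * dpsi a s t s' t' (Suc j)) = d * psi (a - 1) s t j"
   unfolding dpsi_linear[OF j] using D by simp
  then show "t * (x j - (d / ?D) * dpsi a s t s' t' j) = s * (x (Suc j) - (d / ?D) * dpsi a s t s' t' (Suc j))"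
   using d[of j] j by (simp add: algebra_simps)
 qed blast
 have "x j = c * psi a s t j + (d / ?D) * dpsi a s t s' t' j" if "j \<le> a" for j
  using c[OF that] by (simp add: algebra_simps)
 then show ?thesis using that by blast
qed

lemma psi_psi_independent:
 assumes D: "t * s' - s * t' \<noteq> 0" and a: "1 \<le> a"
  and "\<And>j. j \<le> a \<Longrightarrow> c * psi a s t j + d * psi a s' t' j = 0"
 shows "c = 0 \<and> d = 0"
proof -
 have *: "d = 0" if D: "t * s' - s * t' \<noteq> 0" and x: "\<And>j. j \<le> a \<Longrightarrow> c * psi a s t j + d * psi a s' t' j = 0"
  for s t s' t' c d :: 'a
 proof -
  have "(s', t') \<noteq> (0, 0)" using D by auto
  then obtain j where j: "j \<le> a - 1" "psi (a - 1) s' t' j \<noteq> 0" by (rule psi_nonzero)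
  then have ja: "j < a" using a by simp
  have "t * (c * psi a s t j + d * psi a s' t' j) - s * (c * psi a s t (Suc j) + d * psi a s' t' (Suc j)) = 0"
   using x[of j] x[of "Suc j"] ja by simp
  then have "d * (t * s' - s * t') * psi (a - 1) s' t' j = 0"
   unfolding psi_shift[OF ja] by (simp add: algebra_simps)
  then show ?thesis using j D by simp
 qed
 have "t' * s - s' * t \<noteq> 0" using D by (simp add: mult.commute)
 then show ?thesis using *[OF D assms(3)] *[of t' s s' t d c] assms(3) by (simp add: add.commute)
qed

lemma psi_dpsi_independent:
 assumes D: "t * s' - s * t' \<noteq> 0" and a: "1 \<le> a"
  and x: "\<And>j. j \<le> a \<Longrightarrow> c * psi a s t j + d * dpsi a s t s' t' j = 0"
 shows "c = 0 \<and> d = 0"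
proof -
 have st: "(s, t) \<noteq> (0, 0)" using D by auto
 obtain j where j: "j \<le> a - 1" "psi (a - 1) s t j \<noteq> 0" using psi_nonzero[OF st] by blast
 then have ja: "j < a" using a by simp
 have "c * (t * psi a s t j - s * psi a s t (Suc j)) + d * (t * dpsi a s t s' t' j - s * dpsi a s t s' t' (Suc j))
   = t * (c * psi a s t j + d * dpsi a s t s' t' j) - s * (c * psi a s t (Suc j) + d * dpsi a s t s' t' (Suc j))"
  by (simp add: algebra_simps)
 also have "\<dots> = 0" using x[of j] x[of "Suc j"] ja by simp
 finally have "d * ((t * s' - s * t') * psi (a - 1) s t j) = 0"
  using psi_linear[OF ja, of t s] by (simp add: dpsi_linear[OF ja])
 then have d: "d = 0" using j D by simp
 obtain i where "i \<le> a" "psi a s t i \<noteq> 0" using psi_nonzero[OF st] by blast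
 then show ?thesis using x[of i] d by simp
qed

lemma complementary_direction:
 assumes "(s, t) \<noteq> (0, 0 :: 'k::field)" obtains s' t' where "t * s' - s * t' \<noteq> 0"
 using that[of 1 0] that[of 0 1] assms by (cases "t = 0") auto

section \<open>Linear algebra in the plane and in three-space\<close>

lemma common_kernel_2:
 assumes "\<And>x y. x \<in> S \<Longrightarrow> y \<in> S \<Longrightarrow> f x * g y = g x * (f y :: 'k::field)"
 obtains s t where "(s, t) \<noteq> (0, 0)" "\<And>x. x \<in> S \<Longrightarrow> t * f x = s * g x"
proof (cases "\<exists>x\<in>S. (f x, g x) \<noteq> (0, 0)")
 case True
 then obtain x where "x \<in> S" "(f x, g x) \<noteq> (0, 0)" by blast
 then show ?thesis using that[of "f x" "g x"] assms[of x] by (auto simp: mult.commute)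
next
 case False
 then show ?thesis using that[of 1 0] by auto
qed

definition cross3 :: "'k::field \<times> 'k \<times> 'k \<Rightarrow> 'k \<times> 'k \<times> 'k \<Rightarrow> 'k \<times> 'k \<times> 'k" where
 "cross3 x y = (case (x, y) of ((x0, x1, x2), (y0, y1, y2)) \<Rightarrow>
   (x1 * y2 - x2 * y1, x2 * y0 - x0 * y2, x0 * y1 - x1 * y0))"

definition dot3 :: "'k::field \<times> 'k \<times> 'k \<Rightarrow> 'k \<times> 'k \<times> 'k \<Rightarrow> 'k" where
 "dot3 x y = (case (x, y) of ((x0, x1, x2), (y0, y1, y2)) \<Rightarrow> x0 * y0 + x1 * y1 + x2 * y2)"

definition scale3 :: "'k::field \<Rightarrow> 'k \<times> 'k \<times> 'k \<Rightarrow> 'k \<times> 'k \<times> 'k" where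
 "scale3 c x = (case x of (x0, x1, x2) \<Rightarrow> (c * x0, c * x1, c * x2))"

definition disc3 :: "'k::field \<times> 'k \<times> 'k \<Rightarrow> 'k" where
 "disc3 x = (case x of (x0, x1, x2) \<Rightarrow> x1^2 - 4 * x0 * x2)"

abbreviation zero3 :: "'k::field \<times> 'k \<times> 'k" where "zero3 \<equiv> (0, 0, 0)"

definition square3 :: "'k::field \<Rightarrow> 'k \<Rightarrow> 'k \<times> 'k \<times> 'k" where
 "square3 s t = (t * t, - (t * s + s * t), s * s)"

lemma cross3_zero_imp_parallel:
 assumes "cross3 x y = zero3" "x \<noteq> zero3" obtains c where "y = scale3 c x"
proof -
 obtain x0 x1 x2 y0 y1 y2 where xy: "x = (x0, x1, x2)" "y = (y0, y1, y2)" by (metis prod_cases3)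
 have e: "x1 * y2 = x2 * y1" "x2 * y0 = x0 * y2" "x0 * y1 = x1 * y0"
  using assms(1) by (auto simp: cross3_def xy)
 consider "x0 \<noteq> 0" | "x1 \<noteq> 0" | "x2 \<noteq> 0" using assms(2) xy by auto
 then show ?thesis
 proof cases
  case 1 then show ?thesis using that[of "y0 / x0"] e by (simp add: scale3_def xy field_simps)
 next
  case 2 then show ?thesis using that[of "y1 / x1"] e by (simp add: scale3_def xy field_simps)
 next
  case 3 then show ?thesis using that[of "y2 / x2"] e by (simp add: scale3_def xy field_simps)
 qed
qed

text \<open>\<open>u \<times> (x \<times> y) = x (u \<cdot> y) - y (u \<cdot> x)\<close>\<close>

lemma orthogonal_imp_parallel_cross3:
 assumes "dot3 x u = 0" "dot3 y u = 0" shows "cross3 (cross3 x y) u = zero3"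
proof -
 obtain x0 x1 x2 y0 y1 y2 u0 u1 u2 where xy: "x = (x0, x1, x2)" "y = (y0, y1, y2)" "u = (u0, u1, u2)"
  by (metis prod_cases3)
 have e: "x0 * u0 + x1 * u1 + x2 * u2 = 0" "y0 * u0 + y1 * u1 + y2 * u2 = 0"
  using assms by (auto simp: dot3_def xy)
 have "(x2 * y0 - x0 * y2) * u2 - (x0 * y1 - x1 * y0) * u1 = y0 * (x0 * u0 + x1 * u1 + x2 * u2) - x0 * (y0 * u0 + y1 * u1 + y2 * u2)"
  "(x0 * y1 - x1 * y0) * u0 - (x1 * y2 - x2 * y1) * u2 = y1 * (x0 * u0 + x1 * u1 + x2 * u2) - x1 * (y0 * u0 + y1 * u1 + y2 * u2)"
  "(x1 * y2 - x2 * y1) * u1 - (x2 * y0 - x0 * y2) * u0 = y2 * (x0 * u0 + x1 * u1 + x2 * u2) - x2 * (y0 * u0 + y1 * u1 + y2 * u2)"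
  by (simp_all add: algebra_simps)
 then show ?thesis unfolding e by (simp add: cross3_def xy)
qed

lemma cross3_commute: "cross3 x y = zero3 \<Longrightarrow> cross3 y x = zero3"
 by (auto simp: cross3_def algebra_simps split: prod.splits)

lemma dot3_scale3: "dot3 x (scale3 c y) = c * dot3 x y" "dot3 (scale3 c x) y = c * dot3 x y"
 by (auto simp: dot3_def scale3_def algebra_simps split: prod.splits)

lemma common_kernel_3:
 assumes det: "\<And>x y z. x \<in> S \<Longrightarrow> y \<in> S \<Longrightarrow> z \<in> S \<Longrightarrow> dot3 (cross3 x y) z = 0"
 shows "\<exists>h. h \<noteq> zero3 \<and> (\<forall>x\<in>S. dot3 h x = (0::'k::field))"
proof (cases "\<exists>x\<in>S. \<exists>y\<in>S. cross3 x y \<noteq> zero3")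
 case True then show ?thesis using det by blast
next
 case False
 show ?thesis
 proof (cases "\<exists>x\<in>S. x \<noteq> zero3")
  case True
  then obtain x where x: "x \<in> S" "x \<noteq> zero3" by blast
  have "\<exists>h. h \<noteq> zero3 \<and> dot3 h x = 0"
  proof -
   obtain x0 x1 x2 where xx: "x = (x0, x1, x2)" by (metis prod_cases3)
   show ?thesis
   proof (cases "x0 = 0 \<and> x1 = 0")
    case True then show ?thesis by (intro exI[of _ "(1, 0, 0)"]) (simp add: dot3_def xx)
   next
    case False then show ?thesis by (intro exI[of _ "(x1, - x0, 0)"]) (auto simp: dot3_def xx)
   qed
  qed
  then obtain h where h: "h \<noteq> zero3" "dot3 h x = 0" by blast
  have "dot3 h y = 0" if "y \<in> S" for y
   using cross3_zero_imp_parallel[of x y] False x that h dot3_scale3 by (metis mult_zero_right)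
  then show ?thesis using h by blast
 next
  case False
  then show ?thesis by (intro exI[of _ "(1, 0, 0)"]) (auto simp: dot3_def)
 qed
qed

lemma kernel_imp_det_zero:
 assumes "h \<noteq> zero3" "dot3 h x = 0" "dot3 h y = 0" "dot3 h z = (0::'k::field)"
 shows "dot3 (cross3 x y) z = 0"
proof -
 have "cross3 (cross3 x y) h = zero3"
  by (rule orthogonal_imp_parallel_cross3) (use assms in \<open>auto simp: dot3_def mult.commute split: prod.splits\<close>)
 then obtain c where "cross3 x y = scale3 c h"
  using cross3_zero_imp_parallel[OF cross3_commute assms(1)] by blast
 then show ?thesis using assms by (simp add: dot3_scale3)
qed

text \<open>The squares form a conic, which meets every line of the dual plane.\<close>

lemma square3_orthogonal:
 obtains s t where "(s, t) \<noteq> (0, 0)" "dot3 (square3 s t) u = (0 :: 'k::alg_closed_field)"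
proof -
 obtain u0 u1 u2 where u: "u = (u0, u1, u2)" by (metis prod_cases3)
 show ?thesis
 proof (cases "u0 = 0")
  case True then show ?thesis using that[of 0 1] by (simp add: square3_def dot3_def u)
 next
  case False
  then have "degree [:u2, - 2 * u1, u0:] > 0" by simp
  then obtain t where "poly [:u2, - 2 * u1, u0:] t = 0" using alg_closed_imp_poly_has_root by blast
  then show ?thesis using that[of 1 t] by (simp add: square3_def dot3_def u algebra_simps)
 qed
qed

lemma factor_binary_quadric:
 assumes "h \<noteq> zero3"
 obtains s t s' t' where "(s, t) \<noteq> (0, 0)" "(s', t') \<noteq> (0, 0)"
  "h = (t * t', - (t * s' + s * t'), s * (s' :: 'k::alg_closed_field))"
proof -
 obtain h0 h1 h2 where h: "h = (h0, h1, h2)" by (metis prod_cases3)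
 show ?thesis
 proof (cases "h0 = 0")
  case True then show ?thesis using that[of 1 0 h2 "- h1"] assms h by auto
 next
  case False
  then have "degree [:h2, h1, h0:] > 0" by simp
  then obtain s where "poly [:h2, h1, h0:] s = 0" using alg_closed_imp_poly_has_root by blast
  then have "h2 - s * (- h1 - s * h0) = 0" by (simp add: algebra_simps)
  then have "s * (- h1 - s * h0) = h2" by simp
  then show ?thesis using that[of s 1 "- h1 - s * h0" h0] False h by auto
 qed
qed

lemma square3_nz: "(s, t) \<noteq> (0, 0) \<Longrightarrow> square3 s t \<noteq> zero3"
 by (auto simp: square3_def)

lemma proportional_pairs:
 assumes "t * s' - s * t' = (0::'k::field)" "(s, t) \<noteq> (0, 0)"
 obtains c where "s' = c * s" "t' = c * t"
proof (cases "s = 0")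
 case True then show ?thesis using that[of "t' / t"] assms by auto
next
 case False
 then show ?thesis using that[of "s' / s"] assms by (auto simp: field_simps)
qed

lemma disc3_zero_imp_square:
 assumes "disc3 h = 0" "h \<noteq> zero3"
 obtains c s t where "(s, t) \<noteq> (0, 0 :: 'k::alg_closed_field)" "h = scale3 c (square3 s t)"
proof -
 obtain s t s' t' where st: "(s, t) \<noteq> (0, 0)" "h = (t * t', - (t * s' + s * t'), s * s')"
  using factor_binary_quadric[OF assms(2)] by metis
 have "(t * s' - s * t')^2 = disc3 h" by (simp add: disc3_def st power2_eq_square algebra_simps)
 then have "t * s' - s * t' = 0" using assms by simp
 then obtain c where "s' = c * s" "t' = c * t" using proportional_pairs st by metis
 then show ?thesis using that[OF st(1), of c] st by (simp add: scale3_def square3_def algebra_simps)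
qed

lemma disc3_scale_square: "disc3 (scale3 c (square3 s t)) = 0"
 by (simp add: disc3_def scale3_def square3_def power2_eq_square algebra_simps)

text \<open>The square has to be orthogonal to the span of the set. If the span is a plane, then its normal, a cross
 product, has to be a square, which means that its discriminant vanishes; a one-dimensional span imposes no
 condition, since the field is algebraically closed.\<close>

lemma square_kernel_iff:
 fixes S :: "('k::alg_closed_field \<times> 'k \<times> 'k) set"
 shows "(\<exists>s t. (s, t) \<noteq> (0, 0) \<and> (\<forall>x\<in>S. dot3 (square3 s t) x = 0)) \<longleftrightarrow>
  (\<forall>x\<in>S. \<forall>y\<in>S. disc3 (cross3 x y) = 0 \<and> (\<forall>z\<in>S. dot3 (cross3 x y) z = 0))" (is "?L \<longleftrightarrow> ?R")
proof
 assume ?L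
 then obtain s t where st: "(s, t) \<noteq> (0, 0)" "\<forall>x\<in>S. dot3 (square3 s t) x = 0" by blast
 show ?R
 proof (intro ballI conjI)
  fix x y assume xy: "x \<in> S" "y \<in> S"
  show "dot3 (cross3 x y) z = 0" if "z \<in> S" for z
   using kernel_imp_det_zero[OF square3_nz[OF st(1)]] st(2) xy that by blast
  have "cross3 (cross3 x y) (square3 s t) = zero3"
   by (rule orthogonal_imp_parallel_cross3) (use xy st(2) in \<open>auto simp: dot3_def mult.commute split: prod.splits\<close>)
  then obtain c where "cross3 x y = scale3 c (square3 s t)"
   using cross3_zero_imp_parallel[OF cross3_commute square3_nz[OF st(1)]] by blast
  then show "disc3 (cross3 x y) = 0" by (simp add: disc3_scale_square)
 qed
next
 assume R: ?R
 show ?L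
 proof (cases "\<exists>x\<in>S. \<exists>y\<in>S. cross3 x y \<noteq> zero3")
  case True
  then obtain x y where xy: "x \<in> S" "y \<in> S" "cross3 x y \<noteq> zero3" by blast
  then obtain c s t where st: "(s, t) \<noteq> (0, 0)" "cross3 x y = scale3 c (square3 s t)"
   using R disc3_zero_imp_square by metis
  have "c \<noteq> 0" using st xy(3) by (auto simp: scale3_def split: prod.splits)
  then have "dot3 (square3 s t) z = 0" if "z \<in> S" for z
   using R xy that st(2) by (metis dot3_scale3(2) mult_eq_0_iff)
  then show ?thesis using st by blast
 next
  case False
  show ?thesis
  proof (cases "\<exists>x\<in>S. x \<noteq> zero3")
   case True
   then obtain x where x: "x \<in> S" "x \<noteq> zero3" by blast
   obtain s t where st: "(s, t) \<noteq> (0, 0)" "dot3 (square3 s t) x = 0" by (rule square3_orthogonal)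
   have "dot3 (square3 s t) y = 0" if "y \<in> S" for y
    using cross3_zero_imp_parallel[of x y] False x that st dot3_scale3 by (metis mult_zero_right)
   then show ?thesis using st by blast
  next
   case False
   then have "\<forall>x\<in>S. dot3 (square3 1 0) x = 0" by (auto simp: dot3_def)
   then show ?thesis by (intro exI[of _ 1] exI[of _ 0]) auto
  qed
 qed
qed

text \<open>In the coordinates with respect to \<open>(s, t)\<close> and \<open>(s', t')\<close>, whose determinant is \<open>t * s' - s * t'\<close>, only the
 coefficient of the square of the linear form vanishing at \<open>(s, t)\<close> is left.\<close>

lemma vanishes_twice_imp_square:
 fixes h0 h1 h2 :: "'k::field"
 assumes D: "t * s' - s * t' \<noteq> 0" and H: "h0 * s^2 + h1 * (s * t) + h2 * t^2 = 0"
  and H': "2 * h0 * s * s' + h1 * (s * t' + s' * t) + 2 * h2 * t * t' = 0"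
 obtains c where "(h0, h1, h2) = scale3 c (square3 s t)"
proof -
 let ?D = "t * s' - s * t'" and ?H = "h0 * s^2 + h1 * (s * t) + h2 * t^2"
  and ?H' = "2 * h0 * s * s' + h1 * (s * t' + s' * t) + 2 * h2 * t * t'"
  and ?H'' = "h0 * s'^2 + h1 * (s' * t') + h2 * t'^2"
 have "?D^2 * h0 = t'^2 * ?H - t * t' * ?H' + t^2 * ?H''"
  "?D^2 * h1 = - (2 * t' * s') * ?H + (t' * s + s' * t) * ?H' - 2 * t * s * ?H''"
  "?D^2 * h2 = s'^2 * ?H - s * s' * ?H' + s^2 * ?H''"
  by (simp_all add: power2_eq_square algebra_simps)
 then have "?D^2 * h0 = t^2 * ?H''" "?D^2 * h1 = - 2 * t * s * ?H''" "?D^2 * h2 = s^2 * ?H''"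
  unfolding H H' by simp_all
 moreover have "?D^2 \<noteq> 0" using D by simp
 moreover have "y = (z / x) * w" if "x \<noteq> 0" "x * y = w * z" for x y z w :: 'k
  using that by (simp add: field_simps)
 ultimately have "h0 = (?H'' / ?D^2) * t^2" "h1 = (?H'' / ?D^2) * (- 2 * t * s)" "h2 = (?H'' / ?D^2) * s^2"
  by blast+
 then have "(h0, h1, h2) = scale3 (?H'' / ?D^2) (square3 s t)"
  unfolding scale3_def square3_def by (simp add: power2_eq_square algebra_simps)
 then show ?thesis by (rule that)
qed

section \<open>The cones over the strata\<close>

text \<open>The functionals \<open>\<xi> i j\<close> are the coordinates with respect to the bases \<open>b i\<close> of the
 spaces \<open>\<Lambda> i\<close>; they vanish on the vertex. All cones below are described by these
 coordinates and are therefore invariant under translation by the vertex.\<close>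

locale scroll =
 fixes n k m :: nat and a :: "nat \<Rightarrow> nat"
  and b :: "nat \<Rightarrow> nat \<Rightarrow> 'k::alg_closed_field ^ 'd::finite" and \<xi> :: "nat \<Rightarrow> nat \<Rightarrow> 'k ^ 'd \<Rightarrow> 'k"
 assumes n_pos: "1 \<le> n" and km: "k \<le> m" "m \<le> n"
  and a_pos: "i \<in> {1..n} \<Longrightarrow> 1 \<le> a i"
  and a_one: "i \<in> {1..n} \<Longrightarrow> a i = 1 \<longleftrightarrow> i \<le> k"
  and a_two: "i \<in> {1..n} \<Longrightarrow> a i \<le> 2 \<longleftrightarrow> i \<le> m"
  and xi: "i \<in> {1..n} \<Longrightarrow> j \<le> a i \<Longrightarrow> functional (\<xi> i j)"
  and xi_b: "i \<in> {1..n} \<Longrightarrow> j \<le> a i \<Longrightarrow> i' \<in> {1..n} \<Longrightarrow> j' \<le> a i' \<Longrightarrow>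
   \<xi> i j (b i' j') = (if i = i' \<and> j = j' then 1 else 0)"
begin

definition "vertex = {v. \<forall>i\<in>{1..n}. \<forall>j\<le>a i. \<xi> i j v = 0}"

definition mk :: "(nat \<Rightarrow> nat \<Rightarrow> 'k) \<Rightarrow> 'k ^ 'd" where
 "mk x = (\<Sum>i\<in>{1..n}. \<Sum>j\<le>a i. x i j *s b i j)"

definition rank_one :: "nat set \<Rightarrow> 'k ^ 'd \<Rightarrow> bool" where
 "rank_one J v \<longleftrightarrow> (\<exists>s t. (s, t) \<noteq> (0, 0) \<and> (\<forall>i\<in>J. \<forall>j<a i. t * \<xi> i j v = s * \<xi> i (Suc j) v))"

definition columns :: "(nat \<times> nat) set" where
 "columns = {(i, j). i \<in> {1..n} \<and> j + 2 \<le> a i}"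

definition col :: "nat \<times> nat \<Rightarrow> 'k ^ 'd \<Rightarrow> 'k \<times> 'k \<times> 'k" where
 "col = (\<lambda>(i, j) v. (\<xi> i j v, \<xi> i (Suc j) v, \<xi> i (Suc (Suc j)) v))"

definition apolar :: "'k \<times> 'k \<times> 'k \<Rightarrow> 'k ^ 'd \<Rightarrow> bool" where
 "apolar h v \<longleftrightarrow> (\<forall>c\<in>columns. dot3 h (col c v) = 0)"

definition "Xcone = {v. rank_one {1..n} v}"
definition "Acone = {v. \<forall>i\<in>{k<..n}. \<forall>j\<le>a i. \<xi> i j v = 0}"
definition "Bcone = {v. rank_one {k<..n} v}"
definition "Ucone = {v. (\<forall>i\<in>{m<..n}. \<forall>j\<le>a i. \<xi> i j v = 0) \<and>
 (\<exists>\<beta> u. \<forall>i\<in>{k<..m}. \<forall>j\<le>2. \<xi> i j v = \<beta> i * u j)}"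
definition "Vcone = {v. \<exists>s t. (s, t) \<noteq> (0, 0) \<and> apolar (square3 s t) v}"
definition "Wcone = {v. \<exists>h. h \<noteq> zero3 \<and> apolar h v}"

lemma xi_mk:
 assumes "i \<in> {1..n}" "j \<le> a i" shows "\<xi> i j (mk x) = x i j"
proof -
 have "\<xi> i j (mk x) = (\<Sum>i'\<in>{1..n}. \<Sum>j'\<le>a i'. x i' j' * (if i = i' \<and> j = j' then 1 else 0))"
  unfolding mk_def functionalD(6)[OF xi[OF assms]] functionalD(2)[OF xi[OF assms]]
  by (intro sum.cong refl) (simp add: xi_b[OF assms])
 also have "\<dots> = (\<Sum>i'\<in>{1..n}. if i' = i then x i j else 0)"
 proof (intro sum.cong refl)
  fix i' assume "i' \<in> {1..n}"
  show "(\<Sum>j'\<le>a i'. x i' j' * (if i = i' \<and> j = j' then 1 else 0)) = (if i' = i then x i j else 0)"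
   using assms(2) by (cases "i' = i") (auto simp: if_distrib sum.delta cong: if_cong)
 qed
 also have "\<dots> = x i j" using assms(1) by (simp add: sum.delta)
 finally show ?thesis .
qed

lemma mk_cong: "(\<And>i j. i \<in> {1..n} \<Longrightarrow> j \<le> a i \<Longrightarrow> x i j = y i j) \<Longrightarrow> mk x = mk y"
 unfolding mk_def by (intro sum.cong refl) auto

lemma mk_add: "mk x + mk y = mk (\<lambda>i j. x i j + y i j)"
 unfolding mk_def by (simp add: sum.distrib[symmetric] vec.scale_left_distrib)

lemma mk_scale: "c *s mk x = mk (\<lambda>i j. c * x i j)"
 unfolding mk_def by (simp add: vec.scale_sum_right)

lemma mk_zero: "mk (\<lambda>i j. 0) = 0"
 unfolding mk_def by simp

lemma xi_simps:
 assumes "i \<in> {1..n}" "j \<le> a i"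
 shows "\<xi> i j (u + v) = \<xi> i j u + \<xi> i j v" "\<xi> i j (c *s v) = c * \<xi> i j v" "\<xi> i j 0 = 0"
  "\<xi> i j (u - v) = \<xi> i j u - \<xi> i j v"
 using functionalD[OF xi[OF assms]] by auto

lemma in_index: "i \<in> {k<..n} \<Longrightarrow> i \<in> {1..n}" "i \<in> {m<..n} \<Longrightarrow> i \<in> {1..n}" "i \<in> {k<..m} \<Longrightarrow> i \<in> {1..n}"
 "i \<in> {1..k} \<Longrightarrow> i \<in> {1..n}" "i \<in> {k<..m} \<Longrightarrow> i \<in> {k<..n}"
 using km by auto

lemma a_eq_2: "i \<in> {k<..m} \<Longrightarrow> a i = 2"
 using a_one[of i] a_two[of i] a_pos[of i] km by auto

lemma a_eq_1: "i \<in> {1..k} \<Longrightarrow> a i = 1"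
 using a_one[of i] km by auto

lemma a_ge_2: "i \<in> {k<..n} \<Longrightarrow> 2 \<le> a i"
 using a_one[of i] a_pos[of i] by force

lemma a_ge_3: "i \<in> {m<..n} \<Longrightarrow> 3 \<le> a i"
 using a_two[of i] by force

lemma rank_one_iff_psi:
 assumes "J \<subseteq> {1..n}"
 shows "rank_one J v \<longleftrightarrow> (\<exists>s t c. (s, t) \<noteq> (0, 0) \<and> (\<forall>i\<in>J. \<forall>j\<le>a i. \<xi> i j v = c i * psi (a i) s t j))"
proof
 assume "rank_one J v"
 then obtain s t where st: "(s, t) \<noteq> (0, 0)" "\<forall>i\<in>J. \<forall>j<a i. t * \<xi> i j v = s * \<xi> i (Suc j) v"
  unfolding rank_one_def by blast
 have "\<forall>i\<in>J. \<exists>c. \<forall>j\<le>a i. \<xi> i j v = c * psi (a i) s t j"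
 proof
  fix i assume "i \<in> J"
  then have x: "t * \<xi> i j v = s * \<xi> i (Suc j) v" if "j < a i" for j using st(2) that by blast
  show "\<exists>c. \<forall>j\<le>a i. \<xi> i j v = c * psi (a i) s t j"
   by (rule killed_by_linear_form[where x = "\<lambda>j. \<xi> i j v", OF st(1) x]) auto
 qed
 then obtain c where "\<forall>i\<in>J. \<forall>j\<le>a i. \<xi> i j v = c i * psi (a i) s t j" by metis
 then show "\<exists>s t c. (s, t) \<noteq> (0, 0) \<and> (\<forall>i\<in>J. \<forall>j\<le>a i. \<xi> i j v = c i * psi (a i) s t j)"
  using st(1) by blast
next
 assume "\<exists>s t c. (s, t) \<noteq> (0, 0) \<and> (\<forall>i\<in>J. \<forall>j\<le>a i. \<xi> i j v = c i * psi (a i) s t j)"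
 then obtain s t c where st: "(s, t) \<noteq> (0, 0)" "\<forall>i\<in>J. \<forall>j\<le>a i. \<xi> i j v = c i * psi (a i) s t j" by blast
 have "t * \<xi> i j v = s * \<xi> i (Suc j) v" if "i \<in> J" "j < a i" for i j
 proof -
  have "\<xi> i j v = c i * psi (a i) s t j" "\<xi> i (Suc j) v = c i * psi (a i) s t (Suc j)"
   using st(2) that by auto
  then show ?thesis using psi_linear[OF that(2), of t s] by (simp add: mult.left_commute)
 qed
 then show "rank_one J v" unfolding rank_one_def using st(1) by blast
qed

definition minor :: "nat \<Rightarrow> nat \<Rightarrow> nat \<Rightarrow> nat \<Rightarrow> 'k ^ 'd \<Rightarrow> 'k" where
 "minor i j i' j' v = \<xi> i j v * \<xi> i' (Suc j') v - \<xi> i (Suc j) v * \<xi> i' j' v"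

lemma rank_one_iff_minors:
 "rank_one J v \<longleftrightarrow> (\<forall>i\<in>J. \<forall>i'\<in>J. \<forall>j<a i. \<forall>j'<a i'. minor i j i' j' v = 0)"
proof
 assume "rank_one J v"
 then obtain s t where st: "(s, t) \<noteq> (0, 0)" "\<forall>i\<in>J. \<forall>j<a i. t * \<xi> i j v = s * \<xi> i (Suc j) v"
  unfolding rank_one_def by blast
 show "\<forall>i\<in>J. \<forall>i'\<in>J. \<forall>j<a i. \<forall>j'<a i'. minor i j i' j' v = 0"
 proof (intro ballI allI impI)
  fix i i' j j' assume "i \<in> J" "i' \<in> J" "j < a i" "j' < a i'"
  then have e: "t * \<xi> i j v = s * \<xi> i (Suc j) v" "t * \<xi> i' j' v = s * \<xi> i' (Suc j') v" using st by auto
  have "s * minor i j i' j' v = \<xi> i j v * (s * \<xi> i' (Suc j') v) - (s * \<xi> i (Suc j) v) * \<xi> i' j' v"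
   by (simp add: minor_def algebra_simps)
  then have "s * minor i j i' j' v = 0" unfolding e[symmetric] by simp
  moreover have "t * minor i j i' j' v = (t * \<xi> i j v) * \<xi> i' (Suc j') v - \<xi> i (Suc j) v * (t * \<xi> i' j' v)"
   by (simp add: minor_def algebra_simps)
  then have "t * minor i j i' j' v = 0" unfolding e by simp
  ultimately show "minor i j i' j' v = 0" using st(1) by auto
 qed
next
 assume min: "\<forall>i\<in>J. \<forall>i'\<in>J. \<forall>j<a i. \<forall>j'<a i'. minor i j i' j' v = 0"
 let ?S = "{(i, j). i \<in> J \<and> j < a i}" and ?f = "\<lambda>(i, j). \<xi> i j v" and ?g = "\<lambda>(i, j). \<xi> i (Suc j) v"
 have "?f x * ?g y = ?g x * ?f y" if "x \<in> ?S" "y \<in> ?S" for x y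
  using that min by (auto simp: minor_def)
 then obtain s t where st: "(s, t) \<noteq> (0, 0)" "\<And>x. x \<in> ?S \<Longrightarrow> t * ?f x = s * ?g x"
  using common_kernel_2[of ?S ?f ?g] by blast
 have "t * \<xi> i j v = s * \<xi> i (Suc j) v" if "i \<in> J" "j < a i" for i j
  using st(2)[of "(i, j)"] that by simp
 then show "rank_one J v" unfolding rank_one_def using st(1) by blast
qed

lemma polyfun_xi: "i \<in> {1..n} \<Longrightarrow> j \<le> a i \<Longrightarrow> polyfun (\<xi> i j)"
 by (intro polyfun_functional xi)

lemma polyfun_minor:
 assumes "i \<in> {1..n}" "i' \<in> {1..n}" "j < a i" "j' < a i'" shows "polyfun (minor i j i' j')"
 unfolding minor_def[abs_def] using assms by (intro polyfun_intros polyfun_xi) auto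

lemma rank_one_scale:
 assumes J: "J \<subseteq> {1..n}" and "rank_one J v" shows "rank_one J (c *s v)"
proof -
 obtain s t where st: "(s, t) \<noteq> (0, 0)" "\<forall>i\<in>J. \<forall>j<a i. t * \<xi> i j v = s * \<xi> i (Suc j) v"
  using assms(2) unfolding rank_one_def by blast
 have "t * \<xi> i j (c *s v) = s * \<xi> i (Suc j) (c *s v)" if "i \<in> J" "j < a i" for i j
 proof -
  have i: "i \<in> {1..n}" "j \<le> a i" "Suc j \<le> a i" using that J by auto
  have e: "t * \<xi> i j v = s * \<xi> i (Suc j) v" using st(2) that by blast
  have "t * \<xi> i j (c *s v) = c * (t * \<xi> i j v)" using i by (simp add: xi_simps(2) algebra_simps)
  also have "\<dots> = s * \<xi> i (Suc j) (c *s v)" unfolding e using i by (simp add: xi_simps(2) algebra_simps)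
  finally show ?thesis .
 qed
 then show ?thesis unfolding rank_one_def using st(1) by blast
qed

lemma alg_cone_rank_one:
 assumes J: "J \<subseteq> {1..n}" shows "alg_cone {v. rank_one J v}"
proof (rule alg_coneI)
 have "rank_one J 0" unfolding rank_one_def using J by (intro exI[of _ 1] exI[of _ 0]) (auto simp: xi_simps)
 then show "cone {v. rank_one J v}" unfolding cone_def using rank_one_scale[OF J] by blast
 let ?A = "{(i, j, i', j'). i \<in> J \<and> i' \<in> J \<and> j < a i \<and> j' < a i'}"
 show "{v. rank_one J v} = {v. \<forall>x\<in>?A. (\<lambda>(i, j, i', j'). minor i j i' j') x v = 0}"
  unfolding rank_one_iff_minors by auto
 show "polyfun ((\<lambda>(i, j, i', j'). minor i j i' j') x)" if x: "x \<in> ?A" for x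
 proof -
  obtain i j i' j' where "x = (i, j, i', j')" by (metis prod_cases4)
  moreover from this x J have "i \<in> {1..n}" "i' \<in> {1..n}" "j < a i" "j' < a i'" by auto
  ultimately show ?thesis by (simp add: polyfun_minor)
 qed
qed

lemma alg_cone_X: "alg_cone Xcone" and alg_cone_B: "alg_cone Bcone"
 unfolding Xcone_def Bcone_def by (rule alg_cone_rank_one; use km in force)+

lemma subspace_vertex: "vec.subspace vertex"
 unfolding vertex_def vec.subspace_def by (auto simp: xi_simps)

lemma subspace_A: "vec.subspace Acone"
 unfolding Acone_def vec.subspace_def using in_index(1) by (auto simp: xi_simps)

lemma dot3_col_scale:
 assumes "c \<in> columns" shows "dot3 h (col c (x *s v)) = x * dot3 h (col c v)"
 using assms by (auto simp: columns_def col_def dot3_def xi_simps algebra_simps split: prod.splits)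

lemma apolar_scale: "apolar h v \<Longrightarrow> apolar h (x *s v)"
 unfolding apolar_def by (simp add: dot3_col_scale)

lemma apolar_zero: "apolar h 0"
 unfolding apolar_def using dot3_col_scale[of _ h 0 0] by simp

lemma polyfun_col:
 assumes "c \<in> columns" "c' \<in> columns" "c'' \<in> columns"
 shows "polyfun (\<lambda>v. dot3 (cross3 (col c v) (col c' v)) (col c'' v))"
  and "polyfun (\<lambda>v. disc3 (cross3 (col c v) (col c' v)))"
proof -
 obtain i j i' j' i'' j'' where c: "c = (i, j)" "c' = (i', j')" "c'' = (i'', j'')"
  by (metis surj_pair)
 have p: "polyfun (\<xi> i j)" "polyfun (\<xi> i (Suc j))" "polyfun (\<xi> i (Suc (Suc j)))"
  "polyfun (\<xi> i' j')" "polyfun (\<xi> i' (Suc j'))" "polyfun (\<xi> i' (Suc (Suc j')))"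
  "polyfun (\<xi> i'' j'')" "polyfun (\<xi> i'' (Suc j''))" "polyfun (\<xi> i'' (Suc (Suc j'')))"
  using assms by (auto simp: columns_def c intro: polyfun_xi)
 show "polyfun (\<lambda>v. dot3 (cross3 (col c v) (col c' v)) (col c'' v))"
  "polyfun (\<lambda>v. disc3 (cross3 (col c v) (col c' v)))"
  unfolding c col_def dot3_def cross3_def disc3_def prod.case
  by (intro p polyfun_const polyfun_add polyfun_diff polyfun_mult polyfun_power)+
qed

text \<open>A common kernel of the triples \<open>col c v\<close> exists if and only if all \<open>3 \<times> 3\<close> determinants vanish.\<close>

lemma alg_cone_W: "alg_cone Wcone"
proof (rule alg_coneI)
 have "((1 :: 'k), 0, 0) \<noteq> zero3 \<and> apolar (1, 0, 0) 0" using apolar_zero by simp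
 then have "0 \<in> Wcone" unfolding Wcone_def by blast
 then show "cone Wcone" unfolding cone_def Wcone_def using apolar_scale by blast
 let ?A = "columns \<times> columns \<times> columns"
 let ?f = "\<lambda>(c, c', c'') v. dot3 (cross3 (col c v) (col c' v)) (col c'' v)"
 show "polyfun (?f x)" if "x \<in> ?A" for x using that polyfun_col by auto
 show "Wcone = {v. \<forall>x\<in>?A. ?f x v = 0}"
 proof (intro set_eqI iffI)
  fix v assume "v \<in> Wcone"
  then obtain h where h: "h \<noteq> zero3" "apolar h v" unfolding Wcone_def by blast
  then show "v \<in> {v. \<forall>x\<in>?A. ?f x v = 0}"
   unfolding apolar_def by (auto intro: kernel_imp_det_zero[OF h(1)])
 next
  fix v assume v: "v \<in> {v. \<forall>x\<in>?A. ?f x v = 0}"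
  have "\<exists>h. h \<noteq> zero3 \<and> (\<forall>x\<in>(\<lambda>c. col c v) ` columns. dot3 h x = 0)"
   by (rule common_kernel_3) (use v in auto)
  then show "v \<in> Wcone" unfolding Wcone_def apolar_def by blast
 qed
qed

text \<open>By \<open>square_kernel_iff\<close> the existence of an apolar square is expressed by the determinants
 together with the discriminants of the cross products.\<close>

lemma alg_cone_V: "alg_cone Vcone"
proof (rule alg_coneI)
 have "0 \<in> Vcone" unfolding Vcone_def using apolar_zero by (auto intro!: exI[of _ 1])
 then show "cone Vcone" unfolding cone_def Vcone_def using apolar_scale by blast
 let ?A = "columns \<times> columns \<times> columns \<times> (UNIV :: bool set)"
 let ?f = "\<lambda>(c, c', c'', z) v. if z then dot3 (cross3 (col c v) (col c' v)) (col c'' v)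
   else disc3 (cross3 (col c v) (col c' v))"
 show "polyfun (?f x)" if "x \<in> ?A" for x
  using that polyfun_col by (cases x rule: prod_cases4; cases "snd (snd (snd x))") auto
 show "Vcone = {v. \<forall>x\<in>?A. ?f x v = 0}"
 proof (intro set_eqI)
  fix v
  have "v \<in> Vcone \<longleftrightarrow> (\<exists>s t. (s, t) \<noteq> (0, 0) \<and> (\<forall>x\<in>(\<lambda>c. col c v) ` columns. dot3 (square3 s t) x = 0))"
   unfolding Vcone_def apolar_def by auto
  also have "\<dots> \<longleftrightarrow> (\<forall>c\<in>columns. \<forall>c'\<in>columns. disc3 (cross3 (col c v) (col c' v)) = 0 \<and>
    (\<forall>c''\<in>columns. dot3 (cross3 (col c v) (col c' v)) (col c'' v) = 0))"
   unfolding square_kernel_iff by blast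
  also have "\<dots> \<longleftrightarrow> (\<forall>c\<in>columns. \<forall>c'\<in>columns. \<forall>c''\<in>columns. disc3 (cross3 (col c v) (col c' v)) = 0 \<and>
    dot3 (cross3 (col c v) (col c' v)) (col c'' v) = 0)" by blast
  also have "\<dots> \<longleftrightarrow> v \<in> {v. \<forall>x\<in>?A. ?f x v = 0}"
   by (simp add: UNIV_bool Ball_def) blast
  finally show "v \<in> Vcone \<longleftrightarrow> v \<in> {v. \<forall>x\<in>?A. ?f x v = 0}" .
 qed
qed

lemma alg_cone_U: "alg_cone Ucone"
proof -
 let ?Z = "{v. \<forall>i\<in>{m<..n}. \<forall>j\<le>a i. \<xi> i j v = 0}"
 let ?A = "{(i, j, i', j'). i \<in> {k<..m} \<and> i' \<in> {k<..m} \<and> j \<le> 2 \<and> j' \<le> (2::nat)}"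
 let ?f = "\<lambda>(i, j, i', j') v. \<xi> i j v * \<xi> i' j' v - \<xi> i j' v * \<xi> i' j v"
 let ?R = "{v. \<exists>\<beta> u. \<forall>i\<in>{k<..m}. \<forall>j\<le>2. \<xi> i j v = \<beta> i * u j}"
 have fx: "functional (\<xi> i j)" if "i \<in> {k<..m}" "j \<le> 2" for i j
  using xi[of i j] in_index that a_eq_2 by simp
 have "vec.subspace ?Z"
  unfolding vec.subspace_def using in_index(2) by (auto simp: xi_simps)
 moreover have "alg_cone ?R"
 proof (rule alg_coneI)
  show "cone ?R" unfolding cone_def
  proof (intro conjI allI ballI)
   show "0 \<in> ?R" using functionalD(3)[OF fx] by (auto intro!: exI[of _ "\<lambda>_. 0"])
   fix c v assume "v \<in> ?R"
   then obtain \<beta> u where "\<forall>i\<in>{k<..m}. \<forall>j\<le>2. \<xi> i j v = \<beta> i * u j" by blast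
   then have "\<forall>i\<in>{k<..m}. \<forall>j\<le>2. \<xi> i j (c *s v) = \<beta> i * (c * u j)"
    using functionalD(2)[OF fx] by simp
   then show "c *s v \<in> ?R" by (intro CollectI exI[of _ \<beta>] exI[of _ "\<lambda>j. c * u j"])
  qed
  show "polyfun (?f x)" if "x \<in> ?A" for x
   using that by (auto intro!: polyfun_diff polyfun_mult polyfun_functional[OF fx])
  show "?R = {v. \<forall>x\<in>?A. ?f x v = 0}"
  proof (intro set_eqI iffI)
   fix v assume "v \<in> ?R" then show "v \<in> {v. \<forall>x\<in>?A. ?f x v = 0}" by auto
  next
   fix v assume v: "v \<in> {v. \<forall>x\<in>?A. ?f x v = 0}"
   show "v \<in> ?R"
   proof (cases "\<exists>i\<in>{k<..m}. \<exists>j\<le>2. \<xi> i j v \<noteq> 0")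
    case True
    then obtain i0 j0 where 0: "i0 \<in> {k<..m}" "j0 \<le> 2" "\<xi> i0 j0 v \<noteq> 0" by blast
    have pr: "\<xi> i j v = (\<xi> i j0 v / \<xi> i0 j0 v) * \<xi> i0 j v" if "i \<in> {k<..m}" "j \<le> 2" for i j
    proof -
     have "(i, j, i0, j0) \<in> ?A" using that 0 by auto
     then have "?f (i, j, i0, j0) v = 0" using v by blast
     then show ?thesis using 0 by (simp add: field_simps)
    qed
    then show ?thesis
     by (intro CollectI exI[of _ "\<lambda>i. \<xi> i j0 v / \<xi> i0 j0 v"] exI[of _ "\<lambda>j. \<xi> i0 j v"] ballI allI impI)
      (rule pr)
   next
    case False
    then show ?thesis by (auto intro!: exI[of _ "\<lambda>_. 0"])
   qed
  qed
 qed
 ultimately have "alg_cone (?Z \<inter> ?R)" by (rule alg_cone_Int[OF subspace_imp_alg_cone])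
 moreover have "?Z \<inter> ?R = Ucone" unfolding Ucone_def by blast
 ultimately show ?thesis by simp
qed

subsection \<open>Secants and tangents through a point\<close>

lemma apolarI_psi:
 assumes st: "h = (h0, h1, h2)" "h0 * s^2 + h1 * (s * t) + h2 * t^2 = 0" "h0 * s'^2 + h1 * (s' * t') + h2 * t'^2 = 0"
  and x: "\<And>i j. i \<in> {1..n} \<Longrightarrow> j \<le> a i \<Longrightarrow> \<xi> i j v = c i * psi (a i) s t j + d i * psi (a i) s' t' j"
 shows "apolar h v"
proof -
 have "h0 * \<xi> i j v + h1 * \<xi> i (Suc j) v + h2 * \<xi> i (Suc (Suc j)) v = 0" if "i \<in> {1..n}" "j + 2 \<le> a i" for i j
 proof -
  have "h0 * \<xi> i j v + h1 * \<xi> i (Suc j) v + h2 * \<xi> i (Suc (Suc j)) v =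
   c i * (h0 * psi (a i) s t j + h1 * psi (a i) s t (Suc j) + h2 * psi (a i) s t (Suc (Suc j))) +
   d i * (h0 * psi (a i) s' t' j + h1 * psi (a i) s' t' (Suc j) + h2 * psi (a i) s' t' (Suc (Suc j)))"
   using that by (simp add: x algebra_simps)
  also have "\<dots> = 0" unfolding apolar_psi[OF that(2)] st by simp
  finally show ?thesis .
 qed
 then show ?thesis unfolding apolar_def columns_def col_def dot3_def st(1) by auto
qed

lemma apolar_squareI:
 assumes x: "\<And>i j. i \<in> {1..n} \<Longrightarrow> j \<le> a i \<Longrightarrow> \<xi> i j v = c i * psi (a i) s t j + d i * dpsi (a i) s t s' t' j"
 shows "apolar (square3 s t) v"
proof -
 let ?h0 = "t * t" and ?h1 = "- (t * s + s * t)" and ?h2 = "s * s"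
 have H: "?h0 * s^2 + ?h1 * (s * t) + ?h2 * t^2 = 0" "2 * ?h0 * s * s' + ?h1 * (s * t' + s' * t) + 2 * ?h2 * t * t' = 0"
  by (simp_all add: algebra_simps power2_eq_square)
 have "?h0 * \<xi> i j v + ?h1 * \<xi> i (Suc j) v + ?h2 * \<xi> i (Suc (Suc j)) v = 0" if "i \<in> {1..n}" "j + 2 \<le> a i" for i j
 proof -
  have "?h0 * \<xi> i j v + ?h1 * \<xi> i (Suc j) v + ?h2 * \<xi> i (Suc (Suc j)) v =
   c i * (?h0 * psi (a i) s t j + ?h1 * psi (a i) s t (Suc j) + ?h2 * psi (a i) s t (Suc (Suc j))) +
   d i * (?h0 * dpsi (a i) s t s' t' j + ?h1 * dpsi (a i) s t s' t' (Suc j) + ?h2 * dpsi (a i) s t s' t' (Suc (Suc j)))"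
   using that by (simp add: x algebra_simps)
  also have "\<dots> = 0" unfolding apolar_psi[OF that(2)] apolar_dpsi[OF that(2)] H by simp
  finally show ?thesis .
 qed
 then show ?thesis unfolding apolar_def columns_def col_def dot3_def square3_def by auto
qed

lemma apolarD:
 "apolar (h0, h1, h2) v \<Longrightarrow> i \<in> {1..n} \<Longrightarrow> j + 2 \<le> a i \<Longrightarrow>
  h0 * \<xi> i j v + h1 * \<xi> i (Suc j) v + h2 * \<xi> i (Suc (Suc j)) v = 0"
 unfolding apolar_def columns_def col_def dot3_def by auto

lemma apolar_square_form:
 assumes D: "t * s' - s * t' \<noteq> 0" and v: "apolar (square3 s t) v"
 obtains c d where "\<And>i j. i \<in> {1..n} \<Longrightarrow> j \<le> a i \<Longrightarrow>
  \<xi> i j v = c i * psi (a i) s t j + d i * dpsi (a i) s t s' t' j"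
proof -
 have "\<forall>i\<in>{1..n}. \<exists>c d. \<forall>j\<le>a i. \<xi> i j v = c * psi (a i) s t j + d * dpsi (a i) s t s' t' j"
 proof
  fix i assume i: "i \<in> {1..n}"
  show "\<exists>c d. \<forall>j\<le>a i. \<xi> i j v = c * psi (a i) s t j + d * dpsi (a i) s t s' t' j"
   by (rule killed_by_square[where x = "\<lambda>j. \<xi> i j v", OF D a_pos[OF i] apolarD[OF v[unfolded square3_def] i]]) auto
 qed
 then show ?thesis using that by metis
qed

lemma apolar_product_form:
 assumes D: "t * s' - s * t' \<noteq> 0" and v: "apolar (t * t', - (t * s' + s * t'), s * s') v"
 obtains c d where "\<And>i j. i \<in> {1..n} \<Longrightarrow> j \<le> a i \<Longrightarrow>
  \<xi> i j v = c i * psi (a i) s t j + d i * psi (a i) s' t' j"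
proof -
 have "\<forall>i\<in>{1..n}. \<exists>c d. \<forall>j\<le>a i. \<xi> i j v = c * psi (a i) s t j + d * psi (a i) s' t' j"
 proof
  fix i assume i: "i \<in> {1..n}"
  show "\<exists>c d. \<forall>j\<le>a i. \<xi> i j v = c * psi (a i) s t j + d * psi (a i) s' t' j"
   by (rule killed_by_two_linear_forms[where x = "\<lambda>j. \<xi> i j v", OF D a_pos[OF i] apolarD[OF v i]]) auto
 qed
 then show ?thesis using that by metis
qed

lemma mem_X_iff:
 "v \<in> Xcone \<longleftrightarrow> (\<exists>s t c. (s, t) \<noteq> (0, 0) \<and> (\<forall>i\<in>{1..n}. \<forall>j\<le>a i. \<xi> i j v = c i * psi (a i) s t j))"
 unfolding Xcone_def by (simp add: rank_one_iff_psi)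

lemma chord_form:
 assumes w: "w \<notin> Xcone" and v: "v \<in> Xcone" "v' \<in> Xcone" "w = v + v'"
 obtains s t s' t' c d where "t * s' - s * t' \<noteq> 0"
  "\<And>i j. i \<in> {1..n} \<Longrightarrow> j \<le> a i \<Longrightarrow> \<xi> i j w = c i * psi (a i) s t j + d i * psi (a i) s' t' j"
  "\<And>i j. i \<in> {1..n} \<Longrightarrow> j \<le> a i \<Longrightarrow> \<xi> i j v = c i * psi (a i) s t j"
proof -
 obtain s t c where c: "(s, t) \<noteq> (0, 0)" "\<forall>i\<in>{1..n}. \<forall>j\<le>a i. \<xi> i j v = c i * psi (a i) s t j"
  using v(1) mem_X_iff by metis
 obtain s' t' d where d: "(s', t') \<noteq> (0, 0)" "\<forall>i\<in>{1..n}. \<forall>j\<le>a i. \<xi> i j v' = d i * psi (a i) s' t' j"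
  using v(2) mem_X_iff by metis
 have D: "t * s' - s * t' \<noteq> 0"
 proof
  assume "t * s' - s * t' = 0"
  then obtain e where e: "s' = e * s" "t' = e * t" using proportional_pairs c(1) by metis
  have "psi (a i) s' t' j = e ^ a i * psi (a i) s t j" if "j \<le> a i" for i j
  proof -
   have "e ^ a i = e ^ (a i - j) * e ^ j" using that by (simp add: power_add[symmetric])
   then show ?thesis unfolding psi_def e by (simp add: power_mult_distrib)
  qed
  then have "\<forall>i\<in>{1..n}. \<forall>j\<le>a i. \<xi> i j w = (c i + d i * e ^ a i) * psi (a i) s t j"
   using c d v(3) by (simp add: xi_simps algebra_simps)
  then have "(s, t) \<noteq> (0, 0) \<and> (\<forall>i\<in>{1..n}. \<forall>j\<le>a i. \<xi> i j w = (\<lambda>i. c i + d i * e ^ a i) i * psi (a i) s t j)"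
   using c(1) by blast
  then have "w \<in> Xcone" unfolding mem_X_iff by (intro exI)
  then show False using w by blast
 qed
 show ?thesis
  by (rule that[OF D, of c d]) (use c d v(3) in \<open>auto simp: xi_simps\<close>)
qed

definition lin_poly :: "nat \<Rightarrow> nat \<Rightarrow> ('k, 'd) mpoly" where
 "lin_poly i j = (SOME l. l \<in> forms 1 \<and> mpeval l = \<xi> i j)"

lemma lin_poly:
 assumes "i \<in> {1..n}" "j \<le> a i" shows "lin_poly i j \<in> forms 1" "mpeval (lin_poly i j) = \<xi> i j"
proof -
 have "\<exists>l. l \<in> forms 1 \<and> mpeval l = \<xi> i j" using functional_form[OF xi[OF assms]] by blast
 then have "lin_poly i j \<in> forms 1 \<and> mpeval (lin_poly i j) = \<xi> i j"
  unfolding lin_poly_def by (rule someI_ex)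
 then show "lin_poly i j \<in> forms 1" "mpeval (lin_poly i j) = \<xi> i j" by auto
qed

definition minor_poly :: "nat \<Rightarrow> nat \<Rightarrow> nat \<Rightarrow> nat \<Rightarrow> ('k, 'd) mpoly" where
 "minor_poly i j i' j' = lin_poly i j * lin_poly i' (Suc j') - lin_poly i (Suc j) * lin_poly i' j'"

lemma minor_poly:
 assumes "i \<in> {1..n}" "i' \<in> {1..n}" "j < a i" "j' < a i'"
 shows "minor_poly i j i' j' \<in> forms 2" "mpeval (minor_poly i j i' j') v = minor i j i' j' v"
proof -
 have "lin_poly i j * lin_poly i' (Suc j') \<in> forms (1 + 1)" "lin_poly i (Suc j) * lin_poly i' j' \<in> forms (1 + 1)"
  by (intro forms_mult lin_poly; use assms in force)+
 then show "minor_poly i j i' j' \<in> forms 2" unfolding minor_poly_def one_add_one[symmetric] by (rule forms_diff)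
 show "mpeval (minor_poly i j i' j') v = minor i j i' j' v"
  using assms by (simp add: minor_poly_def minor_def lin_poly)
qed

definition minors :: "('k, 'd) mpoly set" where
 "minors = {minor_poly i j i' j' | i j i' j'. i \<in> {1..n} \<and> i' \<in> {1..n} \<and> j < a i \<and> j' < a i'}"

lemma minors_forms: "minors \<subseteq> forms 2"
 using minor_poly(1) by (auto simp: minors_def)

lemma Xcone_minors: "Xcone = {v. \<forall>g\<in>minors. mpeval g v = 0}"
proof (intro set_eqI)
 fix v
 have "v \<in> Xcone \<longleftrightarrow> (\<forall>i\<in>{1..n}. \<forall>i'\<in>{1..n}. \<forall>j<a i. \<forall>j'<a i'. minor i j i' j' v = 0)"
  unfolding Xcone_def by (simp add: rank_one_iff_minors)
 also have "\<dots> \<longleftrightarrow> (\<forall>g\<in>minors. mpeval g v = 0)"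
 proof
  assume "\<forall>i\<in>{1..n}. \<forall>i'\<in>{1..n}. \<forall>j<a i. \<forall>j'<a i'. minor i j i' j' v = 0"
  then show "\<forall>g\<in>minors. mpeval g v = 0" unfolding minors_def by (auto simp: minor_poly(2))
 next
  assume min: "\<forall>g\<in>minors. mpeval g v = 0"
  show "\<forall>i\<in>{1..n}. \<forall>i'\<in>{1..n}. \<forall>j<a i. \<forall>j'<a i'. minor i j i' j' v = 0"
  proof (intro ballI allI impI)
   fix i i' j j' assume i: "i \<in> {1..n}" "i' \<in> {1..n}" "j < a i" "j' < a i'"
   then have "minor_poly i j i' j' \<in> minors" unfolding minors_def by blast
   then have "mpeval (minor_poly i j i' j') v = 0" using min by blast
   then show "minor i j i' j' v = 0" by (simp only: minor_poly(2)[OF i])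
  qed
 qed
 finally show "v \<in> Xcone \<longleftrightarrow> v \<in> {v. \<forall>g\<in>minors. mpeval g v = 0}" by simp
qed

lemma dir_deriv_minor:
 assumes i: "i \<in> {1..n}" "i' \<in> {1..n}" "j < a i" "j' < a i'"
 shows "dir_deriv (minor_poly i j i' j') v w = \<xi> i j v * \<xi> i' (Suc j') w + \<xi> i j w * \<xi> i' (Suc j') v
   - \<xi> i (Suc j) v * \<xi> i' j' w - \<xi> i (Suc j) w * \<xi> i' j' v"
proof -
 let ?R = "[:\<xi> i j v, \<xi> i j w:] * [:\<xi> i' (Suc j') v, \<xi> i' (Suc j') w:] - [:\<xi> i (Suc j) v, \<xi> i (Suc j) w:] * [:\<xi> i' j' v, \<xi> i' j' w:]"
 have "mpeval (minor_poly i j i' j') (v + \<tau> *s w) = poly ?R \<tau>" for \<tau>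
  using i by (simp add: minor_poly(2) minor_def xi_simps algebra_simps)
 then have "dir_deriv (minor_poly i j i' j') v w = coeff ?R 1" by (rule dir_deriv_eq_coeff)
 then show ?thesis by (simp add: algebra_simps)
qed

text \<open>Polarising the minors at \<open>v\<close>, which lies over \<open>(s : t)\<close>, shows that the vector with entries
 \<open>t * \<xi> i j w - s * \<xi> i (j + 1) w\<close> is proportional to \<open>v\<close> with one factor of each monomial removed; this
 determines the part of \<open>w\<close> transversal to the fibre over \<open>(s : t)\<close>.\<close>

lemma tangent_form:
 assumes w: "w \<notin> Xcone" and v: "v \<in> Xcone" "v \<notin> vertex" and tangent: "\<And>g. g \<in> minors \<Longrightarrow> dir_deriv g v w = 0"
 obtains s t s' t' c d \<rho> where "t * s' - s * t' \<noteq> 0"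
  "\<And>i j. i \<in> {1..n} \<Longrightarrow> j \<le> a i \<Longrightarrow> \<xi> i j w = c i * psi (a i) s t j + d i * dpsi (a i) s t s' t' j"
  "\<And>i j. i \<in> {1..n} \<Longrightarrow> j \<le> a i \<Longrightarrow> \<xi> i j v = \<rho> * (d i * psi (a i) s t j)"
proof -
 obtain s t e where e: "(s, t) \<noteq> (0, 0)" "\<forall>i\<in>{1..n}. \<forall>j\<le>a i. \<xi> i j v = e i * psi (a i) s t j"
  using v(1) mem_X_iff by metis
 obtain s' t' where D: "t * s' - s * t' \<noteq> 0" using complementary_direction[OF e(1)] by blast
 let ?D = "t * s' - s * t'"
 define \<kappa> where "\<kappa> = (\<lambda>i j. e i * psi (a i - 1) s t j)"
 define y where "y = (\<lambda>i j. t * \<xi> i j w - s * \<xi> i (Suc j) w)"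
 have vk: "\<xi> i j v = s * \<kappa> i j" "\<xi> i (Suc j) v = t * \<kappa> i j" if "i \<in> {1..n}" "j < a i" for i j
  using e(2) that psi_shift[OF that(2), of s t] by (auto simp: \<kappa>_def)
 have pr: "\<kappa> i j * y i' j' = \<kappa> i' j' * y i j" if i: "i \<in> {1..n}" "i' \<in> {1..n}" "j < a i" "j' < a i'" for i i' j j'
 proof -
  have "minor_poly i j i' j' \<in> minors" unfolding minors_def using i by blast
  then have "dir_deriv (minor_poly i j i' j') v w = 0" by (rule tangent)
  then have "s * \<kappa> i j * \<xi> i' (Suc j') w + \<xi> i j w * (t * \<kappa> i' j')
    - t * \<kappa> i j * \<xi> i' j' w - \<xi> i (Suc j) w * (s * \<kappa> i' j') = 0"
   unfolding dir_deriv_minor[OF i] vk[OF i(1,3)] vk[OF i(2,4)] .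
  then show ?thesis by (simp add: y_def algebra_simps)
 qed
 obtain i0 where i0: "i0 \<in> {1..n}" "e i0 \<noteq> 0" using v(2) e(2) unfolding vertex_def by force
 obtain j0 where j0: "j0 \<le> a i0 - 1" "psi (a i0 - 1) s t j0 \<noteq> 0" using psi_nonzero[OF e(1)] by blast
 have j0': "j0 < a i0" using j0 a_pos[OF i0(1)] by simp
 have k0: "\<kappa> i0 j0 \<noteq> 0" using i0 j0 by (simp add: \<kappa>_def)
 define \<epsilon> where "\<epsilon> = y i0 j0 / \<kappa> i0 j0"
 have y: "y i j = \<epsilon> * \<kappa> i j" if "i \<in> {1..n}" "j < a i" for i j
  using pr[OF i0(1) that(1) j0' that(2)] k0 by (simp add: \<epsilon>_def field_simps)
 have \<epsilon>: "\<epsilon> \<noteq> 0"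
 proof
  assume "\<epsilon> = 0"
  then have "\<forall>i\<in>{1..n}. \<forall>j<a i. t * \<xi> i j w = s * \<xi> i (Suc j) w" using y by (simp add: y_def)
  then have "w \<in> Xcone" unfolding Xcone_def rank_one_def using e(1) by blast
  then show False using w by blast
 qed
 define d where "d = (\<lambda>i. \<epsilon> / ?D * e i)"
 have "\<forall>i\<in>{1..n}. \<exists>c. \<forall>j\<le>a i. \<xi> i j w - d i * dpsi (a i) s t s' t' j = c * psi (a i) s t j"
 proof
  fix i assume i: "i \<in> {1..n}"
  have x: "t * (\<xi> i j w - d i * dpsi (a i) s t s' t' j) = s * (\<xi> i (Suc j) w - d i * dpsi (a i) s t s' t' (Suc j))"
   if j: "j < a i" for j
  proof -
   have "d i * (t * dpsi (a i) s t s' t' j - s * dpsi (a i) s t s' t' (Suc j)) = \<epsilon> * \<kappa> i j"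
    unfolding dpsi_linear[OF j] d_def \<kappa>_def using D by simp
   then show ?thesis using y[OF i j] unfolding y_def by (simp add: algebra_simps)
  qed
  show "\<exists>c. \<forall>j\<le>a i. \<xi> i j w - d i * dpsi (a i) s t s' t' j = c * psi (a i) s t j"
   by (rule killed_by_linear_form[where x = "\<lambda>j. \<xi> i j w - d i * dpsi (a i) s t s' t' j", OF e(1) x]) auto
 qed
 then obtain c where c: "\<forall>i\<in>{1..n}. \<forall>j\<le>a i. \<xi> i j w - d i * dpsi (a i) s t s' t' j = c i * psi (a i) s t j" by metis
 show ?thesis
 proof (rule that[OF D, of c d "?D / \<epsilon>"])
  fix i j assume ij: "i \<in> {1..n}" "j \<le> a i"
  have "\<xi> i j w - d i * dpsi (a i) s t s' t' j = c i * psi (a i) s t j" using c ij by blast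
  then show "\<xi> i j w = c i * psi (a i) s t j + d i * dpsi (a i) s t s' t' j" by (simp add: algebra_simps)
  show "\<xi> i j v = ?D / \<epsilon> * (d i * psi (a i) s t j)"
   using e(2) ij \<epsilon> D by (simp add: d_def)
 qed
qed

subsection \<open>Inclusions\<close>

lemma X_subset_B: "Xcone \<subseteq> Bcone"
 unfolding Xcone_def Bcone_def rank_one_def using in_index(1) by blast

lemma A_subset_B: "Acone \<subseteq> Bcone"
proof
 fix v assume "v \<in> Acone"
 then have "((1 :: 'k), (0 :: 'k)) \<noteq> (0, 0) \<and> (\<forall>i\<in>{k<..n}. \<forall>j<a i. 0 * \<xi> i j v = 1 * \<xi> i (Suc j) v)"
  by (simp add: Acone_def)
 then show "v \<in> Bcone" unfolding Bcone_def rank_one_def by blast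
qed

lemma V_subset_W: "Vcone \<subseteq> Wcone"
 unfolding Vcone_def Wcone_def using square3_nz by blast

lemma column_index: "(i, j) \<in> columns \<Longrightarrow> i \<in> {k<..n}"
 using a_eq_1[of i] unfolding columns_def by force

lemma rank_one_imp_apolar_square:
 assumes st: "\<And>i j. i \<in> {k<..n} \<Longrightarrow> j < a i \<Longrightarrow> t * \<xi> i j v = s * \<xi> i (Suc j) v"
 shows "apolar (square3 s t) v"
 unfolding apolar_def
proof
 fix c assume c: "c \<in> columns"
 obtain i j where ij: "c = (i, j)" by (cases c)
 have "i \<in> {k<..n}" "j + 2 \<le> a i" using c ij column_index by (auto simp: columns_def)
 then have e: "t * \<xi> i j v = s * \<xi> i (Suc j) v" "t * \<xi> i (Suc j) v = s * \<xi> i (Suc (Suc j)) v"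
  using st by auto
 have "dot3 (square3 s t) (col c v) = t * (t * \<xi> i j v) - t * (s * \<xi> i (Suc j) v)
   - s * (t * \<xi> i (Suc j) v) + s * (s * \<xi> i (Suc (Suc j)) v)"
  unfolding ij dot3_def square3_def col_def by (simp add: algebra_simps)
 then show "dot3 (square3 s t) (col c v) = 0" unfolding e by simp
qed

lemma B_subset_V: "Bcone \<subseteq> Vcone"
proof
 fix v assume "v \<in> Bcone"
 then obtain s t where st: "(s, t) \<noteq> (0, 0)" "\<forall>i\<in>{k<..n}. \<forall>j<a i. t * \<xi> i j v = s * \<xi> i (Suc j) v"
  unfolding Bcone_def rank_one_def by blast
 then have "apolar (square3 s t) v" by (intro rank_one_imp_apolar_square) blast
 then show "v \<in> Vcone" unfolding Vcone_def using st(1) by blast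
qed

text \<open>The components with \<open>a i = 2\<close> are multiples of a single triple, and some square is orthogonal to it.\<close>

lemma U_subset_V: "Ucone \<subseteq> Vcone"
proof
 fix v assume "v \<in> Ucone"
 then obtain \<beta> u where v: "\<forall>i\<in>{m<..n}. \<forall>j\<le>a i. \<xi> i j v = 0" "\<forall>i\<in>{k<..m}. \<forall>j\<le>2. \<xi> i j v = \<beta> i * u j"
  unfolding Ucone_def by blast
 obtain s t where st: "(s, t) \<noteq> (0, 0)" "dot3 (square3 s t) (u 0, u 1, u 2) = 0" by (rule square3_orthogonal)
 have "dot3 (square3 s t) (col c v) = 0" if "c \<in> columns" for c
 proof -
  obtain i j where c: "c = (i, j)" by (cases c)
  have i: "i \<in> {k<..n}" "j + 2 \<le> a i" using that c column_index by (auto simp: columns_def)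
  show ?thesis
  proof (cases "i \<le> m")
   case True
   then have "a i = 2" using i a_eq_2 by simp
   then have "j = 0" using i by simp
   then have "col c v = scale3 (\<beta> i) (u 0, u 1, u 2)"
    using v(2) True i unfolding c col_def scale3_def by (simp add: numeral_2_eq_2)
   then show ?thesis using st by (simp add: dot3_scale3)
  next
   case False
   then have "col c v = zero3" using v(1) i unfolding c col_def by simp
   then show ?thesis by (simp add: dot3_def split: prod.splits)
  qed
 qed
 then show "v \<in> Vcone" unfolding Vcone_def apolar_def using st by blast
qed

text \<open>Outside \<open>B \<union> U\<close> the apolar quadric is unique. A tangent vector
 \<open>c i * psi + d i * dpsi\<close> is apolar to a quadric \<open>h\<close> that is not a multiple of \<open>square3 s t\<close>
 only if \<open>d i = 0\<close> for all \<open>i > k\<close>, in case \<open>h\<close> vanishes at \<open>(s, t)\<close>, and otherwise only if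
 the ratio \<open>c i / d i\<close> is the same for all \<open>i\<close> with \<open>a i = 2\<close> and both vanish if \<open>a i > 2\<close>.\<close>

lemma apolar_square_unique:
 assumes st: "(s, t) \<noteq> (0, 0)" and v: "apolar (square3 s t) v" "v \<notin> Bcone" "v \<notin> Ucone" and h: "apolar h v"
 obtains c where "h = scale3 c (square3 s t)"
proof -
 obtain s' t' where D: "t * s' - s * t' \<noteq> 0" using complementary_direction[OF st] by blast
 obtain c d where x: "\<And>i j. i \<in> {1..n} \<Longrightarrow> j \<le> a i \<Longrightarrow>
  \<xi> i j v = c i * psi (a i) s t j + d i * dpsi (a i) s t s' t' j"
  using apolar_square_form[OF D v(1)] by blast
 obtain h0 h1 h2 where h_eq: "h = (h0, h1, h2)" by (metis prod_cases3)
 define H H' where "H = h0 * s^2 + h1 * (s * t) + h2 * t^2"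
  and "H' = 2 * h0 * s * s' + h1 * (s * t' + s' * t) + 2 * h2 * t * t'"
 have eq: "(c i * H + d i * H') * psi (a i - 2) s t j + (d i * H) * dpsi (a i - 2) s t s' t' j = 0"
  if i: "i \<in> {1..n}" "j + 2 \<le> a i" for i j
 proof -
  have "h0 * \<xi> i j v + h1 * \<xi> i (Suc j) v + h2 * \<xi> i (Suc (Suc j)) v =
   c i * (h0 * psi (a i) s t j + h1 * psi (a i) s t (Suc j) + h2 * psi (a i) s t (Suc (Suc j))) +
   d i * (h0 * dpsi (a i) s t s' t' j + h1 * dpsi (a i) s t s' t' (Suc j) + h2 * dpsi (a i) s t s' t' (Suc (Suc j)))"
   using i by (simp add: x algebra_simps)
  also have "\<dots> = (c i * H + d i * H') * psi (a i - 2) s t j + (d i * H) * dpsi (a i - 2) s t s' t' j"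
   unfolding apolar_psi[OF i(2)] apolar_dpsi[OF i(2)] by (simp add: H_def H'_def algebra_simps)
  finally show ?thesis using apolarD[OF h[unfolded h_eq] i] by simp
 qed
 have "H = 0"
 proof (rule ccontr)
  assume H: "H \<noteq> 0"
  have "v \<in> Ucone" unfolding Ucone_def
  proof (intro CollectI conjI ballI allI impI)
   fix i j assume i: "i \<in> {m<..n}" "j \<le> a i"
   have "c i * H + d i * H' = 0 \<and> d i * H = 0"
    using a_ge_3[OF i(1)] eq in_index(2)[OF i(1)] by (intro psi_dpsi_independent[OF D, of "a i - 2"]) auto
   then have "d i = 0" "c i = 0" using H by auto
   then show "\<xi> i j v = 0" using x i in_index by simp
  next
   have pr: "\<xi> i j v = d i * (- H' / H * psi 2 s t j + dpsi 2 s t s' t' j)" if i: "i \<in> {k<..m}" "j \<le> 2" for i j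
   proof -
    have "c i * H + d i * H' = 0"
     using eq[of i 0] i in_index a_eq_2[OF i(1)] by (simp add: psi_def dpsi_def psi_poly_def)
    then have "c i = - d i * H' / H" using H by (simp add: field_simps eq_neg_iff_add_eq_0)
    then show ?thesis using x[of i j] i in_index a_eq_2[OF i(1)] by (simp add: algebra_simps)
   qed
   then show "\<exists>\<beta> u. \<forall>i\<in>{k<..m}. \<forall>j\<le>2. \<xi> i j v = \<beta> i * u j"
    by (intro exI[of _ d] exI[of _ "\<lambda>j. - H' / H * psi 2 s t j + dpsi 2 s t s' t' j"] ballI allI impI)
     (rule pr)
  qed
  then show False using v by blast
 qed
 moreover have "H' = 0"
 proof (rule ccontr)
  assume H': "H' \<noteq> 0"
  have "d i = 0" if i: "i \<in> {k<..n}" for i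
  proof -
   obtain j where j: "j \<le> a i - 2" "psi (a i - 2) s t j \<noteq> 0" using psi_nonzero[OF st] by blast
   then show ?thesis using eq[of i j] i in_index a_ge_2[OF i] H' \<open>H = 0\<close> by auto
  qed
  then have "(s, t) \<noteq> (0, 0) \<and> (\<forall>i\<in>{k<..n}. \<forall>j\<le>a i. \<xi> i j v = c i * psi (a i) s t j)" using st x in_index by simp
  then have "\<exists>s t c. (s, t) \<noteq> (0, 0) \<and> (\<forall>i\<in>{k<..n}. \<forall>j\<le>a i. \<xi> i j v = c i * psi (a i) s t j)"
   by (intro exI)
  moreover have "{k<..n} \<subseteq> {1..n}" by auto
  ultimately have "v \<in> Bcone" unfolding Bcone_def using rank_one_iff_psi by simp
  then show False using v by blast
 qed
 ultimately show ?thesis using vanishes_twice_imp_square[OF D, of h0 h1 h2] that h_eq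
  unfolding H_def H'_def by metis
qed

lemma apolar_unique:
 assumes v: "v \<notin> Bcone" "v \<notin> Ucone" and h: "apolar h v" "h \<noteq> zero3" and h': "apolar h' v"
 obtains c where "h' = scale3 c h"
proof (cases "cross3 h h' = zero3")
 case True then show ?thesis using cross3_zero_imp_parallel[OF True h(2)] that by blast
next
 case False
 \<comment> \<open>The columns are multiples of \<open>h \<times> h'\<close>, which is orthogonal to some square.\<close>
 obtain s t where st: "(s, t) \<noteq> (0, 0)" "dot3 (square3 s t) (cross3 h h') = 0" by (rule square3_orthogonal)
 have sq: "apolar (square3 s t) v"
  unfolding apolar_def
 proof
  fix c assume c: "c \<in> columns"
  have "cross3 (cross3 h h') (col c v) = zero3"
   using h h' c by (intro orthogonal_imp_parallel_cross3) (auto simp: apolar_def)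
  then obtain e where "col c v = scale3 e (cross3 h h')" using cross3_zero_imp_parallel False by blast
  then show "dot3 (square3 s t) (col c v) = 0" using st by (simp add: dot3_scale3)
 qed
 obtain c where c: "h = scale3 c (square3 s t)" using apolar_square_unique[OF st(1) sq v h(1)] by blast
 obtain c' where c': "h' = scale3 c' (square3 s t)" using apolar_square_unique[OF st(1) sq v h'] by blast
 have "cross3 h h' = zero3" unfolding c c' by (simp add: cross3_def scale3_def square3_def algebra_simps)
 then show ?thesis using False by blast
qed

section \<open>Projection from the vertex and adapted frames\<close>

definition "pr v = mk (\<lambda>i j. \<xi> i j v)"

definition "L0 = range mk"

lemma xi_pr: "i \<in> {1..n} \<Longrightarrow> j \<le> a i \<Longrightarrow> \<xi> i j (pr v) = \<xi> i j v"
 by (simp add: pr_def xi_mk)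

lemma pr_mk: "pr (mk x) = mk x"
 unfolding pr_def by (rule mk_cong) (simp add: xi_mk)

lemma pr_in_L0: "pr v \<in> L0"
 by (simp add: pr_def L0_def)

lemma mk_in_L0: "mk x \<in> L0"
 by (simp add: L0_def)

lemma mem_L0_iff: "v \<in> L0 \<longleftrightarrow> pr v = v"
 using pr_mk pr_in_L0 unfolding L0_def by (metis rangeE)

lemma pr_add: "pr (u + v) = pr u + pr v"
 unfolding pr_def mk_add by (rule mk_cong) (simp add: xi_simps)

lemma pr_scale: "pr (c *s v) = c *s pr v"
 unfolding pr_def mk_scale by (rule mk_cong) (simp add: xi_simps)

lemma subspace_L0: "vec.subspace L0"
 unfolding L0_def vec.subspace_def by (auto simp: mk_add mk_scale intro: range_eqI[of _ mk, OF mk_zero[symmetric]])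

lemma vec_eqI: "u \<in> L0 \<Longrightarrow> v \<in> L0 \<Longrightarrow> (\<And>i j. i \<in> {1..n} \<Longrightarrow> j \<le> a i \<Longrightarrow> \<xi> i j u = \<xi> i j v) \<Longrightarrow> u = v"
 unfolding mem_L0_iff pr_def by (metis (no_types, lifting) mk_cong)

lemma diff_pr_in_vertex: "v - pr v \<in> vertex"
 unfolding vertex_def by (simp add: xi_simps xi_pr)

lemma vertex_cap_L0: "v \<in> vertex \<Longrightarrow> v \<in> L0 \<Longrightarrow> v = 0"
 by (rule vec_eqI) (auto simp: vertex_def xi_simps vec.subspace_0[OF subspace_L0])

lemma vertex_subset_X: "vertex \<subseteq> Xcone"
proof
 fix v assume "v \<in> vertex"
 then have "((1 :: 'k), (0 :: 'k)) \<noteq> (0, 0) \<and> (\<forall>i\<in>{1..n}. \<forall>j<a i. 0 * \<xi> i j v = 1 * \<xi> i (Suc j) v)"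
  by (simp add: vertex_def)
 then show "v \<in> Xcone" unfolding Xcone_def rank_one_def by blast
qed

definition xi_invariant :: "('k ^ 'd) set \<Rightarrow> bool" where
 "xi_invariant S \<longleftrightarrow> (\<forall>u v. (\<forall>i\<in>{1..n}. \<forall>j\<le>a i. \<xi> i j u = \<xi> i j v) \<longrightarrow> u \<in> S \<longrightarrow> v \<in> S)"

lemma xi_invariantD:
 "xi_invariant S \<Longrightarrow> u \<in> S \<Longrightarrow> (\<And>i j. i \<in> {1..n} \<Longrightarrow> j \<le> a i \<Longrightarrow> \<xi> i j u = \<xi> i j v) \<Longrightarrow> v \<in> S"
 unfolding xi_invariant_def by blast

lemma xi_invariant_pr: "xi_invariant S \<Longrightarrow> v \<in> S \<longleftrightarrow> pr v \<in> S"
 using xi_pr by (metis xi_invariantD)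

text \<open>A vector \<open>v\<close> of \<open>S\<close> is the sum of \<open>v - pr v\<close>, which lies in the vertex, and of \<open>pr v\<close>, which lies in
 \<open>S \<inter> L0\<close> by invariance.\<close>

lemma join_vertex:
 assumes S: "alg_cone S" "xi_invariant S"
 shows "join (proj_pts vertex) (proj_pts (S \<inter> L0)) = proj_pts S"
proof (rule join_cones)
 show "cone vertex" by (rule subspace_imp_cone[OF subspace_vertex])
 show "cone (S \<inter> L0)"
  using alg_cone_imp_cone[OF S(1)] subspace_imp_cone[OF subspace_L0] by (auto simp: cone_def)
 show "alg_cone S" by (rule S)
 show "S = {p + z |p z. p \<in> vertex \<and> z \<in> S \<inter> L0}"
 proof (intro equalityI subsetI)
  fix v assume "v \<in> S"
  then have "pr v \<in> S \<inter> L0" using xi_invariant_pr[OF S(2)] pr_in_L0 by blast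
  moreover have "v = (v - pr v) + pr v" by simp
  ultimately show "v \<in> {p + z |p z. p \<in> vertex \<and> z \<in> S \<inter> L0}" using diff_pr_in_vertex by blast
 next
  fix v assume "v \<in> {p + z |p z. p \<in> vertex \<and> z \<in> S \<inter> L0}"
  then obtain p z where pz: "v = p + z" "p \<in> vertex" "z \<in> S" by blast
  show "v \<in> S" by (rule xi_invariantD[OF S(2) pz(3)]) (use pz in \<open>simp add: xi_simps vertex_def\<close>)
 qed
 have ne: "vec.span {p} \<noteq> vec.span {z}" if pz: "p \<in> vertex" "z \<in> L0" "p \<noteq> 0" for p z
 proof
  assume "vec.span {p} = vec.span {z}"
  then obtain c where "p = c *s z" using span_singleton_eq_iff[OF pz(3)] by blast
  then have "p \<in> L0" using pz subspace_L0 vec.subspace_scale by blast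
  then show False using vertex_cap_L0 pz by blast
 qed
 have ex: "\<exists>x\<in>T. x \<noteq> 0" if "T \<noteq> {0}" "cone T" for T :: "('k ^ 'd) set" using that by (auto simp: cone_def)
 show "\<exists>p\<in>vertex. p \<noteq> 0 \<and> vec.span {p} \<noteq> vec.span {z}" if "z \<in> S \<inter> L0" "z \<noteq> 0" "vertex \<noteq> {0}" for z
  using ex[OF that(3) subspace_imp_cone[OF subspace_vertex]] ne that by blast
 show "\<exists>z\<in>S \<inter> L0. z \<noteq> 0 \<and> vec.span {p} \<noteq> vec.span {z}" if "p \<in> vertex" "p \<noteq> 0" "S \<inter> L0 \<noteq> {0}" for p
  using ex[OF that(3) \<open>cone (S \<inter> L0)\<close>] ne that by blast
qed

text \<open>The rational normal curves span the spaces \<open>\<Lambda> i\<close>, so the scroll is nondegenerate.\<close>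

lemma functional_zero_if_zero_on_X:
 assumes l: "functional l" and zero: "\<And>v. v \<in> Xcone \<Longrightarrow> l v = 0" shows "l v = 0"
proof -
 have "l (b i j) = 0" if ij: "i \<in> {1..n}" "j \<le> a i" for i j
 proof -
  let ?p = "\<Sum>r\<le>a i. monom (l (b i r)) r"
  have "poly ?p \<tau> = poly 0 \<tau>" for \<tau>
  proof -
   let ?x = "\<lambda>i' r. (if i' = i then psi (a i) 1 \<tau> r else 0)"
   have "\<forall>i'\<in>{1..n}. \<forall>r\<le>a i'. \<xi> i' r (mk ?x) = (if i' = i then 1 else 0) * psi (a i') 1 \<tau> r"
    by (simp add: xi_mk)
   then have "((1 :: 'k), \<tau>) \<noteq> (0, 0) \<and> (\<forall>i'\<in>{1..n}. \<forall>r\<le>a i'. \<xi> i' r (mk ?x) = (\<lambda>i'. if i' = i then 1 else 0) i' * psi (a i') 1 \<tau> r)"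
    by simp
   then have "mk ?x \<in> Xcone" unfolding mem_X_iff by (intro exI)
   then have "l (mk ?x) = 0" by (rule zero)
   moreover have "l (mk ?x) = (\<Sum>i'\<in>{1..n}. if i' = i then \<Sum>r\<le>a i. \<tau> ^ r * l (b i r) else 0)"
    unfolding mk_def functionalD(6)[OF l] functionalD(2)[OF l]
    by (intro sum.cong refl) (auto simp: psi_def)
   ultimately show ?thesis using ij(1) by (simp add: sum.delta poly_sum poly_monom mult.commute)
  qed
  then have "?p = 0" by (intro poly_eq_if_cofinite[of "{}"]) auto
  then have "coeff ?p j = 0" by simp
  then show ?thesis using ij by (simp add: coeff_sum sum.delta)
 qed
 then have "l (pr v) = 0" unfolding pr_def mk_def functionalD(6)[OF l] functionalD(2)[OF l] by simp
 moreover have "l (v - pr v) = 0" using diff_pr_in_vertex vertex_subset_X zero by blast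
 ultimately show ?thesis by (simp add: functionalD[OF l])
qed

lemma xi_invariant_rank_one:
 assumes J: "J \<subseteq> {1..n}" shows "xi_invariant {v. rank_one J v}"
 unfolding xi_invariant_def
proof (intro allI impI)
 fix u v assume eq: "\<forall>i\<in>{1..n}. \<forall>j\<le>a i. \<xi> i j u = \<xi> i j v" and "u \<in> {v. rank_one J v}"
 then have min: "\<forall>i\<in>J. \<forall>i'\<in>J. \<forall>j<a i. \<forall>j'<a i'. minor i j i' j' u = 0" by (simp add: rank_one_iff_minors)
 have "minor i j i' j' v = 0" if "i \<in> J" "i' \<in> J" "j < a i" "j' < a i'" for i i' j j'
 proof -
  have "i \<in> {1..n}" "i' \<in> {1..n}" using J that by auto
  then have "minor i j i' j' v = minor i j i' j' u" using eq that by (simp add: minor_def)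
  then show ?thesis using min that by auto
 qed
 then show "v \<in> {v. rank_one J v}" by (simp add: rank_one_iff_minors)
qed

lemma xi_invariant_X: "xi_invariant Xcone" and xi_invariant_B: "xi_invariant Bcone"
 unfolding Xcone_def Bcone_def by (rule xi_invariant_rank_one; use km in force)+

lemma col_cong:
 assumes "\<forall>i\<in>{1..n}. \<forall>j\<le>a i. \<xi> i j u = \<xi> i j v" "c \<in> columns" shows "col c u = col c v"
 using assms by (auto simp: columns_def col_def)

lemma apolar_cong: "\<forall>i\<in>{1..n}. \<forall>j\<le>a i. \<xi> i j u = \<xi> i j v \<Longrightarrow> apolar h u \<Longrightarrow> apolar h v"
 unfolding apolar_def using col_cong by metis

lemma xi_invariant_V: "xi_invariant Vcone" and xi_invariant_W: "xi_invariant Wcone"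
 unfolding xi_invariant_def Vcone_def Wcone_def using apolar_cong by blast+

definition frame :: "nat \<Rightarrow> (nat \<Rightarrow> 'k ^ 'd \<Rightarrow> 'k) \<Rightarrow> (nat \<Rightarrow> 'k ^ 'd) \<Rightarrow> bool" where
 "frame N \<eta> p \<longleftrightarrow> (\<forall>r<N. functional (\<eta> r) \<and> (\<forall>v\<in>vertex. \<eta> r v = 0) \<and> p r \<in> L0) \<and>
   (\<forall>r<N. \<forall>r'<N. \<eta> r (p r') = (if r = r' then 1 else 0))"

text \<open>For a frame, the sum of the vertex and the span of the vectors \<open>p r\<close>.\<close>

definition frame_space :: "nat \<Rightarrow> (nat \<Rightarrow> 'k ^ 'd \<Rightarrow> 'k) \<Rightarrow> (nat \<Rightarrow> 'k ^ 'd) \<Rightarrow> ('k ^ 'd) set" where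
 "frame_space N \<eta> p = {v. \<forall>i\<in>{1..n}. \<forall>j\<le>a i. \<xi> i j v = (\<Sum>r<N. \<eta> r v * \<xi> i j (p r))}"

context
 fixes N \<eta> p assumes F: "frame N \<eta> p"
begin

lemma frameD: "r < N \<Longrightarrow> functional (\<eta> r)" "r < N \<Longrightarrow> v \<in> vertex \<Longrightarrow> \<eta> r v = 0"
 "r < N \<Longrightarrow> p r \<in> L0" "r < N \<Longrightarrow> r' < N \<Longrightarrow> \<eta> r (p r') = (if r = r' then 1 else 0)"
 using F by (auto simp: frame_def)

lemma eta_pr: "r < N \<Longrightarrow> \<eta> r (pr v) = \<eta> r v"
 using frameD(2)[OF _ diff_pr_in_vertex, of r v] functionalD(5)[OF frameD(1), of r v "pr v"] by simp

lemma xi_sum_p: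
 assumes "i \<in> {1..n}" "j \<le> a i"
 shows "\<xi> i j (\<Sum>r<N. c r *s p r) = (\<Sum>r<N. c r * \<xi> i j (p r))"
 by (simp add: functionalD[OF xi[OF assms]])

lemma frame_space_eq: "frame_space N \<eta> p = {v. pr v = (\<Sum>r<N. \<eta> r v *s p r)}"
proof (intro set_eqI iffI)
 fix v
 have L: "(\<Sum>r<N. \<eta> r v *s p r) \<in> L0"
  using frameD(3) by (intro vec.subspace_sum subspace_L0 vec.subspace_scale) auto
 show "v \<in> {v. pr v = (\<Sum>r<N. \<eta> r v *s p r)}" if "v \<in> frame_space N \<eta> p"
  using that L by (intro CollectI vec_eqI pr_in_L0) (auto simp: xi_sum_p xi_pr frame_space_def)
 show "v \<in> frame_space N \<eta> p" if "v \<in> {v. pr v = (\<Sum>r<N. \<eta> r v *s p r)}"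
  unfolding frame_space_def
 proof (intro CollectI ballI allI impI)
  fix i j assume ij: "i \<in> {1..n}" "j \<le> a i"
  have "\<xi> i j v = \<xi> i j (\<Sum>r<N. \<eta> r v *s p r)" using that xi_pr[OF ij, of v] by simp
  then show "\<xi> i j v = (\<Sum>r<N. \<eta> r v * \<xi> i j (p r))" by (simp add: xi_sum_p[OF ij])
 qed
qed

lemma subspace_frame_space: "vec.subspace (frame_space N \<eta> p)"
 unfolding vec.subspace_def frame_space_def
 using frameD(1) by (auto simp: xi_simps functionalD sum.distrib distrib_right sum_distrib_left mult.assoc)

lemma vertex_subset_frame_space: "vertex \<subseteq> frame_space N \<eta> p"
proof
 fix v assume "v \<in> vertex"
 then show "v \<in> frame_space N \<eta> p" unfolding frame_space_def
  using frameD(2) by (simp add: vertex_def[symmetric]) (simp add: vertex_def)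
qed

lemma p_in_frame_space: "r < N \<Longrightarrow> p r \<in> frame_space N \<eta> p"
proof -
 assume r: "r < N"
 have "(\<Sum>r'<N. \<eta> r' (p r) *s p r') = (\<Sum>r'<N. if r' = r then p r else 0)"
  by (rule sum.cong) (use frameD(4) r in auto)
 also have "\<dots> = p r" using r by (simp add: sum.delta)
 finally show ?thesis unfolding frame_space_eq using frameD(3)[OF r] mem_L0_iff by simp
qed

lemma frame_space_pr: "v \<in> frame_space N \<eta> p \<longleftrightarrow> pr v \<in> frame_space N \<eta> p"
 unfolding frame_space_def by (simp add: xi_pr eta_pr)

lemma xi_invariant_frame_space: "xi_invariant (frame_space N \<eta> p)"
 unfolding xi_invariant_def
proof (intro allI impI)
 fix u v assume eq: "\<forall>i\<in>{1..n}. \<forall>j\<le>a i. \<xi> i j u = \<xi> i j v" and "u \<in> frame_space N \<eta> p"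
 then have "pr u \<in> frame_space N \<eta> p" using frame_space_pr by blast
 moreover have "pr u = pr v" unfolding pr_def using eq by (intro mk_cong) auto
 ultimately show "v \<in> frame_space N \<eta> p" using frame_space_pr by simp
qed

lemma mem_frame_space_L0: "v \<in> frame_space N \<eta> p \<inter> L0 \<Longrightarrow> v = (\<Sum>r<N. \<eta> r v *s p r)"
proof -
 assume "v \<in> frame_space N \<eta> p \<inter> L0"
 then have "pr v = (\<Sum>r<N. \<eta> r v *s p r)" "pr v = v" by (auto simp: frame_space_eq mem_L0_iff)
 then show ?thesis by (rule trans[OF sym, rotated])
qed

lemma frame_eta_zero: "v \<in> frame_space N \<eta> p \<Longrightarrow> (\<And>r. r < N \<Longrightarrow> \<eta> r v = 0) \<Longrightarrow> v \<in> vertex"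
 unfolding frame_space_def vertex_def by simp

lemma dim_frame_space: "vec.dim (frame_space N \<eta> p \<inter> L0) = N"
proof (rule vec.dim_unique[of "p ` {..<N}"])
 show "p ` {..<N} \<subseteq> frame_space N \<eta> p \<inter> L0" using p_in_frame_space frameD(3) by auto
 show "frame_space N \<eta> p \<inter> L0 \<subseteq> vec.span (p ` {..<N})"
 proof
  fix v assume "v \<in> frame_space N \<eta> p \<inter> L0"
  then have "v = (\<Sum>r<N. \<eta> r v *s p r)" by (rule mem_frame_space_L0)
  moreover have "(\<Sum>r<N. \<eta> r v *s p r) \<in> vec.span (p ` {..<N})"
   by (intro vec.span_sum vec.span_scale vec.span_base) auto
  ultimately show "v \<in> vec.span (p ` {..<N})" by metis
 qed
 have inj: "inj_on p {..<N}"
 proof (rule inj_onI)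
  fix r r' assume r: "r \<in> {..<N}" "r' \<in> {..<N}" "p r = p r'"
  have "\<eta> r (p r) = \<eta> r (p r')" using r(3) by simp
  then show "r = r'" using frameD(4)[of r r] frameD(4)[of r r'] r by (simp split: if_splits)
 qed
 then show "card (p ` {..<N}) = N" by (simp add: card_image)
 show "vec.independent (p ` {..<N})"
  unfolding vec.dependent_def
 proof
  assume "\<exists>x\<in>p ` {..<N}. x \<in> vec.span (p ` {..<N} - {x})"
  then obtain r where r: "r < N" "p r \<in> vec.span (p ` {..<N} - {p r})" by auto
  have "\<eta> r x = 0" if "x \<in> vec.span (p ` {..<N} - {p r})" for x
   using that
  proof (induction rule: vec.span_induct_alt)
   case base then show ?case using functionalD[OF frameD(1)[OF r(1)]] by simp
  next
   case (step c x y)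
   then have "\<eta> r x = 0" using frameD(4)[OF r(1)] by auto
   then show ?case using step functionalD[OF frameD(1)[OF r(1)]] by simp
  qed
  then have "\<eta> r (p r) = 0" using r(2) by blast
  then show False using frameD(4)[OF r(1) r(1)] by simp
 qed
qed

end

section \<open>The secant locus of the scroll\<close>

lemma minor_poly_pr:
 assumes "q \<in> minors" "\<And>i j. i \<in> {1..n} \<Longrightarrow> j \<le> a i \<Longrightarrow> \<xi> i j u = \<xi> i j v"
 shows "mpeval q u = mpeval q v"
proof -
 obtain i j i' j' where q: "q = minor_poly i j i' j'" "i \<in> {1..n}" "i' \<in> {1..n}" "j < a i" "j' < a i'"
  using assms(1) unfolding minors_def by blast
 show ?thesis unfolding q(1) minor_poly(2)[OF q(2-5)] minor_def using assms(2) q by simp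
qed

lemma obtain_minor:
 assumes "w \<notin> Xcone" obtains q where "q \<in> minors" "mpeval q w \<noteq> 0"
 using assms Xcone_minors by auto

lemma Xcone_nontrivial: "Xcone \<noteq> {0}"
proof
 assume "Xcone = {0}"
 then have "l v = 0" if "functional l" for l :: "'k ^ 'd \<Rightarrow> 'k" and v
  using functional_zero_if_zero_on_X[OF that] functionalD(3)[OF that] by auto
 then have "\<xi> 1 0 (b 1 0) = 0" using xi[of 1 0] n_pos by simp
 then show False using xi_b[of 1 0 1 0] n_pos by simp
qed

text \<open>Chords and tangents are given here by their coordinates: the component over \<open>(s : t)\<close> of a chord
 through \<open>w\<close>, and the point of contact of a tangent, have to lie in \<open>M\<close>.\<close>

lemma secant_locus_scroll:
 assumes w: "w \<notin> Xcone" and M: "vec.subspace M" "w \<in> M" "vertex \<subseteq> M" and q: "q \<in> minors" "mpeval q w \<noteq> 0"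
  and divides: "\<And>f. (\<And>v. v \<in> Xcone \<Longrightarrow> mpeval f v = 0) \<Longrightarrow> \<exists>h. polyfun h \<and> (\<forall>v\<in>M. mpeval f v = mpeval q v * h v)"
  and chord: "\<And>s t s' t' c d v. t * s' - s * t' \<noteq> 0 \<Longrightarrow>
    (\<And>i j. i \<in> {1..n} \<Longrightarrow> j \<le> a i \<Longrightarrow> \<xi> i j w = c i * psi (a i) s t j + d i * psi (a i) s' t' j) \<Longrightarrow>
    (\<And>i j. i \<in> {1..n} \<Longrightarrow> j \<le> a i \<Longrightarrow> \<xi> i j v = c i * psi (a i) s t j) \<Longrightarrow> v \<in> M"
  and tangent: "\<And>s t s' t' c d \<rho> v. t * s' - s * t' \<noteq> 0 \<Longrightarrow>
    (\<And>i j. i \<in> {1..n} \<Longrightarrow> j \<le> a i \<Longrightarrow> \<xi> i j w = c i * psi (a i) s t j + d i * dpsi (a i) s t s' t' j) \<Longrightarrow>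
    (\<And>i j. i \<in> {1..n} \<Longrightarrow> j \<le> a i \<Longrightarrow> \<xi> i j v = \<rho> * (d i * psi (a i) s t j)) \<Longrightarrow> v \<in> M"
 shows "secant_locus (proj_pts Xcone) (vec.span {w}) = quadric_ideal M q"
proof (rule secant_quadric.secant_locus_quadric, unfold_locales)
 show "Xcone = {v. \<forall>g\<in>minors. mpeval g v = 0}" by (rule Xcone_minors)
 show "minors \<subseteq> forms 2" by (rule minors_forms)
 show "Xcone \<noteq> {0}" by (rule Xcone_nontrivial)
 show "vec.subspace M" "w \<in> M" "w \<notin> Xcone" "mpeval q w \<noteq> 0" by (fact M w q)+
 show "q \<in> forms 2" using q minors_forms by blast
 show "mpeval q v = 0" if "v \<in> Xcone" for v using that q Xcone_minors by blast
 show "\<exists>h. \<forall>v\<in>M. mpeval f v = mpeval q v * mpeval h v" if f: "\<And>v. v \<in> Xcone \<Longrightarrow> mpeval f v = 0" for f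
 proof -
  obtain h where h: "polyfun h" "\<forall>v\<in>M. mpeval f v = mpeval q v * h v" using divides[OF f] by blast
  obtain H where "h = mpeval H" using polyfun_obtain[OF h(1)] by blast
  then show ?thesis using h(2) by blast
 qed
 show "v \<in> M" if "v \<in> Xcone" "v' \<in> Xcone" "w = v + v'" for v v'
  by (rule chord_form[OF w that]) (rule chord)
 show "v \<in> M" if v: "v \<in> Xcone" and t: "\<And>g. g \<in> minors \<Longrightarrow> dir_deriv g v w = 0" for v
 proof (cases "v \<in> vertex")
  case True then show ?thesis using M by blast
 next
  case False
  show ?thesis by (rule tangent_form[OF w v False t]) (assumption, rule tangent)
 qed
qed

text \<open>If \<open>q = 0\<close> on \<open>M\<close> is reduced and contained in the scroll, then the secant locus is the cone over its
 intersection with \<open>L0\<close>.\<close>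

lemma secant_locus_reduced:
 assumes w: "w \<notin> Xcone" and M: "vec.subspace M" "w \<in> M" "vertex \<subseteq> M" "xi_invariant M"
  and q: "q \<in> minors" "mpeval q w \<noteq> 0"
  and u: "u \<in> M" "u \<noteq> 0" "mpeval q u = 0"
  and MX: "\<And>v. v \<in> M \<Longrightarrow> mpeval q v = 0 \<Longrightarrow> v \<in> Xcone"
  and divides: "\<And>f. polyfun f \<Longrightarrow> (\<And>v. v \<in> M \<Longrightarrow> mpeval q v = 0 \<Longrightarrow> f v = 0) \<Longrightarrow>
    \<exists>h. polyfun h \<and> (\<forall>v\<in>M. f v = mpeval q v * h v)"
  and chord: "\<And>s t s' t' c d v. t * s' - s * t' \<noteq> 0 \<Longrightarrow>
    (\<And>i j. i \<in> {1..n} \<Longrightarrow> j \<le> a i \<Longrightarrow> \<xi> i j w = c i * psi (a i) s t j + d i * psi (a i) s' t' j) \<Longrightarrow>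
    (\<And>i j. i \<in> {1..n} \<Longrightarrow> j \<le> a i \<Longrightarrow> \<xi> i j v = c i * psi (a i) s t j) \<Longrightarrow> v \<in> M"
  and tangent: "\<And>s t s' t' c d \<rho> v. t * s' - s * t' \<noteq> 0 \<Longrightarrow>
    (\<And>i j. i \<in> {1..n} \<Longrightarrow> j \<le> a i \<Longrightarrow> \<xi> i j w = c i * psi (a i) s t j + d i * dpsi (a i) s t s' t' j) \<Longrightarrow>
    (\<And>i j. i \<in> {1..n} \<Longrightarrow> j \<le> a i \<Longrightarrow> \<xi> i j v = \<rho> * (d i * psi (a i) s t j)) \<Longrightarrow> v \<in> M"
 shows "secant_locus (proj_pts Xcone) (vec.span {w}) =
  vanishing_ideal (join (proj_pts vertex) (proj_pts {v \<in> M \<inter> L0. mpeval q v = 0}))"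
proof -
 have q2: "q \<in> forms 2" using q minors_forms by blast
 have "secant_locus (proj_pts Xcone) (vec.span {w}) = quadric_ideal M q"
 proof (rule secant_locus_scroll[OF w M(1-3) q _ chord tangent])
  show "\<exists>h. polyfun h \<and> (\<forall>v\<in>M. mpeval f v = mpeval q v * h v)" if "\<And>v. v \<in> Xcone \<Longrightarrow> mpeval f v = 0" for f
   using divides[OF polyfun_mpeval, of f] MX that by blast
 qed
 also have "\<dots> = vanishing_ideal (proj_pts {v \<in> M. mpeval q v = 0})"
  by (rule quadric_ideal_reduced[OF M(1) q2 u divides])
 also have "proj_pts {v \<in> M. mpeval q v = 0} =
   join (proj_pts vertex) (proj_pts ({v \<in> M. mpeval q v = 0} \<inter> L0))"
 proof (rule join_vertex[symmetric])
  show "alg_cone {v \<in> M. mpeval q v = 0}" by (rule alg_cone_quadric[OF M(1) q2])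
  show "xi_invariant {v \<in> M. mpeval q v = 0}"
   unfolding xi_invariant_def
  proof (intro allI impI)
   fix x y assume eq: "\<forall>i\<in>{1..n}. \<forall>j\<le>a i. \<xi> i j x = \<xi> i j y" and x: "x \<in> {v \<in> M. mpeval q v = 0}"
   then have "mpeval q y = mpeval q x" by (intro minor_poly_pr[OF q(1)]) auto
   moreover have "y \<in> M" using xi_invariantD[OF M(4)] eq x by blast
   ultimately show "y \<in> {v \<in> M. mpeval q v = 0}" using x by simp
  qed
 qed
 also have "{v \<in> M. mpeval q v = 0} \<inter> L0 = {v \<in> M \<inter> L0. mpeval q v = 0}" by blast
 finally show ?thesis .
qed

subsection \<open>Tangent directions\<close>

lemma functional_dir_deriv: "functional (\<lambda>x. dir_deriv f v x)"
 unfolding dir_deriv_def by (rule functionalI) (simp_all add: distrib_left sum.distrib sum_distrib_left mult_ac)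

lemma dir_deriv_at_vertex:
 assumes f: "\<And>v. v \<in> Xcone \<Longrightarrow> mpeval f v = 0" and v: "v \<in> vertex" shows "dir_deriv f v w = 0"
proof (rule functional_zero_if_zero_on_X[OF functional_dir_deriv])
 fix x assume x: "x \<in> Xcone"
 have "mpeval f (v + \<tau> *s x) = poly 0 \<tau>" for \<tau>
 proof -
  have "\<tau> *s x \<in> Xcone" using x alg_cone_imp_cone[OF alg_cone_X] cone_scale by blast
  then have "v + \<tau> *s x \<in> Xcone"
   by (rule xi_invariantD[OF xi_invariant_X]) (use v in \<open>simp add: xi_simps vertex_def\<close>)
  then show ?thesis using f by simp
 qed
 then have "dir_deriv f v x = coeff 0 1" by (rule dir_deriv_eq_coeff)
 then show "dir_deriv f v x = 0" by simp
qed

text \<open>The tangent vectors at a point with coordinates \<open>e i * psi\<close>: they are the velocities of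
 the curves with coordinates \<open>(e i + \<tau> c i) * psi a (s + \<tau> s') (t + \<tau> t')\<close>.\<close>

lemma dir_deriv_tangent:
 assumes f: "\<And>v. v \<in> S \<Longrightarrow> mpeval f v = 0"
  and S: "\<And>\<tau> s t c. v + \<tau> *s w - pr (v + \<tau> *s w) + mk (\<lambda>i j. c i * psi (a i) s t j) \<in> S"
  and v: "\<And>i j. i \<in> {1..n} \<Longrightarrow> j \<le> a i \<Longrightarrow> \<xi> i j v = e i * psi (a i) s t j"
  and w: "\<And>i j. i \<in> {1..n} \<Longrightarrow> j \<le> a i \<Longrightarrow> \<xi> i j w = c i * psi (a i) s t j + e i * dpsi (a i) s t s' t' j"
 shows "dir_deriv f v w = 0"
proof -
 let ?x = "\<lambda>\<tau> i j. (e i + \<tau> * c i) * psi (a i) (s + \<tau> * s') (t + \<tau> * t') j"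
 let ?\<gamma> = "\<lambda>\<tau>. v + \<tau> *s w - pr (v + \<tau> *s w) + mk (?x \<tau>)"
 let ?P = "\<lambda>r. [:v $ r - pr v $ r, w $ r - pr w $ r:] +
  (\<Sum>i\<in>{1..n}. \<Sum>j\<le>a i. smult (b i j $ r) ([:e i, c i:] * psi_poly (a i) s t s' t' j))"
 have \<gamma>: "?\<gamma> \<tau> $ r = poly (?P r) \<tau>" for \<tau> r
  by (simp add: pr_add pr_scale mk_def poly_sum poly_psi_poly sum_distrib_left algebra_simps)
 have prv: "pr v $ r = (\<Sum>i\<in>{1..n}. \<Sum>j\<le>a i. (e i * psi (a i) s t j) * b i j $ r)" for r
  unfolding pr_def mk_def sum_component vector_smult_component by (intro sum.cong refl) (simp add: v)
 have prw: "pr w $ r = (\<Sum>i\<in>{1..n}. \<Sum>j\<le>a i. (c i * psi (a i) s t j + e i * dpsi (a i) s t s' t' j) * b i j $ r)" for r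
  unfolding pr_def mk_def sum_component vector_smult_component by (intro sum.cong refl) (simp add: w)
 show ?thesis
 proof (rule dir_deriv_along_curve[where \<gamma> = ?\<gamma> and P = ?P, OF \<gamma>])
  show "mpeval f (?\<gamma> \<tau>) = 0" for \<tau> by (rule f) (rule S)
  show "v $ r = coeff (?P r) 0" for r
   by (simp add: coeff_sum coeff_psi_poly_0 prv mult_ac)
  show "w $ r = coeff (?P r) 1" for r
  proof -
   have c1: "coeff ([:x, y:] * q) 1 = x * coeff q 1 + y * coeff q 0" for x y :: 'k and q
    by (simp add: coeff_pCons)
   have "coeff (?P r) 1 = coeff [:v $ r - pr v $ r, w $ r - pr w $ r:] 1 +
     (\<Sum>i\<in>{1..n}. \<Sum>j\<le>a i. b i j $ r * (e i * dpsi (a i) s t s' t' j + c i * psi (a i) s t j))"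
    by (simp only: coeff_add coeff_sum coeff_smult c1 dpsi_def[symmetric] coeff_psi_poly_0)
   also have "\<dots> = w $ r" by (simp add: prw mult.commute add.commute)
   finally show ?thesis by simp
  qed
 qed
qed

lemma mk_psi_in_X: "(s, t) \<noteq> (0, 0) \<Longrightarrow> mk (\<lambda>i j. c i * psi (a i) s t j) \<in> Xcone"
proof -
 assume "(s, t) \<noteq> (0, 0)"
 then have "(s, t) \<noteq> (0, 0) \<and> (\<forall>i\<in>{1..n}. \<forall>j\<le>a i. \<xi> i j (mk (\<lambda>i j. c i * psi (a i) s t j)) = c i * psi (a i) s t j)"
  by (simp add: xi_mk)
 then show ?thesis unfolding mem_X_iff by (intro exI)
qed

lemma mk_psi_00_in_X: "mk (\<lambda>i j. c i * psi (a i) s t j) \<in> Xcone"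
proof (cases "(s, t) = (0, 0)")
 case True
 have "mk (\<lambda>i j. c i * psi (a i) s t j) = mk (\<lambda>i j. 0)"
 proof (rule mk_cong)
  fix i j assume "i \<in> {1..n}" "j \<le> a i"
  then show "c i * psi (a i) s t j = 0" using True a_pos[of i] by (cases "j = 0") (auto simp: psi_def)
 qed
 then show ?thesis unfolding mk_zero using alg_cone_imp_cone[OF alg_cone_X] by (simp add: cone_def)
qed (rule mk_psi_in_X)

section \<open>The secant loci in the six regions\<close>

abbreviation "Vt \<equiv> proj_pts vertex"
abbreviation "X0 \<equiv> proj_pts (Xcone \<inter> L0)"

lemma cone_X0: "cone (Xcone \<inter> L0)"
 using alg_cone_imp_cone[OF alg_cone_X] subspace_imp_cone[OF subspace_L0] by (auto simp: cone_def)

lemma join_Vt_X0: "join Vt X0 = proj_pts Xcone"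
 by (rule join_vertex[OF alg_cone_X xi_invariant_X])

lemma span_X0: "vec.span (Xcone \<inter> L0) = L0"
proof
 show "vec.span (Xcone \<inter> L0) \<subseteq> L0" by (rule vec.span_minimal) (use subspace_L0 in auto)
 show "L0 \<subseteq> vec.span (Xcone \<inter> L0)"
 proof
  fix x assume x: "x \<in> L0"
  show "x \<in> vec.span (Xcone \<inter> L0)"
  proof (rule ccontr)
   assume "x \<notin> vec.span (Xcone \<inter> L0)"
   then obtain l where l: "functional l" "l x = 1" "\<And>v. v \<in> vec.span (Xcone \<inter> L0) \<Longrightarrow> l v = 0"
    using functional_separates[OF vec.subspace_span] by blast
   have "functional (\<lambda>v. l (pr v))" by (rule functionalI) (simp_all add: pr_add pr_scale functionalD[OF l(1)])
   moreover have "l (pr v) = 0" if "v \<in> Xcone" for v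
    using that xi_invariant_pr[OF xi_invariant_X] pr_in_L0 by (intro l(3) vec.span_base) blast
   ultimately have "l (pr x) = 0" by (rule functional_zero_if_zero_on_X)
   then show False using x l(2) by (simp add: mem_L0_iff)
  qed
 qed
qed

lemma lin_span_X0: "lin_span X0 = proj_pts L0"
 unfolding lin_span_def span_Union_proj_pts[OF cone_X0] span_X0 ..

lemma point_not_in_X:
 assumes "w \<notin> Xcone" shows "vec.span {w} \<in> proj_space - join Vt X0"
proof -
 have "w \<noteq> 0" using assms alg_cone_imp_cone[OF alg_cone_X] by (auto simp: cone_def)
 then show ?thesis unfolding join_Vt_X0
  using assms mem_proj_pts[OF alg_cone_imp_cone[OF alg_cone_X]] by (auto simp: proj_pts_def)
qed

lemma proj_pts_span_singleton: "p \<noteq> 0 \<Longrightarrow> proj_pts (vec.span {p}) = {vec.span {p}}"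
proof (intro equalityI subsetI)
 fix x assume "x \<in> proj_pts (vec.span {p})"
 then obtain v where "v \<in> vec.span {p}" "v \<noteq> 0" "x = vec.span {v}" by (rule proj_ptsE)
 then show "x \<in> {vec.span {p}}" using span_singleton_eq_iff[of v p] by (auto simp: mem_span_singleton)
next
 fix x assume "p \<noteq> 0" "x \<in> {vec.span {p}}"
 then show "x \<in> proj_pts (vec.span {p})" using vec.span_base[of p "{p}"] by (auto simp: proj_pts_def)
qed

lemma chord_apolar:
 assumes "\<And>i j. i \<in> {1..n} \<Longrightarrow> j \<le> a i \<Longrightarrow> \<xi> i j w = c i * psi (a i) s t j + d i * psi (a i) s' t' j"
 shows "apolar (t * t', - (t * s' + s * t'), s * s') w"
 by (rule apolarI_psi[OF refl _ _ assms]) (simp_all add: power2_eq_square algebra_simps)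

lemma product_nz: "t * s' - s * t' \<noteq> 0 \<Longrightarrow> (t * t', - (t * s' + s * t'), s * s') \<noteq> (zero3 :: 'k \<times> 'k \<times> 'k)"
 by auto

lemma disc3_product: "disc3 (t * t', - (t * s' + s * t'), s * s') = (t * s' - s * t' :: 'k)^2"
 by (simp add: disc3_def power2_eq_square algebra_simps)

lemma psi_scaled: "psi c (x * s) (x * t) j = x ^ c * psi c s t j" if "j \<le> c"
proof -
 have "x ^ c = x ^ (c - j) * x ^ j" using that by (simp add: power_add[symmetric])
 then show ?thesis by (simp add: psi_def power_mult_distrib)
qed

lemma curve_in_X: "v + \<tau> *s w - pr (v + \<tau> *s w) + mk (\<lambda>i j. c i * psi (a i) s t j) \<in> Xcone"
 by (rule xi_invariantD[OF xi_invariant_X mk_psi_00_in_X[of c s t]]) (simp add: xi_simps xi_pr)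

lemma form_not_X: "w \<notin> Xcone \<Longrightarrow> \<exists>i\<in>{1..n}. \<exists>j\<le>a i. \<xi> i j w \<noteq> c i * psi (a i) s t j"
proof (rule ccontr)
 assume "w \<notin> Xcone" "\<not> ?thesis"
 then have "\<xi> i j (mk (\<lambda>i j. c i * psi (a i) s t j)) = \<xi> i j w" if "i \<in> {1..n}" "j \<le> a i" for i j
  using that by (auto simp: xi_mk)
 then have "w \<in> Xcone" by (rule xi_invariantD[OF xi_invariant_X mk_psi_00_in_X])
 then show False using \<open>w \<notin> Xcone\<close> by blast
qed

text \<open>Here \<open>M\<close> is the sum of the vertex and the line of \<open>w\<close>, on which every minor is a multiple of the square of the
 coordinate of \<open>w\<close>; a secant or a tangent through \<open>w\<close> would give an apolar quadric.\<close>

lemma region_empty: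
 assumes w: "w \<notin> Wcone" shows "vec.span {w} \<in> SL_empty Vt X0"
proof -
 have wX: "w \<notin> Xcone" using w X_subset_B B_subset_V V_subset_W by blast
 have "w \<notin> vertex" using wX vertex_subset_X by blast
 then obtain i0 j0 where ij: "i0 \<in> {1..n}" "j0 \<le> a i0" "\<xi> i0 j0 w \<noteq> 0" unfolding vertex_def by blast
 define \<eta> where "\<eta> = (\<lambda>v. inverse (\<xi> i0 j0 w) * \<xi> i0 j0 v)"
 have fn: "functional \<eta>" unfolding \<eta>_def by (intro functional_scale xi ij)
 have "frame 1 (\<lambda>_. \<eta>) (\<lambda>_. pr w)"
  unfolding frame_def using fn ij by (auto simp: \<eta>_def vertex_def pr_in_L0 xi_pr)
 note F = this
 define M where "M = frame_space 1 (\<lambda>_. \<eta>) (\<lambda>_. pr w)"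
 have M: "vec.subspace M" "vertex \<subseteq> M"
  unfolding M_def by (rule subspace_frame_space[OF F] vertex_subset_frame_space[OF F])+
 have mem: "v \<in> M \<longleftrightarrow> (\<forall>i\<in>{1..n}. \<forall>j\<le>a i. \<xi> i j v = \<eta> v * \<xi> i j w)" for v
  unfolding M_def frame_space_def by (simp add: xi_pr)
 have ew: "\<eta> w = 1" using ij by (simp add: \<eta>_def)
 have wM: "w \<in> M" unfolding mem ew by simp
 obtain q where q: "q \<in> minors" "mpeval q w \<noteq> 0" using obtain_minor[OF wX] by blast
 have qM: "mpeval q v = mpeval q w * \<eta> v ^ 2" if "v \<in> M" for v
 proof -
  have "mpeval q v = mpeval q (\<eta> v *s w)"
   by (rule minor_poly_pr[OF q(1)]) (use that mem in \<open>auto simp: xi_simps\<close>)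
  moreover have "q \<in> forms 2" using q(1) minors_forms by blast
  ultimately show ?thesis using mpeval_homogeneous[of q 2 "\<eta> v" w] by (simp add: mult.commute)
 qed
 have ker: "{v \<in> M. \<eta> v = 0} = vertex"
  using M(2) frameD(2)[OF F, of 0] by (auto simp: mem) (auto simp: vertex_def)
 have "secant_locus (proj_pts Xcone) (vec.span {w}) = quadric_ideal M q"
 proof (rule secant_locus_scroll[OF wX M(1) wM M(2) q])
  fix f :: "('k, 'd) mpoly" assume f: "\<And>v. v \<in> Xcone \<Longrightarrow> mpeval f v = 0"
  obtain h where "polyfun h" "\<And>v. v \<in> M \<Longrightarrow> mpeval f v = \<eta> v ^ 2 * h v"
  proof (rule divides_by_square[OF fn ew M(1) wM, of f])
   fix v assume "v \<in> M" "\<eta> v = 0"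
   then have v: "v \<in> vertex" using ker by blast
   show "mpeval f v = 0" using v vertex_subset_X f by blast
   show "dir_deriv f v w = 0" by (rule dir_deriv_at_vertex[OF f v])
  qed blast
  then show "\<exists>h. polyfun h \<and> (\<forall>v\<in>M. mpeval f v = mpeval q v * h v)"
   using q(2) by (intro exI[of _ "\<lambda>v. inverse (mpeval q w) * h v"]) (auto simp: qM intro: polyfun_intros)
 next
  fix s t s' t' c d v assume D: "t * s' - s * t' \<noteq> 0"
   and wf: "\<And>i j. i \<in> {1..n} \<Longrightarrow> j \<le> a i \<Longrightarrow> \<xi> i j w = c i * psi (a i) s t j + d i * psi (a i) s' t' j"
  have "apolar (t * t', - (t * s' + s * t'), s * s') w" by (rule chord_apolar[OF wf])
  then have "w \<in> Wcone" unfolding Wcone_def using product_nz[OF D] by blast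
  then show "v \<in> M" using w by blast
 next
  fix s t s' t' c d \<rho> v assume D: "t * s' - s * t' \<noteq> 0"
   and wf: "\<And>i j. i \<in> {1..n} \<Longrightarrow> j \<le> a i \<Longrightarrow> \<xi> i j w = c i * psi (a i) s t j + d i * dpsi (a i) s t s' t' j"
  have "apolar (square3 s t) w" by (rule apolar_squareI[OF wf])
  moreover have "square3 s t \<noteq> zero3" using D by (intro square3_nz) auto
  ultimately have "w \<in> Wcone" unfolding Wcone_def by blast
  then show "v \<in> M" using w by blast
 qed
 moreover have "is_double_hyperplane (quadric_ideal M q) (proj_pts {v \<in> M. \<eta> v = 0}) (proj_pts M)"
  by (rule quadric_ideal_double_hyperplane[OF M(1) fn wM ew q(2) qM])
 moreover have "proj_pts M = lin_span (Vt \<union> {vec.span {w}})"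
 proof -
  have "vec.span (\<Union>(Vt \<union> {vec.span {w}})) = vec.span (vertex \<union> {w})"
  proof -
   have "\<Union>(Vt \<union> {vec.span {w}}) = \<Union>Vt \<union> vec.span {w}" by auto
   then have "vec.span (\<Union>(Vt \<union> {vec.span {w}})) = vec.span (vec.span (\<Union>Vt) \<union> vec.span (vec.span {w}))"
    by (simp only: span_span_union)
   also have "\<dots> = vec.span (vec.span vertex \<union> vec.span {w})"
    by (simp only: span_Union_proj_pts[OF subspace_imp_cone[OF subspace_vertex]] vec.span_span)
   finally show ?thesis by (simp only: span_span_union)
  qed
  also have "\<dots> = M"
  proof
   show "vec.span (vertex \<union> {w}) \<subseteq> M" by (rule vec.span_minimal) (use M wM in auto)
   show "M \<subseteq> vec.span (vertex \<union> {w})"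
   proof
    fix v assume v: "v \<in> M"
    have "v - \<eta> v *s w \<in> vertex" unfolding vertex_def using v mem by (auto simp: xi_simps)
    then have "(v - \<eta> v *s w) + \<eta> v *s w \<in> vec.span (vertex \<union> {w})"
     by (intro vec.span_add vec.span_scale vec.span_base) auto
    then show "v \<in> vec.span (vertex \<union> {w})" by simp
   qed
  qed
  finally show ?thesis unfolding lin_span_def by simp
 qed
 ultimately show ?thesis unfolding SL_empty_def join_Vt_X0 ker
  using point_not_in_X[OF wX] join_Vt_X0 by simp
qed

lemma frame_of_pair:
 assumes p: "p0 \<in> L0" "p1 \<in> L0" "p0 \<notin> vec.span {p1}" "p1 \<notin> vec.span {p0}"
 obtains \<eta> where "frame 2 \<eta> ((!) [p0, p1])"
proof -
 have "\<exists>l. functional l \<and> l x = 1 \<and> l y = 0 \<and> (\<forall>v\<in>vertex. l v = 0)"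
  if xy: "x \<in> L0" "y \<in> L0" "x \<notin> vec.span {y}" for x y
 proof -
  let ?N = "{v. pr v \<in> vec.span {y}}"
  have pr0: "pr 0 = 0" using vec.subspace_0[OF subspace_L0] mem_L0_iff by blast
  have "vec.subspace ?N"
   unfolding vec.subspace_def by (auto simp: pr_add pr_scale pr0 vec.span_add vec.span_scale vec.span_zero)
  moreover have "x \<notin> ?N" using xy mem_L0_iff by simp
  ultimately obtain l where l: "functional l" "l x = 1" "\<And>v. v \<in> ?N \<Longrightarrow> l v = 0"
   using functional_separates by blast
  have "y \<in> ?N" using xy mem_L0_iff vec.span_base[of y "{y}"] by simp
  moreover have "v \<in> ?N" if "v \<in> vertex" for v
  proof -
   have "pr v = mk (\<lambda>i j. 0)" unfolding pr_def by (rule mk_cong) (use that in \<open>simp add: vertex_def\<close>)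
   then have "pr v = 0" by (simp only: mk_zero)
   then show ?thesis by (simp add: vec.span_zero)
  qed
  ultimately show ?thesis using l by blast
 qed
 then obtain l0 l1 where l: "functional l0" "l0 p0 = 1" "l0 p1 = 0" "\<forall>v\<in>vertex. l0 v = 0"
  "functional l1" "l1 p1 = 1" "l1 p0 = 0" "\<forall>v\<in>vertex. l1 v = 0" using p by metis
 have "frame 2 ((!) [l0, l1]) ((!) [p0, p1])"
  unfolding frame_def numeral_2_eq_2 All_less_Suc using l p by simp
 then show ?thesis using that by blast
qed

lemma mem_frame_space_2:
 "v \<in> frame_space 2 \<eta> ((!) [p0, p1]) \<longleftrightarrow>
  (\<forall>i\<in>{1..n}. \<forall>j\<le>a i. \<xi> i j v = \<xi> i j (\<eta> 0 v *s p0 + \<eta> 1 v *s p1))"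
 unfolding frame_space_def by (simp add: numeral_2_eq_2 xi_simps)

text \<open>The point of contact of a tangent through \<open>w\<close> over \<open>(s : t)\<close> is determined up to scalars: contracting with the
 linear form vanishing at \<open>(s : t)\<close> kills the part of \<open>w\<close> in the fibre.\<close>

lemma tangent_coefficients:
 assumes D: "t * s' - s * t' \<noteq> 0" "x * t * s2' - x * s * t2' \<noteq> 0"
  and w: "\<And>i j. i \<in> {1..n} \<Longrightarrow> j \<le> a i \<Longrightarrow> \<xi> i j w = c i * psi (a i) s t j + d i * dpsi (a i) s t s' t' j"
  and w2: "\<And>i j. i \<in> {1..n} \<Longrightarrow> j \<le> a i \<Longrightarrow> \<xi> i j w = c2 i * psi (a i) (x * s) (x * t) j + d2 i * dpsi (a i) (x * s) (x * t) s2' t2' j"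
  and ij: "i \<in> {1..n}" "j \<le> a i"
 shows "d2 i * psi (a i) (x * s) (x * t) j = (x^2 * (t * s' - s * t') / (x * t * s2' - x * s * t2')) * (d i * psi (a i) s t j)"
proof -
 let ?E = "t * s' - s * t'" and ?E2 = "x * t * s2' - x * s * t2'"
 have st: "(s, t) \<noteq> (0, 0)" using D by auto
 obtain r where r: "r \<le> a i - 1" "psi (a i - 1) s t r \<noteq> 0" using psi_nonzero[OF st] by blast
 have ra: "r < a i" using r a_pos[OF ij(1)] by simp
 have "t * \<xi> i r w - s * \<xi> i (Suc r) w = c i * (t * psi (a i) s t r - s * psi (a i) s t (Suc r))
   + d i * (t * dpsi (a i) s t s' t' r - s * dpsi (a i) s t s' t' (Suc r))"
  using ra ij(1) by (simp add: w algebra_simps)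
 then have 1: "t * \<xi> i r w - s * \<xi> i (Suc r) w = d i * (?E * psi (a i - 1) s t r)"
  using dpsi_linear[OF ra, of t s s' t'] psi_linear[OF ra, of t s] by simp
 have "x * t * \<xi> i r w - x * s * \<xi> i (Suc r) w = c2 i * (x * t * psi (a i) (x * s) (x * t) r - x * s * psi (a i) (x * s) (x * t) (Suc r))
   + d2 i * (x * t * dpsi (a i) (x * s) (x * t) s2' t2' r - x * s * dpsi (a i) (x * s) (x * t) s2' t2' (Suc r))"
  using ra ij(1) by (simp add: w2 algebra_simps)
 then have 2: "x * t * \<xi> i r w - x * s * \<xi> i (Suc r) w = d2 i * (?E2 * psi (a i - 1) (x * s) (x * t) r)"
  using dpsi_linear[OF ra, of "x * t" "x * s" s2' t2'] psi_linear[OF ra, of "x * t" "x * s"] by simp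
 have "d2 i * (?E2 * (x ^ (a i - 1) * psi (a i - 1) s t r)) = x * (t * \<xi> i r w - s * \<xi> i (Suc r) w)"
  using 2 unfolding psi_scaled[OF r(1)] by (simp add: algebra_simps)
 also have "\<dots> = x * (d i * (?E * psi (a i - 1) s t r))" unfolding 1 ..
 finally have "(d2 i * ?E2 * x ^ (a i - 1)) * psi (a i - 1) s t r = (x * d i * ?E) * psi (a i - 1) s t r"
  by (simp only: mult_ac)
 then have eq: "d2 i * ?E2 * x ^ (a i - 1) = x * d i * ?E" using r by simp
 have "x ^ a i = x * x ^ (a i - 1)" using ra by (cases "a i") auto
 then have "?E2 * (d2 i * x ^ a i) = x * (d2 i * ?E2 * x ^ (a i - 1))" by (simp only: mult_ac)
 then have "?E2 * (d2 i * x ^ a i) = x^2 * ?E * d i" unfolding eq by (simp add: power2_eq_square)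
 moreover have "y = z / e" if "e * y = z" "e \<noteq> 0" for y z e :: 'k using that by (simp add: field_simps)
 ultimately have "d2 i * x ^ a i = x^2 * ?E * d i / ?E2" using D(2) by blast
 then have "d2 i * x ^ a i * psi (a i) s t j = x^2 * ?E * d i / ?E2 * psi (a i) s t j" by simp
 then show ?thesis unfolding psi_scaled[OF ij(2)] by (simp add: mult_ac)
qed

lemma tangent_coordinates:
 assumes "w \<in> Vcone"
 obtains s t s' t' c d where "t * s' - s * t' \<noteq> 0"
  "\<And>i j. i \<in> {1..n} \<Longrightarrow> j \<le> a i \<Longrightarrow> \<xi> i j w = c i * psi (a i) s t j + d i * dpsi (a i) s t s' t' j"
proof -
 obtain s t where st: "(s, t) \<noteq> (0, 0)" and sq: "apolar (square3 s t) w" using assms unfolding Vcone_def by blast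
 obtain s' t' where D: "t * s' - s * t' \<noteq> 0" using complementary_direction[OF st] by blast
 show ?thesis using apolar_square_form[OF D sq] that[OF D] by blast
qed

text \<open>The apolar quadric has distinct zeros, as it would otherwise be a multiple of a square.\<close>

lemma chord_coordinates:
 assumes w: "w \<in> Wcone" "w \<notin> Vcone"
 obtains s t s' t' c d where "t * s' - s * t' \<noteq> 0"
  "\<And>i j. i \<in> {1..n} \<Longrightarrow> j \<le> a i \<Longrightarrow> \<xi> i j w = c i * psi (a i) s t j + d i * psi (a i) s' t' j"
proof -
 obtain h where h: "h \<noteq> zero3" "apolar h w" using w unfolding Wcone_def by blast
 obtain s t s' t' where st: "(s, t) \<noteq> (0, 0)" "h = (t * t', - (t * s' + s * t'), s * s')" "(s', t') \<noteq> (0, 0)"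
  using factor_binary_quadric[OF h(1)] by metis
 have D: "t * s' - s * t' \<noteq> 0"
 proof
  assume "t * s' - s * t' = 0"
  then have "disc3 h = 0" unfolding st(2) disc3_product by simp
  then obtain e x y where e: "(x, y) \<noteq> (0, 0)" "h = scale3 e (square3 x y)"
   using disc3_zero_imp_square h(1) by metis
  then have "e \<noteq> 0" using h(1) by (auto simp: scale3_def split: prod.splits)
  then have "apolar (square3 x y) w" using h(2) unfolding apolar_def e(2) dot3_scale3 by simp
  then show False using w(2) e(1) unfolding Vcone_def by blast
 qed
 show ?thesis using apolar_product_form[OF D h(2)[unfolded st(2)]] that[OF D] by blast
qed

text \<open>Here \<open>M\<close> is spanned by the vertex, \<open>w\<close> and the point of contact \<open>p1\<close> of the tangent. A polynomial vanishing
 on the scroll vanishes on the span of the vertex and \<open>p1\<close> together with its derivative in the direction of \<open>w\<close>, so it is divisible by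
 the square of the equation. Any other secant or tangent through \<open>w\<close> belongs to the same apolar quadric.\<close>

lemma region_double_point:
 assumes w: "w \<in> Vcone" "w \<notin> Bcone" "w \<notin> Ucone" shows "vec.span {w} \<in> SL_double_point Vt X0"
proof -
 have wX: "w \<notin> Xcone" using w X_subset_B by blast
 obtain s t where st: "(s, t) \<noteq> (0, 0)" and sq: "apolar (square3 s t) w" using w unfolding Vcone_def by blast
 obtain s' t' where D: "t * s' - s * t' \<noteq> 0" using complementary_direction[OF st] by blast
 obtain c d where wf: "\<And>i j. i \<in> {1..n} \<Longrightarrow> j \<le> a i \<Longrightarrow>
   \<xi> i j w = c i * psi (a i) s t j + d i * dpsi (a i) s t s' t' j"
  using apolar_square_form[OF D sq] by blast
 define p1 where "p1 = mk (\<lambda>i j. d i * psi (a i) s t j)"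
 have p1: "p1 \<in> L0" "p1 \<in> Xcone" by (simp_all add: p1_def mk_in_L0 mk_psi_00_in_X)
 have p1xi: "\<xi> i j p1 = d i * psi (a i) s t j" if "i \<in> {1..n}" "j \<le> a i" for i j
  using that by (simp add: p1_def xi_mk)
 have p1nz: "p1 \<noteq> 0"
 proof
  assume "p1 = 0"
  have d0: "d i = 0" if i: "i \<in> {1..n}" for i
  proof -
   obtain j where "j \<le> a i" "psi (a i) s t j \<noteq> 0" using psi_nonzero[OF st] by blast
   then show ?thesis using p1xi[OF i, of j] \<open>p1 = 0\<close> i by (simp add: xi_simps)
  qed
  then show False using form_not_X[OF wX, of c s t] wf by auto
 qed
 have prX: "pr w \<notin> Xcone" using wX xi_invariant_pr[OF xi_invariant_X] by blast
 have cX: "cone Xcone" by (rule alg_cone_imp_cone[OF alg_cone_X])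
 have i1: "pr w \<notin> vec.span {p1}" using prX cone_scale[OF cX p1(2)] by (auto simp: mem_span_singleton)
 have i2: "p1 \<notin> vec.span {pr w}"
 proof
  assume "p1 \<in> vec.span {pr w}"
  then obtain e where "p1 = e *s pr w" by (auto simp: mem_span_singleton)
  moreover from this have "e \<noteq> 0" using p1nz by auto
  ultimately have "pr w = inverse e *s p1" by simp
  then show False using prX p1 cX cone_scale by metis
 qed
 obtain \<eta> where F: "frame 2 \<eta> ((!) [pr w, p1])" using frame_of_pair[OF pr_in_L0 p1(1) i1 i2] by blast
 define M where "M = frame_space 2 \<eta> ((!) [pr w, p1])"
 have M: "vec.subspace M" "vertex \<subseteq> M"
  unfolding M_def by (rule subspace_frame_space[OF F] vertex_subset_frame_space[OF F])+
 have Minv: "xi_invariant M" unfolding M_def by (rule xi_invariant_frame_space[OF F])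
 have mem: "v \<in> M \<longleftrightarrow> (\<forall>i\<in>{1..n}. \<forall>j\<le>a i. \<xi> i j v = \<xi> i j (\<eta> 0 v *s w + \<eta> 1 v *s p1))" for v
  unfolding M_def mem_frame_space_2 by (simp add: xi_simps xi_pr)
 have eta: "functional (\<eta> 0)" "functional (\<eta> 1)" "\<eta> 0 w = 1" "\<eta> 0 p1 = 0" "\<eta> 1 p1 = 1"
  using frameD(1)[OF F] frameD(4)[OF F, of 0 0] frameD(4)[OF F, of 0 1] frameD(4)[OF F, of 1 1] eta_pr[OF F, of 0 w] by auto
 have p1M: "p1 \<in> M" "pr w \<in> M"
  using p_in_frame_space[OF F, of 1] p_in_frame_space[OF F, of 0] by (auto simp: M_def)
 have wM: "w \<in> M" using p1M frame_space_pr[OF F] by (simp add: M_def)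
 obtain q where q: "q \<in> minors" "mpeval q w \<noteq> 0" using obtain_minor[OF wX] by blast
 have q2: "q \<in> forms 2" using q minors_forms by blast
 have qX: "mpeval q v = 0" if "v \<in> Xcone" for v using that q Xcone_minors by blast
 \<comment> \<open>On the hyperplane of \<open>M\<close> spanned by the vertex and \<open>p1\<close>, the vector \<open>w\<close> is tangent to the scroll.\<close>
 have tang: "dir_deriv f x w = 0" if f: "\<And>v. v \<in> Xcone \<Longrightarrow> mpeval f v = 0" and x: "x \<in> M" "\<eta> 0 x = 0" for f x
 proof (cases "\<eta> 1 x = 0")
  case True
  then have "x \<in> vertex" using x mem by (auto simp: vertex_def xi_simps)
  then show ?thesis by (intro dir_deriv_at_vertex f)
 next
  case False
  have "dir_deriv f x (\<eta> 1 x *s w) = 0"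
  proof (rule dir_deriv_tangent[OF f curve_in_X])
   show "\<xi> i j x = (\<eta> 1 x * d i) * psi (a i) s t j" if "i \<in> {1..n}" "j \<le> a i" for i j
    using x mem that by (simp add: xi_simps p1xi)
   show "\<xi> i j (\<eta> 1 x *s w) = (\<eta> 1 x * c i) * psi (a i) s t j + (\<eta> 1 x * d i) * dpsi (a i) s t s' t' j"
    if "i \<in> {1..n}" "j \<le> a i" for i j
    using that by (simp add: xi_simps wf algebra_simps)
  qed
  then show ?thesis using functionalD(2)[OF functional_dir_deriv, of f x "\<eta> 1 x" w] False by simp
 qed
 have kerX: "x \<in> Xcone" if "x \<in> M" "\<eta> 0 x = 0" for x
 proof (rule xi_invariantD[OF xi_invariant_X])
  show "\<eta> 1 x *s p1 \<in> Xcone" using p1 cX cone_scale by blast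
 qed (use that mem in \<open>auto simp: xi_simps\<close>)
 have qM: "mpeval q v = mpeval q w * \<eta> 0 v ^ 2" if "v \<in> M" for v
 proof -
  have "mpeval q v = mpeval q (\<eta> 0 v *s w + \<eta> 1 v *s p1)"
   by (rule minor_poly_pr[OF q(1)]) (use that mem in auto)
  moreover have "dir_deriv q p1 w = 0" by (rule tang[OF qX p1M(1) eta(4)])
  ultimately show ?thesis using quadratic_form_expand[OF q2, of "\<eta> 0 v" w "\<eta> 1 v" p1] qX[OF p1(2)]
   by (simp add: mult.commute)
 qed
 have sl: "secant_locus (proj_pts Xcone) (vec.span {w}) = quadric_ideal M q"
 proof (rule secant_locus_scroll[OF wX M(1) wM M(2) q])
  fix f :: "('k, 'd) mpoly" assume f: "\<And>v. v \<in> Xcone \<Longrightarrow> mpeval f v = 0"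
  obtain h where "polyfun h" "\<And>v. v \<in> M \<Longrightarrow> mpeval f v = \<eta> 0 v ^ 2 * h v"
   by (rule divides_by_square[OF eta(1,3) M(1) wM, of f]) (use kerX f tang[OF f] in auto)
  then show "\<exists>h. polyfun h \<and> (\<forall>v\<in>M. mpeval f v = mpeval q v * h v)"
   using q(2) by (intro exI[of _ "\<lambda>v. inverse (mpeval q w) * h v"]) (auto simp: qM intro: polyfun_intros)
 next
  fix s2 t2 s2' t2' c2 d2 v assume D2: "t2 * s2' - s2 * t2' \<noteq> 0"
   and w2: "\<And>i j. i \<in> {1..n} \<Longrightarrow> j \<le> a i \<Longrightarrow> \<xi> i j w = c2 i * psi (a i) s2 t2 j + d2 i * psi (a i) s2' t2' j"
  have "apolar (t2 * t2', - (t2 * s2' + s2 * t2'), s2 * s2') w" by (rule chord_apolar[OF w2])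
  then obtain e where "(t2 * t2', - (t2 * s2' + s2 * t2'), s2 * s2') = scale3 e (square3 s t)"
   using apolar_unique[OF w(2,3) sq square3_nz[OF st]] by blast
  then have "(t2 * s2' - s2 * t2')^2 = 0" using disc3_product disc3_scale_square by metis
  then show "v \<in> M" using D2 by simp
 next
  fix s2 t2 s2' t2' c2 d2 \<rho> v assume D2: "t2 * s2' - s2 * t2' \<noteq> 0"
   and w2: "\<And>i j. i \<in> {1..n} \<Longrightarrow> j \<le> a i \<Longrightarrow> \<xi> i j w = c2 i * psi (a i) s2 t2 j + d2 i * dpsi (a i) s2 t2 s2' t2' j"
   and v: "\<And>i j. i \<in> {1..n} \<Longrightarrow> j \<le> a i \<Longrightarrow> \<xi> i j v = \<rho> * (d2 i * psi (a i) s2 t2 j)"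
  have "apolar (square3 s2 t2) w" by (rule apolar_squareI[OF w2])
  then obtain e where "square3 s2 t2 = scale3 e (square3 s t)"
   using apolar_unique[OF w(2,3) sq square3_nz[OF st]] by blast
  then have e: "t2 * t2 = e * (t * t)" "t2 * s2 + s2 * t2 = e * (t * s + s * t)" "s2 * s2 = e * (s * s)"
   by (auto simp: square3_def scale3_def)
  have "(t * s2 - s * t2)^2 = t * t * (s2 * s2) - s * t * (t2 * s2 + s2 * t2) + s * s * (t2 * t2)"
   by (simp add: power2_eq_square algebra_simps)
  also have "\<dots> = 0" unfolding e by (simp add: algebra_simps)
  finally have "t * s2 - s * t2 = 0" by simp
  then obtain x where x: "s2 = x * s" "t2 = x * t" using proportional_pairs[of t s2 s t2] st by blast
  let ?\<kappa> = "\<rho> * (x^2 * (t * s' - s * t') / (x * t * s2' - x * s * t2'))"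
  have "\<xi> i j v = \<xi> i j (?\<kappa> *s p1)" if ij: "i \<in> {1..n}" "j \<le> a i" for i j
   using tangent_coefficients[OF D D2[unfolded x] wf w2[unfolded x] ij] v[OF ij] ij
   unfolding x by (simp add: xi_simps p1xi mult.assoc)
  moreover have "?\<kappa> *s p1 \<in> M" using p1M M(1) vec.subspace_scale by blast
  ultimately show "v \<in> M" using xi_invariantD[OF Minv] by metis
 qed
 have "is_double_hyperplane (quadric_ideal M q) (proj_pts {v \<in> M. \<eta> 0 v = 0}) (proj_pts M)"
  by (rule quadric_ideal_double_hyperplane[OF M(1) eta(1) wM eta(3) q(2) qM])
 moreover have "proj_pts {v \<in> M. \<eta> 0 v = 0} = join Vt {vec.span {p1}}"
 proof -
  let ?S = "{v \<in> M. \<eta> 0 v = 0}"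
  have "vec.subspace ?S" using M(1) by (auto simp: vec.subspace_def functionalD[OF eta(1)])
  moreover have "xi_invariant ?S" unfolding xi_invariant_def
  proof (intro allI impI)
   fix x y assume eq: "\<forall>i\<in>{1..n}. \<forall>j\<le>a i. \<xi> i j x = \<xi> i j y" and x: "x \<in> ?S"
   have "pr x = pr y" unfolding pr_def using eq by (intro mk_cong) auto
   then have "\<eta> 0 x = \<eta> 0 y" using eta_pr[OF F, of 0] by (metis zero_less_numeral)
   then show "y \<in> ?S" using xi_invariantD[OF Minv] eq x by auto
  qed
  ultimately have "join Vt (proj_pts (?S \<inter> L0)) = proj_pts ?S" by (intro join_vertex subspace_imp_alg_cone)
  moreover have "?S \<inter> L0 = vec.span {p1}"
  proof (intro equalityI subsetI)
   fix v assume v: "v \<in> ?S \<inter> L0"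
   then have "v = \<eta> 0 v *s pr w + \<eta> 1 v *s p1"
    using mem_frame_space_L0[OF F, of v] by (simp add: M_def numeral_2_eq_2)
   then have "v = \<eta> 1 v *s p1" using v by simp
   then show "v \<in> vec.span {p1}" using mem_span_singleton by blast
  next
   fix v assume "v \<in> vec.span {p1}"
   then obtain e where "v = e *s p1" by (auto simp: mem_span_singleton)
   then show "v \<in> ?S \<inter> L0"
    using p1 p1M eta M(1) subspace_L0 by (auto simp: functionalD[OF eta(1)] vec.subspace_scale)
  qed
  ultimately show ?thesis using proj_pts_span_singleton[OF p1nz] by simp
 qed
 moreover have "proj_pts M = join Vt (proj_pts (M \<inter> L0))"
  by (rule join_vertex[OF subspace_imp_alg_cone[OF M(1)] Minv, symmetric])
 moreover have "linear_space_dim 1 (proj_pts (M \<inter> L0))"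
  unfolding linear_space_dim_def using dim_frame_space[OF F] M(1) subspace_L0 vec.subspace_inter
  by (intro exI[of _ "M \<inter> L0"]) (auto simp: M_def)
 moreover have "proj_pts (M \<inter> L0) \<subseteq> lin_span X0" unfolding lin_span_X0 by (intro proj_pts_mono) auto
 moreover have "vec.span {p1} \<in> proj_pts (M \<inter> L0)" using p1nz p1M p1 by (auto simp: proj_pts_def)
 ultimately show ?thesis unfolding SL_double_point_def using point_not_in_X[OF wX] sl join_Vt_X0
  by (intro CollectI conjI exI[of _ "proj_pts (M \<inter> L0)"] exI[of _ "vec.span {p1}"]) simp_all
qed

text \<open>The end points of a secant through \<open>w\<close> over two given points of the projective line are determined up to scalars.\<close>

lemma chord_coefficients:
 assumes D: "t * s' - s * t' \<noteq> 0" and ij: "i \<in> {1..n}" "j \<le> a i"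
  and w: "\<And>j. j \<le> a i \<Longrightarrow> x j = c * psi (a i) s t j + d * psi (a i) s' t' j"
  and w2: "\<And>j. j \<le> a i \<Longrightarrow> x j = c2 * psi (a i) (e * s) (e * t) j + d2 * psi (a i) (e' * s') (e' * t') j"
 shows "c2 * psi (a i) (e * s) (e * t) j = c * psi (a i) s t j"
proof -
 have "(c - c2 * e ^ a i) * psi (a i) s t r + (d - d2 * e' ^ a i) * psi (a i) s' t' r = 0" if "r \<le> a i" for r
  using w[OF that] w2[OF that] unfolding psi_scaled[OF that] by (simp add: algebra_simps)
 then have "c - c2 * e ^ a i = 0 \<and> d - d2 * e' ^ a i = 0"
  by (rule psi_psi_independent[OF D a_pos[OF ij(1)]])
 then show ?thesis unfolding psi_scaled[OF ij(2)] by simp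
qed

text \<open>Here \<open>M\<close> is spanned by the vertex and the secant through \<open>w\<close>, which is unique because its end points lie
 over the zeros of the only apolar quadric.\<close>

lemma region_two_points:
 assumes w: "w \<in> Wcone" "w \<notin> Vcone" shows "vec.span {w} \<in> SL_two_points Vt X0"
proof -
 have wBU: "w \<notin> Bcone" "w \<notin> Ucone" using w B_subset_V U_subset_V by auto
 have wX: "w \<notin> Xcone" using wBU X_subset_B by blast
 obtain s t s' t' c d where D: "t * s' - s * t' \<noteq> 0" and wf: "\<And>i j. i \<in> {1..n} \<Longrightarrow> j \<le> a i \<Longrightarrow>
   \<xi> i j w = c i * psi (a i) s t j + d i * psi (a i) s' t' j"
  by (rule chord_coordinates[OF w]) (rule that)
 define h where "h = (t * t', - (t * s' + s * t'), s * s')"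
 have h: "h \<noteq> zero3" "apolar h w" unfolding h_def using product_nz[OF D] chord_apolar[OF wf] by auto
 have st: "(s, t) \<noteq> (0, 0)" "h = (t * t', - (t * s' + s * t'), s * s')" "(s', t') \<noteq> (0, 0)"
  using D by (auto simp: h_def)
 define p0 p1 where "p0 = mk (\<lambda>i j. c i * psi (a i) s t j)" and "p1 = mk (\<lambda>i j. d i * psi (a i) s' t' j)"
 have p: "p0 \<in> L0" "p0 \<in> Xcone" "p1 \<in> L0" "p1 \<in> Xcone" by (simp_all add: p0_def p1_def mk_in_L0 mk_psi_00_in_X)
 have prw: "pr w = p0 + p1" unfolding p0_def p1_def mk_add pr_def by (rule mk_cong) (simp add: wf)
 have prX: "pr w \<notin> Xcone" using wX xi_invariant_pr[OF xi_invariant_X] by blast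
 have cX: "cone Xcone" by (rule alg_cone_imp_cone[OF alg_cone_X])
 have ind: "x \<notin> vec.span {y}" if xy: "y \<in> Xcone" "pr w = x + y" for x y
 proof
  assume "x \<in> vec.span {y}"
  then obtain e where "x = e *s y" by (auto simp: mem_span_singleton)
  then have "pr w = (e + 1) *s y" using xy(2) by (simp add: vec.scale_left_distrib)
  then show False using prX xy(1) cX cone_scale by metis
 qed
 have i1: "p0 \<notin> vec.span {p1}" "p1 \<notin> vec.span {p0}" using ind p prw by (auto simp: add.commute)
 have pnz: "p0 \<noteq> 0" "p1 \<noteq> 0" using i1 vec.span_zero by auto
 obtain \<eta> where F: "frame 2 \<eta> ((!) [p0, p1])" using frame_of_pair[OF p(1,3) i1] by blast
 define M where "M = frame_space 2 \<eta> ((!) [p0, p1])"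
 have M: "vec.subspace M" "vertex \<subseteq> M"
  unfolding M_def by (rule subspace_frame_space[OF F] vertex_subset_frame_space[OF F])+
 have Minv: "xi_invariant M" unfolding M_def by (rule xi_invariant_frame_space[OF F])
 have mem: "v \<in> M \<longleftrightarrow> (\<forall>i\<in>{1..n}. \<forall>j\<le>a i. \<xi> i j v = \<xi> i j (\<eta> 0 v *s p0 + \<eta> 1 v *s p1))" for v
  unfolding M_def mem_frame_space_2 ..
 have eta: "functional (\<eta> 0)" "functional (\<eta> 1)" "\<eta> 0 p0 = 1" "\<eta> 0 p1 = 0" "\<eta> 1 p1 = 1" "\<eta> 1 p0 = 0"
  using frameD(1)[OF F] frameD(4)[OF F, of 0 0] frameD(4)[OF F, of 0 1] frameD(4)[OF F, of 1 1] frameD(4)[OF F, of 1 0] by auto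
 have pM: "p0 \<in> M" "p1 \<in> M"
  using p_in_frame_space[OF F, of 1] p_in_frame_space[OF F, of 0] by (auto simp: M_def)
 have "pr w \<in> M" unfolding prw using pM M(1) vec.subspace_add by blast
 then have wM: "w \<in> M" using frame_space_pr[OF F] by (simp add: M_def)
 obtain q where q: "q \<in> minors" "mpeval q w \<noteq> 0" using obtain_minor[OF wX] by blast
 have q2: "q \<in> forms 2" using q minors_forms by blast
 have qX: "mpeval q v = 0" if "v \<in> Xcone" for v using that q Xcone_minors by blast
 define B where "B = dir_deriv q p1 p0"
 have qM: "mpeval q v = B * (\<eta> 0 v * \<eta> 1 v)" if "v \<in> M" for v
 proof -
  have "mpeval q v = mpeval q (\<eta> 0 v *s p0 + \<eta> 1 v *s p1)"
   by (rule minor_poly_pr[OF q(1)]) (use that mem in auto)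
  then show ?thesis using quadratic_form_expand[OF q2, of "\<eta> 0 v" p0 "\<eta> 1 v" p1] qX p
   by (simp add: B_def mult.commute)
 qed
 have B: "B \<noteq> 0" using q(2) qM[OF wM] by auto
 have MX: "v \<in> Xcone" if v: "v \<in> M" "mpeval q v = 0" for v
 proof -
  have "\<eta> 0 v = 0 \<or> \<eta> 1 v = 0" using qM v B by auto
  then have "\<eta> 0 v *s p0 + \<eta> 1 v *s p1 \<in> Xcone" using cone_scale[OF cX p(2)] cone_scale[OF cX p(4)] by auto
  then show ?thesis by (rule xi_invariantD[OF xi_invariant_X]) (use v mem in auto)
 qed
 have sl: "secant_locus (proj_pts Xcone) (vec.span {w}) =
  vanishing_ideal (join Vt (proj_pts {v \<in> M \<inter> L0. mpeval q v = 0}))"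
 proof (rule secant_locus_reduced[OF wX M(1) wM M(2) Minv q pM(1) pnz(1) qX[OF p(2)] MX])
  fix f :: "'k ^ 'd \<Rightarrow> 'k" assume f: "polyfun f" "\<And>v. v \<in> M \<Longrightarrow> mpeval q v = 0 \<Longrightarrow> f v = 0"
  obtain h where "polyfun h" "\<And>v. v \<in> M \<Longrightarrow> f v = \<eta> 0 v * \<eta> 1 v * h v"
   by (rule divides_by_functional_pair[OF f(1) M(1) eta(1,3) pM(1) eta(2,5) pM(2) eta(6)]) (use f(2) qM in auto)
  then show "\<exists>h. polyfun h \<and> (\<forall>v\<in>M. f v = mpeval q v * h v)"
   using B by (intro exI[of _ "\<lambda>v. inverse B * h v"]) (auto simp: qM intro: polyfun_intros)
 next
  fix s2 t2 s2' t2' c2 d2 v assume D2: "t2 * s2' - s2 * t2' \<noteq> 0"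
   and w2: "\<And>i j. i \<in> {1..n} \<Longrightarrow> j \<le> a i \<Longrightarrow> \<xi> i j w = c2 i * psi (a i) s2 t2 j + d2 i * psi (a i) s2' t2' j"
   and v: "\<And>i j. i \<in> {1..n} \<Longrightarrow> j \<le> a i \<Longrightarrow> \<xi> i j v = c2 i * psi (a i) s2 t2 j"
  have "apolar (t2 * t2', - (t2 * s2' + s2 * t2'), s2 * s2') w" by (rule chord_apolar[OF w2])
  then obtain e where e: "h = scale3 e (t2 * t2', - (t2 * s2' + s2 * t2'), s2 * s2')"
   using apolar_unique[OF wBU _ product_nz[OF D2] h(2)] by blast
  then have e': "t * t' = e * (t2 * t2')" "t * s' + s * t' = e * (t2 * s2' + s2 * t2')" "s * s' = e * (s2 * s2')"
   using e unfolding st(2) scale3_def prod.case prod.inject mult_minus_right neg_equal_iff_equal by blast+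
  have root: "(t * y - s * z) * (t' * y - s' * z) = e * ((t2 * y - s2 * z) * (t2' * y - s2' * z))" for y z
  proof -
   have "(t * y - s * z) * (t' * y - s' * z) = (t * t') * y^2 - (t * s' + s * t') * (y * z) + (s * s') * z^2"
    by (simp add: power2_eq_square algebra_simps)
   then show ?thesis unfolding e' by (simp add: power2_eq_square algebra_simps)
  qed
  have r1: "(t * s2 - s * t2) * (t' * s2 - s' * t2) = 0" unfolding root by (simp add: algebra_simps)
  have r2: "(t * s2' - s * t2') * (t' * s2' - s' * t2') = 0" unfolding root by (simp add: algebra_simps)
  have excl: "False" if xy: "y * s2 - x * t2 = 0" "y * s2' - x * t2' = 0" "(x, y) \<noteq> (0, 0)" for x y
  proof -
   obtain u where "s2 = u * x" "t2 = u * y" using proportional_pairs[OF xy(1,3)] by blast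
   moreover obtain u' where "s2' = u' * x" "t2' = u' * y" using proportional_pairs[OF xy(2,3)] by blast
   ultimately show False using D2 by (simp add: algebra_simps)
  qed
  show "v \<in> M"
  proof (cases "t * s2 - s * t2 = 0")
   case True
   then have "t' * s2' - s' * t2' = 0" using excl[OF True _ st(1)] r2 by auto
   then obtain y where y: "s2' = y * s'" "t2' = y * t'" using proportional_pairs[OF _ st(3)] by blast
   obtain x where x: "s2 = x * s" "t2 = x * t" using proportional_pairs[OF True st(1)] by blast
   have "\<xi> i j p0 = \<xi> i j v" if ij: "i \<in> {1..n}" "j \<le> a i" for i j
    using chord_coefficients[OF D ij wf[OF ij(1)] w2[OF ij(1), unfolded x y]] v[OF ij] ij
    unfolding x by (simp add: p0_def xi_mk)
   then show ?thesis by (rule xi_invariantD[OF Minv pM(1)])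
  next
   case False
   then have f1: "t' * s2 - s' * t2 = 0" using r1 by simp
   then have "t * s2' - s * t2' = 0" using excl[OF f1 _ st(3)] r2 by auto
   then obtain y where y: "s2' = y * s" "t2' = y * t" using proportional_pairs[OF _ st(1)] by blast
   obtain x where x: "s2 = x * s'" "t2 = x * t'" using proportional_pairs[OF f1 st(3)] by blast
   have D': "t' * s - s' * t \<noteq> 0" using D by (simp add: mult.commute)
   have wf': "\<xi> i j w = d i * psi (a i) s' t' j + c i * psi (a i) s t j" if "i \<in> {1..n}" "j \<le> a i" for i j
    using wf[OF that] by simp
   have "\<xi> i j p1 = \<xi> i j v" if ij: "i \<in> {1..n}" "j \<le> a i" for i j
    using chord_coefficients[OF D' ij wf'[OF ij(1)] w2[OF ij(1), unfolded x y]] v[OF ij] ij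
    unfolding x by (simp add: p1_def xi_mk)
   then show ?thesis by (rule xi_invariantD[OF Minv pM(2)])
  qed
 next
  fix s2 t2 s2' t2' c2 d2 \<rho> v assume D2: "t2 * s2' - s2 * t2' \<noteq> 0"
   and w2: "\<And>i j. i \<in> {1..n} \<Longrightarrow> j \<le> a i \<Longrightarrow> \<xi> i j w = c2 i * psi (a i) s2 t2 j + d2 i * dpsi (a i) s2 t2 s2' t2' j"
  have "apolar (square3 s2 t2) w" by (rule apolar_squareI[OF w2])
  moreover have "(s2, t2) \<noteq> (0, 0)" using D2 by auto
  ultimately have "w \<in> Vcone" unfolding Vcone_def by blast
  then show "v \<in> M" using w by blast
 qed
 have "proj_pts {v \<in> M \<inter> L0. mpeval q v = 0} = {vec.span {p0}, vec.span {p1}}"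
 proof (intro equalityI subsetI)
  fix y assume "y \<in> proj_pts {v \<in> M \<inter> L0. mpeval q v = 0}"
  then obtain v where v: "v \<in> M \<inter> L0" "mpeval q v = 0" "v \<noteq> 0" "y = vec.span {v}" by (auto elim: proj_ptsE)
  have veq: "v = \<eta> 0 v *s p0 + \<eta> 1 v *s p1"
   using mem_frame_space_L0[OF F, of v] v(1) by (simp add: M_def numeral_2_eq_2)
  have "\<eta> 0 v = 0 \<or> \<eta> 1 v = 0" using qM v B by auto
  then have "v = \<eta> 1 v *s p1 \<or> v = \<eta> 0 v *s p0" using veq by auto
  then have "v \<in> vec.span {p0} \<or> v \<in> vec.span {p1}" using mem_span_singleton by blast
  then have "y \<in> proj_pts (vec.span {p0}) \<or> y \<in> proj_pts (vec.span {p1})" using v by (auto simp: proj_pts_def)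
  then show "y \<in> {vec.span {p0}, vec.span {p1}}" by (simp add: proj_pts_span_singleton pnz)
 next
  fix y assume "y \<in> {vec.span {p0}, vec.span {p1}}"
  then show "y \<in> proj_pts {v \<in> M \<inter> L0. mpeval q v = 0}"
   using pM p pnz qX by (auto simp: proj_pts_def)
 qed
 moreover have "linear_space_dim 1 (proj_pts (M \<inter> L0))"
  unfolding linear_space_dim_def using dim_frame_space[OF F] M(1) subspace_L0 vec.subspace_inter
  by (intro exI[of _ "M \<inter> L0"]) (auto simp: M_def)
 moreover have "proj_pts (M \<inter> L0) \<subseteq> lin_span X0" unfolding lin_span_X0 by (intro proj_pts_mono) auto
 moreover have "vec.span {p0} \<in> proj_pts (M \<inter> L0)" "vec.span {p1} \<in> proj_pts (M \<inter> L0)"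
  using pnz pM p by (auto simp: proj_pts_def)
 moreover have "vec.span {p0} \<noteq> vec.span {p1}" using i1 vec.span_base[of p0 "{p0}"] by auto
 ultimately show ?thesis unfolding SL_two_points_def using point_not_in_X[OF wX] sl join_Vt_X0
  by (intro CollectI conjI exI[of _ "proj_pts (M \<inter> L0)"] exI[of _ "vec.span {p0}"] exI[of _ "vec.span {p1}"]) simp_all
qed

lemma linear_space_dim_frame:
 "frame (Suc e) \<eta> p \<Longrightarrow> linear_space_dim e (proj_pts (frame_space (Suc e) \<eta> p \<inter> L0))"
proof -
 assume F: "frame (Suc e) \<eta> p"
 have "vec.subspace (frame_space (Suc e) \<eta> p \<inter> L0)"
  by (rule vec.subspace_inter[OF subspace_frame_space[OF F] subspace_L0])
 moreover have "vec.dim (frame_space (Suc e) \<eta> p \<inter> L0) = e + 1" using dim_frame_space[OF F] by simp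
 ultimately show ?thesis unfolding linear_space_dim_def by blast
qed

lemma dpsi_1: "j \<le> 1 \<Longrightarrow> dpsi 1 s t s' t' j = psi 1 s' t' j"
 by (cases j) (auto simp: dpsi_def psi_poly_def psi_def)

text \<open>Modulo the vertex, \<open>w = p0 + p2\<close> where \<open>p0\<close> lies over \<open>(s : t)\<close> and \<open>p2\<close>, with nonzero components only
 for \<open>a i = 1\<close>, over another point. The vector \<open>p1\<close> is the point over \<open>(s : t)\<close> of the line section through \<open>p2\<close>. The plane of
 \<open>p0\<close>, \<open>p1\<close>, \<open>p2\<close> meets the scroll in the line \<open>\<langle>p0, p1\<rangle>\<close> of the fibre over \<open>(s : t)\<close> and in the line \<open>\<langle>p1, p2\<rangle>\<close>, which is
 transversal to the fibres.\<close>

lemma region_two_lines: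
 assumes w: "w \<in> Bcone" "w \<notin> Acone" "w \<notin> Xcone" shows "vec.span {w} \<in> SL_two_lines Vt X0"
proof -
 note wX = w(3)
 have cX: "cone Xcone" by (rule alg_cone_imp_cone[OF alg_cone_X])
 obtain s t where st: "(s, t) \<noteq> (0, 0)" "\<forall>i\<in>{k<..n}. \<forall>j<a i. t * \<xi> i j w = s * \<xi> i (Suc j) w"
  using w(1) unfolding Bcone_def rank_one_def by blast
 obtain s' t' where D: "t * s' - s * t' \<noteq> 0" using complementary_direction[OF st(1)] by blast
 have D': "t' * s - s' * t \<noteq> 0" using D by (simp add: mult.commute)
 have "apolar (square3 s t) w" by (rule rank_one_imp_apolar_square) (use st(2) in blast)
 then obtain c d where wf0: "\<And>i j. i \<in> {1..n} \<Longrightarrow> j \<le> a i \<Longrightarrow>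
   \<xi> i j w = c i * psi (a i) s t j + d i * dpsi (a i) s t s' t' j"
  using apolar_square_form[OF D] by blast
 have dk: "d i = 0" if i: "i \<in> {k<..n}" for i
 proof -
  obtain r where r: "r \<le> a i - 1" "psi (a i - 1) s t r \<noteq> 0" using psi_nonzero[OF st(1)] by blast
  have i1: "i \<in> {1..n}" using i in_index by blast
  have ra: "r < a i" using r a_pos[OF i1] by simp
  have "t * \<xi> i r w = s * \<xi> i (Suc r) w" using st(2) i ra by blast
  moreover have "t * \<xi> i r w - s * \<xi> i (Suc r) w = c i * (t * psi (a i) s t r - s * psi (a i) s t (Suc r))
    + d i * (t * dpsi (a i) s t s' t' r - s * dpsi (a i) s t s' t' (Suc r))"
   using ra i1 by (simp add: wf0 algebra_simps)
  ultimately have "d i * ((t * s' - s * t') * psi (a i - 1) s t r) = 0"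
   using dpsi_linear[OF ra, of t s s' t'] psi_linear[OF ra, of t s] by simp
  then show ?thesis using r D by simp
 qed
 have wf: "\<xi> i j w = c i * psi (a i) s t j + d i * psi (a i) s' t' j" if ij: "i \<in> {1..n}" "j \<le> a i" for i j
 proof (cases "i \<le> k")
  case True
  then have "a i = 1" using a_eq_1[of i] ij by simp
  then show ?thesis using wf0[OF ij] dpsi_1[of j s t s' t'] ij by simp
 next
  case False
  then show ?thesis using wf0[OF ij] dk[of i] ij by simp
 qed
 obtain i1 where i1: "i1 \<in> {k<..n}" "c i1 \<noteq> 0"
 proof -
  obtain i j where "i \<in> {k<..n}" "j \<le> a i" "\<xi> i j w \<noteq> 0" using w(2) unfolding Acone_def by blast
  then show ?thesis using wf[of i j] dk[of i] in_index(1)[of i] that[of i] by auto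
 qed
 obtain i0 where i0: "i0 \<in> {1..k}" "d i0 \<noteq> 0"
 proof -
  obtain i j where "i \<in> {1..n}" "j \<le> a i" "\<xi> i j w \<noteq> c i * psi (a i) s t j" using form_not_X[OF wX, of c s t] by blast
  then have "i \<in> {1..n}" "d i \<noteq> 0" using wf[of i j] by auto
  moreover from this have "i \<le> k" using dk[of i] by force
  ultimately show ?thesis using that[of i] by simp
 qed
 have ai0: "a i0 = 1" using a_eq_1 i0 by blast
 have in0: "i0 \<in> {1..n}" "i1 \<in> {1..n}" using in_index i0 i1 by auto
 obtain r where r: "r \<le> a i1 - 1" "psi (a i1 - 1) s t r \<noteq> 0" using psi_nonzero[OF st(1)] by blast
 have ra: "r < a i1" using r a_pos[OF in0(2)] by simp
 define K where "K = c i1 * psi (a i1 - 1) s t r"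
 have K: "K \<noteq> 0" using i1 r by (simp add: K_def)
 have d1: "d i1 = 0" using dk i1 by blast
 define p0 p1 p2 where "p0 = mk (\<lambda>i j. c i * psi (a i) s t j)" and "p1 = mk (\<lambda>i j. d i * psi (a i) s t j)"
  and "p2 = mk (\<lambda>i j. d i * psi (a i) s' t' j)"
 have p: "p0 \<in> L0" "p0 \<in> Xcone" "p1 \<in> L0" "p1 \<in> Xcone" "p2 \<in> L0" "p2 \<in> Xcone"
  by (simp_all add: p0_def p1_def p2_def mk_in_L0 mk_psi_00_in_X)
 have pxi: "\<xi> i j p0 = c i * psi (a i) s t j" "\<xi> i j p1 = d i * psi (a i) s t j" "\<xi> i j p2 = d i * psi (a i) s' t' j"
  if "i \<in> {1..n}" "j \<le> a i" for i j
  using that by (simp_all add: p0_def p1_def p2_def xi_mk)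
 \<comment> \<open>The functionals dual to \<open>p0\<close>, \<open>p1\<close>, \<open>p2\<close>: the components \<open>i0\<close> and \<open>i1\<close> are contracted with the linear forms
  vanishing at \<open>(s' : t')\<close> and \<open>(s : t)\<close>.\<close>
 define \<gamma> where "\<gamma> = (\<lambda>v. inverse (K * (t' * s - s' * t)) * (t' * \<xi> i1 r v - s' * \<xi> i1 (Suc r) v))"
 define \<epsilon> where "\<epsilon> = (\<lambda>v. inverse (d i0 * (t * s' - s * t')) * (t * \<xi> i0 0 v - s * \<xi> i0 1 v))"
 define \<delta> where "\<delta> = (\<lambda>v. inverse (d i0) * (inverse (t' * s - s' * t) * (t' * \<xi> i0 0 v - s' * \<xi> i0 1 v) - c i0 * \<gamma> v))"
 have xf: "functional (\<xi> i1 r)" "functional (\<xi> i1 (Suc r))" "functional (\<xi> i0 0)" "functional (\<xi> i0 1)"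
  using in0 ra ai0 by (auto intro!: xi)
 have fn: "functional \<gamma>" "functional \<epsilon>" "functional \<delta>"
  unfolding \<gamma>_def \<epsilon>_def \<delta>_def by (intro functional_scale functional_diff xf)+
 have x1: "\<xi> i1 r p0 = K * s" "\<xi> i1 (Suc r) p0 = K * t" "\<xi> i1 r p1 = 0" "\<xi> i1 (Suc r) p1 = 0"
   "\<xi> i1 r p2 = 0" "\<xi> i1 (Suc r) p2 = 0"
  using ra in0 psi_shift[OF ra, of s t] by (simp_all add: pxi K_def d1)
 have x0: "\<xi> i0 0 p0 = c i0 * s" "\<xi> i0 1 p0 = c i0 * t" "\<xi> i0 0 p1 = d i0 * s" "\<xi> i0 1 p1 = d i0 * t"
   "\<xi> i0 0 p2 = d i0 * s'" "\<xi> i0 1 p2 = d i0 * t'"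
  using in0 by (simp_all add: pxi ai0 psi_def)
 have dual: "\<gamma> p0 = 1" "\<gamma> p1 = 0" "\<gamma> p2 = 0" "\<epsilon> p0 = 0" "\<epsilon> p1 = 0" "\<epsilon> p2 = 1" "\<delta> p0 = 0" "\<delta> p1 = 1" "\<delta> p2 = 0"
 proof -
  have e1: "t' * (x * s) - s' * (x * t) = x * (t' * s - s' * t)" "t * (x * s') - s * (x * t') = x * (t * s' - s * t')"
    "t' * (x * s') - s' * (x * t') = 0" "t * (x * s) - s * (x * t) = 0" for x by (simp_all add: algebra_simps)
  have "K * (t' * s - s' * t) \<noteq> 0" using K D' by simp
  then have "\<gamma> p0 = 1" unfolding \<gamma>_def x1 e1 by (rule left_inverse)
  then show g: "\<gamma> p0 = 1" "\<gamma> p1 = 0" "\<gamma> p2 = 0" by (simp_all add: \<gamma>_def x1)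
  have "d i0 * (t * s' - s * t') \<noteq> 0" using i0 D by simp
  then have "\<epsilon> p2 = 1" unfolding \<epsilon>_def x0 e1 by (rule left_inverse)
  then show "\<epsilon> p0 = 0" "\<epsilon> p1 = 0" "\<epsilon> p2 = 1" unfolding \<epsilon>_def x0 e1 by simp_all
  have inv: "inverse x * (inverse y * (x * y)) = 1" if "x \<noteq> 0" "y \<noteq> 0" for x y :: 'k
   using that by (simp add: field_simps)
  have "\<delta> p1 = inverse (d i0) * (inverse (t' * s - s' * t) * (d i0 * (t' * s - s' * t)))"
   unfolding \<delta>_def x0 e1 g by simp
  then have "\<delta> p1 = 1" using inv[OF i0(2) D'] by simp
  moreover have "inverse y * (x * y) - x * 1 = 0" if "y \<noteq> 0" for x y :: 'k
   using that by (simp add: field_simps)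
  then have "\<delta> p0 = 0" unfolding \<delta>_def x0 e1 g using D' by simp
  ultimately show "\<delta> p0 = 0" "\<delta> p1 = 1" "\<delta> p2 = 0" unfolding \<delta>_def x0 e1 g by simp_all
 qed
 have vz: "\<gamma> v = 0" "\<epsilon> v = 0" "\<delta> v = 0" if "v \<in> vertex" for v
 proof -
  have "\<xi> i1 r v = 0" "\<xi> i1 (Suc r) v = 0" "\<xi> i0 0 v = 0" "\<xi> i0 1 v = 0"
   using that in0 ra ai0 by (auto simp: vertex_def)
  then show "\<gamma> v = 0" "\<epsilon> v = 0" "\<delta> v = 0" by (simp_all add: \<gamma>_def \<epsilon>_def \<delta>_def)
 qed
 have F: "frame 3 ((!) [\<gamma>, \<delta>, \<epsilon>]) ((!) [p0, p1, p2])"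
  unfolding frame_def numeral_3_eq_3 All_less_Suc using fn vz p dual by simp
 define M where "M = frame_space 3 ((!) [\<gamma>, \<delta>, \<epsilon>]) ((!) [p0, p1, p2])"
 have M: "vec.subspace M" "vertex \<subseteq> M"
  unfolding M_def by (rule subspace_frame_space[OF F] vertex_subset_frame_space[OF F])+
 have Minv: "xi_invariant M" unfolding M_def by (rule xi_invariant_frame_space[OF F])
 have mem: "v \<in> M \<longleftrightarrow> (\<forall>i\<in>{1..n}. \<forall>j\<le>a i. \<xi> i j v = \<gamma> v * \<xi> i j p0 + \<delta> v * \<xi> i j p1 + \<epsilon> v * \<xi> i j p2)" for v
  unfolding M_def frame_space_def by (simp add: numeral_3_eq_3)
 have pM: "p0 \<in> M" "p1 \<in> M" "p2 \<in> M"
  using p_in_frame_space[OF F, of 0] p_in_frame_space[OF F, of 1] p_in_frame_space[OF F, of 2] by (auto simp: M_def)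
 have prw: "pr w = p0 + p2" unfolding p0_def p2_def mk_add pr_def by (rule mk_cong) (simp add: wf)
 have "pr w \<in> M" unfolding prw using pM M(1) vec.subspace_add by blast
 then have wM: "w \<in> M" using frame_space_pr[OF F] by (simp add: M_def)
 define q where "q = minor_poly i0 0 i1 r"
 have ind: "i0 \<in> {1..n}" "i1 \<in> {1..n}" "0 < a i0" "r < a i1" using in0 ra ai0 by auto
 have q: "q \<in> minors" unfolding q_def minors_def using ind by blast
 have q2: "q \<in> forms 2" using q minors_forms by blast
 have qX: "mpeval q v = 0" if "v \<in> Xcone" for v using that q Xcone_minors by blast
 define B where "B = K * (d i0 * (t * s' - s * t'))"
 have B: "B \<noteq> 0" using K i0 D by (simp add: B_def)
 have qM: "mpeval q v = B * (\<gamma> v * \<epsilon> v)" if v: "v \<in> M" for v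
 proof -
  have a: "\<xi> i1 r v = \<gamma> v * (K * s)" "\<xi> i1 (Suc r) v = \<gamma> v * (K * t)"
   using v mem in0 ra x1 by auto
  have b: "t * \<xi> i0 0 v - s * \<xi> i0 1 v = (d i0 * (t * s' - s * t')) * \<epsilon> v"
  proof -
   have "z = x * (inverse x * z)" if "x \<noteq> 0" for x z :: 'k using that by (simp add: mult.assoc[symmetric])
   moreover have "d i0 * (t * s' - s * t') \<noteq> 0" using i0 D by simp
   ultimately show ?thesis unfolding \<epsilon>_def by blast
  qed
  have "mpeval q v = \<gamma> v * K * (t * \<xi> i0 0 v - s * \<xi> i0 1 v)"
   unfolding q_def minor_poly(2)[OF ind] minor_def a by (simp add: algebra_simps)
  then show ?thesis unfolding b B_def by (simp only: mult_ac)
 qed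
 have qw: "mpeval q w \<noteq> 0"
 proof -
  have g: "\<gamma> w = 1" using eta_pr[OF F, of 0 w] functionalD(1)[OF fn(1), of p0 p2] dual by (simp add: prw)
  have "\<epsilon> w = 1" using eta_pr[OF F, of 2 w] functionalD(1)[OF fn(2), of p0 p2] dual by (simp add: prw)
  then show ?thesis using qM[OF wM] g B by simp
 qed
 have MX: "v \<in> Xcone" if v: "v \<in> M" "mpeval q v = 0" for v
 proof -
  consider "\<epsilon> v = 0" | "\<gamma> v = 0" using qM v B by auto
  then show ?thesis
  proof cases
   case 1
   show ?thesis
    by (rule xi_invariantD[OF xi_invariant_X mk_psi_00_in_X[of "\<lambda>i. \<gamma> v * c i + \<delta> v * d i" s t]])
     (use v mem 1 in \<open>auto simp: pxi xi_mk algebra_simps\<close>)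
  next
   case 2
   show ?thesis
   proof (rule xi_invariantD[OF xi_invariant_X mk_psi_00_in_X[of d "\<delta> v * s + \<epsilon> v * s'" "\<delta> v * t + \<epsilon> v * t'"]])
    fix i j assume ij: "i \<in> {1..n}" "j \<le> a i"
    have e: "\<xi> i j v = \<delta> v * (d i * psi (a i) s t j) + \<epsilon> v * (d i * psi (a i) s' t' j)"
     using v mem 2 ij by (simp add: pxi)
    show "\<xi> i j (mk (\<lambda>i j. d i * psi (a i) (\<delta> v * s + \<epsilon> v * s') (\<delta> v * t + \<epsilon> v * t') j)) = \<xi> i j v"
    proof (cases "i \<le> k")
     case True
     then have "a i = 1" using a_eq_1[of i] ij by simp
     then show ?thesis using ij unfolding e by (cases j) (auto simp: xi_mk psi_def algebra_simps)
    next
     case False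
     then have "d i = 0" using dk[of i] ij by simp
     then show ?thesis using ij unfolding e by (simp add: xi_mk)
    qed
   qed
  qed
 qed
 \<comment> \<open>If a secant through \<open>w\<close> meets the ruling of the points \<open>(s : t)\<close>, then its other end lies in
  the second line.\<close>
 have other_end: "u \<in> M"
  if D2: "t2 * s2' - s2 * t2' \<noteq> 0" and w2: "\<And>i j. i \<in> {1..n} \<Longrightarrow> j \<le> a i \<Longrightarrow> \<xi> i j w = c2 i * psi (a i) s2 t2 j + d2 i * psi (a i) s2' t2' j"
   and u: "\<And>i j. i \<in> {1..n} \<Longrightarrow> j \<le> a i \<Longrightarrow> \<xi> i j u = d2 i * psi (a i) s2' t2' j" and par: "t * s2 - s * t2 = 0"
  for s2 t2 s2' t2' c2 d2 u
 proof -
  obtain x where x: "s2 = x * s" "t2 = x * t" using proportional_pairs[OF par st(1)] by blast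
  let ?E = "t * s' - s * t'"
  define D3 where "D3 = t * s2' - s * t2'"
  have D3: "D3 \<noteq> 0" using D2 unfolding x D3_def by (auto simp: algebra_simps)
  let ?\<mu> = "(s' * t2' - t' * s2') / D3"
  have "\<xi> i j (?\<mu> *s p1 + p2) = \<xi> i j u" if ij: "i \<in> {1..n}" "j \<le> a i" for i j
  proof (cases "i \<le> k")
   case True
   then have ai: "a i = 1" using a_eq_1[of i] ij by simp
   have "c i * s + d i * s' = c2 i * (x * s) + d2 i * s2'" "c i * t + d i * t' = c2 i * (x * t) + d2 i * t2'"
    using wf[OF ij(1), of 0] w2[OF ij(1), of 0] wf[OF ij(1), of 1] w2[OF ij(1), of 1] by (simp_all add: ai psi_def x)
   then have "t * (c i * s + d i * s') - s * (c i * t + d i * t') = t * (c2 i * (x * s) + d2 i * s2') - s * (c2 i * (x * t) + d2 i * t2')"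
    by simp
   then have dd: "d i * ?E = d2 i * D3" unfolding D3_def by (simp add: algebra_simps)
   have s2: "D3 * (d2 i * s2') = (s' * t2' - t' * s2') * (d i * s) + D3 * (d i * s')"
   proof -
    have "D3 * (d2 i * s2') = (d2 i * D3) * s2'" by (simp only: mult_ac)
    also have "\<dots> = (d i * ?E) * s2'" unfolding dd ..
    finally show ?thesis unfolding D3_def by (simp add: algebra_simps)
   qed
   have t2: "D3 * (d2 i * t2') = (s' * t2' - t' * s2') * (d i * t) + D3 * (d i * t')"
   proof -
    have "D3 * (d2 i * t2') = (d2 i * D3) * t2'" by (simp only: mult_ac)
    also have "\<dots> = (d i * ?E) * t2'" unfolding dd ..
    finally show ?thesis unfolding D3_def by (simp add: algebra_simps)
   qed
   have div: "z / D3 * x + y = u" if "D3 * u = z * x + D3 * y" for z x y u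
    using that D3 by (simp add: field_simps)
   have "j = 0 \<or> j = 1" using ij ai by auto
   then show ?thesis using div[OF s2] div[OF t2] ij by (auto simp: xi_simps pxi u ai psi_def)
  next
   case False
   have di: "d i = 0" using dk[of i] False ij by simp
   have D3': "t * s2' - s * t2' \<noteq> 0" using D3 by (simp add: D3_def)
   have "(c i - c2 i * x ^ a i) * psi (a i) s t r + (- d2 i) * psi (a i) s2' t2' r = 0" if "r \<le> a i" for r
    using wf[OF ij(1) that] w2[OF ij(1) that] di unfolding x psi_scaled[OF that] by (simp add: algebra_simps)
   then have "c i - c2 i * x ^ a i = 0 \<and> - d2 i = 0"
    by (rule psi_psi_independent[OF D3' a_pos[OF ij(1)]])
   then show ?thesis using ij di by (simp add: xi_simps pxi u)
  qed
  moreover have "?\<mu> *s p1 + p2 \<in> M" using pM M(1) vec.subspace_scale vec.subspace_add by blast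
  ultimately show ?thesis using xi_invariantD[OF Minv] by blast
 qed
 have ge2: "0 + 2 \<le> a i1" using a_ge_2[OF i1(1)] by simp
 have root: "h0 * s^2 + h1 * (s * t) + h2 * t^2 = 0" if h: "apolar (h0, h1, h2) w" for h0 h1 h2
 proof -
  obtain j where j: "j \<le> a i1 - 2" "psi (a i1 - 2) s t j \<noteq> 0" using psi_nonzero[OF st(1)] by blast
  have j2: "j + 2 \<le> a i1" using j ge2 by simp
  have "\<xi> i1 j w = c i1 * psi (a i1) s t j" "\<xi> i1 (Suc j) w = c i1 * psi (a i1) s t (Suc j)"
   "\<xi> i1 (Suc (Suc j)) w = c i1 * psi (a i1) s t (Suc (Suc j))" using j2 in0 by (simp_all add: wf d1)
  then have "c i1 * (h0 * psi (a i1) s t j + h1 * psi (a i1) s t (Suc j) + h2 * psi (a i1) s t (Suc (Suc j))) = 0"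
   using apolarD[OF h in0(2) j2] by (simp add: algebra_simps)
  then show ?thesis unfolding apolar_psi[OF j2] using j i1 by simp
 qed
 have sl: "secant_locus (proj_pts Xcone) (vec.span {w}) =
  vanishing_ideal (join Vt (proj_pts {v \<in> M \<inter> L0. mpeval q v = 0}))"
 proof (rule secant_locus_reduced[OF wX M(1) wM M(2) Minv q qw pM(1) _ qX[OF p(2)] MX])
  show "p0 \<noteq> 0" using dual functionalD(3)[OF fn(1)] by auto
  fix f :: "'k ^ 'd \<Rightarrow> 'k" assume f: "polyfun f" "\<And>v. v \<in> M \<Longrightarrow> mpeval q v = 0 \<Longrightarrow> f v = 0"
  obtain h where "polyfun h" "\<And>v. v \<in> M \<Longrightarrow> f v = \<gamma> v * \<epsilon> v * h v"
   by (rule divides_by_functional_pair[OF f(1) M(1) fn(1) dual(1) pM(1) fn(2) dual(6) pM(3) dual(4)]) (use f(2) qM in auto)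
  then show "\<exists>h. polyfun h \<and> (\<forall>v\<in>M. f v = mpeval q v * h v)"
   using B by (intro exI[of _ "\<lambda>v. inverse B * h v"]) (auto simp: qM intro: polyfun_intros)
 next
  fix s2 t2 s2' t2' c2 d2 v assume D2: "t2 * s2' - s2 * t2' \<noteq> 0"
   and w2: "\<And>i j. i \<in> {1..n} \<Longrightarrow> j \<le> a i \<Longrightarrow> \<xi> i j w = c2 i * psi (a i) s2 t2 j + d2 i * psi (a i) s2' t2' j"
   and v: "\<And>i j. i \<in> {1..n} \<Longrightarrow> j \<le> a i \<Longrightarrow> \<xi> i j v = c2 i * psi (a i) s2 t2 j"
  have "(t2 * t2') * s^2 + (- (t2 * s2' + s2 * t2')) * (s * t) + (s2 * s2') * t^2 = 0"
   by (rule root[OF chord_apolar[OF w2]])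
  then have "(t * s2 - s * t2) * (t * s2' - s * t2') = 0" by (simp add: power2_eq_square algebra_simps)
  then consider "t * s2 - s * t2 = 0" | "t * s2' - s * t2' = 0" by auto
  then show "v \<in> M"
  proof cases
   case 1
   have "w - v \<in> M"
    by (rule other_end[OF D2 w2 _ 1]) (auto simp: xi_simps w2 v)
   then have "w - (w - v) \<in> M" using wM M(1) vec.subspace_diff by blast
   then show ?thesis by simp
  next
   case 2
   have D2': "t2' * s2 - s2' * t2 \<noteq> 0" using D2 by (simp add: mult.commute)
   show ?thesis
    by (rule other_end[OF D2' _ v 2]) (auto simp: w2)
  qed
 next
  fix s2 t2 s2' t2' c2 d2 \<rho> v assume D2: "t2 * s2' - s2 * t2' \<noteq> 0"
   and w2: "\<And>i j. i \<in> {1..n} \<Longrightarrow> j \<le> a i \<Longrightarrow> \<xi> i j w = c2 i * psi (a i) s2 t2 j + d2 i * dpsi (a i) s2 t2 s2' t2' j"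
   and v: "\<And>i j. i \<in> {1..n} \<Longrightarrow> j \<le> a i \<Longrightarrow> \<xi> i j v = \<rho> * (d2 i * psi (a i) s2 t2 j)"
  have "(t2 * t2) * s^2 + (- (t2 * s2 + s2 * t2)) * (s * t) + (s2 * s2) * t^2 = 0"
   by (rule root[OF apolar_squareI[OF w2, unfolded square3_def]])
  then have "(t * s2 - s * t2)^2 = 0" by (simp add: power2_eq_square algebra_simps)
  then have "t * s2 - s * t2 = 0" by simp
  then obtain x where x: "s2 = x * s" "t2 = x * t" using proportional_pairs[OF _ st(1)] by blast
  let ?\<kappa> = "\<rho> * (x^2 * (t * s' - s * t') / (x * t * s2' - x * s * t2'))"
  have "\<xi> i j (?\<kappa> *s p1) = \<xi> i j v" if ij: "i \<in> {1..n}" "j \<le> a i" for i j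
   using tangent_coefficients[OF D D2[unfolded x] wf0 w2[unfolded x] ij] v[OF ij] ij
   unfolding x by (simp add: xi_simps pxi mult.assoc)
  moreover have "?\<kappa> *s p1 \<in> M" using pM M(1) vec.subspace_scale by blast
  ultimately show "v \<in> M" using xi_invariantD[OF Minv] by blast
 qed
 define L L' where "L = frame_space 2 ((!) [\<gamma>, \<delta>]) ((!) [p0, p1]) \<inter> L0"
  and "L' = frame_space 2 ((!) [\<delta>, \<epsilon>]) ((!) [p1, p2]) \<inter> L0"
 have FL: "frame 2 ((!) [\<gamma>, \<delta>]) ((!) [p0, p1])" "frame 2 ((!) [\<delta>, \<epsilon>]) ((!) [p1, p2])"
  unfolding frame_def numeral_2_eq_2 All_less_Suc using fn vz p dual by simp_all
 have memM: "v \<in> M \<inter> L0 \<longleftrightarrow> v = \<gamma> v *s p0 + \<delta> v *s p1 + \<epsilon> v *s p2" for v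
 proof
  assume "v \<in> M \<inter> L0"
  then show "v = \<gamma> v *s p0 + \<delta> v *s p1 + \<epsilon> v *s p2"
   using mem_frame_space_L0[OF F, of v] by (simp add: M_def numeral_3_eq_3)
 next
  assume v: "v = \<gamma> v *s p0 + \<delta> v *s p1 + \<epsilon> v *s p2"
  have "\<gamma> v *s p0 + \<delta> v *s p1 + \<epsilon> v *s p2 \<in> M \<inter> L0"
   using pM p M(1) subspace_L0 by (auto intro!: vec.subspace_add vec.subspace_scale)
  then show "v \<in> M \<inter> L0" using v by simp
 qed
 have memL: "v \<in> L \<longleftrightarrow> v \<in> M \<inter> L0 \<and> \<epsilon> v = 0" for v
 proof
  assume "v \<in> L"
  then have v: "v = \<gamma> v *s p0 + \<delta> v *s p1"
   using mem_frame_space_L0[OF FL(1), of v] by (simp add: L_def numeral_2_eq_2)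
  then have "\<epsilon> v = \<gamma> v * \<epsilon> p0 + \<delta> v * \<epsilon> p1" using functionalD(1,2)[OF fn(2)] by metis
  then have "\<epsilon> v = 0" by (simp add: dual)
  then show "v \<in> M \<inter> L0 \<and> \<epsilon> v = 0" using v memM by simp
 next
  assume v: "v \<in> M \<inter> L0 \<and> \<epsilon> v = 0"
  then have "\<forall>i\<in>{1..n}. \<forall>j\<le>a i. \<xi> i j v = \<gamma> v * \<xi> i j p0 + \<delta> v * \<xi> i j p1" using mem by simp
  then show "v \<in> L" using v by (simp add: L_def mem_frame_space_2 xi_simps)
 qed
 have memL': "v \<in> L' \<longleftrightarrow> v \<in> M \<inter> L0 \<and> \<gamma> v = 0" for v
 proof
  assume "v \<in> L'"
  then have v: "v = \<delta> v *s p1 + \<epsilon> v *s p2"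
   using mem_frame_space_L0[OF FL(2), of v] by (simp add: L'_def numeral_2_eq_2)
  then have "\<gamma> v = \<delta> v * \<gamma> p1 + \<epsilon> v * \<gamma> p2" using functionalD(1,2)[OF fn(1)] by metis
  then have "\<gamma> v = 0" by (simp add: dual)
  then show "v \<in> M \<inter> L0 \<and> \<gamma> v = 0" using v memM by simp
 next
  assume v: "v \<in> M \<inter> L0 \<and> \<gamma> v = 0"
  then have "\<forall>i\<in>{1..n}. \<forall>j\<le>a i. \<xi> i j v = \<delta> v * \<xi> i j p1 + \<epsilon> v * \<xi> i j p2" using mem by simp
  then show "v \<in> L'" using v by (simp add: L'_def mem_frame_space_2 xi_simps)
 qed
 have subs: "vec.subspace L" "vec.subspace L'"
  unfolding L_def L'_def using subspace_frame_space[OF FL(1)] subspace_frame_space[OF FL(2)] subspace_L0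
  by (auto intro: vec.subspace_inter)
 have dims: "linear_space_dim 1 (proj_pts L)" "linear_space_dim 1 (proj_pts L')" "linear_space_dim 2 (proj_pts (M \<inter> L0))"
  using linear_space_dim_frame[of 1] linear_space_dim_frame[of 2] FL F
  by (auto simp: L_def L'_def M_def numeral_2_eq_2 numeral_3_eq_3)
 have "p0 \<in> L" "p0 \<notin> L'" using memL memL' dual pM p by auto
 then have "proj_pts L \<noteq> proj_pts L'"
  using proj_pts_eq_iff[OF subspace_imp_cone[OF subs(1)] subspace_imp_cone[OF subs(2)]] by blast
 moreover have "L \<subseteq> M \<inter> L0" "L' \<subseteq> M \<inter> L0" using memL memL' by blast+
 then have "proj_pts L \<subseteq> lin_span X0" "proj_pts L' \<subseteq> lin_span X0"
  "proj_pts L \<subseteq> proj_pts (M \<inter> L0)" "proj_pts L' \<subseteq> proj_pts (M \<inter> L0)"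
  unfolding lin_span_X0 by (intro proj_pts_mono; blast)+
 moreover have "proj_pts {v \<in> M \<inter> L0. mpeval q v = 0} = proj_pts L \<union> proj_pts L'"
 proof -
  have "{v \<in> M \<inter> L0. mpeval q v = 0} = L \<union> L'" using memL memL' qM B by auto
  then show ?thesis by (auto simp: proj_pts_def)
 qed
 ultimately have "linear_space_dim 1 (proj_pts L) \<and> linear_space_dim 1 (proj_pts L') \<and>
   proj_pts L \<subseteq> lin_span X0 \<and> proj_pts L' \<subseteq> lin_span X0 \<and> proj_pts L \<noteq> proj_pts L' \<and>
   (\<exists>P. linear_space_dim 2 P \<and> proj_pts L \<subseteq> P \<and> proj_pts L' \<subseteq> P) \<and>
   secant_locus (join Vt X0) (vec.span {w}) = vanishing_ideal (join Vt (proj_pts L \<union> proj_pts L'))"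
  using sl join_Vt_X0 dims by metis
 then show ?thesis unfolding SL_two_lines_def using point_not_in_X[OF wX] by blast
qed

lemma smooth_quadric_in_frame:
 assumes F: "frame (e + 2) \<eta> p" and q: "q \<in> minors"
  and smooth: "\<And>v. v \<in> frame_space (e + 2) \<eta> p \<Longrightarrow> v \<notin> vertex \<Longrightarrow> mpeval q v = 0 \<Longrightarrow>
   \<exists>r<e + 2. dir_deriv q v (p r) \<noteq> 0"
 shows "smooth_quadric e (proj_pts {v \<in> frame_space (e + 2) \<eta> p \<inter> L0. mpeval q v = 0})"
 unfolding smooth_quadric_def
proof (intro exI bexI conjI)
 let ?T = "frame_space (e + 2) \<eta> p \<inter> L0"
 show T: "vec.subspace ?T" using subspace_frame_space[OF F] subspace_L0 by (rule vec.subspace_inter)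
 show "vec.dim ?T = e + 2" by (rule dim_frame_space[OF F])
 show q2: "q \<in> forms 2" using q minors_forms by blast
 show "proj_pts {v \<in> ?T. mpeval q v = 0} = {p \<in> proj_pts ?T. \<forall>v\<in>p. mpeval q v = 0}"
  by (rule quadric_points[OF subspace_imp_cone[OF T] q2])
 show "\<forall>v\<in>?T. v \<noteq> 0 \<and> mpeval q v = 0 \<longrightarrow> (\<exists>w\<in>?T. dir_deriv q v w \<noteq> 0)"
 proof (intro ballI impI)
  fix v assume v: "v \<in> ?T" "v \<noteq> 0 \<and> mpeval q v = 0"
  then have "v \<notin> vertex" using vertex_cap_L0 by blast
  then obtain r where "r < e + 2" "dir_deriv q v (p r) \<noteq> 0" using smooth v by blast
  then show "\<exists>w\<in>?T. dir_deriv q v w \<noteq> 0" using p_in_frame_space[OF F] frameD(3)[OF F] by blast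
 qed
qed

text \<open>The components with \<open>a i = 2\<close> are multiples of a triple \<open>u\<close> of nonzero Hankel determinant, and the ones with
 \<open>a i = 1\<close> are contractions of \<open>u\<close> by linear forms \<open>l0 i, l1 i\<close>. Letting \<open>u\<close> vary with these multiples and linear forms fixed
 gives a plane, which meets the scroll where \<open>u\<close> lies on the conic \<open>u 0 * u 2 = u 1 * u 1\<close>.\<close>

lemma region_conic:
 assumes w: "w \<in> Ucone" "w \<notin> Bcone" shows "vec.span {w} \<in> SL_conic Vt X0"
proof -
 have wX: "w \<notin> Xcone" using w X_subset_B by blast
 obtain \<beta>' u' where u': "\<forall>i\<in>{m<..n}. \<forall>j\<le>a i. \<xi> i j w = 0" "\<forall>i\<in>{k<..m}. \<forall>j\<le>2. \<xi> i j w = \<beta>' i * u' j"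
  using w(1) unfolding Ucone_def by blast
 have "\<exists>i0\<in>{k<..m}. \<beta>' i0 \<noteq> 0"
 proof (rule ccontr)
  assume no: "\<not> ?thesis"
  have "\<xi> i j w = 0" if ij: "i \<in> {k<..n}" "j \<le> a i" for i j
  proof (cases "i \<le> m")
   case True
   then have "i \<in> {k<..m}" using ij by auto
   then show ?thesis using no u'(2) a_eq_2[of i] ij by auto
  next
   case False
   then show ?thesis using u'(1) ij by auto
  qed
  then have "w \<in> Acone" by (simp add: Acone_def)
  then show False using w A_subset_B by blast
 qed
 then obtain i0 where i0: "i0 \<in> {k<..m}" "\<beta>' i0 \<noteq> 0" by blast
 have ai0: "a i0 = 2" and in0: "i0 \<in> {1..n}" using i0 a_eq_2 in_index by auto
 define \<beta> where "\<beta> = (\<lambda>i. \<beta>' i / \<beta>' i0)"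
 define u where "u = (\<lambda>j. \<xi> i0 j w)"
 have b0: "\<beta> i0 = 1" using i0 by (simp add: \<beta>_def)
 have wu: "\<xi> i j w = \<beta> i * u j" if "i \<in> {k<..m}" "j \<le> 2" for i j
  using u'(2) that i0 by (simp add: \<beta>_def u_def)
 define \<Delta> where "\<Delta> = u 0 * u 2 - u 1 * u 1"
 have \<Delta>: "\<Delta> \<noteq> 0"
 proof
  assume "\<Delta> = 0"
  then have uu: "u 0 * u 2 = u 1 * u 1" by (simp add: \<Delta>_def)
  have "minor i j i' j' w = 0" if "i \<in> {k<..n}" "i' \<in> {k<..n}" "j < a i" "j' < a i'" for i i' j j'
  proof (cases "i \<le> m \<and> i' \<le> m")
   case True
   then have ii: "i \<in> {k<..m}" "i' \<in> {k<..m}" using that by auto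
   then have "j < 2" "j' < 2" using that a_eq_2 by auto
   then have "(j = 0 \<or> j = 1) \<and> (j' = 0 \<or> j' = 1)" by auto
   moreover have "u 0 * u (Suc (Suc 0)) = u (Suc 0) * u (Suc 0)" using uu by (simp add: numeral_2_eq_2)
   ultimately show ?thesis using ii unfolding minor_def by (auto simp: wu algebra_simps)
  next
   case False
   then show ?thesis using u'(1) that unfolding minor_def by auto
  qed
  then have "w \<in> Bcone" unfolding Bcone_def by (simp add: rank_one_iff_minors)
  then show False using w by blast
 qed
 \<comment> \<open>For \<open>i \<le> k\<close> the component \<open>(\<xi> i 0 w, \<xi> i 1 w)\<close> is the contraction of \<open>u\<close> by a unique linear form,
  since the Hankel determinant of \<open>u\<close> does not vanish.\<close>
 define l0 where "l0 = (\<lambda>i. (\<xi> i 0 w * u 2 - \<xi> i 1 w * u 1) / \<Delta>)"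
 define l1 where "l1 = (\<lambda>i. (\<xi> i 1 w * u 0 - \<xi> i 0 w * u 1) / \<Delta>)"
 have wl: "\<xi> i 0 w = l0 i * u 0 + l1 i * u 1" "\<xi> i 1 w = l0 i * u 1 + l1 i * u 2" for i
 proof -
  have "\<xi> i 0 w * \<Delta> = (\<xi> i 0 w * u 2 - \<xi> i 1 w * u 1) * u 0 + (\<xi> i 1 w * u 0 - \<xi> i 0 w * u 1) * u 1"
   "\<xi> i 1 w * \<Delta> = (\<xi> i 0 w * u 2 - \<xi> i 1 w * u 1) * u 1 + (\<xi> i 1 w * u 0 - \<xi> i 0 w * u 1) * u 2"
   by (simp_all add: \<Delta>_def algebra_simps)
  moreover have "x = y / d * p + z / d * r" if "x * d = y * p + z * r" "d \<noteq> 0" for x d y p z r :: 'k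
   using that by (simp add: field_simps)
  ultimately show "\<xi> i 0 w = l0 i * u 0 + l1 i * u 1" "\<xi> i 1 w = l0 i * u 1 + l1 i * u 2"
   unfolding l0_def l1_def using \<Delta> by blast+
 qed
 define P where "P = (\<lambda>r i j. if i \<le> k then (if r = j then l0 i else if r = Suc j then l1 i else 0)
   else if i \<le> m then (if r = j then \<beta> i else 0) else 0)"
 define p where "p = (\<lambda>r. mk (P r))"
 have pxi: "\<xi> i j (p r) = P r i j" if "i \<in> {1..n}" "j \<le> a i" for i j r
  using that by (simp add: p_def xi_mk)
 have xf: "functional (\<xi> i0 r)" if "r < 3" for r using that in0 ai0 by (intro xi) auto
 have dual: "\<xi> i0 r (p r') = (if r = r' then 1 else 0)" if "r < 3" for r r'
  using that in0 ai0 i0 b0 by (auto simp: pxi P_def)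
 have F: "frame 3 (\<xi> i0) p"
  unfolding frame_def using xf dual in0 ai0 by (auto simp: vertex_def p_def mk_in_L0)
 define M where "M = frame_space 3 (\<xi> i0) p"
 have M: "vec.subspace M" "vertex \<subseteq> M"
  unfolding M_def by (rule subspace_frame_space[OF F] vertex_subset_frame_space[OF F])+
 have Minv: "xi_invariant M" unfolding M_def by (rule xi_invariant_frame_space[OF F])
 define Q where "Q = (\<lambda>i j v. if i \<le> k then (if j = 0 then l0 i * \<xi> i0 0 v + l1 i * \<xi> i0 1 v else l0 i * \<xi> i0 1 v + l1 i * \<xi> i0 2 v)
   else if i \<le> m then \<beta> i * \<xi> i0 j v else 0)"
 have mem: "v \<in> M \<longleftrightarrow> (\<forall>i\<in>{1..n}. \<forall>j\<le>a i. \<xi> i j v = Q i j v)" for v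
 proof -
  have "(\<Sum>r<3. \<xi> i0 r v * \<xi> i j (p r)) = Q i j v" if ij: "i \<in> {1..n}" "j \<le> a i" for i j
  proof -
   have "(\<Sum>r<3. \<xi> i0 r v * \<xi> i j (p r)) = \<xi> i0 0 v * P 0 i j + \<xi> i0 1 v * P 1 i j + \<xi> i0 2 v * P 2 i j"
    using ij by (simp add: numeral_3_eq_3 numeral_2_eq_2 pxi)
   also have "\<dots> = Q i j v"
   proof -
    consider "i \<le> k" | "k < i" "i \<le> m" | "m < i" by linarith
    then show ?thesis
    proof cases
     case 1
     then have "j = 0 \<or> j = 1" using a_eq_1[of i] ij by auto
     then show ?thesis using 1 by (auto simp: P_def Q_def mult.commute)
    next
     case 2
     then have "j = 0 \<or> j = 1 \<or> j = 2" using a_eq_2[of i] ij by auto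
     then show ?thesis using 2 by (auto simp: P_def Q_def mult.commute)
    next
     case 3
     then show ?thesis using km by (simp add: P_def Q_def)
    qed
   qed
   finally show ?thesis .
  qed
  then show ?thesis unfolding M_def frame_space_def by simp
 qed
 have wM: "w \<in> M" unfolding mem
 proof (intro ballI allI impI)
  fix i j assume ij: "i \<in> {1..n}" "j \<le> a i"
  consider "i \<le> k" | "k < i" "i \<le> m" | "m < i" by linarith
  then show "\<xi> i j w = Q i j w"
  proof cases
   case 1
   then have "j = 0 \<or> j = 1" using a_eq_1[of i] ij by auto
   then show ?thesis using 1 wl[of i] by (auto simp: Q_def u_def)
  next
   case 2
   then show ?thesis using wu[of i j] a_eq_2[of i] ij by (simp add: Q_def u_def)
  next
   case 3
   then show ?thesis using km u'(1) ij by (simp add: Q_def)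
  qed
 qed
 define q where "q = minor_poly i0 0 i0 1"
 have ind: "i0 \<in> {1..n}" "i0 \<in> {1..n}" "0 < a i0" "1 < a i0" using in0 ai0 by auto
 have q: "q \<in> minors" unfolding q_def minors_def using ind by blast
 have q2: "q \<in> forms 2" using q minors_forms by blast
 have qv: "mpeval q v = \<xi> i0 0 v * \<xi> i0 2 v - \<xi> i0 1 v * \<xi> i0 1 v" for v
  unfolding q_def minor_poly(2)[OF ind] minor_def by (simp add: numeral_2_eq_2)
 have qw: "mpeval q w \<noteq> 0" using \<Delta> unfolding qv \<Delta>_def u_def .
 have pM: "p r \<in> M" if "r < 3" for r using p_in_frame_space[OF F that] by (simp add: M_def)
 have MX: "v \<in> Xcone" if v: "v \<in> M" "mpeval q v = 0" for v
 proof -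
  obtain s t where st: "(s, t) \<noteq> (0, 0)" "t * \<xi> i0 0 v = s * \<xi> i0 1 v" "t * \<xi> i0 1 v = s * \<xi> i0 2 v"
  proof (cases "\<xi> i0 0 v = 0 \<and> \<xi> i0 1 v = 0")
   case True then show ?thesis using that[of 0 1] by auto
  next
   case False
   then show ?thesis using that[of "\<xi> i0 0 v" "\<xi> i0 1 v"] v(2) unfolding qv by (auto simp: mult.commute)
  qed
  have "t * \<xi> i j v = s * \<xi> i (Suc j) v" if ij: "i \<in> {1..n}" "j < a i" for i j
  proof -
   have m: "\<xi> i j v = Q i j v" "\<xi> i (Suc j) v = Q i (Suc j) v" using v(1) mem ij by auto
   consider "i \<le> k" | "k < i" "i \<le> m" | "m < i" by linarith
   then show ?thesis
   proof cases
    case 1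
    then have "j = 0" using a_eq_1[of i] ij by auto
    moreover have "t * (l0 i * \<xi> i0 0 v + l1 i * \<xi> i0 1 v) = l0 i * (t * \<xi> i0 0 v) + l1 i * (t * \<xi> i0 1 v)"
     by (simp add: algebra_simps)
    ultimately show ?thesis unfolding m Q_def using 1 unfolding st(2,3) by (simp add: algebra_simps)
   next
    case 2
    then have "j = 0 \<or> j = 1" using a_eq_2[of i] ij by auto
    then show ?thesis unfolding m Q_def using 2 st(2,3) by (auto simp: numeral_2_eq_2 mult.left_commute)
   next
    case 3
    then show ?thesis unfolding m Q_def using km by simp
   qed
  qed
  then show ?thesis unfolding Xcone_def rank_one_def using st(1) by blast
 qed
 have x0: "functional (\<xi> i0 0)" "\<xi> i0 0 (p 0) = 1" "p 0 \<in> M" "\<xi> i0 0 (p 2) = 0" using xf dual pM by auto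
 have x2: "functional (\<xi> i0 2)" "\<xi> i0 2 (p 2) = 1" "p 2 \<in> M" "\<xi> i0 2 (p 0) = 0" using xf dual pM by auto
 have x1: "functional (\<xi> i0 1)" "\<xi> i0 1 (p 0) = 0" "\<xi> i0 1 (p 2) = 0" "\<xi> i0 1 (p 1) = 1"
  by (rule xf, simp, (rule trans[OF dual], simp, simp)+)
 have sl: "secant_locus (proj_pts Xcone) (vec.span {w}) =
  vanishing_ideal (join Vt (proj_pts {v \<in> M \<inter> L0. mpeval q v = 0}))"
 proof (rule secant_locus_reduced[OF wX M(1) wM M(2) Minv q qw x0(3) _ _ MX])
  show "p 0 \<noteq> 0" using x0(2) functionalD(3)[OF x0(1)] by auto
  show "mpeval q (p 0) = 0" unfolding qv x0(2,4) x1(2) x2(4) by simp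
  fix f :: "'k ^ 'd \<Rightarrow> 'k" assume f: "polyfun f" "\<And>v. v \<in> M \<Longrightarrow> mpeval q v = 0 \<Longrightarrow> f v = 0"
  obtain h where "polyfun h" "\<And>v. v \<in> M \<Longrightarrow> f v = (\<xi> i0 0 v * \<xi> i0 2 v - \<xi> i0 1 v * \<xi> i0 1 v) * h v"
  proof (rule divides_by_quadric[OF f(1) M(1) x0 x2, of "\<lambda>v. \<xi> i0 1 v * \<xi> i0 1 v" "p 1"])
   show "polyfun (\<lambda>v. \<xi> i0 1 v * \<xi> i0 1 v)" by (intro polyfun_mult polyfun_functional x1)
   show "\<xi> i0 1 (v + c *s p 0) * \<xi> i0 1 (v + c *s p 0) = \<xi> i0 1 v * \<xi> i0 1 v"
    "\<xi> i0 1 (v + c *s p 2) * \<xi> i0 1 (v + c *s p 2) = \<xi> i0 1 v * \<xi> i0 1 v" for v c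
    by (simp_all only: functionalD[OF x1(1)] x1 mult_zero_right add_0_right)
   show "p 1 \<in> M" using pM by simp
   show "\<xi> i0 1 (p 1) * \<xi> i0 1 (p 1) \<noteq> 0" unfolding x1 by simp
   show "f v = 0" if "v \<in> M" "\<xi> i0 0 v * \<xi> i0 2 v = \<xi> i0 1 v * \<xi> i0 1 v" for v
    using f(2)[OF that(1)] that(2) by (simp add: qv)
  qed blast
  then show "\<exists>h. polyfun h \<and> (\<forall>v\<in>M. f v = mpeval q v * h v)" unfolding qv by blast
 next
  fix s t s' t' c d v assume D: "t * s' - s * t' \<noteq> 0"
   and w2: "\<And>i j. i \<in> {1..n} \<Longrightarrow> j \<le> a i \<Longrightarrow> \<xi> i j w = c i * psi (a i) s t j + d i * psi (a i) s' t' j"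
   and v: "\<And>i j. i \<in> {1..n} \<Longrightarrow> j \<le> a i \<Longrightarrow> \<xi> i j v = c i * psi (a i) s t j"
  have u: "\<xi> i0 j w = c i0 * psi 2 s t j + d i0 * psi 2 s' t' j" if "j \<le> 2" for j
   using w2[OF in0, of j] that ai0 by simp
  have vx: "\<xi> i0 j v = c i0 * psi 2 s t j" if "j \<le> 2" for j using v[OF in0, of j] that ai0 by simp
  have wQ: "\<xi> i j w = Q i j w" if "i \<in> {1..n}" "j \<le> a i" for i j using wM mem that by blast
  show "v \<in> M" unfolding mem
  proof (intro ballI allI impI)
   fix i j assume ij: "i \<in> {1..n}" "j \<le> a i"
   consider "i \<le> k" | "k < i" "i \<le> m" | "m < i" by linarith
   then show "\<xi> i j v = Q i j v"
   proof cases
    case 1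
    then have ai: "a i = 1" using a_eq_1[of i] ij by simp
    define lp where "lp = c i0 * (l0 i * s + l1 i * t)"
    define lp' where "lp' = d i0 * (l0 i * s' + l1 i * t')"
    have "(c i - lp) * psi 1 s t r + (d i - lp') * psi 1 s' t' r = 0" if r: "r \<le> 1" for r
    proof -
     have "c i * psi 1 s t r + d i * psi 1 s' t' r = Q i r w"
      using w2[OF ij(1), of r] wQ[OF ij(1), of r] r ai by simp
     also have "\<dots> = lp * psi 1 s t r + lp' * psi 1 s' t' r"
     proof -
      have "r = 0 \<or> r = 1" using r by auto
      then show ?thesis using 1 unfolding Q_def lp_def lp'_def
       by (auto simp: u psi_def power2_eq_square algebra_simps)
     qed
     finally show ?thesis by (simp add: algebra_simps)
    qed
    then have "c i - lp = 0 \<and> d i - lp' = 0" by (rule psi_psi_independent[OF D order_refl])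
    then have ci: "c i = lp" by simp
    have "j = 0 \<or> j = 1" using ij ai by auto
    then show ?thesis using v[OF ij] 1 unfolding ci lp_def Q_def
     by (auto simp: vx ai psi_def power2_eq_square algebra_simps)
   next
    case 2
    then have i: "i \<in> {k<..m}" by auto
    have ai: "a i = 2" using a_eq_2[OF i] .
    have "(c i - \<beta> i * c i0) * psi 2 s t r + (d i - \<beta> i * d i0) * psi 2 s' t' r = 0" if r: "r \<le> 2" for r
    proof -
     have "c i * psi 2 s t r + d i * psi 2 s' t' r = \<beta> i * \<xi> i0 r w"
      using w2[OF ij(1), of r] wQ[OF ij(1), of r] r ai 2 by (simp add: Q_def)
     then show ?thesis unfolding u[OF r] by (simp add: algebra_simps)
    qed
    then have "c i - \<beta> i * c i0 = 0 \<and> d i - \<beta> i * d i0 = 0" by (rule psi_psi_independent[OF D one_le_numeral])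
    then show ?thesis using v[OF ij] 2 ij ai by (simp add: Q_def vx)
   next
    case 3
    have "c i * psi (a i) s t r + d i * psi (a i) s' t' r = 0" if r: "r \<le> a i" for r
     using w2[OF ij(1) r] wQ[OF ij(1) r] 3 km by (simp add: Q_def)
    then have "c i = 0 \<and> d i = 0" by (rule psi_psi_independent[OF D a_pos[OF ij(1)]])
    then show ?thesis using v[OF ij] 3 km by (simp add: Q_def)
   qed
  qed
 next
  fix s t s' t' c d \<rho> v assume D: "t * s' - s * t' \<noteq> 0"
   and w2: "\<And>i j. i \<in> {1..n} \<Longrightarrow> j \<le> a i \<Longrightarrow> \<xi> i j w = c i * psi (a i) s t j + d i * dpsi (a i) s t s' t' j"
   and v: "\<And>i j. i \<in> {1..n} \<Longrightarrow> j \<le> a i \<Longrightarrow> \<xi> i j v = \<rho> * (d i * psi (a i) s t j)"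
  have u: "\<xi> i0 j w = c i0 * psi 2 s t j + d i0 * dpsi 2 s t s' t' j" if "j \<le> 2" for j
   using w2[OF in0, of j] that ai0 by simp
  have vx: "\<xi> i0 j v = \<rho> * (d i0 * psi 2 s t j)" if "j \<le> 2" for j using v[OF in0, of j] that ai0 by simp
  have wQ: "\<xi> i j w = Q i j w" if "i \<in> {1..n}" "j \<le> a i" for i j using wM mem that by blast
  have dp: "dpsi 2 s t s' t' 0 = 2 * s * s'" "dpsi 2 s t s' t' 1 = s * t' + s' * t" "dpsi 2 s t s' t' 2 = 2 * t * t'"
   by (simp_all add: dpsi_def psi_poly_def power2_eq_square algebra_simps)
  show "v \<in> M" unfolding mem
  proof (intro ballI allI impI)
   fix i j assume ij: "i \<in> {1..n}" "j \<le> a i"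
   consider "i \<le> k" | "k < i" "i \<le> m" | "m < i" by linarith
   then show "\<xi> i j v = Q i j v"
   proof cases
    case 1
    then have ai: "a i = 1" using a_eq_1[of i] ij by simp
    have e0: "c i * s + d i * s' = l0 i * (c i0 * s^2 + d i0 * (2 * s * s')) + l1 i * (c i0 * (s * t) + d i0 * (s * t' + s' * t))"
     using w2[OF ij(1), of 0] wQ[OF ij(1), of 0] ai 1 u[of 0] u[of 1] dp
     by (simp add: Q_def psi_def dpsi_1[unfolded One_nat_def])
    have e1: "c i * t + d i * t' = l0 i * (c i0 * (s * t) + d i0 * (s * t' + s' * t)) + l1 i * (c i0 * t^2 + d i0 * (2 * t * t'))"
     using w2[OF ij(1), of 1] wQ[OF ij(1), of 1] ai 1 u[of 1] u[of 2] dp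
     by (simp add: Q_def psi_def dpsi_1[unfolded One_nat_def])
    have "d i * (t * s' - s * t') = t * (c i * s + d i * s') - s * (c i * t + d i * t')"
     by (simp add: algebra_simps)
    also have "\<dots> = (d i0 * (l0 i * s + l1 i * t)) * (t * s' - s * t')"
     unfolding e0 e1 by (simp add: power2_eq_square algebra_simps)
    finally have di: "d i = d i0 * (l0 i * s + l1 i * t)" using D by simp
    have "j = 0 \<or> j = 1" using ij ai by auto
    then show ?thesis using v[OF ij] 1 unfolding di Q_def
     by (auto simp: vx ai psi_def power2_eq_square algebra_simps)
   next
    case 2
    then have i: "i \<in> {k<..m}" by auto
    have ai: "a i = 2" using a_eq_2[OF i] .
    have "(c i - \<beta> i * c i0) * psi 2 s t r + (d i - \<beta> i * d i0) * dpsi 2 s t s' t' r = 0" if r: "r \<le> 2" for r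
    proof -
     have "c i * psi 2 s t r + d i * dpsi 2 s t s' t' r = \<beta> i * \<xi> i0 r w"
      using w2[OF ij(1), of r] wQ[OF ij(1), of r] r ai 2 by (simp add: Q_def)
     then show ?thesis unfolding u[OF r] by (simp add: algebra_simps)
    qed
    then have "c i - \<beta> i * c i0 = 0 \<and> d i - \<beta> i * d i0 = 0" by (rule psi_dpsi_independent[OF D one_le_numeral])
    then show ?thesis using v[OF ij] 2 ij ai by (simp add: Q_def vx)
   next
    case 3
    have "c i * psi (a i) s t r + d i * dpsi (a i) s t s' t' r = 0" if r: "r \<le> a i" for r
     using w2[OF ij(1) r] wQ[OF ij(1) r] 3 km by (simp add: Q_def)
    then have "c i = 0 \<and> d i = 0" by (rule psi_dpsi_independent[OF D a_pos[OF ij(1)]])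
    then show ?thesis using v[OF ij] 3 km by (simp add: Q_def)
   qed
  qed
 qed
 have "smooth_quadric 1 (proj_pts {v \<in> M \<inter> L0. mpeval q v = 0})"
 proof -
  have dd: "dir_deriv q v x = \<xi> i0 0 v * \<xi> i0 2 x + \<xi> i0 0 x * \<xi> i0 2 v - \<xi> i0 1 v * \<xi> i0 1 x - \<xi> i0 1 x * \<xi> i0 1 v" for v x
   unfolding q_def dir_deriv_minor[OF ind] by (simp add: numeral_2_eq_2)
  have three: "1 + 2 = (3 :: nat)" by simp
  have F': "frame (1 + 2) (\<xi> i0) p" unfolding three by (rule F)
  have "smooth_quadric 1 (proj_pts {v \<in> frame_space (1 + 2) (\<xi> i0) p \<inter> L0. mpeval q v = 0})"
  proof (rule smooth_quadric_in_frame[OF F' q])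
   fix v assume v: "v \<in> frame_space (1 + 2) (\<xi> i0) p" "v \<notin> vertex" "mpeval q v = 0"
   have "\<not> (\<xi> i0 0 v = 0 \<and> \<xi> i0 2 v = 0)"
   proof
    assume z: "\<xi> i0 0 v = 0 \<and> \<xi> i0 2 v = 0"
    then have "\<xi> i0 1 v = 0" using v(3) unfolding qv by simp
    moreover have "r = 0 \<or> r = 1 \<or> r = 2" if "r < 1 + 2" for r :: nat using that by linarith
    ultimately have "\<xi> i0 r v = 0" if "r < 1 + 2" for r using z that by metis
    then have "v \<in> vertex" using frame_eta_zero[OF F' v(1)] by blast
    then show False using v by blast
   qed
   then have "dir_deriv q v (p 2) \<noteq> 0 \<or> dir_deriv q v (p 0) \<noteq> 0" unfolding dd using x0 x1 x2 by auto
   then obtain r where "r \<in> {0, 2}" "dir_deriv q v (p r) \<noteq> 0" by auto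
   then show "\<exists>r<1 + 2. dir_deriv q v (p r) \<noteq> 0" by (intro exI[of _ r]) auto
  qed
  then show ?thesis unfolding three M_def .
 qed
 moreover have "proj_pts {v \<in> M \<inter> L0. mpeval q v = 0} \<subseteq> lin_span X0"
  unfolding lin_span_X0 by (intro proj_pts_mono) auto
 ultimately show ?thesis unfolding SL_conic_def using point_not_in_X[OF wX] sl join_Vt_X0 by auto
qed

text \<open>Only components with \<open>a i = 1\<close> occur, so that \<open>w\<close> is a matrix with two columns, of rank two since it does not lie on
 the scroll. The matrices whose columns lie in its column space form a subspace of dimension four, which meets the scroll in the matrices of rank
 one.\<close>

lemma region_quadric:
 assumes w: "w \<in> Acone" "w \<notin> Xcone" shows "vec.span {w} \<in> SL_quadric Vt X0"
proof -
 note wX = w(2)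
 have w0: "\<xi> i j w = 0" if "i \<in> {1..n}" "k < i" "j \<le> a i" for i j
  using w(1) that unfolding Acone_def by auto
 obtain i1 i2 where i12: "i1 \<in> {1..k}" "i2 \<in> {1..k}" "\<xi> i1 0 w * \<xi> i2 1 w - \<xi> i1 1 w * \<xi> i2 0 w \<noteq> 0"
 proof -
  have "\<exists>i\<in>{1..n}. \<exists>i'\<in>{1..n}. \<exists>j<a i. \<exists>j'<a i'. minor i j i' j' w \<noteq> 0"
   using wX unfolding Xcone_def by (simp add: rank_one_iff_minors)
  then obtain i i' j j' where ii: "i \<in> {1..n}" "i' \<in> {1..n}" "j < a i" "j' < a i'" "minor i j i' j' w \<noteq> 0" by blast
  have "i \<le> k"
  proof (rule ccontr)
   assume "\<not> i \<le> k"
   then show False using w0[OF ii(1), of j] w0[OF ii(1), of "Suc j"] ii unfolding minor_def by auto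
  qed
  moreover have "i' \<le> k"
  proof (rule ccontr)
   assume "\<not> i' \<le> k"
   then show False using w0[OF ii(2), of j'] w0[OF ii(2), of "Suc j'"] ii unfolding minor_def by auto
  qed
  ultimately have "i \<in> {1..k}" "i' \<in> {1..k}" using ii by auto
  moreover from this have "j = 0" "j' = 0" using ii a_eq_1 by auto
  ultimately show ?thesis using that[of i i'] ii(5) by (simp add: minor_def)
 qed
 have ai: "a i1 = 1" "a i2 = 1" and in12: "i1 \<in> {1..n}" "i2 \<in> {1..n}" using i12 a_eq_1 in_index by auto
 define \<Delta> where "\<Delta> = \<xi> i1 0 w * \<xi> i2 1 w - \<xi> i1 1 w * \<xi> i2 0 w"
 have \<Delta>: "\<Delta> \<noteq> 0" using i12(3) by (simp add: \<Delta>_def)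
 \<comment> \<open>Cramer's rule expresses the component \<open>i\<close> of \<open>w\<close> by the independent components \<open>i1\<close> and \<open>i2\<close>.\<close>
 define l where "l = (\<lambda>i. (\<xi> i 0 w * \<xi> i2 1 w - \<xi> i 1 w * \<xi> i2 0 w) / \<Delta>)"
 define l' where "l' = (\<lambda>i. (\<xi> i 1 w * \<xi> i1 0 w - \<xi> i 0 w * \<xi> i1 1 w) / \<Delta>)"
 have wl: "\<xi> i 0 w = l i * \<xi> i1 0 w + l' i * \<xi> i2 0 w" "\<xi> i 1 w = l i * \<xi> i1 1 w + l' i * \<xi> i2 1 w" for i
 proof -
  have "\<xi> i 0 w * \<Delta> = (\<xi> i 0 w * \<xi> i2 1 w - \<xi> i 1 w * \<xi> i2 0 w) * \<xi> i1 0 w + (\<xi> i 1 w * \<xi> i1 0 w - \<xi> i 0 w * \<xi> i1 1 w) * \<xi> i2 0 w"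
   "\<xi> i 1 w * \<Delta> = (\<xi> i 0 w * \<xi> i2 1 w - \<xi> i 1 w * \<xi> i2 0 w) * \<xi> i1 1 w + (\<xi> i 1 w * \<xi> i1 0 w - \<xi> i 0 w * \<xi> i1 1 w) * \<xi> i2 1 w"
   by (simp_all add: \<Delta>_def algebra_simps)
  moreover have "x = y / d * p + z / d * r" if "x * d = y * p + z * r" "d \<noteq> 0" for x d y p z r :: 'k
   using that by (simp add: field_simps)
  ultimately show "\<xi> i 0 w = l i * \<xi> i1 0 w + l' i * \<xi> i2 0 w" "\<xi> i 1 w = l i * \<xi> i1 1 w + l' i * \<xi> i2 1 w"
   unfolding l_def l'_def using \<Delta> by blast+
 qed
 have l12: "l i1 = 1" "l i2 = 0" "l' i1 = 0" "l' i2 = 1"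
  using \<Delta> by (simp_all add: l_def l'_def \<Delta>_def mult.commute)
 define P where "P = (\<lambda>r i (j :: nat). if i \<le> k then (if r = j then l i else if r = j + 2 then l' i else 0) else 0)"
 define p where "p = (\<lambda>r. mk (P r))"
 define \<eta> where "\<eta> = (\<lambda>r. if r < 2 then \<xi> i1 r else \<xi> i2 (r - 2))"
 have e: "\<eta> 0 = \<xi> i1 0" "\<eta> 1 = \<xi> i1 1" "\<eta> 2 = \<xi> i2 0" "\<eta> 3 = \<xi> i2 1" by (simp_all add: \<eta>_def)
 have pxi: "\<xi> i j (p r) = P r i j" if "i \<in> {1..n}" "j \<le> a i" for i j r
  using that by (simp add: p_def xi_mk)
 have r4: "r = 0 \<or> r = 1 \<or> r = 2 \<or> r = 3" if "r < 4" for r :: nat using that by auto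
 have xf: "functional (\<eta> r)" if "r < 4" for r
  unfolding \<eta>_def using that ai in12 by (auto intro!: xi)
 note e = e e(2)[unfolded One_nat_def]
 have dual: "\<eta> r (p r') = (if r = r' then 1 else 0)" if r: "r < 4" "r' < 4" for r r'
  using r4[OF r(1)] r4[OF r(2)] in12 ai i12 l12 by (auto simp: e pxi P_def)
 have F: "frame 4 \<eta> p"
  unfolding frame_def
 proof (intro conjI allI impI ballI)
  fix r :: nat assume r: "r < 4"
  show "functional (\<eta> r)" by (rule xf[OF r])
  show "p r \<in> L0" by (simp add: p_def mk_in_L0)
  show "\<eta> r v = 0" if "v \<in> vertex" for v
   using r4[OF r] that in12 ai by (auto simp: e vertex_def)
  show "\<eta> r (p r') = (if r = r' then 1 else 0)" if "r' < 4" for r' by (rule dual[OF r that])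
 qed
 define M where "M = frame_space 4 \<eta> p"
 have M: "vec.subspace M" "vertex \<subseteq> M"
  unfolding M_def by (rule subspace_frame_space[OF F] vertex_subset_frame_space[OF F])+
 have Minv: "xi_invariant M" unfolding M_def by (rule xi_invariant_frame_space[OF F])
 define Q where "Q = (\<lambda>i j v. if i \<le> k then l i * \<xi> i1 j v + l' i * \<xi> i2 j v else 0)"
 have mem: "v \<in> M \<longleftrightarrow> (\<forall>i\<in>{1..n}. \<forall>j\<le>a i. \<xi> i j v = Q i j v)" for v
 proof -
  have "(\<Sum>r<4. \<eta> r v * \<xi> i j (p r)) = Q i j v" if ij: "i \<in> {1..n}" "j \<le> a i" for i j
  proof -
   have "(\<Sum>r<4. \<eta> r v * \<xi> i j (p r)) = \<eta> 0 v * P 0 i j + \<eta> 1 v * P 1 i j + \<eta> 2 v * P 2 i j + \<eta> 3 v * P 3 i j"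
    using ij by (simp add: eval_nat_numeral pxi)
   also have "\<dots> = Q i j v"
   proof (cases "i \<le> k")
    case True
    then have "j = 0 \<or> j = 1" using a_eq_1[of i] ij by auto
    then show ?thesis using True unfolding e by (auto simp: P_def Q_def mult.commute)
   next
    case False
    then show ?thesis by (simp add: P_def Q_def)
   qed
   finally show ?thesis .
  qed
  then show ?thesis unfolding M_def frame_space_def by simp
 qed
 have wM: "w \<in> M" unfolding mem
 proof (intro ballI allI impI)
  fix i j assume ij: "i \<in> {1..n}" "j \<le> a i"
  show "\<xi> i j w = Q i j w"
  proof (cases "i \<le> k")
   case True
   then have "j = 0 \<or> j = 1" using a_eq_1[of i] ij by auto
   then show ?thesis using True wl[of i] by (auto simp: Q_def)
  next
   case False
   then show ?thesis using w0[OF ij(1) _ ij(2)] by (simp add: Q_def)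
  qed
 qed
 define q where "q = minor_poly i1 0 i2 0"
 have ind: "i1 \<in> {1..n}" "i2 \<in> {1..n}" "0 < a i1" "0 < a i2" using in12 ai by auto
 have q: "q \<in> minors" unfolding q_def minors_def using ind by blast
 have qv: "mpeval q v = \<xi> i1 0 v * \<xi> i2 1 v - \<xi> i1 1 v * \<xi> i2 0 v" for v
  unfolding q_def minor_poly(2)[OF ind] minor_def by simp
 have qw: "mpeval q w \<noteq> 0" using \<Delta> unfolding qv \<Delta>_def .
 have pM: "p r \<in> M" if "r < 4" for r using p_in_frame_space[OF F that] by (simp add: M_def)
 have MX: "v \<in> Xcone" if v: "v \<in> M" "mpeval q v = 0" for v
 proof -
  obtain s t where st: "(s, t) \<noteq> (0, 0)" "t * \<xi> i1 0 v = s * \<xi> i1 1 v" "t * \<xi> i2 0 v = s * \<xi> i2 1 v"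
  proof (cases "\<xi> i1 0 v = 0 \<and> \<xi> i1 1 v = 0")
   case True
   then show ?thesis using that[of "\<xi> i2 0 v" "\<xi> i2 1 v"] that[of 0 1]
    by (cases "\<xi> i2 0 v = 0 \<and> \<xi> i2 1 v = 0") (auto simp: mult.commute)
  next
   case False
   then show ?thesis using that[of "\<xi> i1 0 v" "\<xi> i1 1 v"] v(2) unfolding qv by (auto simp: mult.commute)
  qed
  have "t * \<xi> i j v = s * \<xi> i (Suc j) v" if ij: "i \<in> {1..n}" "j < a i" for i j
  proof -
   have m: "\<xi> i j v = Q i j v" "\<xi> i (Suc j) v = Q i (Suc j) v" using v(1) mem ij by auto
   show ?thesis
   proof (cases "i \<le> k")
    case True
    then have "j = 0" using a_eq_1[of i] ij by auto
    moreover have "t * (l i * \<xi> i1 0 v + l' i * \<xi> i2 0 v) = l i * (t * \<xi> i1 0 v) + l' i * (t * \<xi> i2 0 v)"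
     by (simp add: algebra_simps)
    ultimately show ?thesis unfolding m Q_def using True unfolding st(2,3) by (simp add: algebra_simps)
   next
    case False
    then show ?thesis unfolding m Q_def by simp
   qed
  qed
  then show ?thesis unfolding Xcone_def rank_one_def using st(1) by blast
 qed
 have x0: "functional (\<xi> i1 0)" "\<xi> i1 0 (p 0) = 1" "p 0 \<in> M" "\<xi> i1 0 (p 3) = 0"
  using xf[of 0] dual[of 0 0] dual[of 0 3] pM by (auto simp: e)
 have x3: "functional (\<xi> i2 1)" "\<xi> i2 1 (p 3) = 1" "p 3 \<in> M" "\<xi> i2 1 (p 0) = 0"
  using xf[of 3] dual[of 3 3] dual[of 3 0] pM by (simp_all add: e)
 have x1: "functional (\<xi> i1 1)" "\<xi> i1 1 (p 0) = 0" "\<xi> i1 1 (p 1) = 1" "\<xi> i1 1 (p 2) = 0" "\<xi> i1 1 (p 3) = 0"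
  using xf[of 1] dual[of 1 0] dual[of 1 1] dual[of 1 2] dual[of 1 3] unfolding e by simp_all
 have x2: "functional (\<xi> i2 0)" "\<xi> i2 0 (p 0) = 0" "\<xi> i2 0 (p 1) = 0" "\<xi> i2 0 (p 2) = 1" "\<xi> i2 0 (p 3) = 0"
  using xf[of 2] dual[of 2 0] dual[of 2 1] dual[of 2 2] dual[of 2 3] unfolding e by simp_all
 have y: "\<xi> i1 0 (p 1) = 0" "\<xi> i1 0 (p 2) = 0" "\<xi> i2 1 (p 1) = 0" "\<xi> i2 1 (p 2) = 0"
  using dual[of 0 1] dual[of 0 2] dual[of 3 1] dual[of 3 2] unfolding e by simp_all
 have sl: "secant_locus (proj_pts Xcone) (vec.span {w}) =
  vanishing_ideal (join Vt (proj_pts {v \<in> M \<inter> L0. mpeval q v = 0}))"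
 proof (rule secant_locus_reduced[OF wX M(1) wM M(2) Minv q qw x0(3) _ _ MX])
  show "p 0 \<noteq> 0" using x0(2) functionalD(3)[OF x0(1)] by auto
  show "mpeval q (p 0) = 0" unfolding qv x1 x2 x3 by simp
  fix f :: "'k ^ 'd \<Rightarrow> 'k" assume f: "polyfun f" "\<And>v. v \<in> M \<Longrightarrow> mpeval q v = 0 \<Longrightarrow> f v = 0"
  obtain h where "polyfun h" "\<And>v. v \<in> M \<Longrightarrow> f v = (\<xi> i1 0 v * \<xi> i2 1 v - \<xi> i1 1 v * \<xi> i2 0 v) * h v"
  proof (rule divides_by_quadric[OF f(1) M(1) x0 x3, of "\<lambda>v. \<xi> i1 1 v * \<xi> i2 0 v" "p 1 + p 2"])
   show "polyfun (\<lambda>v. \<xi> i1 1 v * \<xi> i2 0 v)" by (intro polyfun_mult polyfun_functional x1 x2)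
   show "\<xi> i1 1 (v + c *s p 0) * \<xi> i2 0 (v + c *s p 0) = \<xi> i1 1 v * \<xi> i2 0 v"
    "\<xi> i1 1 (v + c *s p 3) * \<xi> i2 0 (v + c *s p 3) = \<xi> i1 1 v * \<xi> i2 0 v" for v c
    by (simp_all only: functionalD[OF x1(1)] functionalD[OF x2(1)] x1 x2 mult_zero_right add_0_right)
   show "p 1 + p 2 \<in> M" using pM[of 1] pM[of 2] M(1) vec.subspace_add by simp
   show "\<xi> i1 1 (p 1 + p 2) * \<xi> i2 0 (p 1 + p 2) \<noteq> 0"
    unfolding functionalD[OF x1(1)] functionalD[OF x2(1)] x1 x2 by simp
   show "f v = 0" if "v \<in> M" "\<xi> i1 0 v * \<xi> i2 1 v = \<xi> i1 1 v * \<xi> i2 0 v" for v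
    using f(2)[OF that(1)] that(2) by (simp add: qv)
  qed blast
  then show "\<exists>h. polyfun h \<and> (\<forall>v\<in>M. f v = mpeval q v * h v)" unfolding qv by blast
 next
  fix s t s' t' c d v assume D: "t * s' - s * t' \<noteq> 0"
   and w2: "\<And>i j. i \<in> {1..n} \<Longrightarrow> j \<le> a i \<Longrightarrow> \<xi> i j w = c i * psi (a i) s t j + d i * psi (a i) s' t' j"
   and v: "\<And>i j. i \<in> {1..n} \<Longrightarrow> j \<le> a i \<Longrightarrow> \<xi> i j v = c i * psi (a i) s t j"
  have wQ: "\<xi> i j w = Q i j w" if "i \<in> {1..n}" "j \<le> a i" for i j using wM mem that by blast
  show "v \<in> M" unfolding mem
  proof (intro ballI allI impI)
   fix i j assume ij: "i \<in> {1..n}" "j \<le> a i"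
   show "\<xi> i j v = Q i j v"
   proof (cases "i \<le> k")
    case True
    then have a1: "a i = 1" using a_eq_1[of i] ij by simp
    have "(c i - (l i * c i1 + l' i * c i2)) * psi 1 s t r + (d i - (l i * d i1 + l' i * d i2)) * psi 1 s' t' r = 0"
     if r: "r \<le> 1" for r
     using w2[OF ij(1), of r] wQ[OF ij(1), of r] w2[OF in12(1), of r] w2[OF in12(2), of r] r a1 ai True
     by (simp add: Q_def algebra_simps)
    then have "c i - (l i * c i1 + l' i * c i2) = 0 \<and> d i - (l i * d i1 + l' i * d i2) = 0"
     by (rule psi_psi_independent[OF D order_refl])
    then have ci: "c i = l i * c i1 + l' i * c i2" by simp
    show ?thesis using v[OF ij] v[OF in12(1), of j] v[OF in12(2), of j] True ij a1 ai
     by (simp add: Q_def ci algebra_simps)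
   next
    case False
    have "c i * psi (a i) s t r + d i * psi (a i) s' t' r = 0" if r: "r \<le> a i" for r
     using w2[OF ij(1) r] wQ[OF ij(1) r] False by (simp add: Q_def)
    then have "c i = 0 \<and> d i = 0" by (rule psi_psi_independent[OF D a_pos[OF ij(1)]])
    then show ?thesis using v[OF ij] False by (simp add: Q_def)
   qed
  qed
 next
  fix s t s' t' c d \<rho> v assume D: "t * s' - s * t' \<noteq> 0"
   and w2: "\<And>i j. i \<in> {1..n} \<Longrightarrow> j \<le> a i \<Longrightarrow> \<xi> i j w = c i * psi (a i) s t j + d i * dpsi (a i) s t s' t' j"
   and v: "\<And>i j. i \<in> {1..n} \<Longrightarrow> j \<le> a i \<Longrightarrow> \<xi> i j v = \<rho> * (d i * psi (a i) s t j)"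
  have wQ: "\<xi> i j w = Q i j w" if "i \<in> {1..n}" "j \<le> a i" for i j using wM mem that by blast
  show "v \<in> M" unfolding mem
  proof (intro ballI allI impI)
   fix i j assume ij: "i \<in> {1..n}" "j \<le> a i"
   show "\<xi> i j v = Q i j v"
   proof (cases "i \<le> k")
    case True
    then have a1: "a i = 1" using a_eq_1[of i] ij by simp
    have "(c i - (l i * c i1 + l' i * c i2)) * psi 1 s t r + (d i - (l i * d i1 + l' i * d i2)) * dpsi 1 s t s' t' r = 0"
     if r: "r \<le> 1" for r
     using w2[OF ij(1), of r] wQ[OF ij(1), of r] w2[OF in12(1), of r] w2[OF in12(2), of r] r a1 ai True
     by (simp add: Q_def algebra_simps)
    then have "c i - (l i * c i1 + l' i * c i2) = 0 \<and> d i - (l i * d i1 + l' i * d i2) = 0"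
     by (rule psi_dpsi_independent[OF D order_refl])
    then have di: "d i = l i * d i1 + l' i * d i2" by simp
    show ?thesis using v[OF ij] v[OF in12(1), of j] v[OF in12(2), of j] True ij a1 ai
     by (simp add: Q_def di algebra_simps)
   next
    case False
    have "c i * psi (a i) s t r + d i * dpsi (a i) s t s' t' r = 0" if r: "r \<le> a i" for r
     using w2[OF ij(1) r] wQ[OF ij(1) r] False by (simp add: Q_def)
    then have "c i = 0 \<and> d i = 0" by (rule psi_dpsi_independent[OF D a_pos[OF ij(1)]])
    then show ?thesis using v[OF ij] False by (simp add: Q_def)
   qed
  qed
 qed
 have "smooth_quadric 2 (proj_pts {v \<in> M \<inter> L0. mpeval q v = 0})"
 proof -
  have dd: "dir_deriv q v x = \<xi> i1 0 v * \<xi> i2 1 x + \<xi> i1 0 x * \<xi> i2 1 v - \<xi> i1 1 v * \<xi> i2 0 x - \<xi> i1 1 x * \<xi> i2 0 v" for v x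
   unfolding q_def dir_deriv_minor[OF ind] by simp
  have four: "2 + 2 = (4 :: nat)" by simp
  have F': "frame (2 + 2) \<eta> p" unfolding four by (rule F)
  have "smooth_quadric 2 (proj_pts {v \<in> frame_space (2 + 2) \<eta> p \<inter> L0. mpeval q v = 0})"
  proof (rule smooth_quadric_in_frame[OF F' q])
   fix v assume v: "v \<in> frame_space (2 + 2) \<eta> p" "v \<notin> vertex" "mpeval q v = 0"
   have "dir_deriv q v (p 0) = \<xi> i2 1 v" "dir_deriv q v (p 1) = - \<xi> i2 0 v"
    "dir_deriv q v (p 2) = - \<xi> i1 1 v" "dir_deriv q v (p 3) = \<xi> i1 0 v"
    unfolding dd x0 x1 x2 x3 y by simp_all
   note der = this
   have "\<exists>r<4. \<eta> r v \<noteq> 0" using frame_eta_zero[OF F' v(1)] v(2) by auto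
   then have "\<xi> i1 0 v \<noteq> 0 \<or> \<xi> i1 1 v \<noteq> 0 \<or> \<xi> i2 0 v \<noteq> 0 \<or> \<xi> i2 1 v \<noteq> 0" using r4 e by metis
   then have "dir_deriv q v (p 3) \<noteq> 0 \<or> dir_deriv q v (p 2) \<noteq> 0 \<or> dir_deriv q v (p 1) \<noteq> 0 \<or> dir_deriv q v (p 0) \<noteq> 0"
    unfolding der neg_equal_0_iff_equal by argo
   moreover have "0 < (2::nat) + 2" "1 < (2::nat) + 2" "2 < (2::nat) + 2" "3 < (2::nat) + 2" by simp_all
   ultimately show "\<exists>r<2 + 2. dir_deriv q v (p r) \<noteq> 0" by blast
  qed
  then show ?thesis unfolding four M_def .
 qed
 moreover have "proj_pts {v \<in> M \<inter> L0. mpeval q v = 0} \<subseteq> lin_span X0"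
  unfolding lin_span_X0 by (intro proj_pts_mono) auto
 ultimately show ?thesis unfolding SL_quadric_def using point_not_in_X[OF wX] sl join_Vt_X0 by auto
qed

end

section \<open>Smooth quadrics and supports of ideals\<close>

lemma dir_deriv_polar:
 fixes q :: "('k::alg_closed_field, 'd::finite) mpoly"
 assumes "q \<in> forms 2"
 shows "dir_deriv q v w = mpeval q (v + w) - mpeval q v - mpeval q w"
 using quadratic_form_expand[OF assms, of 1 w 1 v] by (simp add: add.commute)

lemma dir_deriv_form_commute:
 fixes q :: "('k::alg_closed_field, 'd::finite) mpoly"
 assumes "q \<in> forms 2" shows "dir_deriv q v w = dir_deriv q w v"
 unfolding dir_deriv_polar[OF assms] by (simp add: add.commute)

lemma dir_deriv_scaleI: "dir_deriv f v (c *s w) = c * dir_deriv f v w"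
 by (simp add: dir_deriv_def sum_distrib_left mult_ac)

lemma dir_deriv_addI: "dir_deriv f v (x + y) = dir_deriv f v x + dir_deriv f v y"
 by (simp add: dir_deriv_def sum.distrib distrib_left)

text \<open>If the points of a smooth quadric lay in a proper subspace \<open>N\<close>, then on each line through a
 point \<open>u\<close> of \<open>N\<close> and a point outside \<open>N\<close> the quadratic polynomial would have no root, hence
 be constant; this makes \<open>u\<close> a singular point.\<close>

lemma dim_span_smooth_quadric:
 fixes D :: "('k::alg_closed_field, 'd::finite) point set"
 assumes "smooth_quadric e D" shows "vec.dim (vec.span (\<Union>D)) = e + 2"
proof -
 obtain T q where q: "q \<in> forms 2" and T: "vec.subspace T" "vec.dim T = e + 2"
  and D: "D = {p \<in> proj_pts T. \<forall>v\<in>p. mpeval q v = 0}"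
  and smooth: "\<forall>v\<in>T. v \<noteq> 0 \<and> mpeval q v = 0 \<longrightarrow> (\<exists>w\<in>T. dir_deriv q v w \<noteq> 0)"
  using assms unfolding smooth_quadric_def by blast
 have D': "D = proj_pts {v \<in> T. mpeval q v = 0}"
  unfolding D quadric_points[OF subspace_imp_cone[OF T(1)] q] ..
 have cD: "cone {v \<in> T. mpeval q v = 0}" by (rule alg_cone_imp_cone[OF alg_cone_quadric[OF T(1) q]])
 let ?S = "vec.span {v \<in> T. mpeval q v = 0}"
 have S: "vec.span (\<Union>D) = ?S" unfolding D' by (rule span_Union_proj_pts[OF cD])
 have ST: "?S \<subseteq> T" by (rule vec.span_minimal) (use T in auto)
 have "?S = T"
 proof (rule ccontr)
  assume ne: "?S \<noteq> T"
  have "\<exists>N u. vec.subspace N \<and> ?S \<subseteq> N \<and> N \<subseteq> T \<and> N \<noteq> T \<and> u \<in> N \<and> u \<noteq> 0"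
  proof (cases "?S = {0}")
   case True
   have "T \<noteq> {0}" using T(2) by auto
   then obtain u where u: "u \<in> T" "u \<noteq> 0" using vec.subspace_0[OF T(1)] by blast
   have "vec.span {u} \<subseteq> T" by (rule vec.span_minimal) (use u T in auto)
   moreover have "vec.dim (vec.span {u}) \<le> 1" using vec.dim_le_card[of "vec.span {u}" "{u}"] by simp
   then have "vec.span {u} \<noteq> T" using T(2) by auto
   moreover have "?S \<subseteq> vec.span {u}" using True vec.span_zero by auto
   ultimately show ?thesis using u vec.span_base[of u "{u}"] by (intro exI[of _ "vec.span {u}"] exI[of _ u]) auto
  next
   case False
   then obtain u where "u \<in> ?S" "u \<noteq> 0" using vec.span_zero by blast
   then show ?thesis using ne ST by (intro exI[of _ ?S] exI[of _ u]) auto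
  qed
  then obtain N u where N: "vec.subspace N" "?S \<subseteq> N" "N \<subseteq> T" "N \<noteq> T" and u: "u \<in> N" "u \<noteq> 0" by blast
  obtain w where w: "w \<in> T" "w \<notin> N" using N by blast
  have const: "mpeval q u = 0 \<and> dir_deriv q u x = 0" if x: "x \<in> T" "x \<notin> N" for x
  proof -
   let ?P = "[:mpeval q x, dir_deriv q u x, mpeval q u:]"
   have nz: "poly ?P \<tau> \<noteq> 0" for \<tau>
   proof
    assume "poly ?P \<tau> = 0"
    then have "mpeval q (1 *s x + \<tau> *s u) = 0"
     unfolding quadratic_form_expand[OF q] by (simp add: power2_eq_square algebra_simps)
    moreover have "1 *s x + \<tau> *s u \<in> T" using x u N T by (intro vec.subspace_add vec.subspace_scale) auto
    ultimately have "1 *s x + \<tau> *s u \<in> ?S" by (intro vec.span_base) auto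
    then have "(1 *s x + \<tau> *s u) - \<tau> *s u \<in> N" using N u by (intro vec.subspace_diff vec.subspace_scale) auto
    then show False using x by simp
   qed
   have "degree ?P = 0" using nz alg_closed_imp_poly_has_root[of ?P] by blast
   then show ?thesis by (auto split: if_splits)
  qed
  have "dir_deriv q u x = 0" if x: "x \<in> T" for x
  proof (cases "x \<in> N")
   case True
   have "w + x \<notin> N" using vec.subspace_diff[OF N(1), of "w + x" x] True w by auto
   then have "dir_deriv q u (w + x) = 0" using const w x vec.subspace_add[OF T(1)] by blast
   then show ?thesis using const[OF w] by (simp add: dir_deriv_addI)
  qed (use const x in blast)
  then show False using smooth u N const[OF w] by blast
 qed
 then show ?thesis using S T by simp
qed

text \<open>On a line contained in a smooth conic the derivative in a direction transversal to the line is a linear form,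
 and its zero is a singular point.\<close>

lemma no_line_in_smooth_conic:
 fixes D :: "('k::alg_closed_field, 'd::finite) point set"
 assumes "smooth_quadric 1 D" "linear_space_dim 1 L" shows "\<not> L \<subseteq> D"
proof
 assume LD: "L \<subseteq> D"
 obtain T q where q: "q \<in> forms 2" and T: "vec.subspace T" "vec.dim T = 1 + 2"
  and D: "D = {p \<in> proj_pts T. \<forall>v\<in>p. mpeval q v = 0}"
  and smooth: "\<forall>v\<in>T. v \<noteq> 0 \<and> mpeval q v = 0 \<longrightarrow> (\<exists>w\<in>T. dir_deriv q v w \<noteq> 0)"
  using assms unfolding smooth_quadric_def by blast
 obtain N where N: "vec.subspace N" "vec.dim N = 2" "L = proj_pts N"
  using assms(2) unfolding linear_space_dim_def by auto
 have ND: "N \<subseteq> {v \<in> T. mpeval q v = 0}"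
  using LD unfolding N D quadric_points[OF subspace_imp_cone[OF T(1)] q, symmetric]
  by (subst (asm) proj_pts_subset_iff) (use N T q in \<open>auto intro: subspace_imp_cone alg_cone_imp_cone alg_cone_quadric\<close>)
 obtain B where B: "B \<subseteq> N" "vec.independent B" "N \<subseteq> vec.span B" "card B = 2"
  using vec.basis_exists[of N] N by metis
 then obtain u v where uv: "B = {u, v}" "u \<noteq> v" by (auto simp: card_2_iff)
 have "T \<noteq> N" using T N by auto
 then obtain w where w: "w \<in> T" "w \<notin> N" using ND by blast
 have wB: "w \<notin> vec.span B" using w vec.span_minimal[OF B(1) N(1)] by blast
 have uvT: "u \<in> T" "v \<in> T" "u \<in> N" "v \<in> N" using B uv ND by auto
 have ind: "vec.independent (insert w B)" using B wB by (simp add: vec.independent_insertI)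
 have "insert w B \<subseteq> T" using uv uvT w by auto
 moreover have "card (insert w B) = vec.dim T"
  using B T wB vec.span_base[of w B] uv by (subst card_insert_disjoint) auto
 ultimately have "T \<subseteq> vec.span (insert w B)" using ind by (intro vec.card_ge_dim_independent) auto
 define \<alpha> \<beta> where "\<alpha> = (if dir_deriv q u w = 0 then 1 else - dir_deriv q v w)"
  and "\<beta> = (if dir_deriv q u w = 0 then 0 else dir_deriv q u w)"
 define x where "x = \<alpha> *s u + \<beta> *s v"
 have "x \<noteq> 0"
 proof
  assume x0: "x = 0"
  show False
  proof (cases "\<beta> = 0")
   case True
   then have "u = 0" using x0 by (simp add: x_def \<alpha>_def \<beta>_def split: if_splits)
   then show False using B(2) uv vec.dependent_zero by auto
  next
   case False
   have "\<beta> *s v = x - \<alpha> *s u" unfolding x_def by simp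
   then have "inverse \<beta> *s (\<beta> *s v) = inverse \<beta> *s (- (\<alpha> *s u))" unfolding x0 by simp
   then have "v = (inverse \<beta> * (- \<alpha>)) *s u" using False by (simp add: vec.scale_minus_right)
   then have "v \<in> vec.span {u}" unfolding mem_span_singleton by (rule exI)
   moreover have "B - {v} = {u}" using uv by auto
   ultimately have "v \<in> vec.span (B - {v})" by (simp only:)
   moreover have "v \<in> B" using uv by simp
   ultimately have "vec.dependent B" unfolding vec.dependent_def by (rule bexI)
   then show False using B(2) by contradiction
  qed
 qed
 moreover have xN: "x \<in> N" unfolding x_def using uvT N(1) by (intro vec.subspace_add vec.subspace_scale)
 then have "x \<in> T" "mpeval q x = 0" using ND by auto
 moreover have "dir_deriv q x y = 0" if y: "y \<in> T" for y
 proof -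
  have q0: "mpeval q z = 0" if "z \<in> N" for z using that ND by blast
  have N0: "dir_deriv q x z = 0" if "z \<in> N" for z
   unfolding dir_deriv_polar[OF q] using q0[OF that] q0[OF xN] q0[OF vec.subspace_add[OF N(1) xN that]] by simp
  have "dir_deriv q x w = \<alpha> * dir_deriv q w u + \<beta> * dir_deriv q w v"
   unfolding dir_deriv_form_commute[OF q, of x w] unfolding x_def by (simp add: dir_deriv_addI dir_deriv_scaleI)
  also have "\<dots> = 0" unfolding dir_deriv_form_commute[OF q, of w u] dir_deriv_form_commute[OF q, of w v] by (simp add: \<alpha>_def \<beta>_def)
  finally have "dir_deriv q x w = 0" .
  moreover have "y \<in> vec.span (insert w B)" using y \<open>T \<subseteq> vec.span (insert w B)\<close> by blast
  then obtain c where "y - c *s w \<in> vec.span B" by (auto simp: vec.span_insert)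
  then have "y - c *s w \<in> N" using vec.span_minimal[OF B(1) N(1)] by blast
  then have "dir_deriv q x (y - c *s w) = 0" by (rule N0)
  ultimately have "dir_deriv q x ((y - c *s w) + c *s w) = 0" unfolding dir_deriv_addI dir_deriv_scaleI by simp
  then show ?thesis by simp
 qed
 ultimately show False using smooth by blast
qed

definition zero_pts :: "('k::field, 'd::finite) mpoly set \<Rightarrow> ('k, 'd) point set" where
 "zero_pts J = {p \<in> proj_space. \<forall>f\<in>J. \<forall>v\<in>p. v \<noteq> 0 \<longrightarrow> mpeval f v = 0}"

text \<open>The zero vector imposes no condition: a polynomial vanishing on a point vanishes at zero.\<close>

lemma zero_pts_vanishing_ideal:
 assumes "Y \<subseteq> proj_space" shows "zero_pts (vanishing_ideal Y) = zclosure Y"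
proof
 show "zclosure Y \<subseteq> zero_pts (vanishing_ideal Y)" by (auto simp: zclosure_def zero_pts_def)
 show "zero_pts (vanishing_ideal Y) \<subseteq> zclosure Y"
 proof
  fix p assume p: "p \<in> zero_pts (vanishing_ideal Y)"
  then obtain u where u: "u \<noteq> 0" "p = vec.span {u}" by (auto simp: zero_pts_def elim: proj_ptsE)
  have "Y \<noteq> {}"
  proof
   assume "Y = {}"
   then have "1 \<in> vanishing_ideal Y" by (simp add: vanishing_ideal_def)
   then show False using p u vec.span_base[of u "{u}"] by (force simp: zero_pts_def)
  qed
  then obtain y where y: "y \<in> Y" by blast
  then obtain w where "y = vec.span {w}" using assms by (blast elim: proj_ptsE)
  then have "0 \<in> y" by (simp add: vec.span_zero)
  note y = y this
  have "mpeval f v = 0" if "f \<in> vanishing_ideal Y" "v \<in> p" for f v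
   using that p y by (cases "v = 0") (auto simp: zero_pts_def vanishing_ideal_def)
  then show "p \<in> zclosure Y" using p by (auto simp: zclosure_def zero_pts_def)
 qed
qed

lemma zclosure_idem: "Y \<subseteq> proj_space \<Longrightarrow> zclosure (zclosure Y) = zclosure Y"
proof
 assume "Y \<subseteq> proj_space"
 show "zclosure (zclosure Y) \<subseteq> zclosure Y"
 proof
  fix p assume p: "p \<in> zclosure (zclosure Y)"
  have "f \<in> vanishing_ideal (zclosure Y)" if "f \<in> vanishing_ideal Y" for f
   using that by (auto simp: zclosure_def vanishing_ideal_def)
  then show "p \<in> zclosure Y" using p by (auto simp: zclosure_def)
 qed
qed (rule subset_zclosure, auto simp: zclosure_def)

lemma zero_pts_double_hyperplane:
 assumes J: "is_double_hyperplane J E M" and M: "M \<subseteq> proj_space" "zclosure M = M"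
 shows "zero_pts J = E"
proof -
 obtain l where E: "E = {p \<in> M. \<forall>v\<in>p. mpeval l v = 0}" and l: "l \<in> forms 1"
  and Jl: "J = saturate (mpideal.span (vanishing_ideal M \<union> {l ^ 2}))"
  using J unfolding is_double_hyperplane_def by blast
 have sub: "vanishing_ideal M \<union> {l ^ 2} \<subseteq> J"
 proof
  fix f assume "f \<in> vanishing_ideal M \<union> {l ^ 2}"
  then have "g * f \<in> mpideal.span (vanishing_ideal M \<union> {l ^ 2})" for g
   by (intro mpideal.span_scale mpideal.span_base)
  then show "f \<in> J" unfolding Jl saturate_def by blast
 qed
 show ?thesis
 proof
  show "zero_pts J \<subseteq> E"
  proof
   fix p assume p: "p \<in> zero_pts J"
   then have "p \<in> zero_pts (vanishing_ideal M)" using sub by (auto simp: zero_pts_def)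
   then have "p \<in> M" unfolding zero_pts_vanishing_ideal[OF M(1)] M(2) .
   moreover have "mpeval l v = 0" if v: "v \<in> p" for v
   proof (cases "v = 0")
    case True
    then show ?thesis using mpeval_homogeneous[OF l, of 0 0] by simp
   next
    case False
    have "l ^ 2 \<in> J" using sub by blast
    then have "mpeval (l ^ 2) v = 0" using p v False unfolding zero_pts_def by blast
    then show ?thesis by simp
   qed
   ultimately show "p \<in> E" unfolding E by blast
  qed
  show "E \<subseteq> zero_pts J"
  proof
   fix p assume p: "p \<in> E"
   have "mpeval f v = 0" if f: "f \<in> J" and v: "v \<in> p" "v \<noteq> 0" for f v
   proof -
    obtain e where e: "\<forall>g\<in>forms e. g * f \<in> mpideal.span (vanishing_ideal M \<union> {l ^ 2})"
     using f unfolding Jl saturate_def by blast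
    obtain g where g: "g \<in> forms e" "mpeval g v \<noteq> 0" using obtain_nonvanishing_form[OF v(2)] .
    have "mpideal.span (vanishing_ideal M \<union> {l ^ 2}) \<subseteq> {h. mpeval h v = 0}"
    proof (rule mpideal.span_minimal)
     show "mpideal.subspace {h. mpeval h v = 0}" by (auto simp: mpideal.subspace_def)
     show "vanishing_ideal M \<union> {l ^ 2} \<subseteq> {h. mpeval h v = 0}"
      using p v unfolding E by (auto simp: vanishing_ideal_def)
    qed
    then have "mpeval (g * f) v = 0" using e g by blast
    then show ?thesis using g by simp
   qed
   then show "p \<in> zero_pts J" using p M unfolding zero_pts_def E by blast
  qed
 qed
qed

lemma lin_span_points: "lin_span Y \<subseteq> proj_space"
 unfolding lin_span_def by (rule proj_pts_mono) simp

lemma join_points: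
 assumes "Y \<subseteq> proj_space" "Z \<subseteq> proj_space" shows "join Y Z \<subseteq> proj_space"
 using assms by (auto simp: join_def zclosure_def)

lemma zclosure_join:
 assumes "Y \<subseteq> proj_space" "Z \<subseteq> proj_space" "zclosure Y = Y" "zclosure Z = Z"
 shows "zclosure (join Y Z) = join Y Z"
proof -
 have "\<Union>{lin_span {y, z} | y z. y \<in> Y \<and> z \<in> Z \<and> y \<noteq> z} \<subseteq> proj_space"
  using lin_span_points by blast
 then show ?thesis using assms by (simp add: join_def zclosure_idem)
qed

lemma span_Union_join:
 assumes YZ: "Y \<subseteq> proj_space" "Z \<subseteq> proj_space" "Y \<inter> Z = {}"
 shows "vec.span (\<Union>(join Y Z)) = vec.span (\<Union>Y \<union> \<Union>Z)"
proof (cases "Y = {} \<or> Z = {}")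
 case False
 let ?K = "\<Union>{lin_span {y, z} | y z. y \<in> Y \<and> z \<in> Z \<and> y \<noteq> z}"
 have K: "?K \<subseteq> proj_space" using lin_span_points by blast
 have U: "\<Union>(lin_span {y, z}) = vec.span (y \<union> z)" if yz: "y \<in> Y" "z \<in> Z" for y z
 proof -
  obtain v where v: "v \<noteq> 0" "y = vec.span {v}" using YZ(1) yz by (blast elim: proj_ptsE)
  then have "v \<in> vec.span (y \<union> z)" using vec.span_base[of v "{v}"] by (auto intro: vec.span_base)
  then have "vec.span (y \<union> z) \<noteq> {0}" using v by auto
  then show ?thesis unfolding lin_span_def by (simp add: Union_proj_pts[OF subspace_imp_cone])
 qed
 have "vec.span (\<Union>(join Y Z)) = vec.span (\<Union>?K)"
  using False span_Union_zclosure[OF K] by (simp add: join_def)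
 also have "\<dots> = vec.span (\<Union>Y \<union> \<Union>Z)"
 proof
  have "\<Union>?K \<subseteq> vec.span (\<Union>Y \<union> \<Union>Z)"
  proof
   fix x assume "x \<in> \<Union>?K"
   then obtain y z where yz: "y \<in> Y" "z \<in> Z" "x \<in> \<Union>(lin_span {y, z})" by blast
   have "vec.span (y \<union> z) \<subseteq> vec.span (\<Union>Y \<union> \<Union>Z)" using yz by (intro vec.span_mono) blast
   then show "x \<in> vec.span (\<Union>Y \<union> \<Union>Z)" using yz U by blast
  qed
  then show "vec.span (\<Union>?K) \<subseteq> vec.span (\<Union>Y \<union> \<Union>Z)" by (rule vec.span_minimal) simp
  have "\<Union>Y \<union> \<Union>Z \<subseteq> \<Union>?K"
  proof
   fix x assume "x \<in> \<Union>Y \<union> \<Union>Z"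
   then obtain y z where yz: "y \<in> Y" "z \<in> Z" "x \<in> y \<union> z" using False by blast
   then have "x \<in> \<Union>(lin_span {y, z})" unfolding U[OF yz(1,2)] by (intro vec.span_base)
   moreover have "y \<noteq> z" using yz YZ by blast
   ultimately show "x \<in> \<Union>?K" using yz by blast
  qed
  then show "vec.span (\<Union>Y \<union> \<Union>Z) \<subseteq> vec.span (\<Union>?K)" by (rule vec.span_mono)
 qed
 finally show ?thesis .
qed (auto simp: join_def)

lemma subset_zclosure_join:
 assumes "Y \<subseteq> proj_space" "Z \<subseteq> proj_space" "Y \<inter> Z = {}"
 shows "Z \<subseteq> zclosure (join Y Z)"
proof (cases "Y = {} \<or> Z = {}")
 case True
 then show ?thesis using assms subset_zclosure[of Z] by (auto simp: join_def)
next
 case False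
 show ?thesis
 proof
  fix z assume z: "z \<in> Z"
  obtain y where y: "y \<in> Y" using False by blast
  obtain v where v: "v \<noteq> 0" "z = vec.span {v}" using assms(2) z by (blast elim: proj_ptsE)
  then have "v \<in> vec.span (\<Union>{y, z})" using vec.span_base[of v "{v}"] by (auto intro: vec.span_base)
  then have "z \<in> lin_span {y, z}" using v unfolding lin_span_def proj_pts_def by blast
  moreover have "y \<noteq> z" using y z assms by blast
  ultimately have "z \<in> \<Union>{lin_span {y, z} | y z. y \<in> Y \<and> z \<in> Z \<and> y \<noteq> z}" using y z by blast
  moreover have "\<Union>{lin_span {y, z} | y z. y \<in> Y \<and> z \<in> Z \<and> y \<noteq> z} \<subseteq> join Y Z"
   using False lin_span_points by (simp add: join_def) (rule subset_zclosure, blast)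
  ultimately show "z \<in> zclosure (join Y Z)" using subset_zclosure[OF join_points[OF assms(1,2)]] by blast
 qed
qed

context scroll begin

section \<open>The strata are disjoint\<close>

definition support_dim :: "('k, 'd) mpoly set \<Rightarrow> nat" where
 "support_dim J = vec.dim (vec.span (\<Union>(zero_pts J)))"

lemma Vt_points: "Vt \<subseteq> proj_space" by (rule proj_pts_mono) simp

lemma Vt_closed: "zclosure Vt = Vt"
 by (rule zclosure_proj_pts[OF subspace_imp_alg_cone[OF subspace_vertex]])

lemma span_Union_L0:
 assumes "D \<subseteq> proj_pts L0" shows "vec.span (\<Union>D) \<subseteq> L0"
proof (rule vec.span_minimal[OF _ subspace_L0])
 show "\<Union>D \<subseteq> L0" using assms mem_point_of_cone[OF subspace_imp_cone[OF subspace_L0]] by blast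
qed

lemma Vt_disjoint: assumes "D \<subseteq> proj_pts L0" shows "Vt \<inter> D = {}"
proof -
 have "p \<notin> D" if p: "p \<in> Vt" for p
 proof
  assume "p \<in> D"
  then have pL: "p \<in> proj_pts L0" using assms by blast
  obtain v where v: "v \<in> vertex" "v \<noteq> 0" "p = vec.span {v}" using p by (rule proj_ptsE)
  then have "v \<in> L0" using pL mem_proj_pts[OF subspace_imp_cone[OF subspace_L0]] by blast
  then show False using v vertex_cap_L0 by blast
 qed
 then show ?thesis by blast
qed

text \<open>The vertex and \<open>L0\<close> are complementary.\<close>

lemma dim_join_vertex:
 assumes D: "D \<subseteq> proj_pts L0"
 shows "vec.dim (vec.span (\<Union>(join Vt D))) = vec.dim vertex + vec.dim (vec.span (\<Union>D))"
proof -
 let ?D = "vec.span (\<Union>D)"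
 have "D \<subseteq> proj_space" using D proj_pts_mono[of L0 UNIV] by blast
 then have "vec.span (\<Union>(join Vt D)) = vec.span (\<Union>Vt \<union> \<Union>D)"
  by (rule span_Union_join[OF Vt_points _ Vt_disjoint[OF D]])
 also have "\<dots> = vec.span (vec.span (\<Union>Vt) \<union> vec.span (\<Union>D))" by (rule span_span_union[symmetric])
 also have "vec.span (\<Union>Vt) = vertex"
  unfolding span_Union_proj_pts[OF subspace_imp_cone[OF subspace_vertex]] using subspace_vertex by simp
 also have "vec.span (vertex \<union> ?D) = {x + y | x y. x \<in> vertex \<and> y \<in> ?D}"
  unfolding vec.span_Un using subspace_vertex by (simp add: vec.span_span vec.span_eq_iff[THEN iffD2])
 finally have "vec.dim (vec.span (\<Union>(join Vt D))) = vec.dim {x + y | x y. x \<in> vertex \<and> y \<in> ?D}" by simp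
 moreover have "vec.dim {x + y | x y. x \<in> vertex \<and> y \<in> ?D} + vec.dim (vertex \<inter> ?D) = vec.dim vertex + vec.dim ?D"
  by (rule vec.dim_sums_Int[OF subspace_vertex vec.subspace_span])
 moreover have "vertex \<inter> ?D \<subseteq> {0}" using vertex_cap_L0 span_Union_L0[OF D] by blast
 then have "vec.dim (vertex \<inter> ?D) = 0" by (simp add: vec.dim_eq_0)
 ultimately show ?thesis by simp
qed

lemma support_dim_join:
 assumes D: "D \<subseteq> proj_pts L0"
 shows "support_dim (vanishing_ideal (join Vt D)) = vec.dim vertex + vec.dim (vec.span (\<Union>D))"
proof -
 have "D \<subseteq> proj_space" using D proj_pts_mono[of L0 UNIV] by blast
 then have J: "join Vt D \<subseteq> proj_space" by (rule join_points[OF Vt_points])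
 show ?thesis unfolding support_dim_def zero_pts_vanishing_ideal[OF J] span_Union_zclosure[OF J]
  by (rule dim_join_vertex[OF D])
qed

lemma support_dim_SL_empty:
 assumes "p \<in> SL_empty Vt X0" shows "support_dim (secant_locus (join Vt X0) p) = vec.dim vertex"
proof -
 have "is_double_hyperplane (secant_locus (join Vt X0) p) Vt (lin_span (Vt \<union> {p}))"
  using assms unfolding SL_empty_def by blast
 moreover have "zclosure (lin_span (Vt \<union> {p})) = lin_span (Vt \<union> {p})"
  unfolding lin_span_def by (rule zclosure_proj_pts[OF subspace_imp_alg_cone[OF vec.subspace_span]])
 ultimately have "zero_pts (secant_locus (join Vt X0) p) = Vt"
  by (rule zero_pts_double_hyperplane[OF _ lin_span_points])
 then show ?thesis
  by (simp add: support_dim_def span_Union_proj_pts[OF subspace_imp_cone[OF subspace_vertex]])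
qed

lemma linear_space_dim_facts:
 assumes "linear_space_dim e L"
 shows "vec.dim (vec.span (\<Union>L)) = e + 1" "zclosure L = L" "L \<subseteq> proj_space"
proof -
 obtain T where T: "vec.subspace T" "vec.dim T = e + 1" "L = proj_pts T"
  using assms unfolding linear_space_dim_def by blast
 show "vec.dim (vec.span (\<Union>L)) = e + 1"
  unfolding T(3) span_Union_proj_pts[OF subspace_imp_cone[OF T(1)]] using T(2) by simp
 show "zclosure L = L" unfolding T(3) by (rule zclosure_proj_pts[OF subspace_imp_alg_cone[OF T(1)]])
 show "L \<subseteq> proj_space" unfolding T(3) by (rule proj_pts_mono) simp
qed

lemma dim_span_point:
 assumes "p \<in> proj_space" shows "vec.dim (vec.span p) = 1"
proof -
 obtain v where v: "v \<noteq> 0" "p = vec.span {v}" using assms by (blast elim: proj_ptsE)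
 have "vec.independent {v}" using v by simp
 then have "vec.dim (vec.span {v}) = card {v}" by (rule vec.dim_span_eq_card_independent)
 then show ?thesis by (simp add: v)
qed

lemma dim_span_two_points:
 assumes "p \<in> proj_space" "p' \<in> proj_space" "p \<noteq> p'" shows "vec.dim (vec.span (p \<union> p')) = 2"
proof -
 obtain u v where u: "u \<noteq> 0" "p = vec.span {u}" and v: "v \<noteq> 0" "p' = vec.span {v}"
  using assms by (blast elim: proj_ptsE)
 have "v \<notin> vec.span {u}"
 proof
  assume "v \<in> vec.span {u}"
  then obtain c where c: "v = c *s u" by (auto simp: mem_span_singleton)
  then have "c \<noteq> 0" using v by auto
  then show False using c v u assms(3) span_singleton_eq_iff[OF v(1), of u] by blast
 qed
 then have "vec.independent {v, u}" using u by (simp add: vec.independent_insert)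
 then have "vec.dim (vec.span {v, u}) = card {v, u}" by (rule vec.dim_span_eq_card_independent)
 moreover have "v \<noteq> u" using \<open>v \<notin> vec.span {u}\<close> vec.span_base[of u "{u}"] by auto
 moreover have "vec.span (p \<union> p') = vec.span {v, u}"
  unfolding u v span_span_union by (simp add: insert_commute)
 ultimately show ?thesis by simp
qed

lemma support_dim_SL_double_point:
 assumes "p \<in> SL_double_point Vt X0" shows "support_dim (secant_locus (join Vt X0) p) = vec.dim vertex + 1"
proof -
 obtain L x where L: "linear_space_dim 1 L" "L \<subseteq> lin_span X0" "x \<in> L"
  and d: "is_double_hyperplane (secant_locus (join Vt X0) p) (join Vt {x}) (join Vt L)"
  using assms unfolding SL_double_point_def by blast
 note l = linear_space_dim_facts[OF L(1)]
 have x: "x \<in> proj_space" "{x} \<subseteq> proj_pts L0" using L l unfolding lin_span_X0 by blast+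
 have "zero_pts (secant_locus (join Vt X0) p) = join Vt {x}"
  by (rule zero_pts_double_hyperplane[OF d join_points[OF Vt_points l(3)] zclosure_join[OF Vt_points l(3) Vt_closed l(2)]])
 then show ?thesis unfolding support_dim_def using dim_join_vertex[OF x(2)] dim_span_point[OF x(1)] by simp
qed

lemma support_dim_SL_two_points:
 assumes "p \<in> SL_two_points Vt X0" shows "support_dim (secant_locus (join Vt X0) p) = vec.dim vertex + 2"
proof -
 obtain L x y where L: "L \<subseteq> lin_span X0" "x \<in> L" "y \<in> L" "x \<noteq> y" "linear_space_dim 1 L"
  and s: "secant_locus (join Vt X0) p = vanishing_ideal (join Vt {x, y})"
  using assms unfolding SL_two_points_def by blast
 have x: "x \<in> proj_space" "y \<in> proj_space" "{x, y} \<subseteq> proj_pts L0"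
  using L linear_space_dim_facts(3)[OF L(5)] unfolding lin_span_X0 by blast+
 show ?thesis unfolding s support_dim_join[OF x(3)] using dim_span_two_points[OF x(1,2) L(4)] by simp
qed

text \<open>Two distinct coplanar lines span their plane.\<close>

lemma support_dim_SL_two_lines:
 assumes "p \<in> SL_two_lines Vt X0" shows "support_dim (secant_locus (join Vt X0) p) = vec.dim vertex + 3"
proof -
 obtain L L' P where L: "linear_space_dim 1 L" "linear_space_dim 1 L'" "L \<subseteq> lin_span X0" "L' \<subseteq> lin_span X0"
  "L \<noteq> L'" and P: "linear_space_dim 2 P" "L \<subseteq> P" "L' \<subseteq> P"
  and s: "secant_locus (join Vt X0) p = vanishing_ideal (join Vt (L \<union> L'))"
  using assms unfolding SL_two_lines_def by blast
 have LL: "L \<union> L' \<subseteq> proj_pts L0" using L unfolding lin_span_X0 by blast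
 obtain T T' where T: "vec.subspace T" "vec.dim T = 2" "L = proj_pts T" "vec.subspace T'" "vec.dim T' = 2" "L' = proj_pts T'"
  using L(1,2) unfolding linear_space_dim_def by auto
 let ?S = "vec.span (\<Union>(L \<union> L'))"
 have "T \<noteq> {0}" "T' \<noteq> {0}" using T by auto
 then have TS: "T \<subseteq> ?S" "T' \<subseteq> ?S"
  using Union_proj_pts[OF subspace_imp_cone[OF T(1)]] Union_proj_pts[OF subspace_imp_cone[OF T(4)]] T(3,6)
   vec.span_superset[of "\<Union>(L \<union> L')"] by auto
 have "vec.dim ?S \<le> vec.dim (vec.span (\<Union>P))" using P by (intro vec.dim_subset vec.span_mono) blast
 then have "vec.dim ?S \<le> 3" using linear_space_dim_facts(1)[OF P(1)] by simp
 moreover have "\<not> vec.dim ?S \<le> 2"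
 proof
  assume "vec.dim ?S \<le> 2"
  then have "vec.dim T \<ge> vec.dim ?S" "vec.dim T' \<ge> vec.dim ?S" using T by linarith+
  note le = this
  have "T = ?S" by (rule vec.subspace_dim_equal[OF T(1) vec.subspace_span TS(1) le(1)])
  moreover have "T' = ?S" by (rule vec.subspace_dim_equal[OF T(4) vec.subspace_span TS(2) le(2)])
  ultimately have "L = L'" unfolding T(3,6) by (rule arg_cong[OF trans[OF _ sym]])
  then show False using L(5) by contradiction
 qed
 ultimately have "vec.dim ?S = 3" by simp
 then show ?thesis unfolding s support_dim_join[OF LL] by simp
qed

lemma support_dim_SL_smooth:
 assumes "smooth_quadric e D" "D \<subseteq> lin_span X0"
  "secant_locus (join Vt X0) p = vanishing_ideal (join Vt D)"
 shows "support_dim (secant_locus (join Vt X0) p) = vec.dim vertex + (e + 2)"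
 unfolding assms(3) support_dim_join[OF assms(2)[unfolded lin_span_X0]] dim_span_smooth_quadric[OF assms(1)] ..

lemma polyfun_pr: "polyfun (\<lambda>v. pr v $ r)"
 unfolding pr_def mk_def sum_component vector_smult_component
 by (intro polyfun_sum polyfun_mult polyfun_functional xi polyfun_const) auto

text \<open>The cone over the conic is closed and meets \<open>L0\<close> in the conic itself, which would contain the lines.\<close>

lemma SL_two_lines_conic_disjoint: "SL_two_lines Vt X0 \<inter> SL_conic Vt X0 = {}"
proof -
 have False if p: "p \<in> SL_two_lines Vt X0" "p \<in> SL_conic Vt X0" for p
 proof -
  obtain L L' where L: "linear_space_dim 1 L" "L \<subseteq> lin_span X0" "L' \<subseteq> lin_span X0"
   and s: "secant_locus (join Vt X0) p = vanishing_ideal (join Vt (L \<union> L'))"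
   using p(1) unfolding SL_two_lines_def by blast
  obtain D where D: "smooth_quadric 1 D" "D \<subseteq> proj_pts L0"
   and s': "secant_locus (join Vt X0) p = vanishing_ideal (join Vt D)"
   using p(2) unfolding SL_conic_def lin_span_X0 by blast
  obtain T q where q: "q \<in> forms 2" and T: "vec.subspace T"
   and Dq: "D = {p \<in> proj_pts T. \<forall>v\<in>p. mpeval q v = 0}"
   using D(1) unfolding smooth_quadric_def by blast
  define C where "C = {v \<in> T. mpeval q v = 0}"
  have C: "alg_cone C" "D = proj_pts C"
   using alg_cone_quadric[OF T q] quadric_points[OF subspace_imp_cone[OF T] q] Dq by (simp_all add: C_def)
  then have "C \<subseteq> L0"
   using D(2) proj_pts_subset_iff[OF alg_cone_imp_cone[OF C(1)] subspace_imp_cone[OF subspace_L0]] by blast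
  define S where "S = {v. pr v \<in> C}"
  obtain F where F: "\<forall>f\<in>F. polyfun f" "C = {v. \<forall>f\<in>F. f v = 0}" using C(1) unfolding alg_cone_def by blast
  have S: "alg_cone S"
  proof (rule alg_coneI[where A = F and f = "\<lambda>f v. f (pr v)"])
   have "pr 0 = 0" using pr_scale[of 0 0] by simp
   then show "cone S" using alg_cone_imp_cone[OF C(1)] unfolding S_def cone_def mem_Collect_eq pr_scale by simp
   show "polyfun (\<lambda>v. f (pr v))" if "f \<in> F" for f
    by (rule polyfun_compose[OF bspec[OF F(1) that] polyfun_pr])
   show "S = {v. \<forall>f\<in>F. f (pr v) = 0}" by (simp add: S_def F(2))
  qed
  have "xi_invariant S"
   unfolding xi_invariant_def S_def pr_def by (metis (mono_tags, lifting) mem_Collect_eq mk_cong)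
  moreover have SL: "S \<inter> L0 = C" using \<open>C \<subseteq> L0\<close> mem_L0_iff by (auto simp: S_def)
  ultimately have J: "join Vt D = proj_pts S" using join_vertex[OF S] C(2) by simp
  have Lp: "L \<union> L' \<subseteq> proj_pts L0" "L \<union> L' \<subseteq> proj_space"
   using L proj_pts_mono[of L0 UNIV] unfolding lin_span_X0 by blast+
  have J': "join Vt (L \<union> L') \<subseteq> proj_space" by (rule join_points[OF Vt_points Lp(2)])
  have "zclosure (join Vt (L \<union> L')) = zclosure (join Vt D)"
   using s s' zero_pts_vanishing_ideal[OF J'] zero_pts_vanishing_ideal[of "join Vt D"] J proj_pts_mono[of S UNIV] by simp
  then have "L \<union> L' \<subseteq> proj_pts S"
   using subset_zclosure_join[OF Vt_points Lp(2) Vt_disjoint[OF Lp(1)]] unfolding J zclosure_proj_pts[OF S] by blast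
  have "L \<subseteq> D"
  proof
   fix x assume x: "x \<in> L"
   then have "x \<in> proj_pts S" "x \<in> proj_pts L0" using \<open>L \<union> L' \<subseteq> proj_pts S\<close> Lp by blast+
   then obtain v where v: "v \<in> S" "v \<noteq> 0" "x = vec.span {v}" by (blast elim: proj_ptsE)
   then have "v \<in> L0" using \<open>x \<in> proj_pts L0\<close> mem_proj_pts[OF subspace_imp_cone[OF subspace_L0]] by blast
   then show "x \<in> D" unfolding C(2) using v SL by (auto simp: proj_pts_def)
  qed
  then show False using no_line_in_smooth_conic[OF D(1) L(1)] by contradiction
 qed
 then show ?thesis by blast
qed

text \<open>The regions cover the complement of the scroll, each lies in its stratum, and the strata are disjoint.\<close>

theorem strata:
 "SL_empty Vt X0 = proj_space - proj_pts Wcone"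
 "SL_two_points Vt X0 = proj_pts Wcone - proj_pts Vcone"
 "SL_double_point Vt X0 = proj_pts Vcone - (proj_pts Bcone \<union> proj_pts Ucone)"
 "SL_two_lines Vt X0 = proj_pts Bcone - (proj_pts Acone \<union> proj_pts Xcone)"
 "SL_conic Vt X0 = proj_pts Ucone - proj_pts Bcone"
 "SL_quadric Vt X0 = proj_pts Acone - proj_pts Xcone"
proof -
 note inc = X_subset_B A_subset_B B_subset_V U_subset_V V_subset_W
 have cones: "cone Xcone" "cone Acone" "cone Bcone" "cone Ucone" "cone Vcone" "cone Wcone"
  using alg_cone_X alg_cone_B alg_cone_U alg_cone_V alg_cone_W subspace_A
  by (auto intro: alg_cone_imp_cone subspace_imp_cone)
 define SL :: "nat \<Rightarrow> ('k, 'd) point set" where "SL i = (if i = 0 then SL_empty Vt X0 else if i = 1 then SL_two_points Vt X0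
  else if i = 2 then SL_double_point Vt X0 else if i = 3 then SL_two_lines Vt X0
  else if i = 4 then SL_conic Vt X0 else SL_quadric Vt X0)" for i
 define R where "R i = (if i = 0 then UNIV - Wcone else if i = 1 then Wcone - Vcone
  else if i = 2 then Vcone - (Bcone \<union> Ucone) else if i = 3 then Bcone - (Acone \<union> Xcone)
  else if i = 4 then Ucone - Bcone else Acone - Xcone)" for i :: nat
 have six: "i = 0 \<or> i = 1 \<or> i = 2 \<or> i = 3 \<or> i = 4 \<or> i = 5" if "i < 6" for i :: nat using that by linarith
 have region: "vec.span {w} \<in> SL i" if "w \<in> R i" "i < 6" for i w
  using six[OF that(2)] that(1)
  by (elim disjE) (simp_all add: SL_def R_def region_empty region_two_points region_double_point
    region_two_lines region_conic region_quadric)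
 have quadric: "\<exists>D. smooth_quadric 1 D \<and> D \<subseteq> lin_span X0 \<and> secant_locus (join Vt X0) p = vanishing_ideal (join Vt D)"
  if "p \<in> SL_conic Vt X0" for p using that unfolding SL_conic_def by blast
 have quadric': "\<exists>D. smooth_quadric 2 D \<and> D \<subseteq> lin_span X0 \<and> secant_locus (join Vt X0) p = vanishing_ideal (join Vt D)"
  if "p \<in> SL_quadric Vt X0" for p using that unfolding SL_quadric_def by blast
 have dim: "support_dim (secant_locus (join Vt X0) p) = vec.dim vertex + (if i = 1 then 2 else if i = 2 then 1 else if i = 4 then 3 else if i = 5 then 4 else i)"
  if "p \<in> SL i" "i < 6" for i p
  using six[OF that(2)]
 proof (elim disjE)
  assume "i = 4"
  then show ?thesis using that(1) quadric support_dim_SL_smooth[of 1] by (fastforce simp: SL_def)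
 next
  assume "i = 5"
  then show ?thesis using that(1) quadric' support_dim_SL_smooth[of 2] by (fastforce simp: SL_def)
 qed (use that(1) in \<open>simp_all add: SL_def support_dim_SL_empty support_dim_SL_double_point
    support_dim_SL_two_points support_dim_SL_two_lines\<close>)
 have disj: "i = i'" if p: "p \<in> SL i" "p \<in> SL i'" "i < 6" "i' < 6" for i i' p
 proof (rule ccontr)
  assume ne: "i \<noteq> i'"
  have "(if i = 1 then 2 else if i = 2 then 1 else if i = 4 then 3 else if i = 5 then 4 else i) =
   (if i' = 1 then 2 else if i' = 2 then 1 else if i' = 4 then 3 else if i' = 5 then 4 else i')"
   using dim[OF p(1,3)] dim[OF p(2,4)] by linarith
  then have "i = 3 \<and> i' = 4 \<or> i = 4 \<and> i' = 3"
   using six[OF p(3)] six[OF p(4)] ne by (elim disjE) simp_all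
  then have "p \<in> SL_two_lines Vt X0 \<inter> SL_conic Vt X0" using p(1,2) by (auto simp: SL_def)
  then show False using SL_two_lines_conic_disjoint by blast
 qed
 have cover: "\<exists>i<6. w \<in> R i" if "w \<notin> Xcone" for w
 proof -
  have "w \<in> R 0 \<or> w \<in> R 1 \<or> w \<in> R 2 \<or> w \<in> R 3 \<or> w \<in> R 4 \<or> w \<in> R 5"
   using that by (simp add: R_def) blast
  moreover have "(0 :: nat) < 6" "(1 :: nat) < 6" "(2 :: nat) < 6" "(3 :: nat) < 6" "(4 :: nat) < 6" "(5 :: nat) < 6" by simp_all
  ultimately show ?thesis by blast
 qed
 have out: "\<exists>w. w \<notin> Xcone \<and> w \<noteq> 0 \<and> p = vec.span {w}" if "p \<in> SL i" for p i
 proof -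
  have "p \<in> proj_space - join Vt X0"
   using that by (auto simp: SL_def SL_empty_def SL_two_points_def SL_double_point_def SL_two_lines_def
     SL_conic_def SL_quadric_def split: if_splits)
  then have p: "p \<in> proj_space" "p \<notin> proj_pts Xcone" unfolding join_Vt_X0 by blast+
  from p(1) obtain w where "w \<noteq> 0" "p = vec.span {w}" by (blast elim: proj_ptsE)
  then show ?thesis using p(2) by (auto simp: proj_pts_def)
 qed
 have key: "SL i = {vec.span {w} | w. w \<in> R i \<and> w \<noteq> 0}" if i: "i < 6" for i
 proof (intro equalityI subsetI)
  fix p assume p: "p \<in> SL i"
  then obtain w where w: "w \<notin> Xcone" "w \<noteq> 0" "p = vec.span {w}" using out by blast
  obtain i' where i': "i' < 6" "w \<in> R i'" using cover[OF w(1)] by blast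
  have "vec.span {w} \<in> SL i'" by (rule region[OF i'(2,1)])
  then have "i' = i" using disj[of p i' i] p i i' w by simp
  then show "p \<in> {vec.span {w} | w. w \<in> R i \<and> w \<noteq> 0}" using w i' by blast
 next
  fix p assume "p \<in> {vec.span {w} | w. w \<in> R i \<and> w \<noteq> 0}"
  then show "p \<in> SL i" using region i by blast
 qed
 have diff: "{vec.span {w} | w. w \<in> S - T \<and> w \<noteq> 0} = proj_pts S - proj_pts T" if "cone T" for S T :: "('k ^ 'd) set"
  using mem_proj_pts[OF that] unfolding proj_pts_def by blast
 have un: "proj_pts (S \<union> T) = proj_pts S \<union> proj_pts T" for S T :: "('k ^ 'd) set" by (auto simp: proj_pts_def)
 have cu: "cone (S \<union> T)" if "cone S" "cone T" for S T :: "('k ^ 'd) set" using that by (auto simp: cone_def)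
 show "SL_empty Vt X0 = proj_space - proj_pts Wcone"
  using key[of 0] diff[OF cones(6), of UNIV] by (simp add: SL_def R_def)
 show "SL_two_points Vt X0 = proj_pts Wcone - proj_pts Vcone"
  using key[of 1] diff[OF cones(5), of Wcone] by (simp add: SL_def R_def)
 show "SL_double_point Vt X0 = proj_pts Vcone - (proj_pts Bcone \<union> proj_pts Ucone)"
  using key[of 2] diff[OF cu[OF cones(3,4)], of Vcone] unfolding un by (simp add: SL_def R_def)
 show "SL_two_lines Vt X0 = proj_pts Bcone - (proj_pts Acone \<union> proj_pts Xcone)"
  using key[of 3] diff[OF cu[OF cones(2,1)], of Bcone] unfolding un by (simp add: SL_def R_def)
 show "SL_conic Vt X0 = proj_pts Ucone - proj_pts Bcone"
  using key[of 4] diff[OF cones(3), of Ucone] by (simp add: SL_def R_def)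
 show "SL_quadric Vt X0 = proj_pts Acone - proj_pts Xcone"
  using key[of 5] diff[OF cones(1), of Acone] by (simp add: SL_def R_def)
qed

end

section \<open>Joins, secants and tangents of the scroll\<close>

lemma pcompose_power: "pcompose (p ^ n) q = pcompose p q ^ n"
 by (induction n) (simp_all add: pcompose_1 pcompose_mult)

text \<open>Substitution of \<open>c \<tau>\<close> for \<open>\<tau>\<close>.\<close>

lemma dpsi_scale: "dpsi a s t (c * s') (c * t') j = c * dpsi a s t s' t' j"
proof -
 have "psi_poly a s t (c * s') (c * t') j = pcompose (psi_poly a s t s' t' j) [:0, c:]"
  unfolding psi_poly_def pcompose_mult pcompose_power by (simp add: pcompose_pCons mult.commute)
 then show ?thesis unfolding dpsi_def by (simp add: coeff_pcompose_linear)
qed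

context scroll begin

definition phi :: "nat \<Rightarrow> 'k \<Rightarrow> 'k \<Rightarrow> 'k ^ 'd" where
 "phi i s t = (\<Sum>j\<le>a i. (s ^ (a i - j) * t ^ j) *s b i j)"

text \<open>The cone over the subscroll with index set \<open>J\<close>, described by coordinates.\<close>

definition SCone :: "nat set \<Rightarrow> ('k ^ 'd) set" where
 "SCone J = {mk (\<lambda>i j. (if i \<in> J then c i else 0) * psi (a i) s t j) | c s t. (s, t) \<noteq> (0, 0)}"

lemma mk_eq_sum_phi:
 assumes "J \<subseteq> {1..n}"
 shows "mk (\<lambda>i j. (if i \<in> J then c i else 0) * psi (a i) s t j) = (\<Sum>i\<in>J. c i *s phi i s t)"
proof -
 have "mk (\<lambda>i j. (if i \<in> J then c i else 0) * psi (a i) s t j) = (\<Sum>i\<in>{1..n}. if i \<in> J then c i *s phi i s t else 0)"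
  unfolding mk_def phi_def by (intro sum.cong refl) (simp add: psi_def vec.scale_sum_right)
 also have "\<dots> = (\<Sum>i\<in>{1..n} \<inter> J. c i *s phi i s t)" by (simp add: sum.inter_restrict)
 also have "{1..n} \<inter> J = J" using assms by blast
 finally show ?thesis .
qed

lemma subscroll_phi:
 assumes J: "J \<subseteq> {1..n}" shows "subscroll phi J = proj_pts (SCone J)"
proof -
 have fin: "finite J" using J finite_subset by blast
 have span: "vec.span {phi i s t | i. i \<in> J} = {mk (\<lambda>i j. (if i \<in> J then c i else 0) * psi (a i) s t j) | c. True}" for s t
 proof
  show "vec.span {phi i s t | i. i \<in> J} \<subseteq> {mk (\<lambda>i j. (if i \<in> J then c i else 0) * psi (a i) s t j) | c. True}"
  proof (rule vec.span_minimal)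
   show "{phi i s t | i. i \<in> J} \<subseteq> {mk (\<lambda>i j. (if i \<in> J then c i else 0) * psi (a i) s t j) | c. True}"
   proof
    fix x assume "x \<in> {phi i s t | i. i \<in> J}"
    then obtain i where i: "i \<in> J" "x = phi i s t" by blast
    have "x = (\<Sum>i'\<in>J. (if i' = i then 1 else 0) *s phi i' s t)"
     using i fin by (simp add: if_distrib[of "\<lambda>c. c *s _"] sum.delta cong: if_cong)
    then show "x \<in> {mk (\<lambda>i j. (if i \<in> J then c i else 0) * psi (a i) s t j) | c. True}"
     unfolding mk_eq_sum_phi[OF J] by (intro CollectI exI conjI TrueI)
   qed
   show "vec.subspace {mk (\<lambda>i j. (if i \<in> J then c i else 0) * psi (a i) s t j) | c. True}"
    unfolding vec.subspace_def
   proof (intro conjI ballI allI)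
    show "0 \<in> {mk (\<lambda>i j. (if i \<in> J then c i else 0) * psi (a i) s t j) | c. True}"
     unfolding mk_eq_sum_phi[OF J] by (intro CollectI exI[of _ "\<lambda>_. 0"]) simp
    fix x y c assume "x \<in> {mk (\<lambda>i j. (if i \<in> J then c i else 0) * psi (a i) s t j) | c. True}"
    then obtain d where d: "x = (\<Sum>i\<in>J. d i *s phi i s t)" unfolding mk_eq_sum_phi[OF J] by blast
    show "c *s x \<in> {mk (\<lambda>i j. (if i \<in> J then c i else 0) * psi (a i) s t j) | c. True}"
     unfolding mk_eq_sum_phi[OF J] d by (intro CollectI exI[of _ "\<lambda>i. c * d i"]) (simp add: vec.scale_sum_right)
    assume "y \<in> {mk (\<lambda>i j. (if i \<in> J then c i else 0) * psi (a i) s t j) | c. True}"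
    then obtain e where e: "y = (\<Sum>i\<in>J. e i *s phi i s t)" unfolding mk_eq_sum_phi[OF J] by blast
    show "x + y \<in> {mk (\<lambda>i j. (if i \<in> J then c i else 0) * psi (a i) s t j) | c. True}"
     unfolding mk_eq_sum_phi[OF J] d e
     by (intro CollectI exI[of _ "\<lambda>i. d i + e i"]) (simp add: vec.scale_left_distrib sum.distrib)
   qed
  qed
  show "{mk (\<lambda>i j. (if i \<in> J then c i else 0) * psi (a i) s t j) | c. True} \<subseteq> vec.span {phi i s t | i. i \<in> J}"
  proof
   fix x assume "x \<in> {mk (\<lambda>i j. (if i \<in> J then c i else 0) * psi (a i) s t j) | c. True}"
   then obtain c where x: "x = (\<Sum>i\<in>J. c i *s phi i s t)" unfolding mk_eq_sum_phi[OF J] by blast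
   show "x \<in> vec.span {phi i s t | i. i \<in> J}"
    unfolding x by (intro vec.span_sum vec.span_scale vec.span_base) blast
  qed
 qed
 show ?thesis unfolding subscroll_def span SCone_def proj_pts_def by fastforce
qed

lemma SConeI: "(s, t) \<noteq> (0, 0) \<Longrightarrow> v = mk (\<lambda>i j. (if i \<in> J then c i else 0) * psi (a i) s t j) \<Longrightarrow> v \<in> SCone J"
 unfolding SCone_def by blast

lemma SCone_X0: "SCone {1..n} = Xcone \<inter> L0"
 proof (intro equalityI subsetI)
  fix v assume "v \<in> SCone {1..n}"
  then obtain c s t where v: "v = mk (\<lambda>i j. (if i \<in> {1..n} then c i else 0) * psi (a i) s t j)" unfolding SCone_def by blast
  show "v \<in> Xcone \<inter> L0" unfolding v by (intro IntI mk_psi_00_in_X mk_in_L0)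
 next
  fix v assume v: "v \<in> Xcone \<inter> L0"
  then obtain s t c where c: "(s, t) \<noteq> (0, 0)" "\<forall>i\<in>{1..n}. \<forall>j\<le>a i. \<xi> i j v = c i * psi (a i) s t j"
   using mem_X_iff by auto
  have "v = pr v" using v mem_L0_iff by simp
  also have "\<dots> = mk (\<lambda>i j. (if i \<in> {1..n} then c i else 0) * psi (a i) s t j)"
   unfolding pr_def by (rule mk_cong) (use c in simp)
  finally show "v \<in> SCone {1..n}" by (rule SConeI[OF c(1)])
 qed

lemma subscroll_X0: "subscroll phi {1..n} = X0"
 unfolding SCone_X0[symmetric] by (rule subscroll_phi) simp

lemma cone_SCone: "cone (SCone J)"
 unfolding cone_def
proof (intro conjI allI ballI)
 have "0 = mk (\<lambda>i j. (if i \<in> J then (\<lambda>_. 0) i else 0) * psi (a i) 1 0 j)"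
  unfolding mk_zero[symmetric] by (rule mk_cong) simp
 then show "0 \<in> SCone J" by (rule SConeI[rotated]) simp
 fix e v assume "v \<in> SCone J"
 then obtain c s t where v: "(s, t) \<noteq> (0, 0)" "v = mk (\<lambda>i j. (if i \<in> J then c i else 0) * psi (a i) s t j)"
  unfolding SCone_def by blast
 have "e *s v = mk (\<lambda>i j. (if i \<in> J then (\<lambda>i. e * c i) i else 0) * psi (a i) s t j)"
  unfolding v mk_scale by (rule mk_cong) simp
 then show "e *s v \<in> SCone J" by (rule SConeI[OF v(1)])
qed

text \<open>The lines in a join connect distinct points, so every point has to be distinct from some point of the scroll.\<close>

lemma two_points:
 assumes "1 \<in> J"
 obtains u v where "u \<in> SCone J" "v \<in> SCone J" "u \<noteq> 0" "v \<noteq> 0" "vec.span {u} \<noteq> vec.span {v}"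
proof -
 define u where "u = mk (\<lambda>i j. (if i \<in> J then (\<lambda>i. if i = 1 then 1 else 0) i else 0) * psi (a i) 1 0 j)"
 define v where "v = mk (\<lambda>i j. (if i \<in> J then (\<lambda>i. if i = 1 then 1 else 0) i else 0) * psi (a i) 0 1 j)"
 have n1: "1 \<in> {1..n}" using n_pos by simp
 have a1: "1 \<le> a 1" by (rule a_pos[OF n1])
 have u: "\<xi> 1 0 u = 1" using n1 assms by (simp add: u_def xi_mk psi_def)
 have v: "\<xi> 1 0 v = 0" "\<xi> 1 (a 1) v = 1" using n1 a1 assms by (simp_all add: v_def xi_mk psi_def)
 have nz: "u \<noteq> 0" "v \<noteq> 0" using u v n1 xi_simps(3)[OF n1] by auto
 have "vec.span {u} \<noteq> vec.span {v}"
 proof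
  assume "vec.span {u} = vec.span {v}"
  then obtain c where "u = c *s v" using span_singleton_eq_iff[OF nz(1)] by blast
  then show False using u v n1 by (simp add: xi_simps)
 qed
 moreover have "u \<in> SCone J" by (rule SConeI[OF _ u_def]) simp
 moreover have "v \<in> SCone J" by (rule SConeI[OF _ v_def]) simp
 ultimately show ?thesis using nz that by blast
qed

text \<open>A vector of \<open>L0\<close> lies in \<open>Bcone\<close> if its components with \<open>a i \<ge> 2\<close> lie over a point \<open>(s : t)\<close>; the
 components with \<open>a i = 1\<close> are arbitrary and can be split into a part over \<open>(s : t)\<close> and a part over a second point.\<close>

lemma join_S1_X0: "join (subscroll phi {1..k}) X0 = proj_pts (Bcone \<inter> L0)"
proof -
 have kn: "{1..k} \<subseteq> {1..n}" using km by auto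
 have "join (proj_pts (SCone {1..k})) (proj_pts (Xcone \<inter> L0)) = proj_pts (Bcone \<inter> L0)"
 proof (rule join_cones[OF cone_SCone cone_X0])
  show "alg_cone (Bcone \<inter> L0)" by (rule alg_cone_Int[OF alg_cone_B subspace_imp_alg_cone[OF subspace_L0]])
  show "Bcone \<inter> L0 = {p + z | p z. p \<in> SCone {1..k} \<and> z \<in> Xcone \<inter> L0}"
  proof (intro equalityI subsetI)
   fix v assume v: "v \<in> Bcone \<inter> L0"
   have "{k<..n} \<subseteq> {1..n}" by auto
   then obtain s t c where c: "(s, t) \<noteq> (0, 0)" "\<forall>i\<in>{k<..n}. \<forall>j\<le>a i. \<xi> i j v = c i * psi (a i) s t j"
    using v rank_one_iff_psi[of "{k<..n}" v] unfolding Bcone_def by auto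
   obtain s' t' where D: "t * s' - s * t' \<noteq> 0" using complementary_direction[OF c(1)] by blast
   let ?D = "t * s' - s * t'"
   have quot: "x = y / ?D * p + z / ?D * q" if "x * ?D = y * p + z * q" for x y z p q
    using that D by (simp add: add_divide_distrib[symmetric] eq_divide_eq)
   \<comment> \<open>For \<open>a i = 1\<close> the pair of coordinates is an arbitrary vector of the plane, expressed in the
    basis \<open>(s, t)\<close>, \<open>(s', t')\<close>.\<close>
   define d where "d = (\<lambda>i. (t * \<xi> i 0 v - s * \<xi> i 1 v) / ?D)"
   define e where "e = (\<lambda>i. if i \<le> k then (s' * \<xi> i 1 v - t' * \<xi> i 0 v) / ?D else c i)"
   define p where "p = mk (\<lambda>i j. (if i \<in> {1..k} then d i else 0) * psi (a i) s' t' j)"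
   define z where "z = mk (\<lambda>i j. e i * psi (a i) s t j)"
   have "v = pr v" using v mem_L0_iff by simp
   also have "\<dots> = p + z" unfolding p_def z_def mk_add pr_def
   proof (rule mk_cong)
    fix i j assume ij: "i \<in> {1..n}" "j \<le> a i"
    show "\<xi> i j v = (if i \<in> {1..k} then d i else 0) * psi (a i) s' t' j + e i * psi (a i) s t j"
    proof (cases "i \<le> k")
     case True
     then have "a i = 1" "i \<in> {1..k}" using ij a_eq_1 by auto
     then consider "j = 0" | "j = 1" using ij by linarith
     then show ?thesis
     proof cases
      case 1
      have "\<xi> i 0 v * ?D = (t * \<xi> i 0 v - s * \<xi> i 1 v) * s' + (s' * \<xi> i 1 v - t' * \<xi> i 0 v) * s"
       by (simp add: algebra_simps)
      then have "\<xi> i 0 v = d i * s' + e i * s" using quot True by (simp add: d_def e_def)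
      then show ?thesis using 1 True \<open>a i = 1\<close> \<open>i \<in> {1..k}\<close> by (simp add: psi_def)
     next
      case 2
      have "\<xi> i 1 v * ?D = (t * \<xi> i 0 v - s * \<xi> i 1 v) * t' + (s' * \<xi> i 1 v - t' * \<xi> i 0 v) * t"
       by (simp add: algebra_simps)
      then have "\<xi> i 1 v = d i * t' + e i * t" using quot True by (simp add: d_def e_def)
      then show ?thesis using 2 True \<open>a i = 1\<close> \<open>i \<in> {1..k}\<close> by (simp add: psi_def)
     qed
    next
     case False
     then show ?thesis using c(2) ij by (simp add: e_def)
    qed
   qed
   finally have "v = p + z" .
   moreover have "(s', t') \<noteq> (0, 0)" using D by auto
   then have "p \<in> SCone {1..k}" by (rule SConeI[OF _ p_def])
   moreover have "z \<in> Xcone \<inter> L0" unfolding z_def using mk_psi_00_in_X mk_in_L0 by blast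
   ultimately show "v \<in> {p + z | p z. p \<in> SCone {1..k} \<and> z \<in> Xcone \<inter> L0}" by blast
  next
   fix v assume "v \<in> {p + z | p z. p \<in> SCone {1..k} \<and> z \<in> Xcone \<inter> L0}"
   then obtain p z where pz: "v = p + z" "p \<in> SCone {1..k}" "z \<in> Xcone" "z \<in> L0" by blast
   obtain c s' t' where p: "p = mk (\<lambda>i j. (if i \<in> {1..k} then c i else 0) * psi (a i) s' t' j)"
    using pz(2) unfolding SCone_def by blast
   obtain s t where st: "(s, t) \<noteq> (0, 0)" "\<forall>i\<in>{1..n}. \<forall>j<a i. t * \<xi> i j z = s * \<xi> i (Suc j) z"
    using pz(3) unfolding Xcone_def rank_one_def by blast
   have "\<forall>i\<in>{k<..n}. \<forall>j<a i. t * \<xi> i j v = s * \<xi> i (Suc j) v"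
   proof (intro ballI allI impI)
    fix i j assume i: "i \<in> {k<..n}" "j < a i"
    have "\<xi> i j v = \<xi> i j z" "\<xi> i (Suc j) v = \<xi> i (Suc j) z"
     using i in_index(1)[OF i(1)] unfolding pz(1) p by (simp_all add: xi_simps xi_mk)
    then show "t * \<xi> i j v = s * \<xi> i (Suc j) v" using st(2) i in_index(1)[OF i(1)] by simp
   qed
   then have "v \<in> Bcone" unfolding Bcone_def rank_one_def using st(1) by blast
   moreover have "p \<in> L0" unfolding p by (rule mk_in_L0)
   then have "v \<in> L0" unfolding pz(1) using pz(4) by (rule vec.subspace_add[OF subspace_L0])
   ultimately show "v \<in> Bcone \<inter> L0" by blast
  qed
  show "\<exists>p\<in>SCone {1..k}. p \<noteq> 0 \<and> vec.span {p} \<noteq> vec.span {z}" if P: "SCone {1..k} \<noteq> {0}" for z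
  proof -
   have "k \<noteq> 0"
   proof
    assume "k = 0"
    have "x = 0" if "x \<in> SCone {1..k}" for x
    proof -
     have "\<exists>c s t. x = mk (\<lambda>i j. (if i \<in> {1..k} then c i else 0) * psi (a i) s t j)"
      using that unfolding SCone_def by blast
     then show ?thesis using \<open>k = 0\<close> mk_zero by auto
    qed
    then show False using P cone_SCone[of "{1..k}"] by (auto simp: cone_def)
   qed
   then have "1 \<in> {1..k}" by simp
   then obtain u v where "u \<in> SCone {1..k}" "v \<in> SCone {1..k}" "u \<noteq> 0" "v \<noteq> 0" "vec.span {u} \<noteq> vec.span {v}"
    using two_points by metis
   then show ?thesis by metis
  qed
  show "\<exists>z\<in>Xcone \<inter> L0. z \<noteq> 0 \<and> vec.span {p} \<noteq> vec.span {z}" for p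
  proof -
   have "1 \<in> {1..n}" using n_pos by simp
   then obtain u v where "u \<in> SCone {1..n}" "v \<in> SCone {1..n}" "u \<noteq> 0" "v \<noteq> 0" "vec.span {u} \<noteq> vec.span {v}"
    using two_points by metis
   then show ?thesis unfolding SCone_X0 by metis
  qed
 qed
 then show ?thesis unfolding subscroll_phi[OF kn] .
qed

lemma join_B: "join Vt (join (subscroll phi {1..k}) X0) = proj_pts Bcone"
 unfolding join_S1_X0 by (rule join_vertex[OF alg_cone_B xi_invariant_B])

lemma lin_span_A: "lin_span (Vt \<union> lin_span (subscroll phi {1..k})) = proj_pts Acone"
proof -
 have kn: "{1..k} \<subseteq> {1..n}" using km by auto
 let ?S = "vec.span (SCone {1..k})"
 have "vec.span (\<Union>(Vt \<union> lin_span (subscroll phi {1..k}))) = vec.span (vec.span (\<Union>Vt) \<union> vec.span (\<Union>(proj_pts ?S)))"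
  unfolding span_span_union lin_span_def subscroll_phi[OF kn] span_Union_proj_pts[OF cone_SCone] by simp
 also have "\<dots> = vec.span (vertex \<union> SCone {1..k})"
  unfolding span_Union_proj_pts[OF subspace_imp_cone[OF subspace_vertex]]
   span_Union_proj_pts[OF subspace_imp_cone[OF vec.subspace_span]]
  by (simp add: vec.span_span span_span_union)
 also have "\<dots> = Acone"
 proof
  have "SCone {1..k} \<subseteq> Acone"
   unfolding SCone_def Acone_def using in_index(1) by (auto simp: xi_mk)
  moreover have "vertex \<subseteq> Acone" unfolding vertex_def Acone_def using in_index(1) by auto
  ultimately show "vec.span (vertex \<union> SCone {1..k}) \<subseteq> Acone" by (intro vec.span_minimal subspace_A) auto
  show "Acone \<subseteq> vec.span (vertex \<union> SCone {1..k})"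
  proof
   fix v assume v: "v \<in> Acone"
   have bS: "\<xi> i j v *s b i j \<in> vec.span (vertex \<union> SCone {1..k})" if ij: "i \<in> {1..n}" "j \<le> a i" for i j
   proof (cases "i \<le> k")
    case True
    then have i: "i \<in> {1..k}" "a i = 1" using ij a_eq_1 by auto
    have e: "phi i 1 0 = b i 0" "phi i 0 1 = b i 1" using i by (simp_all add: phi_def)
    have "phi i s t \<in> SCone {1..k}" if "(s, t) \<noteq> (0, 0)" for s t
    proof -
     have "phi i s t = (\<Sum>i'\<in>{1..k}. (if i' = i then 1 else 0) *s phi i' s t)"
      using i by (simp add: if_distrib[of "\<lambda>c. c *s _"] sum.delta cong: if_cong)
     also have "\<dots> = mk (\<lambda>i' j. (if i' \<in> {1..k} then (\<lambda>i'. if i' = i then 1 else 0) i' else 0) * psi (a i') s t j)"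
      by (rule mk_eq_sum_phi[OF kn, symmetric])
     finally show ?thesis by (rule SConeI[OF that])
    qed
    then have "b i 0 \<in> SCone {1..k}" "b i 1 \<in> SCone {1..k}" unfolding e[symmetric] by simp_all
    moreover have "j = 0 \<or> j = 1" using ij i by linarith
    ultimately have "b i j \<in> SCone {1..k}" by blast
    then show ?thesis by (intro vec.span_scale vec.span_base) blast
   next
    case False
    then have "\<xi> i j v = 0" using v ij unfolding Acone_def by auto
    then show ?thesis by (simp add: vec.span_zero)
   qed
   have "pr v \<in> vec.span (vertex \<union> SCone {1..k})"
    unfolding pr_def mk_def by (intro vec.span_sum bS) auto
   moreover have "v - pr v \<in> vec.span (vertex \<union> SCone {1..k})" using diff_pr_in_vertex by (intro vec.span_base) blast
   ultimately have "(v - pr v) + pr v \<in> vec.span (vertex \<union> SCone {1..k})" by (rule vec.span_add[rotated])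
   then show "v \<in> vec.span (vertex \<union> SCone {1..k})" by simp
  qed
 qed
 finally show ?thesis by (simp add: lin_span_def)
qed

definition plane_vec :: "(nat \<Rightarrow> 'k) \<Rightarrow> (nat \<Rightarrow> 'k) \<Rightarrow> 'k ^ 'd" where
 "plane_vec \<beta> u = mk (\<lambda>i j. if i \<in> {k+1..m} then \<beta> i * u j else 0)"

lemma plane_vec_simps:
 "plane_vec \<beta> u + plane_vec \<beta> u' = plane_vec \<beta> (\<lambda>j. u j + u' j)" "c *s plane_vec \<beta> u = plane_vec \<beta> (\<lambda>j. c * u j)"
 "plane_vec \<beta> (\<lambda>_. 0) = 0"
 unfolding plane_vec_def mk_add mk_scale mk_zero[symmetric] by (rule mk_cong; simp add: algebra_simps)+

lemma plane_vec_cong: "(\<And>j. j \<le> 2 \<Longrightarrow> u j = u' j) \<Longrightarrow> plane_vec \<beta> u = plane_vec \<beta> u'"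
 unfolding plane_vec_def by (rule mk_cong) (use a_eq_2 in auto)

text \<open>The triples \<open>psi 2 1 0\<close>, \<open>psi 2 1 1\<close> and \<open>psi 2 0 1\<close> form a basis of three-space.\<close>

lemma conic_plane: "lin_span (conic phi {k+1..m} \<beta>) = proj_pts {plane_vec \<beta> u | u. True}"
proof -
 have mn: "{k+1..m} \<subseteq> {1..n}" using km by auto
 have pt: "(\<Sum>i\<in>{k+1..m}. \<beta> i *s phi i s t) = plane_vec \<beta> (psi 2 s t)" for s t
  unfolding mk_eq_sum_phi[OF mn, symmetric] plane_vec_def by (rule mk_cong) (use a_eq_2 in auto)
 have C: "conic phi {k+1..m} \<beta> = {vec.span {plane_vec \<beta> (psi 2 s t)} | s t. (s, t) \<noteq> (0, 0)}"
  unfolding conic_def pt ..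
 have "vec.span (\<Union>(conic phi {k+1..m} \<beta>)) = {plane_vec \<beta> u | u. True}" (is "?L = ?R")
 proof
  have sub: "vec.subspace ?R" unfolding vec.subspace_def
   using plane_vec_simps by (auto simp: plane_vec_simps) (metis plane_vec_simps(3))
  have "\<Union>(conic phi {k+1..m} \<beta>) \<subseteq> ?R"
   unfolding C by (auto simp: mem_span_singleton plane_vec_simps)
  then show "?L \<subseteq> ?R" by (rule vec.span_minimal[OF _ sub])
  show "?R \<subseteq> ?L"
  proof
   fix x assume "x \<in> ?R"
   then obtain u where x: "x = plane_vec \<beta> u" by blast
   have "plane_vec \<beta> (psi 2 s t) \<in> \<Union>(conic phi {k+1..m} \<beta>)" if "(s, t) \<noteq> (0, 0)" for s t
    unfolding C using that vec.span_base[of "plane_vec \<beta> (psi 2 s t)" "{plane_vec \<beta> (psi 2 s t)}"] by blast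
   then have q: "plane_vec \<beta> (psi 2 s t) \<in> ?L" if "(s, t) \<noteq> (0, 0)" for s t using that by (intro vec.span_base)
   have "plane_vec \<beta> u = (u 0 - u 1) *s plane_vec \<beta> (psi 2 1 0) + (u 1 *s plane_vec \<beta> (psi 2 1 1)
     + (u 2 - u 1) *s plane_vec \<beta> (psi 2 0 1))"
    unfolding plane_vec_simps
   proof (rule plane_vec_cong)
    fix j :: nat assume "j \<le> 2"
    then have "j = 0 \<or> j = 1 \<or> j = 2" by linarith
    then show "u j = (u 0 - u 1) * psi 2 1 0 j + (u 1 * psi 2 1 1 j + (u 2 - u 1) * psi 2 0 1 j)"
     by (elim disjE) (simp_all add: psi_def)
   qed
   also have "\<dots> \<in> ?L" by (intro vec.span_add vec.span_scale q) simp_all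
   finally show "x \<in> ?L" unfolding x .
  qed
 qed
 then show ?thesis by (simp add: lin_span_def)
qed

lemma conic_planes_phi: "conic_planes phi {k+1..m} = proj_pts {plane_vec \<beta> u | \<beta> u. True}"
proof (intro equalityI subsetI)
 fix p assume "p \<in> conic_planes phi {k+1..m}"
 then obtain \<beta> where "p \<in> lin_span (conic phi {k+1..m} \<beta>)" unfolding conic_planes_def by blast
 then show "p \<in> proj_pts {plane_vec \<beta> u | \<beta> u. True}" unfolding conic_plane proj_pts_def by blast
next
 fix p assume "p \<in> proj_pts {plane_vec \<beta> u | \<beta> u. True}"
 then obtain \<beta> u where p: "p = vec.span {plane_vec \<beta> u}" "plane_vec \<beta> u \<noteq> 0" unfolding proj_pts_def by blast
 have "\<exists>j\<in>{k+1..m}. \<beta> j \<noteq> 0"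
 proof (rule ccontr)
  assume "\<not> ?thesis"
  then have "plane_vec \<beta> u = mk (\<lambda>i j. 0)" unfolding plane_vec_def by (intro mk_cong) auto
  then show False using p mk_zero by simp
 qed
 moreover have "p \<in> lin_span (conic phi {k+1..m} \<beta>)" unfolding conic_plane proj_pts_def using p by blast
 ultimately show "p \<in> conic_planes phi {k+1..m}" unfolding conic_planes_def by blast
qed

lemma join_U: "join (proj_pts Acone) (conic_planes phi {k+1..m}) = proj_pts Ucone"
 unfolding conic_planes_phi
proof (rule join_cones)
 let ?Z = "{plane_vec \<beta> u | \<beta> u. True}"
 show cA: "cone Acone" by (rule subspace_imp_cone[OF subspace_A])
 show cZ: "cone ?Z" unfolding cone_def
  using plane_vec_simps(2) by (auto simp: plane_vec_simps(2)) (metis plane_vec_simps(3), blast)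
 show "alg_cone Ucone" by (rule alg_cone_U)
 have xZ: "\<xi> i j (plane_vec \<beta> u) = (if i \<in> {k+1..m} then \<beta> i * u j else 0)" if "i \<in> {1..n}" "j \<le> a i" for i j \<beta> u
  using that by (simp add: plane_vec_def xi_mk)
 show "Ucone = {p + z | p z. p \<in> Acone \<and> z \<in> ?Z}"
 proof (intro equalityI subsetI)
  fix v assume "v \<in> Ucone"
  then obtain \<beta> u where v: "\<forall>i\<in>{m<..n}. \<forall>j\<le>a i. \<xi> i j v = 0" "\<forall>i\<in>{k<..m}. \<forall>j\<le>2. \<xi> i j v = \<beta> i * u j"
   unfolding Ucone_def by blast
  have "v - plane_vec \<beta> u \<in> Acone" unfolding Acone_def
  proof (intro CollectI ballI allI impI)
   fix i j assume ij: "i \<in> {k<..n}" "j \<le> a i"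
   then have i: "i \<in> {1..n}" by auto
   show "\<xi> i j (v - plane_vec \<beta> u) = 0"
    using ij v a_eq_2[of i] by (cases "i \<le> m") (auto simp: xi_simps[OF i ij(2)] xZ[OF i ij(2)])
  qed
  moreover have "v = (v - plane_vec \<beta> u) + plane_vec \<beta> u" by simp
  ultimately show "v \<in> {p + z | p z. p \<in> Acone \<and> z \<in> ?Z}" by blast
 next
  fix v assume "v \<in> {p + z | p z. p \<in> Acone \<and> z \<in> ?Z}"
  then obtain p \<beta> u where v: "v = p + plane_vec \<beta> u" "p \<in> Acone" by blast
  have e: "\<xi> i j v = (if i \<in> {k+1..m} then \<beta> i * u j else 0)" if "i \<in> {k<..n}" "j \<le> a i" for i j
  proof -
   have i: "i \<in> {1..n}" using that by auto
   show ?thesis using v(2) that unfolding v(1) Acone_def by (simp add: xi_simps[OF i that(2)] xZ[OF i that(2)])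
  qed
  have "\<forall>i\<in>{m<..n}. \<forall>j\<le>a i. \<xi> i j v = 0" using e km by auto
  moreover have "\<forall>i\<in>{k<..m}. \<forall>j\<le>2. \<xi> i j v = \<beta> i * u j" using e km a_eq_2 by auto
  ultimately show "v \<in> Ucone" unfolding Ucone_def by blast
 qed
 have ne: "vec.span {p} \<noteq> vec.span {z}" if pz: "p \<in> Acone" "z \<in> ?Z" "p \<noteq> 0" for p z
 proof
  assume "vec.span {p} = vec.span {z}"
  then obtain c where "p = c *s z" using span_singleton_eq_iff[OF pz(3)] by blast
  then have "p \<in> ?Z" using cZ pz(2) cone_scale by blast
  then obtain \<beta> u where p: "p = plane_vec \<beta> u" by blast
  have "p = mk (\<lambda>i j. 0)" unfolding p plane_vec_def
  proof (rule mk_cong)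
   fix i j assume ij: "i \<in> {1..n}" "j \<le> a i"
   show "(if i \<in> {k+1..m} then \<beta> i * u j else 0) = 0"
   proof (cases "i \<in> {k+1..m}")
    case True
    then have "\<xi> i j p = 0" using pz(1) ij km unfolding Acone_def by auto
    then show ?thesis using True xZ[OF ij] unfolding p by simp
   next
    case False
    then show ?thesis by (rule if_not_P)
   qed
  qed
  then show False using pz(3) mk_zero by simp
 qed
 have ex: "\<exists>x\<in>T. x \<noteq> 0" if "T \<noteq> {0}" "cone T" for T :: "('k ^ 'd) set" using that by (auto simp: cone_def)
 show "\<exists>p\<in>Acone. p \<noteq> 0 \<and> vec.span {p} \<noteq> vec.span {z}" if z: "z \<in> ?Z" "z \<noteq> 0" "Acone \<noteq> {0}" for z
 proof -
  obtain p where "p \<in> Acone" "p \<noteq> 0" using ex[OF z(3) cA] by blast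
  then show ?thesis using ne[OF _ z(1)] by blast
 qed
 show "\<exists>z\<in>?Z. z \<noteq> 0 \<and> vec.span {p} \<noteq> vec.span {z}" if p: "p \<in> Acone" "p \<noteq> 0" "?Z \<noteq> {0}" for p
 proof -
  obtain z where "z \<in> ?Z" "z \<noteq> 0" using ex[OF p(3) cZ] by blast
  then show ?thesis using ne[OF p(1) _ p(2)] by blast
 qed
qed

end

lemma vanishing_ideal_antimono: "Y \<subseteq> Z \<Longrightarrow> f \<in> vanishing_ideal Z \<Longrightarrow> f \<in> vanishing_ideal Y"
 by (auto simp: vanishing_ideal_def)

context scroll begin

lemma eq_mkI: "v \<in> L0 \<Longrightarrow> (\<And>i j. i \<in> {1..n} \<Longrightarrow> j \<le> a i \<Longrightarrow> \<xi> i j v = x i j) \<Longrightarrow> v = mk x"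
 by (rule vec_eqI[OF _ mk_in_L0]) (simp_all add: xi_mk)

lemma mk_psi_in_X0: "mk (\<lambda>i j. c i * psi (a i) s t j) \<in> Xcone \<inter> L0"
 using mk_psi_00_in_X mk_in_L0 by blast

lemma X0_two_points:
 obtains u v where "u \<in> Xcone \<inter> L0" "v \<in> Xcone \<inter> L0" "u \<noteq> 0" "v \<noteq> 0" "vec.span {u} \<noteq> vec.span {v}"
proof -
 have "1 \<in> {1..n}" using n_pos by simp
 then show ?thesis using that unfolding SCone_X0[symmetric] by (rule two_points)
qed

lemma chord_in_W:
 assumes "u \<in> Xcone" "v \<in> Xcone" shows "u + v \<in> Wcone"
proof -
 obtain s t c where c: "(s, t) \<noteq> (0, 0)" "\<forall>i\<in>{1..n}. \<forall>j\<le>a i. \<xi> i j u = c i * psi (a i) s t j"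
  using assms(1) mem_X_iff by auto
 obtain s' t' d where d: "(s', t') \<noteq> (0, 0)" "\<forall>i\<in>{1..n}. \<forall>j\<le>a i. \<xi> i j v = d i * psi (a i) s' t' j"
  using assms(2) mem_X_iff by auto
 have "apolar (t * t', - (t * s' + s * t'), s * s') (u + v)"
  by (rule chord_apolar[of _ c _ _ d]) (use c d in \<open>simp add: xi_simps\<close>)
 moreover have "(t * t', - (t * s' + s * t'), s * s') \<noteq> zero3" using c(1) d(1) by auto
 ultimately show ?thesis unfolding Wcone_def by blast
qed

text \<open>A point of a tangent line is the limit for \<open>\<tau> \<rightarrow> 0\<close> of points of the secant lines through the points over
 \<open>(s, t)\<close> and \<open>(s + \<tau> s', t + \<tau> t')\<close>: the difference quotients are polynomial in \<open>\<tau>\<close>.\<close>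

lemma tangent_limit_of_chords:
 assumes f: "\<And>u v. u \<in> Xcone \<inter> L0 \<Longrightarrow> v \<in> Xcone \<inter> L0 \<Longrightarrow> mpeval f (u + v) = 0"
 shows "mpeval f (mk (\<lambda>i j. c i * psi (a i) s t j + d i * dpsi (a i) s t s' t' j)) = 0"
proof -
 have "\<exists>Q. psi_poly (a i) s t s' t' j = pCons (psi (a i) s t j) Q" for i j
  using coeff_psi_poly_0[of "a i" s t s' t' j] by (cases "psi_poly (a i) s t s' t' j") auto
 then obtain Q where Q: "\<And>i j. psi_poly (a i) s t s' t' j = pCons (psi (a i) s t j) (Q i j)" by metis
 have Q0: "poly (Q i j) 0 = dpsi (a i) s t s' t' j" for i j
  unfolding dpsi_def Q by (simp add: poly_0_coeff_0)
 have Q1: "psi (a i) s t j + \<tau> * poly (Q i j) \<tau> = psi (a i) (s + \<tau> * s') (t + \<tau> * t') j" for i j \<tau>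
  using arg_cong[OF Q[of i j], of "\<lambda>p. poly p \<tau>"] by (simp add: poly_psi_poly)
 let ?\<gamma> = "\<lambda>\<tau>. mk (\<lambda>i j. c i * psi (a i) s t j + d i * poly (Q i j) \<tau>)"
 let ?P = "\<lambda>r. \<Sum>i\<in>{1..n}. \<Sum>j\<le>a i. smult (b i j $ r) ([:c i * psi (a i) s t j:] + smult (d i) (Q i j))"
 obtain R where R: "\<And>\<tau>. poly R \<tau> = mpeval f (\<chi> r. poly (?P r) \<tau>)"
  by (rule mpeval_along_curve[of f ?P]) (rule that)
 have \<gamma>: "(\<chi> r. poly (?P r) \<tau>) = ?\<gamma> \<tau>" for \<tau>
  by (simp add: vec_eq_iff mk_def poly_sum algebra_simps)
 have "poly R \<tau> = poly 0 \<tau>" if "\<tau> \<notin> {0}" for \<tau>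
 proof -
  have "?\<gamma> \<tau> = mk (\<lambda>i j. (c i - d i / \<tau>) * psi (a i) s t j) + mk (\<lambda>i j. (d i / \<tau>) * psi (a i) (s + \<tau> * s') (t + \<tau> * t') j)"
   unfolding mk_add Q1[symmetric] by (rule mk_cong) (use that in \<open>simp add: field_simps\<close>)
  then show ?thesis unfolding R \<gamma> by (simp only: f[OF mk_psi_in_X0 mk_psi_in_X0] poly_0)
 qed
 then have "R = 0" by (intro poly_eq_if_cofinite[of "{0}"]) auto
 then have "mpeval f (?\<gamma> 0) = 0" using R[of 0] \<gamma>[of 0] by simp
 then show ?thesis unfolding Q0 .
qed

text \<open>A vector apolar to a product of distinct linear forms lies on a chord, and one apolar to a square is a limit of
 vectors on chords.\<close>

lemma secant_variety_X0: "secant_variety X0 = proj_pts (Wcone \<inter> L0)"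
 unfolding secant_variety_def
proof (rule zclosure_eqI)
 let ?Y = "\<Union>{lin_span {y, z} | y z. y \<in> X0 \<and> z \<in> X0 \<and> y \<noteq> z}"
 show "alg_cone (Wcone \<inter> L0)" by (rule alg_cone_Int[OF alg_cone_W subspace_imp_alg_cone[OF subspace_L0]])
 show "?Y \<subseteq> proj_pts (Wcone \<inter> L0)"
 proof
  fix x assume "x \<in> ?Y"
  then obtain y z where yz: "y \<in> X0" "z \<in> X0" "x \<in> lin_span {y, z}" by blast
  from yz(1) obtain u where u: "u \<in> Xcone \<inter> L0" "y = vec.span {u}" by (rule proj_ptsE)
  from yz(2) obtain v where v: "v \<in> Xcone \<inter> L0" "z = vec.span {v}" by (rule proj_ptsE)
  have "x \<in> proj_pts (vec.span {u, v})" using yz(3) unfolding u v lin_span_pair .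
  then obtain w where w: "w \<in> vec.span {u, v}" "w \<noteq> 0" "x = vec.span {w}" by (rule proj_ptsE)
  then obtain \<alpha> \<beta> where "w = \<alpha> *s u + \<beta> *s v" by (auto simp: mem_span_pair)
  moreover have "\<alpha> *s u \<in> Xcone \<inter> L0" "\<beta> *s v \<in> Xcone \<inter> L0" using u v cone_scale[OF cone_X0] by blast+
  ultimately have "w \<in> Wcone \<inter> L0" using chord_in_W vec.subspace_add[OF subspace_L0] by blast
  then show "x \<in> proj_pts (Wcone \<inter> L0)" using w by (auto simp: proj_pts_def)
 qed
 fix v f assume v: "v \<in> Wcone \<inter> L0" and f: "f \<in> vanishing_ideal ?Y"
 have chord: "mpeval f (\<alpha> *s u + \<beta> *s u') = 0"
  if u: "u \<in> Xcone \<inter> L0" "u' \<in> Xcone \<inter> L0" "u \<noteq> 0" "u' \<noteq> 0" "vec.span {u} \<noteq> vec.span {u'}" for u u' \<alpha> \<beta>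
 proof -
  have yz: "vec.span {u} \<in> X0" "vec.span {u'} \<in> X0" using u unfolding proj_pts_def by blast+
  have "u \<in> vec.span {u, u'}" by (intro vec.span_base) simp
  then have ne: "vec.span {u, u'} \<noteq> {0}" using u(3) by blast
  have "proj_pts (vec.span {u, u'}) \<subseteq> ?Y" unfolding lin_span_pair[symmetric] using yz u(5) by blast
  then have "f \<in> vanishing_ideal (proj_pts (vec.span {u, u'}))" using f by (rule vanishing_ideal_antimono)
  then have "\<forall>x\<in>vec.span {u, u'}. mpeval f x = 0"
   unfolding mem_vanishing_ideal[OF subspace_imp_cone[OF vec.subspace_span] ne] .
  then show ?thesis using mem_span_pair by blast
 qed
 obtain p p' where p: "p \<in> Xcone \<inter> L0" "p' \<in> Xcone \<inter> L0" "p \<noteq> 0" "p' \<noteq> 0" "vec.span {p} \<noteq> vec.span {p'}"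
  by (rule X0_two_points)
 have one: "mpeval f u = 0" if u: "u \<in> Xcone \<inter> L0" for u
 proof (cases "u = 0")
  case True
  then show ?thesis using chord[OF p, of 0 0] by simp
 next
  case False
  obtain p'' where "p'' \<in> Xcone \<inter> L0" "p'' \<noteq> 0" "vec.span {u} \<noteq> vec.span {p''}" using p by metis
  then show ?thesis using chord[OF u _ False, of p'' 1 0] by simp
 qed
 have two: "mpeval f (u + u') = 0" if u: "u \<in> Xcone \<inter> L0" "u' \<in> Xcone \<inter> L0" for u u'
 proof (cases "u = 0 \<or> u' = 0 \<or> vec.span {u} = vec.span {u'}")
  case False
  then show ?thesis using chord[OF u, of 1 1] by simp
 next
  case True
  show ?thesis
  proof (cases "u = 0 \<or> u' = 0")
   case True
   then show ?thesis using one u by auto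
  next
   case False
   then obtain c where "u = c *s u'" using \<open>u = 0 \<or> u' = 0 \<or> _\<close> span_singleton_eq_iff[of u u'] by blast
   then have "u + u' = (c + 1) *s u'" by (simp add: vec.scale_left_distrib)
   then show ?thesis using one cone_scale[OF cone_X0 u(2)] by simp
  qed
 qed
 show "mpeval f v = 0"
 proof (cases "v \<in> Vcone")
  case True
  then obtain s t s' t' c d where vf: "\<And>i j. i \<in> {1..n} \<Longrightarrow> j \<le> a i \<Longrightarrow>
    \<xi> i j v = c i * psi (a i) s t j + d i * dpsi (a i) s t s' t' j" by (rule tangent_coordinates) (rule that)
  have "v = mk (\<lambda>i j. c i * psi (a i) s t j + d i * dpsi (a i) s t s' t' j)" using IntD2[OF v] vf by (rule eq_mkI)
  then show ?thesis using tangent_limit_of_chords[OF two, of c s t d s' t'] by (simp only:)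
 next
  case False
  then obtain s t s' t' c d where vf: "\<And>i j. i \<in> {1..n} \<Longrightarrow> j \<le> a i \<Longrightarrow>
    \<xi> i j v = c i * psi (a i) s t j + d i * psi (a i) s' t' j"
   using v by (elim IntE) (rule chord_coordinates, assumption, rule False, rule that)
  have "v = mk (\<lambda>i j. c i * psi (a i) s t j + d i * psi (a i) s' t' j)" using IntD2[OF v] vf by (rule eq_mkI)
  also have "\<dots> = mk (\<lambda>i j. c i * psi (a i) s t j) + mk (\<lambda>i j. d i * psi (a i) s' t' j)" by (simp add: mk_add)
  finally show ?thesis using two[OF mk_psi_in_X0 mk_psi_in_X0] by (simp only:)
 qed
qed

text \<open>The multiples \<open>\<rho>\<close> account for the choice of a vector on the point of contact. For \<open>\<rho> = 0\<close> the derivative vanishes in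
 the directions of the scroll, which span \<open>L0\<close>.\<close>

lemma dir_deriv_tangent_X0:
 assumes f: "\<And>v. v \<in> Xcone \<inter> L0 \<Longrightarrow> mpeval f v = 0"
 shows "dir_deriv f (\<rho> *s mk (\<lambda>i j. d i * psi (a i) s t j))
  (mk (\<lambda>i j. c i * psi (a i) s t j + d i * dpsi (a i) s t s' t' j)) = 0"
proof (cases "\<rho> = 0")
 case True
 have line: "dir_deriv f 0 x = 0" if x: "x \<in> Xcone \<inter> L0" for x
 proof -
  have "mpeval f (0 + \<tau> *s x) = poly 0 \<tau>" for \<tau> using f cone_scale[OF cone_X0 x] by simp
  then have "dir_deriv f 0 x = coeff 0 1" by (rule dir_deriv_eq_coeff)
  then show ?thesis by simp
 qed
 have "vec.span (Xcone \<inter> L0) \<subseteq> {x. dir_deriv f 0 x = 0}"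
 proof (rule vec.span_minimal)
  show "vec.subspace {x. dir_deriv f 0 x = 0}"
   using functionalD[OF functional_dir_deriv, of f 0] by (auto simp: vec.subspace_def)
 qed (use line in blast)
 then show ?thesis using True mk_in_L0 unfolding span_X0 by auto
next
 case False
 show ?thesis
 proof (rule dir_deriv_tangent[where S = "Xcone \<inter> L0" and e = "\<lambda>i. \<rho> * d i" and s' = "s' / \<rho>" and t' = "t' / \<rho>" and c = c and s = s and t = t])
  show "mpeval f v = 0" if "v \<in> Xcone \<inter> L0" for v using that by (rule f)
  show "\<rho> *s mk (\<lambda>i j. d i * psi (a i) s t j) + \<tau> *s mk x - pr (\<rho> *s mk (\<lambda>i j. d i * psi (a i) s t j) + \<tau> *s mk x) +
    mk (\<lambda>i j. e i * psi (a i) s'' t'' j) \<in> Xcone \<inter> L0" for \<tau> x e s'' t''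
   using mk_psi_00_in_X mk_in_L0 by (simp add: pr_add pr_scale pr_mk)
  fix i j assume ij: "i \<in> {1..n}" "j \<le> a i"
  show "\<xi> i j (\<rho> *s mk (\<lambda>i j. d i * psi (a i) s t j)) = \<rho> * d i * psi (a i) s t j"
   using ij by (simp add: xi_simps xi_mk)
  have "dpsi (a i) s t (s' / \<rho>) (t' / \<rho>) j = dpsi (a i) s t s' t' j / \<rho>"
   using dpsi_scale[of "a i" s t "1 / \<rho>" s' t' j] by simp
  then show "\<xi> i j (mk (\<lambda>i j. c i * psi (a i) s t j + d i * dpsi (a i) s t s' t' j)) =
    c i * psi (a i) s t j + \<rho> * d i * dpsi (a i) s t (s' / \<rho>) (t' / \<rho>) j"
   using ij False by (simp add: xi_mk)
 qed
qed

text \<open>A tangent vector is apolar to the square of the form vanishing at its point of contact by \<open>tangent_form\<close>, and it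
 lies in \<open>L0\<close> because the linear forms vanishing on \<open>L0\<close> belong to the ideal of the scroll. Conversely, a vector apolar to a square is
 tangent at \<open>mk (\<lambda>i j. d i * psi (a i) s t j)\<close>, or a point of the scroll if this vector is zero.\<close>

lemma tangent_variety_X0: "tangent_variety X0 = proj_pts (Vcone \<inter> L0)"
 unfolding tangent_variety_def
proof (rule zclosure_eqI)
 have ne: "Xcone \<inter> L0 \<noteq> {0}"
 proof
  assume "Xcone \<inter> L0 = {0}"
  then have "L0 = {0}" using span_X0 by simp
  moreover obtain u where "u \<in> Xcone \<inter> L0" "u \<noteq> 0" by (rule X0_two_points)
  ultimately show False by blast
 qed
 note I = mem_vanishing_ideal[OF cone_X0 ne]
 show "alg_cone (Vcone \<inter> L0)" by (rule alg_cone_Int[OF alg_cone_V subspace_imp_alg_cone[OF subspace_L0]])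
 show "(\<Union>p\<in>X0. tangent_space X0 p) \<subseteq> proj_pts (Vcone \<inter> L0)"
 proof
  fix x assume "x \<in> (\<Union>p\<in>X0. tangent_space X0 p)"
  then obtain p where p: "p \<in> X0" "x \<in> tangent_space X0 p" by blast
  from p(1) obtain v where v: "v \<in> Xcone \<inter> L0" "v \<noteq> 0" "p = vec.span {v}" by (rule proj_ptsE)
  obtain w where w: "\<forall>f\<in>vanishing_ideal X0. \<forall>v\<in>p. dir_deriv f v w = 0" "w \<noteq> 0" "x = vec.span {w}"
   using p(2) unfolding tangent_space_def proj_pts_def by blast
  have dd: "dir_deriv f v w = 0" if "\<And>u. u \<in> Xcone \<inter> L0 \<Longrightarrow> mpeval f u = 0" for f
  proof -
   have "f \<in> vanishing_ideal X0" unfolding I using that by blast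
   moreover have "v \<in> p" unfolding v(3) by (intro vec.span_base) simp
   ultimately show ?thesis using w(1) by blast
  qed
  have "w \<in> L0"
  proof (rule ccontr)
   assume "w \<notin> L0"
   then obtain l where l: "functional l" "l w = 1" "\<And>u. u \<in> L0 \<Longrightarrow> l u = 0"
    using functional_separates[OF subspace_L0] by blast
   obtain L where L: "mpeval L = l" using functional_form[OF l(1)] by blast
   have "mpeval L (v + \<tau> *s w) = poly [:0, 1:] \<tau>" for \<tau>
    unfolding L using l(2) l(3)[of v] v(1) by (simp add: functionalD[OF l(1)])
   then have "dir_deriv L v w = coeff [:0, 1:] 1" by (rule dir_deriv_eq_coeff)
   moreover have "dir_deriv L v w = 0" by (rule dd) (simp add: L l(3))
   ultimately show False by simp
  qed
  moreover have "w \<in> Vcone"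
  proof (cases "w \<in> Xcone")
   case True
   then show ?thesis using X_subset_B B_subset_V by blast
  next
   case False
   have vv: "v \<in> Xcone" "v \<notin> vertex" using v vertex_cap_L0 by blast+
   have "dir_deriv g v w = 0" if "g \<in> minors" for g
    by (rule dd) (use that Xcone_minors in blast)
   then obtain s t s' t' c d where D: "t * s' - s * t' \<noteq> 0"
    and wf: "\<And>i j. i \<in> {1..n} \<Longrightarrow> j \<le> a i \<Longrightarrow> \<xi> i j w = c i * psi (a i) s t j + d i * dpsi (a i) s t s' t' j"
    by (rule tangent_form[OF False vv]) (blast, rule that)
   have "apolar (square3 s t) w" by (rule apolar_squareI[OF wf])
   moreover have "(s, t) \<noteq> (0, 0)" using D by auto
   ultimately show ?thesis unfolding Vcone_def by blast
  qed
  ultimately show "x \<in> proj_pts (Vcone \<inter> L0)" using w by (auto simp: proj_pts_def)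
 qed
 fix v f assume v: "v \<in> Vcone \<inter> L0" "v \<noteq> 0" and f: "f \<in> vanishing_ideal (\<Union>p\<in>X0. tangent_space X0 p)"
 obtain s t s' t' c d where D: "t * s' - s * t' \<noteq> 0" and vf: "\<And>i j. i \<in> {1..n} \<Longrightarrow> j \<le> a i \<Longrightarrow>
   \<xi> i j v = c i * psi (a i) s t j + d i * dpsi (a i) s t s' t' j" by (rule tangent_coordinates[OF IntD1[OF v(1)]]) (rule that)
 have vmk: "v = mk (\<lambda>i j. c i * psi (a i) s t j + d i * dpsi (a i) s t s' t' j)" using IntD2[OF v(1)] vf by (rule eq_mkI)
 have key: "mpeval f v = 0"
  if e: "mk (\<lambda>i j. e i * psi (a i) s t j) \<noteq> 0" "v = mk (\<lambda>i j. c i * psi (a i) s t j + e i * dpsi (a i) s t x y j)" for e x y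
 proof -
  let ?u = "mk (\<lambda>i j. e i * psi (a i) s t j)"
  have u: "?u \<in> Xcone \<inter> L0" using mk_psi_00_in_X mk_in_L0 by blast
  have "dir_deriv g u' v = 0" if g: "g \<in> vanishing_ideal X0" and u': "u' \<in> vec.span {?u}" for g u'
  proof -
   obtain \<rho> where "u' = \<rho> *s ?u" using u' by (auto simp: mem_span_singleton)
   then show ?thesis unfolding e(2) using dir_deriv_tangent_X0[of g] g unfolding I by blast
  qed
  then have "vec.span {v} \<in> tangent_space X0 (vec.span {?u})"
   unfolding tangent_space_def proj_pts_def using v(2) by blast
  moreover have "vec.span {?u} \<in> X0" using u e(1) unfolding proj_pts_def by blast
  moreover have "v \<in> vec.span {v}" by (intro vec.span_base) simp
  ultimately show ?thesis using f unfolding vanishing_ideal_def by blast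
 qed
 show "mpeval f v = 0"
 proof (cases "mk (\<lambda>i j. d i * psi (a i) s t j) = 0")
  case False
  then show ?thesis using key vmk by blast
 next
  case True
  have st: "(s, t) \<noteq> (0, 0)" using D by auto
  have d0: "d i = 0" if i: "i \<in> {1..n}" for i
  proof -
   obtain j where "j \<le> a i" "psi (a i) s t j \<noteq> 0" using psi_nonzero[OF st] by blast
   then show ?thesis using arg_cong[OF True, of "\<xi> i j"] i by (simp add: xi_mk xi_simps)
  qed
  have z: "dpsi (a i) s t 0 0 j = 0" for i j using dpsi_scale[of "a i" s t 0 0 0 j] by simp
  have "v = mk (\<lambda>i j. c i * psi (a i) s t j)" unfolding vmk by (rule mk_cong) (simp add: d0)
  then show ?thesis using key[of c 0 0] v(2) unfolding z by simp
 qed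
qed

lemma join_V: "join Vt (tangent_variety X0) = proj_pts Vcone"
 unfolding tangent_variety_X0 by (rule join_vertex[OF alg_cone_V xi_invariant_V])

lemma join_W: "join Vt (secant_variety X0) = proj_pts Wcone"
 unfolding secant_variety_X0 by (rule join_vertex[OF alg_cone_W xi_invariant_W])

end

section \<open>Coordinates adapted to the scroll and its vertex\<close>

text \<open>The indices with \<open>a i \<le> c\<close> are the first ones, as \<open>a\<close> is monotone.\<close>

lemma initial_segment_card:
 fixes n c :: nat and a :: "nat \<Rightarrow> nat"
 assumes "mono_on {1..n} a"
 shows "{i \<in> {1..n}. a i \<le> c} = {1..card {i \<in> {1..n}. a i \<le> c}}"
proof (cases "{i \<in> {1..n}. a i \<le> c} = {}")
 case False
 let ?S = "{i \<in> {1..n}. a i \<le> c}"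
 have M: "Max ?S \<in> ?S" using False by (intro Max_in) auto
 have "?S = {1..Max ?S}"
 proof
  show "?S \<subseteq> {1..Max ?S}" by auto
  show "{1..Max ?S} \<subseteq> ?S"
  proof
   fix i assume i: "i \<in> {1..Max ?S}"
   then have "a i \<le> a (Max ?S)" using M by (intro mono_onD[OF assms]) auto
   then show "i \<in> ?S" using M i by auto
  qed
 qed
 moreover from this have "card ?S = Max ?S" by (metis card_atLeastAtMost diff_Suc_1)
 ultimately show ?thesis by simp
qed simp

text \<open>The vector \<open>b i j\<close> is not in the span of \<open>T\<close> and of the other basis vectors, and is therefore separated from it.\<close>

lemma dual_functionals:
 fixes b :: "nat \<Rightarrow> nat \<Rightarrow> 'k::field ^ 'd::finite" and I :: "(nat \<times> nat) set" and T :: "('k ^ 'd) set"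
 defines "N \<equiv> {b i j | i j. (i, j) \<in> I}"
 assumes inj: "inj_on (\<lambda>(i, j). b i j) I" and ind: "vec.independent N"
  and T: "vec.subspace T" "T \<inter> vec.span N \<subseteq> {0}"
 shows "\<exists>\<xi>. \<forall>(i, j)\<in>I. functional (\<xi> i j) \<and> (\<forall>v\<in>T. \<xi> i j v = 0) \<and>
  (\<forall>(i', j')\<in>I. \<xi> i j (b i' j') = (if i = i' \<and> j = j' then 1 else 0))"
proof -
 have "\<exists>l. functional l \<and> (\<forall>v\<in>T. l v = 0) \<and> (\<forall>(i', j')\<in>I. l (b i' j') = (if i = i' \<and> j = j' then 1 else 0))"
  if ij: "(i, j) \<in> I" for i j
 proof -
  have bN: "b i j \<in> N" using ij N_def by blast
  let ?R = "vec.span (T \<union> (N - {b i j}))"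
  have "b i j \<notin> ?R"
  proof
   assume "b i j \<in> ?R"
   then obtain t y where ty: "b i j = t + y" "t \<in> T" "y \<in> vec.span (N - {b i j})"
    unfolding vec.span_Un vec.span_eq_iff[THEN iffD2, OF T(1)] by blast
   have "y \<in> vec.span N" using ty(3) vec.span_mono[of "N - {b i j}" N] by blast
   then have "b i j - y \<in> vec.span N" by (rule vec.span_diff[OF vec.span_base[OF bN]])
   then have "t \<in> vec.span N" using ty(1) by simp
   then have "t = 0" using T(2) ty(2) by blast
   then have "b i j \<in> vec.span (N - {b i j})" using ty by simp
   then show False using ind bN unfolding vec.dependent_def by blast
  qed
  then obtain l where l: "functional l" "l (b i j) = 1" "\<And>v. v \<in> ?R \<Longrightarrow> l v = 0"
   using functional_separates[OF vec.subspace_span] by blast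
  have "l v = 0" if "v \<in> T" for v using that by (intro l(3) vec.span_base) blast
  moreover have "l (b i' j') = (if i = i' \<and> j = j' then 1 else 0)" if ij': "(i', j') \<in> I" for i' j'
  proof (cases "(i, j) = (i', j')")
   case True
   then show ?thesis using l(2) by simp
  next
   case False
   then have "b i' j' \<noteq> b i j" using inj_onD[OF inj _ ij ij'] by auto
   moreover have "b i' j' \<in> N" using ij' N_def by blast
   ultimately have "b i' j' \<in> ?R" by (intro vec.span_base) blast
   then show ?thesis using l(3) False by auto
  qed
  ultimately show ?thesis using l(1) by blast
 qed
 note ex = this
 define dual where "dual i j l \<longleftrightarrow> functional l \<and> (\<forall>v\<in>T. l v = 0) \<and>
  (\<forall>(i', j')\<in>I. l (b i' j') = (if i = i' \<and> j = j' then 1 else 0))" for i j l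
 define \<zeta> where "\<zeta> i j = (SOME l. dual i j l)" for i j
 have "dual i j (\<zeta> i j)" if "(i, j) \<in> I" for i j
 proof -
  have "\<exists>l. dual i j l" unfolding dual_def by (rule ex[OF that])
  then show ?thesis unfolding \<zeta>_def by (rule someI_ex)
 qed
 then have "\<forall>(i, j)\<in>I. dual i j (\<zeta> i j)" by blast
 then show ?thesis unfolding dual_def by (rule exI[of _ \<zeta>])
qed

lemma (in scroll) L0_eq_span: "L0 = vec.span {b i j | i j. i \<in> {1..n} \<and> j \<le> a i}"
proof
 show "L0 \<subseteq> vec.span {b i j | i j. i \<in> {1..n} \<and> j \<le> a i}"
 proof
  fix v assume "v \<in> L0"
  then obtain x where v: "v = mk x" unfolding L0_def by blast
  show "v \<in> vec.span {b i j | i j. i \<in> {1..n} \<and> j \<le> a i}"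
   unfolding v mk_def by (intro vec.span_sum vec.span_scale vec.span_base) blast
 qed
 have "b i j \<in> L0" if ij: "i \<in> {1..n}" "j \<le> a i" for i j
 proof -
  have "mk (\<lambda>i' j'. if i' = i \<and> j' = j then 1 else 0) = (\<Sum>i'\<in>{1..n}. if i' = i then b i j else 0)"
   unfolding mk_def
  proof (intro sum.cong refl)
   fix i' assume "i' \<in> {1..n}"
   show "(\<Sum>j'\<le>a i'. (if i' = i \<and> j' = j then 1 else 0) *s b i' j') = (if i' = i then b i j else 0)"
    using ij(2) by (cases "i' = i") (simp_all add: if_distrib[of "\<lambda>c. c *s _"] sum.delta cong: if_cong)
  qed
  also have "\<dots> = b i j" using ij(1) by (simp add: sum.delta)
  finally show ?thesis using mk_in_L0 by metis
 qed
 then show "vec.span {b i j | i j. i \<in> {1..n} \<and> j \<le> a i} \<subseteq> L0"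
  by (intro vec.span_minimal subspace_L0) auto
qed

lemma subscroll_cong:
 "(\<And>i s t. i \<in> J \<Longrightarrow> \<phi> i s t = \<psi> i s t) \<Longrightarrow> subscroll \<phi> J = subscroll \<psi> J"
proof -
 assume eq: "\<And>i s t. i \<in> J \<Longrightarrow> \<phi> i s t = \<psi> i s t"
 have "{\<phi> i s t | i. i \<in> J} = {\<psi> i s t | i. i \<in> J}" for s t using eq by (intro Collect_cong) metis
 then show ?thesis by (simp add: subscroll_def)
qed

lemma conic_planes_cong:
 "(\<And>i s t. i \<in> J \<Longrightarrow> \<phi> i s t = \<psi> i s t) \<Longrightarrow> conic_planes \<phi> J = conic_planes \<psi> J"
proof -
 assume eq: "\<And>i s t. i \<in> J \<Longrightarrow> \<phi> i s t = \<psi> i s t"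
 have "(\<Sum>i\<in>J. \<beta> i *s \<phi> i s t) = (\<Sum>i\<in>J. \<beta> i *s \<psi> i s t)" for \<beta> s t
  by (intro sum.cong refl) (simp add: eq)
 then show ?thesis by (simp add: conic_planes_def conic_def)
qed

theorem theorem5p3:
 fixes r n k m :: nat
  and a :: "nat \<Rightarrow> nat"
  and \<Lambda> :: "nat \<Rightarrow> ('k::alg_closed_field ^ 'd::finite) set"
  and \<phi> :: "nat \<Rightarrow> 'k \<Rightarrow> 'k \<Rightarrow> 'k ^ 'd"
  and Vt X0 X S1 \<Delta> V W A B U :: "('k, 'd) point set"
 assumes ambient: "CARD('d) = r + 2"
  and smooth_scroll: "smooth_scroll_data n a \<Lambda> \<phi>"
  and X0_eq: "X0 = subscroll \<phi> {1..n}"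
  and vertex: "complementary_to_vertex Vt X0"
  and X_eq: "X = join Vt X0"
  and codim: "zdim X + 2 \<le> enat (r + 1)"
  and k_eq: "k = card {i \<in> {1..n}. a i = 1}"
  and m_eq: "m = card {i \<in> {1..n}. a i \<le> 2}"
  and S1_eq: "S1 = subscroll \<phi> {1..k}"
  and Delta_eq: "\<Delta> = conic_planes \<phi> {k+1..m}"
  and V_eq: "V = join Vt (tangent_variety X0)"
  and W_eq: "W = join Vt (secant_variety X0)"
  and A_eq: "A = lin_span (Vt \<union> lin_span S1)"
  and B_eq: "B = join Vt (join S1 X0)"
  and U_eq: "U = join A \<Delta>"
 shows "X \<subseteq> B \<and> A \<subseteq> B \<and> B \<union> U \<subseteq> V \<and> V \<subseteq> W \<and>
  SL_empty Vt X0 = proj_space - W \<and>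
  SL_two_points Vt X0 = W - V \<and>
  SL_double_point Vt X0 = V - (B \<union> U) \<and>
  SL_two_lines Vt X0 = B - (A \<union> X) \<and>
  SL_conic Vt X0 = U - B \<and>
  SL_quadric Vt X0 = A - X"
proof -
 have n: "1 \<le> n" and a1: "\<And>i. i \<in> {1..n} \<Longrightarrow> 1 \<le> a i" and mono: "mono_on {1..n} a"
  and emb: "\<forall>i\<in>{1..n}. rational_normal_embedding (a i) (\<Lambda> i) (\<phi> i)"
  and dimL: "vec.dim (vec.span (\<Union>i\<in>{1..n}. \<Lambda> i)) = (\<Sum>i=1..n. a i + 1)"
  using smooth_scroll unfolding smooth_scroll_data_def by auto
 obtain b where b: "\<And>i. i \<in> {1..n} \<Longrightarrow> vec.span (b i ` {..a i}) = \<Lambda> i"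
   "\<And>i s t. i \<in> {1..n} \<Longrightarrow> \<phi> i s t = (\<Sum>j\<le>a i. (s ^ (a i - j) * t ^ j) *s b i j)"
  using emb unfolding rational_normal_embedding_def by metis
 have "{i \<in> {1..n}. a i = 1} = {i \<in> {1..n}. a i \<le> 1}" using a1 by force
 then have one: "{i \<in> {1..n}. a i = 1} = {1..k}"
  using initial_segment_card[OF mono, of 1] k_eq by simp
 have two: "{i \<in> {1..n}. a i \<le> 2} = {1..m}" using initial_segment_card[OF mono, of 2] m_eq by simp
 have "k \<le> m" unfolding k_eq m_eq by (rule card_mono) auto
 moreover have "m \<le> card {1..n}" unfolding m_eq by (rule card_mono) auto
 ultimately have km: "k \<le> m" "m \<le> n" by simp_all
 define I where "I = (SIGMA i:{1..n}. {..a i})"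
 let ?N = "{b i j | i j. (i, j) \<in> I}"
 have N_im: "?N = (\<lambda>(i, j). b i j) ` I" by auto
 have fin: "finite I" "finite ?N" unfolding N_im by (auto simp: I_def)
 have spanN: "vec.span ?N = vec.span (\<Union>i\<in>{1..n}. \<Lambda> i)"
 proof
  have "b i j \<in> (\<Union>i\<in>{1..n}. \<Lambda> i)" if "(i, j) \<in> I" for i j
  proof -
   have i: "i \<in> {1..n}" "j \<le> a i" using that by (auto simp: I_def)
   then have "b i j \<in> \<Lambda> i" unfolding b(1)[OF i(1), symmetric] by (intro vec.span_base) auto
   then show ?thesis using i by blast
  qed
  then show "vec.span ?N \<subseteq> vec.span (\<Union>i\<in>{1..n}. \<Lambda> i)" by (intro vec.span_mono) blast
  have "\<Lambda> i \<subseteq> vec.span ?N" if i: "i \<in> {1..n}" for i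
   unfolding b(1)[OF i, symmetric] by (rule vec.span_mono) (use i in \<open>auto simp: I_def\<close>)
  then have "(\<Union>i\<in>{1..n}. \<Lambda> i) \<subseteq> vec.span ?N" by (rule UN_least)
  then show "vec.span (\<Union>i\<in>{1..n}. \<Lambda> i) \<subseteq> vec.span ?N" by (rule vec.span_minimal) simp
 qed
 have cardI: "card I = (\<Sum>i=1..n. a i + 1)" by (simp add: I_def)
 have "card I = vec.dim (vec.span ?N)" unfolding spanN dimL cardI ..
 also have "\<dots> \<le> card ?N" using vec.dim_le_card[OF _ fin(2), of "vec.span ?N"] by simp
 finally have cIN: "card I \<le> card ?N" .
 have cNI: "card ?N \<le> card I" unfolding N_im by (rule card_image_le[OF fin(1)])
 have inj: "inj_on (\<lambda>(i, j). b i j) I"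
  using cIN cNI unfolding N_im by (intro eq_card_imp_inj_on fin) simp
 have ind: "vec.independent ?N"
  by (rule vec.card_le_dim_spanning[where V = "vec.span ?N"])
   (use vec.span_superset[of ?N] fin(2) cNI \<open>card I = vec.dim (vec.span ?N)\<close> in auto)
 have I_iff: "(i, j) \<in> I \<longleftrightarrow> i \<in> {1..n} \<and> j \<le> a i" for i j by (auto simp: I_def)
 have scroll: "scroll n k m a b \<xi>" if \<xi>: "\<forall>(i, j)\<in>I. functional (\<xi> i j) \<and> (\<forall>v\<in>T. \<xi> i j v = 0) \<and>
   (\<forall>(i', j')\<in>I. \<xi> i j (b i' j') = (if i = i' \<and> j = j' then 1 else 0))" for \<xi> T
 proof
  show "1 \<le> n" "k \<le> m" "m \<le> n" using n km by auto
  fix i assume i: "i \<in> {1..n}"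
  show "1 \<le> a i" by (rule a1[OF i])
  show "a i = 1 \<longleftrightarrow> i \<le> k" using i arg_cong[OF one, of "\<lambda>S. i \<in> S"] by simp
  show "a i \<le> 2 \<longleftrightarrow> i \<le> m" using i arg_cong[OF two, of "\<lambda>S. i \<in> S"] by simp
  fix j assume j: "j \<le> a i"
  show "functional (\<xi> i j)" using \<xi> i j I_iff by blast
  fix i' j' assume "i' \<in> {1..n}" "j' \<le> a i'"
  then show "\<xi> i j (b i' j') = (if i = i' \<and> j = j' then 1 else 0)" using \<xi> i j I_iff by blast
 qed
 have NI: "{b i j | i j. i \<in> {1..n} \<and> j \<le> a i} = ?N" by (simp add: I_iff)
 \<comment> \<open>Any dual functionals show that the scroll spans the \<open>\<Lambda> i\<close>; only then can they be chosen to
  vanish on the vertex.\<close>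
 have lin_X0: "lin_span X0 = proj_pts (vec.span ?N)"
 proof -
  obtain \<xi> where \<xi>: "\<forall>(i, j)\<in>I. functional (\<xi> i j) \<and> (\<forall>v\<in>{0}. \<xi> i j v = 0) \<and>
   (\<forall>(i', j')\<in>I. \<xi> i j (b i' j') = (if i = i' \<and> j = j' then 1 else 0))"
   using dual_functionals[OF inj ind vec.subspace_single_0] by blast
  interpret S: scroll n k m a b \<xi> by (rule scroll[OF \<xi>])
  have "X0 = subscroll S.phi {1..n}" unfolding X0_eq
   by (rule subscroll_cong) (simp add: b(2) S.phi_def)
  then show ?thesis using S.lin_span_X0 S.subscroll_X0 S.L0_eq_span NI by simp
 qed
 obtain T where T: "vec.subspace T" "Vt = proj_pts T"
  and disj: "Vt \<inter> lin_span X0 = {}" and all: "lin_span (Vt \<union> lin_span X0) = proj_space"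
  using vertex unfolding complementary_to_vertex_def linear_space_def by blast
 have cT: "cone T" "cone (vec.span ?N)" using T(1) by (auto intro: subspace_imp_cone)
 have TN: "T \<inter> vec.span ?N \<subseteq> {0}"
 proof
  fix v assume v: "v \<in> T \<inter> vec.span ?N"
  show "v \<in> {0}"
  proof (rule ccontr)
   assume "v \<notin> {0}"
   then have "vec.span {v} \<in> Vt \<inter> lin_span X0" unfolding T lin_X0 using v by (auto simp: proj_pts_def)
   then show False using disj by blast
  qed
 qed
 have "vec.span (T \<union> ?N) = UNIV"
 proof -
  have "vec.span (\<Union>(Vt \<union> lin_span X0)) = vec.span (vec.span (\<Union>(proj_pts T)) \<union> vec.span (\<Union>(proj_pts (vec.span ?N))))"
   unfolding T lin_X0 span_span_union by simp
  also have "\<dots> = vec.span (T \<union> ?N)"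
   unfolding span_Union_proj_pts[OF cT(1)] span_Union_proj_pts[OF cT(2)] vec.span_span span_span_union ..
  finally have "proj_pts (vec.span (T \<union> ?N)) = proj_space" using all by (simp add: lin_span_def)
  then show ?thesis
   using proj_pts_eq_iff[of "vec.span (T \<union> ?N)" UNIV] subspace_imp_cone vec.subspace_span vec.subspace_UNIV by blast
 qed
 obtain \<xi> where \<xi>: "\<forall>(i, j)\<in>I. functional (\<xi> i j) \<and> (\<forall>v\<in>T. \<xi> i j v = 0) \<and>
   (\<forall>(i', j')\<in>I. \<xi> i j (b i' j') = (if i = i' \<and> j = j' then 1 else 0))"
  using dual_functionals[OF inj ind T(1) TN] by blast
 interpret S: scroll n k m a b \<xi> by (rule scroll[OF \<xi>])
 have L0: "S.L0 = vec.span ?N" using S.L0_eq_span NI by simp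
 have vT: "S.vertex = T"
 proof
  have "\<xi> i j v = 0" if "v \<in> T" "(i, j) \<in> I" for v i j using \<xi> that by blast
  then show "T \<subseteq> S.vertex" unfolding S.vertex_def I_iff by blast
  show "S.vertex \<subseteq> T"
  proof
   fix v assume v: "v \<in> S.vertex"
   have "v \<in> vec.span (T \<union> ?N)" using \<open>vec.span (T \<union> ?N) = UNIV\<close> by simp
   then obtain t x where tx: "v = t + x" "t \<in> T" "x \<in> vec.span ?N"
    unfolding vec.span_Un vec.span_eq_iff[THEN iffD2, OF T(1)] by blast
   have "t \<in> S.vertex" using tx(2) \<open>T \<subseteq> S.vertex\<close> by blast
   then have "v - t \<in> S.vertex" using v by (intro vec.subspace_diff S.subspace_vertex)
   then have "x = 0" using tx S.vertex_cap_L0[of x] by (simp add: L0)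
   then show "v \<in> T" using tx by simp
  qed
 qed
 have phi: "\<phi> i s t = S.phi i s t" if "i \<in> {1..n}" for i s t using b(2)[OF that] by (simp add: S.phi_def)
 have Vt': "Vt = proj_pts S.vertex" by (simp add: T vT)
 have X0': "X0 = S.X0"
  unfolding X0_eq S.subscroll_X0[symmetric] by (rule subscroll_cong) (rule phi)
 have S1': "S1 = subscroll S.phi {1..k}" unfolding S1_eq by (rule subscroll_cong) (rule phi, use km in auto)
 have D': "\<Delta> = conic_planes S.phi {k+1..m}" unfolding Delta_eq by (rule conic_planes_cong) (rule phi, use km in auto)
 have sets: "X = proj_pts S.Xcone" "A = proj_pts S.Acone" "B = proj_pts S.Bcone" "U = proj_pts S.Ucone"
  "V = proj_pts S.Vcone" "W = proj_pts S.Wcone"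
  using S.join_Vt_X0 S.lin_span_A S.join_B S.join_U S.join_V S.join_W
  unfolding X_eq A_eq B_eq U_eq V_eq W_eq Vt' X0' S1' D' by simp_all
 have "X \<subseteq> B" "A \<subseteq> B" "B \<subseteq> V" "U \<subseteq> V" "V \<subseteq> W"
  unfolding sets by (intro proj_pts_mono S.X_subset_B S.A_subset_B S.B_subset_V S.U_subset_V S.V_subset_W)+
 then show ?thesis using S.strata unfolding sets Vt' X0' by simp
qed

end
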